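(* Let $\xi$ be a real random variable with mean zero, unit variance, and $\mathbb{E}|\xi|^{6+\tau}<\infty$ for some $\tau>0$. For each $N\ge1$, let $\mathbf{Y}_N$ be an iid random matrix of size $N$ with atom variable $\xi$, i.e. an $N\times N$ matrix whose entries are iid copies of $\xi$. Let $f_1,\dots,f_k:\mathbb{C}\to\mathbb{C}$ be analytic in a neighborhood of the disk $|z|\le1$ and bounded otherwise. In addition, assume that $f_j(z)+f_j(\bar z)\in\mathbb{R}$ for all $z$ in a neighborhood of the disk $|z|\le1$ and each $1\le j\le k$. Then, as $N\to\infty$, the random vector $$\left(\operatorname{tr} f_j\left(\tfrac{1}{\sqrt N}\mathbf{Y}_N\right)-\mathbb{E}\operatorname{tr} f_j\left(\tfrac{1}{\sqrt N}\mathbf{Y}_N\right)\right)_{j=1}^k$$ converges in distribution to a mean-zero multivariate Gaussian vector $(\mathcal{G}(f_1),\dots,\mathcal{G}(f_k))$ with covariances $$\mathbb{E}[\mathcal{G}(f_i)\mathcal{G}(f_j)]:=-\frac{1}{4\pi^2}\oint_{\mathcal{C}}\oint_{\mathcal{C}}f_i(z)f_j(w)(1-zw)^{-2}\,dz\,dw,$$ where $\mathcal{C}$ is a contour lying within the region of analyticity of $f_1,\dots,f_k$, but enclosing the unit disk.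
   Context: For an $N\times N$ matrix $\mathbf{M}$ with eigenvalues $\lambda_1(\mathbf{M}),\dots,\lambda_N(\mathbf{M})$ (with multiplicity), $\operatorname{tr} f(\mathbf{M}):=\sum_{i=1}^N f(\lambda_i(\mathbf{M}))$. "Analytic in a neighborhood of the disk $|z|\le 1$ and bounded otherwise" means: there is $\delta>0$ such that each $f_j$ is analytic in a neighborhood of $\{|z|\le1+\delta\}$ and bounded on $\{|z|>1+\delta\}$. Test functions are understood to be Borel measurable. $\mathcal{C}$ is a simple closed contour which, with its interior, lies in the region of analyticity and whose interior contains the closed unit disk; both integrals use the same orientation. *)

theory Defs
  imports
    "HOL-Probability.Probability"
    "HOL-Complex_Analysis.Complex_Analysis"
    "Jordan_Normal_Form.Char_Poly"
begin

no_notation vec_index (infixl \<open>$\<close> 100)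

(* proots lists the roots of the characteristic polynomial with multiplicity, so every
   eigenvalue is counted according to its algebraic multiplicity. *)
definition trace_fun :: "(complex \<Rightarrow> complex) \<Rightarrow> complex mat \<Rightarrow> complex" where
  "trace_fun f A = (\<Sum>z \<in># proots (char_poly A). f z)"

(* P is the probability space carrying the atom variable \<xi>, and M the one carrying the matrix Y. *)
definition iid_random_matrix ::
  "'a measure \<Rightarrow> ('a \<Rightarrow> real) \<Rightarrow> nat \<Rightarrow> 'b measure \<Rightarrow> ('b \<Rightarrow> real mat) \<Rightarrow> bool" where
  "iid_random_matrix P \<xi> N M Y \<longleftrightarrow>
     prob_space M \<and>
     (\<forall>\<omega> \<in> space M. Y \<omega> \<in> carrier_mat N N) \<and>
     prob_space.indep_vars M (\<lambda>_. borel) (\<lambda>p \<omega>. Y \<omega> $$ p) ({..<N} \<times> {..<N}) \<and>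
     (\<forall>p \<in> {..<N} \<times> {..<N}. distr M borel (\<lambda>\<omega>. Y \<omega> $$ p) = distr P borel \<xi>)"

definition scaled_matrix :: "nat \<Rightarrow> real mat \<Rightarrow> complex mat" where
  "scaled_matrix N A = map_mat complex_of_real ((1 / sqrt (real N)) \<cdot>\<^sub>m A)"

definition centered_statistics ::
  "('k::finite \<Rightarrow> complex \<Rightarrow> complex) \<Rightarrow> nat \<Rightarrow> 'b measure \<Rightarrow> ('b \<Rightarrow> real mat) \<Rightarrow> 'b \<Rightarrow> complex ^ 'k" where
  "centered_statistics f N M Y \<omega> =
     (\<chi> j. trace_fun (f j) (scaled_matrix N (Y \<omega>))
        - (\<integral>\<omega>'. trace_fun (f j) (scaled_matrix N (Y \<omega>')) \<partial>M))"

definition converges_weakly ::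
  "(nat \<Rightarrow> 'a::metric_space measure) \<Rightarrow> 'a measure \<Rightarrow> bool" where
  "converges_weakly \<mu> \<nu> \<longleftrightarrow>
     (\<forall>g :: 'a \<Rightarrow> real. continuous_on UNIV g \<longrightarrow> bounded (range g) \<longrightarrow>
        (\<lambda>n. \<integral>x. g x \<partial>\<mu> n) \<longlonglongrightarrow> (\<integral>x. g x \<partial>\<nu>))"

(* A law is Gaussian if all its one-dimensional linear images are normal; s = 0 is the
   degenerate normal law, a point mass. *)
definition gaussian_law :: "'a::euclidean_space measure \<Rightarrow> bool" where
  "gaussian_law \<nu> \<longleftrightarrow>
     prob_space \<nu> \<and> sets \<nu> = sets borel \<and>
     (\<forall>t. \<exists>m s. 0 \<le> s \<and>
        distr \<nu> borel (\<lambda>x. inner t x) =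
          (if s = 0 then return borel m
           else density lborel (\<lambda>x. ennreal (normal_density m s x))))"

end

theory Submission
  imports Defs "Jordan_Normal_Form.Schur_Decomposition" "HOL-Real_Asymp.Real_Asymp"
begin

text \<open>
  Write \<open>X = Y / sqrt N\<close>, with eigenvalues \<open>\<lambda>\<^sub>i\<close>, and \<open>f\<^sub>j z = (\<Sum>m. a\<^sub>m z\<^sup>m)\<close> near the closed unit disk.
  The assumption that \<open>f\<^sub>j z + f\<^sub>j (cnj z)\<close> is real makes the coefficients real. If all
  eigenvalues lie in the disk of convergence, then \<open>tr f\<^sub>j X - N f\<^sub>j 0\<close> is the series
  \<open>\<Sum>m\<ge>1. a\<^sub>m T\<^sub>m\<close> with \<open>T\<^sub>m = tr X\<^sup>m\<close>. Hence it is enough to know the joint limit of finitely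
  many \<open>T\<^sub>m\<close>, to bound the tail of the series uniformly in \<open>N\<close>, and to make the exceptional event
  so rare that it cannot contribute.

  \<^bold>\<open>Finitely many traces.\<close> The entries are first truncated at \<open>N\<close> to a power below \<open>1/2\<close>, so that
  the scaled entries are at most \<open>q = N powr (- \<epsilon>)\<close>. A product of traces of powers is a sum over maps
  from a disjoint union of cycles to the indices. By \<open>expectation_perm_trace_approx\<close>, its
  expectation is in the limit the number of ways to glue the vertices in pairs compatibly with the
  rotation of the cycles: either two cycles of the same length \<open>l\<close> are glued, in \<open>l\<close> ways, or an
  even cycle is folded onto itself, in one way. This gives \<open>num_pairings_rec\<close>, which is the recursion
  for the moments of a normal law. Thus the \<open>T\<^sub>l\<close> are asymptotically independent normal variables
  of variance \<open>l\<close>, with mean 1 for even \<open>l\<close> and 0 for odd \<open>l\<close>.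

  \<^bold>\<open>The tail.\<close> If the eigenvalues lie strictly inside the circle of radius \<open>R\<close>, then \<open>T\<^sub>m\<close> is, up to the
  factor \<open>2 m R\<^sup>m\<close>, the \<open>m\<close>-th Fourier coefficient of \<open>ln (cmod (det (t - X)) / R\<^sup>N)\<close> on that circle.
  This function has mean zero by Jensen's formula, so its \<open>L\<^sup>1\<close> norm is at most twice that of its
  positive part, which is below \<open>(cmod (det (t - X)))\<^sup>2 / R\<^bsup>2 N\<^esup>\<close>. The expectation of the latter is
  bounded by \<open>1 / (1 - R\<^bsup>-2\<^esup>)\<close>, because different permutations in the determinant are uncorrelated
  (\<open>expectation_char_det_sq_le\<close>). Hence \<open>E \<bar>T\<^sub>m\<bar>\<close> is, on the good event, at most a constant times
  \<open>m R\<^sup>m\<close> (\<open>expectation_trace_good_le\<close>). The mean over the circle is taken over the \<open>n\<close>-th roots of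
  unity, and \<open>n\<close> tends to infinity.

  \<^bold>\<open>The exceptional event.\<close> Off the disk the functions are only bounded, so the statistics may be
  of order \<open>N\<close>, and the exceptional event must have probability \<open>o(1 / N)\<close>. That no entry is truncated
  follows from the moment of order \<open>6 + \<tau>\<close>, since there are \<open>N\<^sup>2\<close> entries. For the eigenvalues,
  \<open>\<bar>\<lambda>\<^sub>i\<bar>\<^bsup>2 l\<^esup>\<close> is at most the squared Frobenius norm of the \<open>l\<close>-th power of the truncated matrix, whose
  expectation is a sum over pairs of walks (\<open>expectation_frobenius_sq_le\<close>), with \<open>l\<close> about \<open>(ln N)\<^sup>2\<close>.

  The limit law is that of the random series \<open>\<Sum>m. sqrt m a\<^sub>m g\<^sub>m\<close> with independent standard normal
  \<open>g\<^sub>m\<close>. Its covariances \<open>\<Sum>m. m a\<^sub>m b\<^sub>m\<close> are the given contour integrals by two residue computations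
  (\<open>double_contour_integral_sums\<close>). Convergence of characteristic functions together with bounded
  first moments gives weak convergence (\<open>converges_weakly_if_char_tendsto\<close>).
\<close>

no_notation vec_index (infixl "$" 100)
no_notation scalar_prod (infix "\<bullet>" 70)

section \<open>Weak convergence from characteristic functions\<close>

inductive trig_poly :: "('a::real_inner \<Rightarrow> complex) \<Rightarrow> bool" where
  wave: "trig_poly (\<lambda>x. c * cis (t \<bullet> x))"
| add: "trig_poly f \<Longrightarrow> trig_poly g \<Longrightarrow> trig_poly (\<lambda>x. f x + g x)"

lemma trig_poly_const: "trig_poly (\<lambda>x. c)"
  using trig_poly.wave[of c 0] by simp

lemma trig_poly_cmult: "trig_poly f \<Longrightarrow> trig_poly (\<lambda>x. c * f x)"
proof (induction rule: trig_poly.induct)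
  case (wave d t)
  then show ?case using trig_poly.wave[of "c * d" t] by (simp add: mult.assoc)
next
  case (add f g)
  then show ?case using trig_poly.add[of "\<lambda>x. c * f x" "\<lambda>x. c * g x"] by (simp add: distrib_left)
qed

lemma trig_poly_wave_mult: "trig_poly f \<Longrightarrow> trig_poly (\<lambda>x. c * cis (t \<bullet> x) * f x)"
proof (induction rule: trig_poly.induct)
  case (wave d s)
  have "trig_poly (\<lambda>x. c * d * cis ((t + s) \<bullet> x))" by (rule trig_poly.wave)
  then show ?case by (simp add: inner_add_left cis_mult[symmetric] mult_ac)
next
  case (add f g)
  then show ?case
    using trig_poly.add[of "\<lambda>x. c * cis (t \<bullet> x) * f x" "\<lambda>x. c * cis (t \<bullet> x) * g x"]
    by (simp add: distrib_left)
qed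

lemma trig_poly_mult: "trig_poly f \<Longrightarrow> trig_poly g \<Longrightarrow> trig_poly (\<lambda>x. f x * g x)"
proof (induction rule: trig_poly.induct)
  case (wave d s)
  then show ?case by (rule trig_poly_wave_mult)
next
  case (add f h)
  then show ?case
    using trig_poly.add[of "\<lambda>x. f x * g x" "\<lambda>x. h x * g x"] by (simp add: distrib_right)
qed

lemma trig_poly_sum:
  "finite A \<Longrightarrow> (\<And>a. a \<in> A \<Longrightarrow> trig_poly (f a)) \<Longrightarrow> trig_poly (\<lambda>x. \<Sum>a\<in>A. f a x)"
  by (induction A rule: finite_induct) (auto intro: trig_poly_const trig_poly.add)

lemma trig_poly_sin: "trig_poly (\<lambda>x. complex_of_real (sin (t \<bullet> x)))"
proof -
  have "trig_poly (\<lambda>x. (1 / (2 * \<i>)) * cis (t \<bullet> x) + (- 1 / (2 * \<i>)) * cis ((- t) \<bullet> x))"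
    by (intro trig_poly.add trig_poly.wave)
  moreover have "(1 / (2 * \<i>)) * cis u + (- 1 / (2 * \<i>)) * cis (- u) = complex_of_real (sin u)" for u
    by (simp add: complex_eq_iff Re_divide Im_divide cmod_def power2_eq_square)
  ultimately show ?thesis by simp
qed

text \<open>
  A polynomial in the bounded functions \<open>sin (c x\<^sub>b)\<close> is a trigonometric polynomial which,
  unlike a polynomial in the coordinates, is controlled on the whole space by its values on a cube.
\<close>

lemma trig_poly_real_polynomial_sin:
  fixes p :: "'a::euclidean_space \<Rightarrow> real"
  assumes "real_polynomial_function p"
  shows "trig_poly (\<lambda>x. complex_of_real (p (\<Sum>b\<in>Basis. sin (c * (x \<bullet> b)) *\<^sub>R b)))"
  using assms
proof (induction rule: real_polynomial_function.induct)
  case (linear f)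
  interpret bounded_linear f by fact
  have "trig_poly (\<lambda>x. \<Sum>b\<in>Basis. complex_of_real (f b) * complex_of_real (sin ((c *\<^sub>R b) \<bullet> x)))"
    by (intro trig_poly_sum trig_poly_cmult trig_poly_sin) auto
  then show ?case by (simp add: sum scaleR inner_commute mult.commute)
next
  case (const c)
  then show ?case by (rule trig_poly_const)
next
  case (add f g)
  then show ?case by (simp add: trig_poly.add)
next
  case (mult f g)
  then show ?case by (simp add: trig_poly_mult)
qed

lemma trig_poly_measurable_bounded:
  fixes h :: "'a::euclidean_space \<Rightarrow> complex"
  assumes "trig_poly h"
  shows "h \<in> borel_measurable borel" "\<exists>C. \<forall>x. norm (h x) \<le> C"
  using assms
proof (induction rule: trig_poly.induct)
  case (wave c t)
  { case 1 show ?case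
      by (intro borel_measurable_continuous_onI continuous_intros) }
  { case 2 show ?case by (intro exI[of _ "norm c"]) (simp add: norm_mult) }
next
  case (add f g)
  { case 1 show ?case using add by auto }
  { case 2 from add obtain C D where "\<And>x. norm (f x) \<le> C" "\<And>x. norm (g x) \<le> D" by metis
    then show ?case by (intro exI[of _ "C + D"]) (meson add_mono norm_triangle_ineq order_trans) }
qed

lemma trig_poly_integrable:
  fixes h :: "'a::euclidean_space \<Rightarrow> complex"
  assumes "trig_poly h" "prob_space M" "sets M = sets borel"
  shows "integrable M h"
proof -
  interpret prob_space M by fact
  obtain C where "\<And>x. norm (h x) \<le> C" using trig_poly_measurable_bounded(2)[OF assms(1)] by blast
  moreover have "h \<in> borel_measurable M"
    using trig_poly_measurable_bounded(1)[OF assms(1)] assms(3) by (simp cong: measurable_cong_sets)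
  ultimately show ?thesis by (intro integrable_const_bound[of _ C]) auto
qed

text \<open>
  Convergence of characteristic functions is the case of a single wave, and both sides are linear.
\<close>

lemma trig_poly_integral_tendsto:
  fixes h :: "'a::euclidean_space \<Rightarrow> complex"
  assumes "trig_poly h"
    and "\<forall>\<^sub>F n in sequentially. prob_space (\<mu> n)" "\<And>n. sets (\<mu> n) = sets borel"
    and "prob_space \<nu>" "sets \<nu> = sets borel"
    and conv: "\<And>t. (\<lambda>n. \<integral>x. cis (t \<bullet> x) \<partial>\<mu> n) \<longlonglongrightarrow> (\<integral>x. cis (t \<bullet> x) \<partial>\<nu>)"
  shows "(\<lambda>n. \<integral>x. h x \<partial>\<mu> n) \<longlonglongrightarrow> (\<integral>x. h x \<partial>\<nu>)"
  using assms(1)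
proof (induction rule: trig_poly.induct)
  case (wave c t)
  show ?case using tendsto_mult_left[OF conv, of c t] by simp
next
  case (add f g)
  have "(\<lambda>n. (\<integral>x. f x \<partial>\<mu> n) + (\<integral>x. g x \<partial>\<mu> n)) \<longlonglongrightarrow> (\<integral>x. f x \<partial>\<nu>) + (\<integral>x. g x \<partial>\<nu>)"
    using add by (intro tendsto_add)
  moreover have "\<forall>\<^sub>F n in sequentially. (\<integral>x. f x \<partial>\<mu> n) + (\<integral>x. g x \<partial>\<mu> n) = (\<integral>x. f x + g x \<partial>\<mu> n)"
    using assms(2)
  proof eventually_elim
    case (elim n)
    then show ?case
      using add assms(3) by (intro Bochner_Integration.integral_add[symmetric] trig_poly_integrable)
  qed
  ultimately show ?case
    using add assms(4,5) by (simp add: Bochner_Integration.integral_add trig_poly_integrable Lim_transform_eventually)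
qed

text \<open>
  The continuity theorem in several dimensions, for first moments bounded uniformly. On the cube of
  side \<open>2 R\<close> the coordinatewise map \<open>x \<mapsto> sin (\<pi> x / (2 R))\<close> is injective, so a test function is
  there a continuous function of it, and hence nearly a polynomial in it. Off the cube this
  trigonometric polynomial is still bounded, and Markov's inequality makes the cube's complement
  negligible.
\<close>

theorem converges_weakly_if_char_tendsto:
  fixes \<mu> :: "nat \<Rightarrow> 'a::euclidean_space measure"
  assumes ps: "\<forall>\<^sub>F n in sequentially. prob_space (\<mu> n)" and sets: "\<And>n. sets (\<mu> n) = sets borel"
    and psn: "prob_space \<nu>" and setsn: "sets \<nu> = sets borel"
    and conv: "\<And>t. (\<lambda>n. \<integral>x. cis (t \<bullet> x) \<partial>\<mu> n) \<longlonglongrightarrow> (\<integral>x. cis (t \<bullet> x) \<partial>\<nu>)"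
    and tight: "\<forall>\<^sub>F n in sequentially. integrable (\<mu> n) norm \<and> (\<integral>x. norm x \<partial>\<mu> n) \<le> B"
    and tightn: "integrable \<nu> norm" "(\<integral>x. norm x \<partial>\<nu>) \<le> B"
  shows "converges_weakly \<mu> \<nu>"
  unfolding converges_weakly_def
proof (intro allI impI)
  fix g :: "'a \<Rightarrow> real"
  assume g: "continuous_on UNIV g" and "bounded (range g)"
  then obtain C where C: "C > 0" "\<And>x. \<bar>g x\<bar> \<le> C"
    by (metis bounded_pos rangeI real_norm_def)
  have B: "B \<ge> 0" using tightn(2) by (meson Bochner_Integration.integral_nonneg norm_ge_zero order_trans)
  show "(\<lambda>n. \<integral>x. g x \<partial>\<mu> n) \<longlonglongrightarrow> (\<integral>x. g x \<partial>\<nu>)"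
  proof (rule tendstoI)
    fix e :: real assume e: "e > 0"
    define \<eta> where "\<eta> = min 1 (e / 8)"
    have \<eta>: "\<eta> > 0" "\<eta> \<le> 1" "\<eta> \<le> e / 8" using e by (auto simp: \<eta>_def)
    define R where "R = 8 * (2 * C + 1) * (B + 1) / e"
    have R: "R > 0" using C B e by (simp add: R_def)
    have RB: "(2 * C + 1) * B / R \<le> e / 8"
    proof -
      have "(2 * C + 1) * B \<le> (2 * C + 1) * (B + 1)" using C by simp
      also have "\<dots> = e / 8 * R" using e by (simp add: R_def)
      finally show ?thesis using R by (simp add: pos_divide_le_eq)
    qed
    define c where "c = pi / (2 * R)"
    have c: "c > 0" using R by (simp add: c_def)
    define s :: "'a \<Rightarrow> 'a" where "s x = (\<Sum>b\<in>Basis. sin (c * (x \<bullet> b)) *\<^sub>R b)" for x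
    define t :: "'a \<Rightarrow> 'a" where "t u = (\<Sum>b\<in>Basis. (arcsin (u \<bullet> b) / c) *\<^sub>R b)" for u
    define K :: "'a set" where "K = cbox (- (\<Sum>b\<in>Basis. b)) (\<Sum>b\<in>Basis. b)"
    have one: "(\<Sum>b\<in>Basis. b) \<bullet> b = 1" if "b \<in> Basis" for b :: 'a
      using that by (simp add: inner_sum_left_Basis)
    have K: "u \<in> K \<longleftrightarrow> (\<forall>b\<in>Basis. -1 \<le> u \<bullet> b \<and> u \<bullet> b \<le> 1)" for u
      by (auto simp: K_def mem_box one inner_minus_left)
    have sK: "s x \<in> K" for x
      by (auto simp: K s_def)
    \<comment> \<open>on the cube, \<open>t\<close> inverts the coordinatewise sine, because \<open>c * R = pi / 2\<close>\<close>
    have ts: "t (s x) = x" if "\<forall>b\<in>Basis. \<bar>x \<bullet> b\<bar> \<le> R" for x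
    proof (rule euclidean_eqI)
      fix b :: 'a assume b: "b \<in> Basis"
      have "\<bar>c * (x \<bullet> b)\<bar> \<le> c * R" using that b c by (simp add: abs_mult)
      also have "c * R = pi / 2" using R by (simp add: c_def)
      finally have "arcsin (sin (c * (x \<bullet> b))) = c * (x \<bullet> b)" by (intro arcsin_sin) auto
      then show "t (s x) \<bullet> b = x \<bullet> b" using b c by (simp add: t_def s_def)
    qed
    have "continuous_on K (\<lambda>u. g (t u))"
    proof (rule continuous_on_compose2[OF g])
      show "continuous_on K t" unfolding t_def
        by (intro continuous_intros) (use c K in auto)
    qed auto
    then obtain p where p: "real_polynomial_function p" "\<And>u. u \<in> K \<Longrightarrow> \<bar>g (t u) - p u\<bar> < \<eta>"
      using Stone_Weierstrass_real_polynomial_function[of K "\<lambda>u. g (t u)" \<eta>] \<eta>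
      by (auto simp: K_def)
    define h where "h x = p (s x)" for x
    have th: "trig_poly (\<lambda>x. complex_of_real (h x))"
      unfolding h_def s_def by (rule trig_poly_real_polynomial_sin) (rule p)
    have hm: "h \<in> borel_measurable borel"
      using measurable_compose[OF trig_poly_measurable_bounded(1)[OF th] borel_measurable_Re] by simp
    have hC: "\<bar>h x\<bar> \<le> C + 1" for x
      using p(2)[OF sK[of x]] C(2)[of "t (s x)"] \<eta> unfolding h_def by linarith
    have gh: "\<bar>g x - h x\<bar> \<le> \<eta> + (2 * C + 1) / R * norm x" for x
    proof (cases "\<forall>b\<in>Basis. \<bar>x \<bullet> b\<bar> \<le> R")
      case True
      have "\<bar>g x - h x\<bar> \<le> \<eta>" using p(2)[OF sK[of x]] ts[OF True] by (simp add: h_def)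
      moreover have "0 \<le> (2 * C + 1) / R * norm x" using C R by simp
      ultimately show ?thesis by linarith
    next
      case False
      then obtain b where "b \<in> Basis" "\<bar>x \<bullet> b\<bar> > R" by force
      then have "norm x > R" using Basis_le_norm[of b x] by linarith
      then have "(2 * C + 1) * 1 \<le> (2 * C + 1) * (norm x / R)"
        using R C by (intro mult_left_mono) auto
      moreover have "\<bar>g x - h x\<bar> \<le> 2 * C + 1" using C(2)[of x] hC[of x] by linarith
      ultimately show ?thesis using \<eta> by simp
    qed
    have close: "\<bar>(\<integral>x. g x \<partial>M) - (\<integral>x. h x \<partial>M)\<bar> \<le> e / 4"
      and hI: "integrable M h"
      if M: "prob_space M" "sets M = sets borel" "integrable M norm" "(\<integral>x. norm x \<partial>M) \<le> B" for M
    proof -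
      interpret prob_space M by fact
      have [measurable]: "h \<in> borel_measurable M" "g \<in> borel_measurable M"
        using hm borel_measurable_continuous_onI[OF g] M(2) by (simp_all cong: measurable_cong_sets)
      show hI: "integrable M h" by (rule integrable_const_bound[of _ "C + 1"]) (use hC in auto)
      have gI: "integrable M g" by (rule integrable_const_bound[of _ C]) (use C in auto)
      have "\<bar>(\<integral>x. g x \<partial>M) - (\<integral>x. h x \<partial>M)\<bar> = \<bar>\<integral>x. g x - h x \<partial>M\<bar>" using gI hI by simp
      also have "\<dots> \<le> (\<integral>x. \<bar>g x - h x\<bar> \<partial>M)" by (rule integral_abs_bound)
      also have "\<dots> \<le> (\<integral>x. \<eta> + (2 * C + 1) / R * norm x \<partial>M)"
        by (rule integral_mono) (use gI hI M gh in auto)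
      also have "\<dots> = \<eta> + (2 * C + 1) / R * (\<integral>x. norm x \<partial>M)" using M by (simp add: prob_space)
      also have "\<dots> \<le> \<eta> + (2 * C + 1) / R * B" using M C R by (intro add_left_mono mult_left_mono) auto
      also have "\<dots> \<le> e / 4" using \<eta> RB unfolding times_divide_eq_left by linarith
      finally show "\<bar>(\<integral>x. g x \<partial>M) - (\<integral>x. h x \<partial>M)\<bar> \<le> e / 4" .
    qed
    have "(\<lambda>n. \<integral>x. complex_of_real (h x) \<partial>\<mu> n) \<longlonglongrightarrow> (\<integral>x. complex_of_real (h x) \<partial>\<nu>)"
      by (rule trig_poly_integral_tendsto[OF th ps sets psn setsn conv])
    then have "(\<lambda>n. \<integral>x. h x \<partial>\<mu> n) \<longlonglongrightarrow> (\<integral>x. h x \<partial>\<nu>)"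
      by (simp add: tendsto_of_real_iff)
    then have "\<forall>\<^sub>F n in sequentially. dist (\<integral>x. h x \<partial>\<mu> n) (\<integral>x. h x \<partial>\<nu>) < e / 4"
      using e by (intro tendstoD) auto
    with ps tight show "\<forall>\<^sub>F n in sequentially. dist (\<integral>x. g x \<partial>\<mu> n) (\<integral>x. g x \<partial>\<nu>) < e"
    proof eventually_elim
      case (elim n)
      have "\<bar>(\<integral>x. g x \<partial>\<mu> n) - (\<integral>x. h x \<partial>\<mu> n)\<bar> \<le> e / 4" using close[of "\<mu> n"] elim sets by auto
      moreover have "\<bar>(\<integral>x. g x \<partial>\<nu>) - (\<integral>x. h x \<partial>\<nu>)\<bar> \<le> e / 4" using close[of \<nu>] psn setsn tightn by auto
      ultimately show ?case using elim(3) e unfolding dist_real_def by linarith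
    qed
  qed
qed

section \<open>Weighted sums over pairs of walks\<close>

text \<open>
  A bound on the expected product of the entries along the list \<open>h\<close> of steps, when an entry has mean
  at most \<open>1 / N\<close>, second moment at most \<open>1 / N\<close>, and each further factor costs \<open>q\<close>. The truncated
  subtraction makes the first two visits of an edge cost \<open>1 / N\<close> together.
\<close>

definition edge_weight :: "nat \<Rightarrow> real \<Rightarrow> (nat \<times> nat) list \<Rightarrow> real" where
  "edge_weight N q h = (\<Prod>e\<in>set h. q ^ (count_list h e - 2) / real N)"

text \<open>
  Sums over the walks of \<open>n\<close> steps from \<open>u\<close>; the summand sees the list of steps and the endpoint.
\<close>

fun walk_sum :: "nat \<Rightarrow> nat \<Rightarrow> nat \<Rightarrow> ((nat \<times> nat) list \<Rightarrow> nat \<Rightarrow> real) \<Rightarrow> real" where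
  "walk_sum N 0 u \<phi> = \<phi> [] u"
| "walk_sum N (Suc n) u \<phi> = (\<Sum>v<N. walk_sum N n v (\<lambda>w. \<phi> ((u, v) # w)))"

lemma walk_sum_mono:
  "(\<And>w z. length w = n \<Longrightarrow> \<phi> w z \<le> \<psi> w z) \<Longrightarrow> walk_sum N n u \<phi> \<le> walk_sum N n u \<psi>"
  by (induction n arbitrary: u \<phi> \<psi>) (auto intro!: sum_mono)

lemma walk_sum_cmult: "walk_sum N n u (\<lambda>w z. c * \<phi> w z) = c * walk_sum N n u \<phi>"
  by (induction n arbitrary: u \<phi>) (auto simp: sum_distrib_left)

lemma edge_weight_nonneg: "0 \<le> q \<Longrightarrow> 0 \<le> edge_weight N q h"
  by (auto simp: edge_weight_def intro!: prod_nonneg)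

text \<open>
  The price of one more step: \<open>1 / N\<close> along a new edge, nothing along an edge used once, and \<open>q\<close>
  along an edge used at least twice. The bad steps are the free ones, where the walk may choose among
  several once-used edges.
\<close>

lemma edge_weight_Cons:
  "edge_weight N q (e # h) =
     (if e \<notin> set h then 1 / real N else if count_list h e = 1 then 1 else q) * edge_weight N q h"
proof (cases "e \<in> set h")
  case False
  have "(\<Prod>x\<in>set h. q ^ (count_list (e # h) x - 2) / real N) = edge_weight N q h"
    unfolding edge_weight_def using False by (intro prod.cong) auto
  then show ?thesis using False by (simp add: edge_weight_def)
next
  case True
  have eq: "q ^ (count_list (e # h) e - 2) / real N
      = (if count_list h e = 1 then 1 else q) * (q ^ (count_list h e - 2) / real N)"
  proof -
    have "count_list h e \<noteq> 0" using True by (simp add: count_list_0_iff)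
    moreover have "count_list h e - 1 = Suc (count_list h e - 2)" if "count_list h e \<noteq> 1"
      using that calculation by simp
    ultimately show ?thesis by (cases "count_list h e = 1") simp_all
  qed
  have "edge_weight N q (e # h) = (\<Prod>x\<in>set h. q ^ (count_list (e # h) x - 2) / real N)"
    using True by (simp add: edge_weight_def insert_absorb)
  also have "\<dots> = (q ^ (count_list (e # h) e - 2) / real N) * (\<Prod>x\<in>set h - {e}. q ^ (count_list (e # h) x - 2) / real N)"
    using True by (intro prod.remove) auto
  also have "(\<Prod>x\<in>set h - {e}. q ^ (count_list (e # h) x - 2) / real N)
      = (\<Prod>x\<in>set h - {e}. q ^ (count_list h x - 2) / real N)"
    by (intro prod.cong) auto
  also have "(q ^ (count_list (e # h) e - 2) / real N) * \<dots> =
    (if count_list h e = 1 then 1 else q) * ((q ^ (count_list h e - 2) / real N) * \<dots>)"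
    unfolding eq by (simp only: mult.assoc)
  also have "(q ^ (count_list h e - 2) / real N) * (\<Prod>x\<in>set h - {e}. q ^ (count_list h x - 2) / real N)
     = edge_weight N q h"
    unfolding edge_weight_def using True by (intro prod.remove[symmetric]) auto
  finally show ?thesis using True by simp
qed

definition out_nbrs :: "(nat \<times> nat) list \<Rightarrow> nat \<Rightarrow> nat set" where
  "out_nbrs h u = {v. (u, v) \<in> set h}"

text \<open>
  The edges that allow a choice among free steps: used exactly once, and starting at a vertex with
  at least two out-neighbours.
\<close>

definition tokens :: "(nat \<times> nat) list \<Rightarrow> (nat \<times> nat) set" where
  "tokens h = {e \<in> set h. count_list h e = 1 \<and> 2 \<le> card (out_nbrs h (fst e))}"

lemma finite_out_nbrs [simp]: "finite (out_nbrs h u)"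
proof -
  have "out_nbrs h u \<subseteq> snd ` set h" by (force simp: out_nbrs_def)
  then show ?thesis by (rule finite_subset) simp
qed

lemma card_out_nbrs_le: "card (out_nbrs h u) \<le> length h"
proof -
  have "out_nbrs h u \<subseteq> snd ` set h" by (force simp: out_nbrs_def)
  then have "card (out_nbrs h u) \<le> card (snd ` set h)" by (intro card_mono) auto
  also have "\<dots> \<le> card (set h)" by (rule card_image_le) simp
  also have "\<dots> \<le> length h" by (rule card_length)
  finally show ?thesis .
qed

lemma out_nbrs_Cons: "out_nbrs ((u, v) # h) x = (if x = u then insert v (out_nbrs h u) else out_nbrs h x)"
  by (auto simp: out_nbrs_def)

lemma finite_tokens [simp]: "finite (tokens h)"
  by (simp add: tokens_def)

lemma tokens_fresh: "out_nbrs h u = {} \<Longrightarrow> tokens ((u, v) # h) = tokens h"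
proof -
  assume a: "out_nbrs h u = {}"
  then have "fst e \<noteq> u" if "e \<in> set h" for e using that by (cases e) (auto simp: out_nbrs_def)
  then show ?thesis using a by (auto simp: tokens_def out_nbrs_Cons)
qed

text \<open>
  A new edge out of \<open>u\<close> is a token itself, and it turns the edge to the only previous out-neighbour
  into one. All other tokens were there before.
\<close>

lemma card_tokens_new:
  assumes "v \<notin> out_nbrs h u" "out_nbrs h u \<noteq> {}"
  shows "card (tokens ((u, v) # h)) \<le> card (tokens h) + 2"
proof -
  obtain v0 where v0: "v0 \<in> out_nbrs h u" using assms by auto
  have "tokens ((u, v) # h) \<subseteq> tokens h \<union> {(u, v), (u, v0)}"
  proof
    fix e assume e: "e \<in> tokens ((u, v) # h)"
    show "e \<in> tokens h \<union> {(u, v), (u, v0)}"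
    proof (rule ccontr)
      assume n: "\<not> ?thesis"
      then have ne: "e \<noteq> (u, v)" "e \<noteq> (u, v0)" by auto
      then have h: "e \<in> set h" "count_list h e = 1" using e by (auto simp: tokens_def)
      have "2 \<le> card (out_nbrs h (fst e))"
      proof (cases "fst e = u")
        case True
        then have "{snd e, v0} \<subseteq> out_nbrs h u" using h v0 by (cases e) (auto simp: out_nbrs_def)
        moreover have "snd e \<noteq> v0" using ne True by (cases e) auto
        ultimately show ?thesis using True card_mono[of "out_nbrs h u" "{snd e, v0}"] by simp
      next
        case False
        then show ?thesis using e by (auto simp: tokens_def out_nbrs_Cons)
      qed
      then show False using n h by (auto simp: tokens_def)
    qed
  qed
  then have "card (tokens ((u, v) # h)) \<le> card (tokens h \<union> {(u, v), (u, v0)})"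
    by (intro card_mono) auto
  also have "\<dots> \<le> card (tokens h) + card {(u, v), (u, v0)}" by (rule card_Un_le)
  also have "card {(u, v), (u, v0)} \<le> 2" by (simp add: card_insert_if)
  finally show ?thesis by simp
qed

lemma tokens_old:
  assumes "v \<in> out_nbrs h u"
  shows "tokens ((u, v) # h) = (if count_list h (u, v) = 1 then tokens h - {(u, v)} else tokens h)"
proof -
  have m: "(u, v) \<in> set h" using assms by (simp add: out_nbrs_def)
  then have "count_list h (u, v) \<noteq> 0" by (simp add: count_list_0_iff)
  with m assms show ?thesis by (auto simp: tokens_def out_nbrs_Cons insert_absorb)
qed

text \<open>
  Each token is worth a factor \<open>K\<close>, which pays for the choice when the token is consumed. Tokens
  arise only at a vertex that the walk has left before, and a factor \<open>B\<close> for standing at such a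
  vertex pays for the two tokens that a new edge may create there.
\<close>

definition potential :: "real \<Rightarrow> real \<Rightarrow> (nat \<times> nat) list \<Rightarrow> nat \<Rightarrow> real" where
  "potential K B h u = K ^ card (tokens h) * (if out_nbrs h u = {} then 1 else B)"

text \<open>
  The weighted potential grows by at most \<open>1 + \<eta>\<close> per step. A new edge has at most \<open>N\<close> targets at
  price \<open>1 / N\<close>; only few of them carry the factor \<open>B\<close>, because few vertices have been visited. An
  old edge has at most \<open>D\<close> targets, and with two or more of them each step loses a factor \<open>K\<close>, either
  by consuming a token or by the price \<open>q\<close>. From a vertex left before, the choice of \<open>B\<close> makes the new
  edges cost only the share \<open>\<eta>\<close> of the potential, and the old edges cost the share 1.
\<close>

lemma potential_step:
  fixes N D :: nat and q K B \<eta> :: real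
  assumes N: "N \<ge> 1" and len: "length h < D" and q: "0 \<le> q" "2 * real D * q \<le> 1"
    and K: "K = 2 * real D" and \<eta>: "0 < \<eta>"
    and B: "B = K\<^sup>2 * (1 + \<eta>) / \<eta>" and DB: "real D * B \<le> \<eta> * real N"
  shows "(\<Sum>v<N. edge_weight N q ((u, v) # h) * potential K B ((u, v) # h) v)
     \<le> (1 + \<eta>) * (edge_weight N q h * potential K B h u)"
proof -
  define k where "k = card (tokens h)"
  define O' where "O' = out_nbrs h u"
  have D: "real D \<ge> 1" using len by simp
  have K1: "K \<ge> 1" "K > 0" using K D by auto
  have "\<eta> * 1 \<le> (1 + \<eta>) * K\<^sup>2"
    using K1 \<eta> by (intro mult_mono) auto
  then have B1: "B \<ge> 1" using \<eta> by (simp add: B field_simps)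
  have KB: "K\<^sup>2 * (1 + \<eta>) = \<eta> * B" using \<eta> by (simp add: B)
  \<comment> \<open>the price of the step to \<open>v\<close>\<close>
  define st where "st v = (if (u, v) \<notin> set h then 1 / real N else if count_list h (u, v) = 1 then 1 else q)" for v
  have st0: "st v \<ge> 0" for v using q by (simp add: st_def)
  have finO: "finite O'" by (simp add: O'_def)
  have cardO: "real (card O') \<le> real D" using card_out_nbrs_le[of h u] len by (simp add: O'_def)
  \<comment> \<open>the step sum splits into steps along a new edge and steps along a used one\<close>
  define c where "c = (if O' = {} then K ^ k else K ^ (k + 2))"
  have new: "(\<Sum>v\<in>{..<N} - O'. st v * potential K B ((u, v) # h) v) \<le> c * (1 + \<eta>)"
  proof -
    \<comment> \<open>the vertices that have been left, including \<open>u\<close> now\<close>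
    define S where "S = insert u (fst ` set h)"
    have cS: "real (card S) \<le> real D"
    proof -
      have "card S \<le> Suc (card (fst ` set h))" by (simp add: S_def card_insert_if)
      also have "card (fst ` set h) \<le> length h"
        using card_image_le[of "set h" fst] card_length[of h] by simp
      finally show ?thesis using len by simp
    qed
    have "(\<Sum>v\<in>{..<N} - O'. st v * potential K B ((u, v) # h) v)
      \<le> (\<Sum>v\<in>{..<N} - O'. 1 / real N * (c * (1 + (if v \<in> S then B else 0))))"
    proof (rule sum_mono)
      fix v assume v: "v \<in> {..<N} - O'"
      then have "st v = 1 / real N" by (simp add: st_def O'_def out_nbrs_def)
      moreover have "K ^ card (tokens ((u, v) # h)) \<le> c"
      proof (cases "O' = {}")
        case True then show ?thesis by (simp add: c_def O'_def tokens_fresh k_def)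
      next
        case False
        then have "card (tokens ((u, v) # h)) \<le> k + 2"
          using card_tokens_new[of v h u] v by (simp add: O'_def k_def)
        then show ?thesis using False K1 power_increasing[of _ "k + 2" K] by (simp only: c_def if_False)
      qed
      moreover have "(if out_nbrs ((u, v) # h) v = {} then 1 else B) \<le> 1 + (if v \<in> S then B else 0)"
      proof -
        have "v \<in> S" if "out_nbrs ((u, v) # h) v \<noteq> {}"
          using that by (force simp: S_def out_nbrs_def)
        then show ?thesis using B1 by auto
      qed
      ultimately show "st v * potential K B ((u, v) # h) v \<le> 1 / real N * (c * (1 + (if v \<in> S then B else 0)))"
        unfolding potential_def using K1 B1 by (intro mult_mono) (auto simp: c_def)
    qed
    also have "\<dots> \<le> (\<Sum>v<N. 1 / real N * (c * (1 + (if v \<in> S then B else 0))))"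
      using K1 B1 by (intro sum_mono2) (auto simp: c_def)
    also have "\<dots> = c / real N * (\<Sum>v<N. 1 + (if v \<in> S then B else 0))"
      unfolding sum_distrib_left by (simp only: times_divide_eq_left times_divide_eq_right mult_1)
    also have "(\<Sum>v<N. 1 + (if v \<in> S then B else 0)) = real N + real (card ({..<N} \<inter> S)) * B"
      by (simp add: sum.distrib sum.If_cases Int_def)
    also have "c / real N * (real N + real (card ({..<N} \<inter> S)) * B) \<le> c / real N * (real N + \<eta> * real N)"
    proof (intro mult_left_mono add_left_mono)
      have "card ({..<N} \<inter> S) \<le> card S" by (intro card_mono) (auto simp: S_def)
      then have "real (card ({..<N} \<inter> S)) * B \<le> real D * B" using cS B1 by (intro mult_right_mono) auto
      then show "real (card ({..<N} \<inter> S)) * B \<le> \<eta> * real N" using DB by simp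
      show "0 \<le> c / real N" using K1 by (simp add: c_def)
    qed
    also have "\<dots> = c * (1 + \<eta>)" using N by (simp add: field_simps)
    finally show ?thesis .
  qed
  have old: "(\<Sum>v\<in>{..<N} \<inter> O'. st v * potential K B ((u, v) # h) v) \<le> (if O' = {} then 0 else K ^ k * B)"
  proof (cases "O' = {}")
    case False
    \<comment> \<open>a single old edge is taken without a choice and consumes no token\<close>
    define m where "m = (if card O' = 1 then 1 else 1 / K)"
    have trm: "st v * potential K B ((u, v) # h) v \<le> m * (K ^ k * B)" if v: "v \<in> O'" for v
    proof -
      have mem: "(u, v) \<in> set h" using v by (simp add: O'_def out_nbrs_def)
      have "st v * K ^ card (tokens ((u, v) # h)) \<le> m * K ^ k"
      proof (cases "card O' = 1")
        case True
        have "(u, v) \<notin> tokens h" using True by (simp add: tokens_def O'_def)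
        then have "tokens ((u, v) # h) = tokens h" using v by (simp add: tokens_old O'_def)
        moreover have "q \<le> 1"
        proof -
          have "1 * q \<le> 2 * real D * q" using D q by (intro mult_right_mono) auto
          then show ?thesis using q by simp
        qed
        moreover have "st v \<le> 1" using mem \<open>q \<le> 1\<close> by (simp add: st_def)
        ultimately show ?thesis using True K1 by (simp add: m_def k_def mult_left_le_one_le st0)
      next
        case False
        then have two: "2 \<le> card O'"
          using v finO by (metis One_nat_def Suc_1 card_gt_0_iff empty_iff less_Suc0 not_less not_less_eq_eq antisym_conv3 Suc_leI)
        show ?thesis
        proof (cases "count_list h (u, v) = 1")
          case one: True
          then have tok: "(u, v) \<in> tokens h" using two mem by (simp add: tokens_def O'_def)
          then have "card (tokens h) > 0" by (metis card_gt_0_iff empty_iff finite_tokens)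
          then obtain k' where k': "k = Suc k'" by (cases k) (auto simp: k_def)
          have "card (tokens ((u, v) # h)) = k'"
            using v one tok k' by (simp add: tokens_old O'_def k_def)
          then show ?thesis using one mem False k' K1 by (simp add: st_def m_def)
        next
          case many: False
          then have "card (tokens ((u, v) # h)) = k" using v by (simp add: tokens_old O'_def k_def)
          moreover have "q \<le> 1 / K" using q K K1 by (simp add: field_simps)
          ultimately show ?thesis using many mem False K1 mult_right_mono[of q "1 / K" "K ^ k"] by (simp add: st_def m_def)
        qed
      qed
      then have "st v * K ^ card (tokens ((u, v) # h)) * B \<le> m * K ^ k * B"
        using B1 by (intro mult_right_mono) auto
      moreover have "st v * potential K B ((u, v) # h) v \<le> st v * K ^ card (tokens ((u, v) # h)) * B"
        unfolding potential_def mult.assoc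
        using B1 K1 st0 by (intro mult_left_mono) auto
      ultimately show ?thesis by (simp add: mult.assoc)
    qed
    have "(\<Sum>v\<in>{..<N} \<inter> O'. st v * potential K B ((u, v) # h) v) \<le> (\<Sum>v\<in>{..<N} \<inter> O'. m * (K ^ k * B))"
      by (intro sum_mono trm) auto
    also have "\<dots> \<le> (\<Sum>v\<in>O'. m * (K ^ k * B))"
      using finO K1 B1 by (intro sum_mono2) (auto simp: m_def)
    also have "\<dots> = (real (card O') * m) * (K ^ k * B)" by simp
    also have "\<dots> \<le> 1 * (K ^ k * B)"
    proof (intro mult_right_mono)
      show "real (card O') * m \<le> 1"
        using cardO K K1 D by (auto simp: m_def)
      show "0 \<le> K ^ k * B" using K1 B1 by simp
    qed
    finally show ?thesis using False by simp
  qed simp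
  have "(\<Sum>v<N. st v * potential K B ((u, v) # h) v)
     = (\<Sum>v\<in>{..<N} - O'. st v * potential K B ((u, v) # h) v) + (\<Sum>v\<in>{..<N} \<inter> O'. st v * potential K B ((u, v) # h) v)"
    by (subst sum.union_disjoint[symmetric]) (auto intro: sum.cong)
  also have "\<dots> \<le> c * (1 + \<eta>) + (if O' = {} then 0 else K ^ k * B)" using new old by (rule add_mono)
  also have "\<dots> \<le> (1 + \<eta>) * potential K B h u"
  proof (cases "O' = {}")
    case True then show ?thesis by (simp add: c_def potential_def O'_def k_def)
  next
    case False
    have "c * (1 + \<eta>) = K ^ k * (K\<^sup>2 * (1 + \<eta>))" using False by (simp add: c_def power_add power2_eq_square)
    also have "\<dots> = K ^ k * (\<eta> * B)" by (simp only: KB)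
    finally show ?thesis using False by (simp add: potential_def O'_def k_def algebra_simps)
  qed
  finally have main: "(\<Sum>v<N. st v * potential K B ((u, v) # h) v) \<le> (1 + \<eta>) * potential K B h u" .
  have "(\<Sum>v<N. edge_weight N q ((u, v) # h) * potential K B ((u, v) # h) v)
      = edge_weight N q h * (\<Sum>v<N. st v * potential K B ((u, v) # h) v)"
    by (simp add: edge_weight_Cons st_def sum_distrib_left mult_ac)
  also have "\<dots> \<le> edge_weight N q h * ((1 + \<eta>) * potential K B h u)"
    by (intro mult_left_mono main edge_weight_nonneg q)
  finally show ?thesis by (simp add: mult_ac)
qed

lemma walk_sum_potential:
  fixes N D :: nat and q K B \<eta> :: real
  assumes "N \<ge> 1" "0 \<le> q" "2 * real D * q \<le> 1" "K = 2 * real D" "0 < \<eta>"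
    "B = K\<^sup>2 * (1 + \<eta>) / \<eta>" "real D * B \<le> \<eta> * real N"
  shows "length h + n \<le> D \<Longrightarrow>
    walk_sum N n u (\<lambda>w z. edge_weight N q (rev w @ h) * potential K B (rev w @ h) z)
      \<le> (1 + \<eta>) ^ n * (edge_weight N q h * potential K B h u)"
proof (induction n arbitrary: u h)
  case (Suc n)
  have "walk_sum N (Suc n) u (\<lambda>w z. edge_weight N q (rev w @ h) * potential K B (rev w @ h) z)
    = (\<Sum>v<N. walk_sum N n v (\<lambda>w z. edge_weight N q (rev w @ (u, v) # h) * potential K B (rev w @ (u, v) # h) z))"
    by simp
  also have "\<dots> \<le> (\<Sum>v<N. (1 + \<eta>) ^ n * (edge_weight N q ((u, v) # h) * potential K B ((u, v) # h) v))"
    using Suc.prems by (intro sum_mono Suc.IH) auto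
  also have "\<dots> = (1 + \<eta>) ^ n * (\<Sum>v<N. edge_weight N q ((u, v) # h) * potential K B ((u, v) # h) v)"
    by (simp add: sum_distrib_left)
  also have "\<dots> \<le> (1 + \<eta>) ^ n * ((1 + \<eta>) * (edge_weight N q h * potential K B h u))"
    using assms Suc.prems by (intro mult_left_mono potential_step[where D = D]) auto
  finally show ?case by (simp add: mult_ac)
qed simp

text \<open>
  The second walk starts again at \<open>u\<close>. This jump from the end of the first walk may raise the
  potential by a factor \<open>B\<close>, once; otherwise the two walks are one history of \<open>2 n\<close> steps. The
  weight does not depend on the order of the steps, so the history can be stored newest first.
\<close>

theorem double_walk_sum_le:
  fixes N n :: nat and q \<eta> :: real
  assumes N: "N \<ge> 1" and q: "0 \<le> q" "4 * real n * q \<le> 1" and \<eta>: "0 < \<eta>" and n: "n \<ge> 1"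
    and D: "32 * real n ^ 3 * (1 + \<eta>) \<le> \<eta>\<^sup>2 * real N"
  shows "walk_sum N n u (\<lambda>w z. walk_sum N n u (\<lambda>w' z'. edge_weight N q (w @ w')))
     \<le> (16 * real n ^ 2 * (1 + \<eta>) / \<eta>) * (1 + \<eta>) ^ (2 * n)"
proof -
  define K where "K = 2 * real (2 * n)"
  define B where "B = K\<^sup>2 * (1 + \<eta>) / \<eta>"
  have B: "B = 16 * real n ^ 2 * (1 + \<eta>) / \<eta>" by (simp add: B_def K_def power_mult_distrib)
  have K1: "K \<ge> 1" using n by (simp add: K_def)
  have "\<eta> * 1 \<le> (1 + \<eta>) * K\<^sup>2"
    using K1 \<eta> by (intro mult_mono) auto
  then have B1: "B \<ge> 1" using \<eta> by (simp add: B_def field_simps)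
  have DB: "real (2 * n) * B \<le> \<eta> * real N"
    using D \<eta> by (simp add: B field_simps power2_eq_square power3_eq_cube)
  have q2: "2 * real (2 * n) * q \<le> 1" using q by simp
  have pot1: "1 \<le> potential K B h z" for h z
    using K1 B1 by (auto simp: potential_def intro: mult_ge1_I order_trans[OF _ mult_mono[of 1 _ 1]])
  have potB: "potential K B h z \<le> B * potential K B h z'" for h z z'
    using B1 K1 by (auto simp: potential_def mult_ac intro!: mult_left_mono order_trans[OF _ mult_mono[of 1 B 1 B]])
  have "walk_sum N n u (\<lambda>w z. walk_sum N n u (\<lambda>w' z'. edge_weight N q (w @ w')))
     \<le> walk_sum N n u (\<lambda>w z. (1 + \<eta>) ^ n * B * (edge_weight N q (rev w @ []) * potential K B (rev w @ []) z))"
  proof (rule walk_sum_mono)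
    fix w z assume len: "length (w :: (nat \<times> nat) list) = n"
    have "walk_sum N n u (\<lambda>w' z'. edge_weight N q (w @ w'))
       \<le> walk_sum N n u (\<lambda>w' z'. edge_weight N q (rev w' @ rev w) * potential K B (rev w' @ rev w) z')"
    proof (rule walk_sum_mono)
      fix w' z'
      have "edge_weight N q (w @ w') = edge_weight N q (rev w' @ rev w)"
        unfolding edge_weight_def by (simp add: Un_commute add.commute)
      also have "\<dots> \<le> edge_weight N q (rev w' @ rev w) * potential K B (rev w' @ rev w) z'"
        using mult_left_mono[OF pot1 edge_weight_nonneg[OF q(1)]] by simp
      finally show "edge_weight N q (w @ w') \<le> edge_weight N q (rev w' @ rev w) * potential K B (rev w' @ rev w) z'" .
    qed
    also have "\<dots> \<le> (1 + \<eta>) ^ n * (edge_weight N q (rev w) * potential K B (rev w) u)"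
      using len by (intro walk_sum_potential[where D = "2 * n"] N q(1) q2 \<eta> DB) (auto simp: K_def B_def)
    also have "\<dots> \<le> (1 + \<eta>) ^ n * (edge_weight N q (rev w) * (B * potential K B (rev w) z))"
      using \<eta> edge_weight_nonneg[OF q(1)] by (intro mult_left_mono potB) auto
    finally show "walk_sum N n u (\<lambda>w' z'. edge_weight N q (w @ w'))
       \<le> (1 + \<eta>) ^ n * B * (edge_weight N q (rev w @ []) * potential K B (rev w @ []) z)"
      by (simp add: mult_ac)
  qed
  also have "\<dots> = (1 + \<eta>) ^ n * B * walk_sum N n u (\<lambda>w z. edge_weight N q (rev w @ []) * potential K B (rev w @ []) z)"
    by (rule walk_sum_cmult)
  also have "\<dots> \<le> (1 + \<eta>) ^ n * B * ((1 + \<eta>) ^ n * (edge_weight N q [] * potential K B [] u))"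
    using \<eta> B1 by (intro mult_left_mono walk_sum_potential[where D = "2 * n"] N q(1) q2 DB) (auto simp: K_def B_def)
  also have "edge_weight N q [] * potential K B [] u = 1"
    by (simp add: edge_weight_def potential_def tokens_def out_nbrs_def)
  finally show ?thesis unfolding B[symmetric] mult_2 power_add by (simp add: mult_ac)
qed

section \<open>Moments of a random array along a permutation\<close>

lemma sum_PiE_insert:
  assumes "a \<notin> A"
  shows "(\<Sum>f\<in>insert a A \<rightarrow>\<^sub>E T. F f) = (\<Sum>v\<in>T. \<Sum>g\<in>A \<rightarrow>\<^sub>E T. F (g(a := v)))"
proof -
  have "(\<Sum>f\<in>insert a A \<rightarrow>\<^sub>E T. F f) = (\<Sum>(v, g)\<in>T \<times> (A \<rightarrow>\<^sub>E T). F (g(a := v)))"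
    unfolding PiE_insert_eq
    by (subst sum.reindex[OF inj_combinator[OF assms]]) (simp add: case_prod_unfold)
  then show ?thesis by (simp add: sum.cartesian_product)
qed

text \<open>
  A map that takes only \<open>k\<close> values has about \<open>N\<^sup>k\<close> choices, which the weight cancels: each further
  point takes either a new value, at total weight at most 1, or one of the old values.
\<close>

lemma sum_inverse_power_card_image_le:
  assumes "finite A" "N \<ge> 1"
  shows "(\<Sum>f\<in>A \<rightarrow>\<^sub>E {..<N}. (1 / real N) ^ card (f ` A)) \<le> real (card A + 1) ^ card A"
  using assms(1)
proof (induction A rule: finite_induct)
  case (insert a A)
  have "(\<Sum>f\<in>insert a A \<rightarrow>\<^sub>E {..<N}. (1 / real N) ^ card (f ` insert a A))
    = (\<Sum>g\<in>A \<rightarrow>\<^sub>E {..<N}. \<Sum>v<N. (1 / real N) ^ card (insert v (g ` A)))"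
  proof -
    have "(g(a := v)) ` insert a A = insert v (g ` A)" for g :: "'a \<Rightarrow> nat" and v
      using insert(2) by (force simp: image_iff)
    then show ?thesis unfolding sum_PiE_insert[OF insert(2)] by (subst sum.swap) simp
  qed
  also have "\<dots> \<le> (\<Sum>g\<in>A \<rightarrow>\<^sub>E {..<N}. real (card A + 1) * (1 / real N) ^ card (g ` A))"
  proof (rule sum_mono)
    fix g :: "'a \<Rightarrow> nat"
    define c where "c = (1 / real N) ^ card (g ` A)"
    have c0: "c \<ge> 0" by (simp add: c_def)
    have "(\<Sum>v<N. (1 / real N) ^ card (insert v (g ` A))) \<le> (\<Sum>v<N. c / real N + (if v \<in> g ` A then c else 0))"
      using insert(1) c0 by (intro sum_mono) (auto simp: card_insert_if c_def)
    also have "\<dots> = c + real (card ({..<N} \<inter> g ` A)) * c"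
      using assms(2) by (simp add: sum.distrib sum.If_cases Int_def)
    also have "\<dots> \<le> c + real (card A) * c"
    proof -
      have "card ({..<N} \<inter> g ` A) \<le> card A"
        using card_mono[of "g ` A" "{..<N} \<inter> g ` A"] card_image_le[of A g] insert(1) by simp
      then show ?thesis using c0 by (simp add: mult_right_mono)
    qed
    finally show "(\<Sum>v<N. (1 / real N) ^ card (insert v (g ` A))) \<le> real (card A + 1) * (1 / real N) ^ card (g ` A)"
      by (simp add: c_def algebra_simps)
  qed
  also have "\<dots> = real (card A + 1) * (\<Sum>g\<in>A \<rightarrow>\<^sub>E {..<N}. (1 / real N) ^ card (g ` A))"
    by (simp only: sum_distrib_left)
  also have "\<dots> \<le> real (card A + 1) * real (card A + 1) ^ card A"
    by (intro mult_left_mono insert.IH) auto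
  also have "\<dots> = real (card A + 1) ^ Suc (card A)" by simp
  also have "\<dots> \<le> real (card (insert a A) + 1) ^ card (insert a A)"
    unfolding card_insert_disjoint[OF insert(1,2)] by (intro power_mono) auto
  finally show ?case .
qed simp

text \<open>
  A map that is not injective has at most \<open>card A - 1\<close> values and is therefore rarer by \<open>1 / N\<close>.
\<close>

lemma card_inj_functions_approx:
  assumes "finite A" "N \<ge> 1"
  shows "\<bar>real (card {f \<in> A \<rightarrow>\<^sub>E {..<N}. inj_on f A}) / real N ^ card A - 1\<bar> \<le> real (card A + 1) ^ card A / real N"
proof -
  define S where "S = A \<rightarrow>\<^sub>E {..<N}"
  define I where "I = {f \<in> S. inj_on f A}"
  have fin: "finite S" using assms(1) by (simp add: S_def finite_PiE)
  have cS: "real (card S) = real N ^ card A" using assms(1) by (simp add: S_def card_PiE)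
  have "real (card (S - I)) * (1 / real N ^ card A) \<le> (\<Sum>f\<in>S - I. (1 / real N) ^ card (f ` A) / real N)"
  proof -
    have "1 / real N ^ card A \<le> (1 / real N) ^ card (f ` A) / real N" if "f \<in> S - I" for f
    proof -
      have "card (f ` A) < card A"
        using that assms(1) card_image_le[of A f] eq_card_imp_inj_on[of A f] by (auto simp: I_def nat_less_le)
      then have "(1 / real N) ^ card A \<le> (1 / real N) ^ Suc (card (f ` A))"
        using assms(2) by (intro power_decreasing) auto
      then show ?thesis by (simp add: power_one_over mult.commute)
    qed
    then have "(\<Sum>f\<in>S - I. 1 / real N ^ card A) \<le> (\<Sum>f\<in>S - I. (1 / real N) ^ card (f ` A) / real N)"
      by (intro sum_mono)
    then show ?thesis by simp
  qed
  also have "\<dots> \<le> (\<Sum>f\<in>S. (1 / real N) ^ card (f ` A) / real N)"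
    using fin by (intro sum_mono2) auto
  also have "\<dots> \<le> real (card A + 1) ^ card A / real N"
    unfolding sum_divide_distrib[symmetric] S_def
    by (intro divide_right_mono sum_inverse_power_card_image_le assms) auto
  finally have *: "real (card (S - I)) / real N ^ card A \<le> real (card A + 1) ^ card A / real N" by simp
  have "real (card (S - I)) = real (card S) - real (card I)"
    using fin by (subst card_Diff_subset) (auto simp: I_def card_mono of_nat_diff)
  then have "real (card I) / real N ^ card A - 1 = - (real (card (S - I)) / real N ^ card A)"
    using cS assms(2) by (simp add: diff_divide_distrib)
  then show ?thesis using * by (simp add: I_def S_def)
qed

text \<open>
  For a union of directed cycles \<open>J\<close> with successor \<open>\<sigma>\<close>, these are the ways to glue the vertices in
  pairs so that the edges are glued in pairs as well.
\<close>

definition commuting_pairings :: "'s set \<Rightarrow> ('s \<Rightarrow> 's) \<Rightarrow> ('s \<Rightarrow> 's) set" where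
  "commuting_pairings J \<sigma> =
     {\<tau>. \<tau> permutes J \<and> (\<forall>s\<in>J. \<tau> s \<noteq> s \<and> \<tau> (\<tau> s) = s \<and> \<tau> (\<sigma> s) = \<sigma> (\<tau> s))}"

lemma finite_commuting_pairings [simp]: "finite J \<Longrightarrow> finite (commuting_pairings J \<sigma>)"
  by (rule finite_subset[OF _ finite_permutations[of J]]) (auto simp: commuting_pairings_def)

text \<open>
  The map \<open>f\<close> identifies exactly the vertices that \<open>\<tau>\<close> pairs.
\<close>

definition paired_by :: "'s set \<Rightarrow> ('s \<Rightarrow> 's) \<Rightarrow> ('s \<Rightarrow> nat) \<Rightarrow> bool" where
  "paired_by J \<tau> f \<longleftrightarrow> (\<forall>s\<in>J. \<forall>s'\<in>J. f s = f s' \<longleftrightarrow> s' = s \<or> s' = \<tau> s)"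

definition pairs :: "'s set \<Rightarrow> ('s \<Rightarrow> 's) \<Rightarrow> 's set set" where
  "pairs J \<tau> = (\<lambda>s. {s, \<tau> s}) ` J"

lemma card_pairs:
  assumes "finite J" "\<tau> \<in> commuting_pairings J \<sigma>"
  shows "2 * card (pairs J \<tau>) = card J"
proof -
  have \<tau>: "\<tau> s \<in> J" "\<tau> s \<noteq> s" "\<tau> (\<tau> s) = s" if "s \<in> J" for s
    using assms(2) that by (auto simp: commuting_pairings_def permutes_in_image)
  have "card J = card (\<Union> (pairs J \<tau>))"
    using \<tau> by (intro arg_cong[where f = card]) (auto simp: pairs_def)
  also have "\<dots> = (\<Sum>p\<in>pairs J \<tau>. card p)"
  proof (rule card_Union_disjoint)
    have "p = {x, \<tau> x}" if px: "p \<in> pairs J \<tau>" "x \<in> p" for p x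
    proof -
      obtain s where s: "s \<in> J" "p = {s, \<tau> s}" using px by (auto simp: pairs_def)
      then have "x = s \<or> x = \<tau> s" using that by simp
      then show ?thesis using s \<tau>(3)[OF s(1)] by (metis insert_commute)
    qed
    then show "pairwise disjnt (pairs J \<tau>)" unfolding pairwise_def disjnt_def by blast
  qed (auto simp: pairs_def)
  also have "\<dots> = (\<Sum>p\<in>pairs J \<tau>. 2)"
  proof (rule sum.cong)
    fix p assume "p \<in> pairs J \<tau>"
    then obtain s where s: "s \<in> J" "p = {s, \<tau> s}" by (auto simp: pairs_def)
    then show "card p = 2" using \<tau>(2)[OF s(1)] by (simp add: card_insert_if)
  qed simp
  finally show ?thesis by simp
qed

lemma card_paired_by:
  assumes "finite J" "\<tau> \<in> commuting_pairings J \<sigma>"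
  shows "card {f \<in> J \<rightarrow>\<^sub>E {..<N}. paired_by J \<tau> f}
       = card {g \<in> pairs J \<tau> \<rightarrow>\<^sub>E {..<N}. inj_on g (pairs J \<tau>)}"
proof -
  have \<tau>: "\<tau> s \<in> J" "\<tau> s \<noteq> s" "\<tau> (\<tau> s) = s" if "s \<in> J" for s
    using assms(2) that by (auto simp: commuting_pairings_def permutes_in_image)
  define Q where "Q = pairs J \<tau>"
  have pQ: "{s, \<tau> s} \<in> Q" if "s \<in> J" for s using that by (auto simp: Q_def pairs_def)
  have pe: "{s, \<tau> s} = {s', \<tau> s'} \<longleftrightarrow> s' = s \<or> s' = \<tau> s" if "s \<in> J" "s' \<in> J" for s s'
    using that \<tau> by (metis doubleton_eq_iff)
  have "bij_betw (\<lambda>g. \<lambda>s\<in>J. g {s, \<tau> s}) {g \<in> Q \<rightarrow>\<^sub>E {..<N}. inj_on g Q} {f \<in> J \<rightarrow>\<^sub>E {..<N}. paired_by J \<tau> f}"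
  proof (rule bij_betwI[where g = "\<lambda>f. \<lambda>p\<in>Q. f (SOME s. s \<in> p)"])
    show "(\<lambda>g. \<lambda>s\<in>J. g {s, \<tau> s}) \<in> {g \<in> Q \<rightarrow>\<^sub>E {..<N}. inj_on g Q} \<rightarrow> {f \<in> J \<rightarrow>\<^sub>E {..<N}. paired_by J \<tau> f}"
    proof (rule funcsetI)
      fix g assume "g \<in> {g \<in> Q \<rightarrow>\<^sub>E {..<N}. inj_on g Q}"
      then have g: "g \<in> Q \<rightarrow>\<^sub>E {..<N}" "inj_on g Q" by auto
      have "(\<lambda>s\<in>J. g {s, \<tau> s}) \<in> J \<rightarrow>\<^sub>E {..<N}" using g pQ by auto
      moreover have "paired_by J \<tau> (\<lambda>s\<in>J. g {s, \<tau> s})"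
        unfolding paired_by_def using g(2) pQ pe by (simp add: inj_on_eq_iff)
      ultimately show "(\<lambda>s\<in>J. g {s, \<tau> s}) \<in> {f \<in> J \<rightarrow>\<^sub>E {..<N}. paired_by J \<tau> f}" by simp
    qed
    have some: "(SOME s. s \<in> p) \<in> J" "p = {SOME s. s \<in> p, \<tau> (SOME s. s \<in> p)}" if "p \<in> Q" for p
    proof -
      obtain s where s: "s \<in> J" "p = {s, \<tau> s}" using \<open>p \<in> Q\<close> by (auto simp: Q_def pairs_def)
      have "(SOME s. s \<in> p) \<in> p" by (rule someI[of _ s]) (simp add: s)
      then have "(SOME s. s \<in> p) = s \<or> (SOME s. s \<in> p) = \<tau> s" using s by auto
      then show "(SOME s. s \<in> p) \<in> J" "p = {SOME s. s \<in> p, \<tau> (SOME s. s \<in> p)}"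
        using s \<tau>[OF s(1)] by (metis, metis insert_commute)
    qed
    show "(\<lambda>f. \<lambda>p\<in>Q. f (SOME s. s \<in> p)) \<in> {f \<in> J \<rightarrow>\<^sub>E {..<N}. paired_by J \<tau> f} \<rightarrow> {g \<in> Q \<rightarrow>\<^sub>E {..<N}. inj_on g Q}"
    proof (rule funcsetI)
      fix f assume "f \<in> {f \<in> J \<rightarrow>\<^sub>E {..<N}. paired_by J \<tau> f}"
      then have f: "f \<in> J \<rightarrow>\<^sub>E {..<N}" "paired_by J \<tau> f" by auto
      have "(\<lambda>p\<in>Q. f (SOME s. s \<in> p)) \<in> Q \<rightarrow>\<^sub>E {..<N}" using f some by auto
      moreover have "inj_on (\<lambda>p\<in>Q. f (SOME s. s \<in> p)) Q"
      proof (rule inj_onI)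
        fix p p' assume p: "p \<in> Q" "p' \<in> Q" and "(\<lambda>p\<in>Q. f (SOME s. s \<in> p)) p = (\<lambda>p\<in>Q. f (SOME s. s \<in> p)) p'"
        then have "f (SOME s. s \<in> p) = f (SOME s. s \<in> p')" by simp
        then have "(SOME s. s \<in> p') = (SOME s. s \<in> p) \<or> (SOME s. s \<in> p') = \<tau> (SOME s. s \<in> p)"
          using f(2) some(1)[OF p(1)] some(1)[OF p(2)] by (simp add: paired_by_def)
        then show "p = p'" using some[OF p(1)] some[OF p(2)] pe by metis
      qed
      ultimately show "(\<lambda>p\<in>Q. f (SOME s. s \<in> p)) \<in> {g \<in> Q \<rightarrow>\<^sub>E {..<N}. inj_on g Q}" by simp
    qed
    fix g assume g: "g \<in> {g \<in> Q \<rightarrow>\<^sub>E {..<N}. inj_on g Q}"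
    show "(\<lambda>p\<in>Q. (\<lambda>s\<in>J. g {s, \<tau> s}) (SOME s. s \<in> p)) = g"
    proof (rule ext)
      fix p show "(\<lambda>p\<in>Q. (\<lambda>s\<in>J. g {s, \<tau> s}) (SOME s. s \<in> p)) p = g p"
      proof (cases "p \<in> Q")
        case True
        then show ?thesis using some(1)[OF True] some(2)[OF True, symmetric] by simp
      next
        case False
        have "g \<in> Q \<rightarrow>\<^sub>E {..<N}" using g by simp
        then show ?thesis using PiE_arb[of g Q "\<lambda>_. {..<N}" p] False by simp
      qed
    qed
  next
    have sm: "(SOME r. r \<in> {s, \<tau> s}) = s \<or> (SOME r. r \<in> {s, \<tau> s}) = \<tau> s" for s
    proof -
      have "(SOME r. r \<in> {s, \<tau> s}) \<in> {s, \<tau> s}" by (rule someI[of _ s]) simp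
      then show ?thesis by auto
    qed
    fix f assume f: "f \<in> {f \<in> J \<rightarrow>\<^sub>E {..<N}. paired_by J \<tau> f}"
    show "(\<lambda>s\<in>J. (\<lambda>p\<in>Q. f (SOME s. s \<in> p)) {s, \<tau> s}) = f"
    proof (rule ext)
      fix s show "(\<lambda>s\<in>J. (\<lambda>p\<in>Q. f (SOME s. s \<in> p)) {s, \<tau> s}) s = f s"
      proof (cases "s \<in> J")
        case True
        then have "f s = f (\<tau> s)" using f \<tau> by (simp add: paired_by_def)
        then have "f (SOME r. r \<in> {s, \<tau> s}) = f s" using sm[of s] by metis
        then show ?thesis using True pQ by simp
      next
        case False
        have "f \<in> J \<rightarrow>\<^sub>E {..<N}" using f by simp
        then show ?thesis using PiE_arb[of f J "\<lambda>_. {..<N}" s] False by simp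
      qed
    qed
  qed
  then show ?thesis unfolding Q_def by (simp add: bij_betw_same_card)
qed

text \<open>
  A square array of bounded iid variables, close to centered with variance \<open>1 / N\<close>, in which every moment
  beyond the second carries powers of a small parameter \<open>q\<close>.
\<close>

locale iid_array = prob_space M for M :: "'b measure" +
  fixes N :: nat and y :: "nat \<times> nat \<Rightarrow> 'b \<Rightarrow> real" and \<mu> :: "nat \<Rightarrow> real" and q :: real
  assumes N: "N \<ge> 1"
    and indep: "indep_vars (\<lambda>_. borel) y ({..<N} \<times> {..<N})"
    and bounded_entries: "\<exists>C. \<forall>e\<in>{..<N} \<times> {..<N}. \<forall>\<omega>\<in>space M. \<bar>y e \<omega>\<bar> \<le> C"
    and moments: "\<And>e p. e \<in> {..<N} \<times> {..<N} \<Longrightarrow> expectation (\<lambda>\<omega>. y e \<omega> ^ p) = \<mu> p"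
    and q: "1 / real N \<le> q" "q \<le> 1"
    and \<mu>1: "\<bar>\<mu> 1\<bar> \<le> q / real N"
    and \<mu>2: "0 \<le> \<mu> 2" "\<mu> 2 \<le> 1 / real N"
    and \<mu>3: "\<And>p. p \<ge> 3 \<Longrightarrow> \<bar>\<mu> p\<bar> \<le> q ^ (p - 2) / real N"
begin

lemma q0: "q > 0"
proof -
  have "1 / real N > 0" using N by simp
  then show ?thesis using q(1) by linarith
qed

lemma entry_measurable [measurable (raw)]:
  "e \<in> {..<N} \<times> {..<N} \<Longrightarrow> y e \<in> borel_measurable M"
  using indep by (auto simp: indep_vars_def)

lemma \<mu>_le: "p \<ge> 1 \<Longrightarrow> \<bar>\<mu> p\<bar> \<le> q ^ (p - 2) / real N"
proof -
  assume "p \<ge> 1"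
  then consider "p = 1" | "p = 2" | "p \<ge> 3" by linarith
  then show ?thesis
  proof cases
    case 1
    have "q / real N \<le> 1 / real N" using q(2) by (intro divide_right_mono) auto
    then have "\<bar>\<mu> 1\<bar> \<le> 1 / real N" using \<mu>1 by linarith
    then show ?thesis using 1 by simp
  qed (use \<mu>2 \<mu>3 in auto)
qed

lemma \<mu>_le_inverse: "p \<ge> 1 \<Longrightarrow> \<bar>\<mu> p\<bar> \<le> 1 / real N"
proof -
  assume "p \<ge> 1"
  moreover have "q ^ (p - 2) / real N \<le> 1 / real N"
    using power_le_one[of q "p - 2"] q0 q(2) by (intro divide_right_mono) auto
  ultimately show ?thesis using \<mu>_le[of p] by linarith
qed

lemma \<mu>_le_bad: "p \<ge> 1 \<Longrightarrow> p \<noteq> 2 \<Longrightarrow> \<bar>\<mu> p\<bar> \<le> q / real N"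
proof -
  assume "p \<ge> 1" "p \<noteq> 2"
  then consider "p = 1" | "p \<ge> 3" by linarith
  then show ?thesis
  proof cases
    case 2
    then have "q ^ (p - 2) \<le> q ^ 1" using q0 q by (intro power_decreasing) auto
    then have "q ^ (p - 2) / real N \<le> q / real N" by (intro divide_right_mono) auto
    then show ?thesis using \<mu>3[OF 2] by linarith
  qed (use \<mu>1 in auto)
qed

lemma prod_entries_integrable:
  assumes "finite J" "e ` J \<subseteq> {..<N} \<times> {..<N}"
  shows "integrable M (\<lambda>\<omega>. \<Prod>s\<in>J. y (e s) \<omega>)"
proof -
  obtain C where C: "\<forall>e\<in>{..<N} \<times> {..<N}. \<forall>\<omega>\<in>space M. \<bar>y e \<omega>\<bar> \<le> C"
    using bounded_entries by blast
  show ?thesis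
  proof (rule integrable_const_bound)
    show "AE \<omega> in M. norm (\<Prod>s\<in>J. y (e s) \<omega>) \<le> (\<Prod>s\<in>J. C)"
    proof (rule AE_I2)
      fix \<omega> assume "\<omega> \<in> space M"
      then have "\<bar>\<Prod>s\<in>J. y (e s) \<omega>\<bar> \<le> (\<Prod>s\<in>J. C)"
        unfolding abs_prod using C assms(2) by (intro prod_mono) auto
      then show "norm (\<Prod>s\<in>J. y (e s) \<omega>) \<le> (\<Prod>s\<in>J. C)" by simp
    qed
    show "(\<lambda>\<omega>. \<Prod>s\<in>J. y (e s) \<omega>) \<in> borel_measurable M"
      using assms(2) by (intro borel_measurable_prod entry_measurable) auto
  qed
qed

lemma expectation_prod_entries:
  assumes "finite J" "e ` J \<subseteq> {..<N} \<times> {..<N}"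
  shows "expectation (\<lambda>\<omega>. \<Prod>s\<in>J. y (e s) \<omega>) = (\<Prod>x\<in>e ` J. \<mu> (card {s\<in>J. e s = x}))"
proof -
  have eq: "(\<lambda>\<omega>. \<Prod>s\<in>J. y (e s) \<omega>) = (\<lambda>\<omega>. \<Prod>x\<in>e ` J. y x \<omega> ^ card {s\<in>J. e s = x})"
  proof
    fix \<omega>
    have "(\<Prod>s\<in>J. y (e s) \<omega>) = (\<Prod>x\<in>e ` J. \<Prod>s\<in>{s\<in>J. e s = x}. y (e s) \<omega>)"
      using assms(1) by (rule prod.image_gen)
    also have "\<dots> = (\<Prod>x\<in>e ` J. y x \<omega> ^ card {s\<in>J. e s = x})"
      by (intro prod.cong) (auto simp: prod_constant)
    finally show "(\<Prod>s\<in>J. y (e s) \<omega>) = (\<Prod>x\<in>e ` J. y x \<omega> ^ card {s\<in>J. e s = x})" .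
  qed
  have "expectation (\<lambda>\<omega>. \<Prod>s\<in>J. y (e s) \<omega>) = (\<Prod>x\<in>e ` J. expectation (\<lambda>\<omega>. y x \<omega> ^ card {s\<in>J. e s = x}))"
    unfolding eq
  proof (rule indep_vars_lebesgue_integral)
    have "indep_vars (\<lambda>_. borel) (\<lambda>x \<omega>. (\<lambda>u. u ^ card {s\<in>J. e s = x}) (y x \<omega>)) ({..<N} \<times> {..<N})"
      by (rule indep_vars_compose2[OF indep]) auto
    then show "indep_vars (\<lambda>_. borel) (\<lambda>x \<omega>. y x \<omega> ^ card {s\<in>J. e s = x}) (e ` J)"
      using assms(2) by (rule indep_vars_subset)
    fix x assume "x \<in> e ` J"
    then have "integrable M (\<lambda>\<omega>. \<Prod>s\<in>{s\<in>J. e s = x}. y (e s) \<omega>)"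
      using assms by (intro prod_entries_integrable) auto
    also have "(\<lambda>\<omega>. \<Prod>s\<in>{s\<in>J. e s = x}. y (e s) \<omega>) = (\<lambda>\<omega>. y x \<omega> ^ card {s\<in>J. e s = x})"
      by (auto intro!: prod.cong simp flip: prod_constant)
    finally show "integrable M (\<lambda>\<omega>. y x \<omega> ^ card {s\<in>J. e s = x})" .
  qed (use assms in auto)
  also have "\<dots> = (\<Prod>x\<in>e ` J. \<mu> (card {s\<in>J. e s = x}))"
    using assms(2) by (intro prod.cong moments) auto
  finally show ?thesis .
qed

text \<open>
  If \<open>\<sigma>\<close> consists of cycles of lengths \<open>m\<^sub>1, m\<^sub>2, \<dots>\<close>, this is the product of the traces of the
  corresponding powers of the array. Working with \<open>\<sigma>\<close> treats all cycles on the same footing.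
\<close>

definition perm_trace :: "'s set \<Rightarrow> ('s \<Rightarrow> 's) \<Rightarrow> 'b \<Rightarrow> real" where
  "perm_trace J \<sigma> \<omega> = (\<Sum>f\<in>J \<rightarrow>\<^sub>E {..<N}. \<Prod>s\<in>J. y (f s, f (\<sigma> s)) \<omega>)"

text \<open>
  The image of the cycles under \<open>f\<close> is a directed graph in which every vertex has an outgoing edge,
  so it has at least as many edges as vertices. If some edge is not used exactly twice, then its
  moment gives the factor \<open>q\<close>. If all edges are used exactly twice and there are as many edges as
  vertices, then out-degrees are 1, and \<open>f\<close> glues the vertices in pairs compatibly with \<open>\<sigma>\<close>. The
  remaining case has one edge more than vertices and gains \<open>1 / N\<close>.
\<close>

lemma bad_term_le:
  assumes J: "finite J" and \<sigma>: "bij_betw \<sigma> J J" and f: "f \<in> J \<rightarrow>\<^sub>E {..<N}"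
    and bad: "\<not> (\<exists>\<tau>\<in>commuting_pairings J \<sigma>. paired_by J \<tau> f)"
  shows "\<bar>expectation (\<lambda>\<omega>. \<Prod>s\<in>J. y (f s, f (\<sigma> s)) \<omega>)\<bar> \<le> q * (1 / real N) ^ card (f ` J)"
proof -
  define e where "e s = (f s, f (\<sigma> s))" for s
  define E where "E = e ` J"
  define p where "p x = card {s\<in>J. e s = x}" for x
  have \<sigma>J: "\<sigma> s \<in> J" if "s \<in> J" for s using bij_betwE[OF \<sigma>] that by blast
  have finE: "finite E" using J by (simp add: E_def)
  have p1: "p x \<ge> 1" if "x \<in> E" for x
  proof -
    have "{s\<in>J. e s = x} \<noteq> {}" using that by (auto simp: E_def)
    then show ?thesis using J by (simp add: p_def Suc_le_eq card_gt_0_iff)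
  qed
  have fE: "fst ` E = f ` J" by (force simp: E_def e_def image_image)
  have VE: "card (f ` J) \<le> card E" using card_image_le[OF finE, of fst] fE by simp
  have "\<bar>expectation (\<lambda>\<omega>. \<Prod>s\<in>J. y (e s) \<omega>)\<bar> = (\<Prod>x\<in>E. \<bar>\<mu> (p x)\<bar>)"
    using f \<sigma>J J by (subst expectation_prod_entries) (auto simp: e_def E_def p_def abs_prod)
  also have "\<dots> \<le> q * (1 / real N) ^ card (f ` J)"
  proof (cases "\<exists>x\<in>E. p x \<noteq> 2")
    case True
    then obtain x where x: "x \<in> E" "p x \<noteq> 2" by blast
    have "(\<Prod>x\<in>E. \<bar>\<mu> (p x)\<bar>) = \<bar>\<mu> (p x)\<bar> * (\<Prod>x\<in>E - {x}. \<bar>\<mu> (p x)\<bar>)"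
      by (rule prod.remove[OF finE x(1)])
    also have "\<dots> \<le> (q / real N) * (\<Prod>x\<in>E - {x}. 1 / real N)"
      using \<mu>_le_bad[OF p1] \<mu>_le_inverse[OF p1] x q0
      by (intro mult_mono prod_mono) (auto intro!: prod_nonneg)
    also have "\<dots> = q * ((1 / real N) * (1 / real N) ^ card (E - {x}))" by simp
    also have "(1 / real N) * (1 / real N) ^ card (E - {x}) = (1 / real N) ^ card E"
      using x finE by (metis power_Suc card_Suc_Diff1)
    also have "q * (1 / real N) ^ card E \<le> q * (1 / real N) ^ card (f ` J)"
      using VE q0 N by (intro mult_left_mono power_decreasing) auto
    finally show ?thesis .
  next
    case False
    then have p2: "p x = 2" if "x \<in> E" for x using that by blast
    have "card (f ` J) \<noteq> card E"
    proof
      assume "card (f ` J) = card E"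
      then have inj: "inj_on fst E" using fE finE eq_card_imp_inj_on by metis
      have fol: "f s = f s' \<longleftrightarrow> e s = e s'" if "s \<in> J" "s' \<in> J" for s s'
      proof -
        have "fst (e s) = f s" "fst (e s') = f s'" "e s \<in> E" "e s' \<in> E"
          using that by (auto simp: e_def E_def)
        then show ?thesis using inj by (metis inj_on_eq_iff)
      qed
      have two: "card {s'\<in>J. f s' = f s} = 2" if "s \<in> J" for s
      proof -
        have "{s'\<in>J. f s' = f s} = {s'\<in>J. e s' = e s}" using that fol by auto
        then show ?thesis using p2[of "e s"] that by (simp add: p_def E_def)
      qed
      define \<tau> where "\<tau> s = (if s \<in> J then THE s'. s' \<in> J \<and> f s' = f s \<and> s' \<noteq> s else s)" for s
      have ex: "\<exists>!s'. s' \<in> J \<and> f s' = f s \<and> s' \<noteq> s" if sJ: "s \<in> J" for s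
      proof -
        obtain a b where ab: "{s'\<in>J. f s' = f s} = {a, b}" "a \<noteq> b"
          using two[OF sJ] unfolding card_2_iff by blast
        have mem: "s' \<in> J \<and> f s' = f s \<longleftrightarrow> s' = a \<or> s' = b" for s'
          using eqset_imp_iff[OF ab(1), of s'] by simp
        then consider "s = a" | "s = b" using sJ by blast
        then show ?thesis
        proof cases
          case 1
          show ?thesis by (rule ex1I[of _ b]) (use mem ab(2) 1 in metis)+
        next
          case 2
          show ?thesis by (rule ex1I[of _ a]) (use mem ab(2) 2 in metis)+
        qed
      qed
      have \<tau>: "\<tau> s \<in> J \<and> f (\<tau> s) = f s \<and> \<tau> s \<noteq> s" if "s \<in> J" for s
        using theI'[OF ex[OF that]] that by (simp add: \<tau>_def)
      have \<tau>u: "s' = \<tau> s" if "s \<in> J" "s' \<in> J" "f s' = f s" "s' \<noteq> s" for s s'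
        using ex[OF that(1)] \<tau>[OF that(1)] that by blast
      have \<tau>\<tau>: "\<tau> (\<tau> s) = s" if "s \<in> J" for s
        using \<tau>u[of "\<tau> s" s] \<tau>[OF that] that by metis
      have perm: "\<tau> permutes J"
      proof (rule bij_imp_permutes)
        show "bij_betw \<tau> J J" using \<tau> \<tau>\<tau> by (intro bij_betwI[where g = \<tau>]) auto
      qed (simp add: \<tau>_def)
      have comm: "\<tau> (\<sigma> s) = \<sigma> (\<tau> s)" if s: "s \<in> J" for s
      proof -
        have "e (\<tau> s) = e s" using fol \<tau>[OF s] s by metis
        then have "f (\<sigma> (\<tau> s)) = f (\<sigma> s)" by (simp add: e_def)
        moreover have "\<sigma> (\<tau> s) \<noteq> \<sigma> s" using \<tau>[OF s] bij_betw_imp_inj_on[OF \<sigma>] s by (metis inj_onD)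
        ultimately show ?thesis using \<tau>u[of "\<sigma> s" "\<sigma> (\<tau> s)"] \<sigma>J \<tau>[OF s] s by metis
      qed
      have "\<tau> \<in> commuting_pairings J \<sigma>"
        using perm \<tau> \<tau>\<tau> comm by (simp add: commuting_pairings_def)
      moreover have "paired_by J \<tau> f"
        unfolding paired_by_def using \<tau> \<tau>u by metis
      ultimately show False using bad by blast
    qed
    then have lt: "Suc (card (f ` J)) \<le> card E" using VE by simp
    have "(\<Prod>x\<in>E. \<bar>\<mu> (p x)\<bar>) \<le> (\<Prod>x\<in>E. 1 / real N)"
      using \<mu>_le_inverse[OF p1] by (intro prod_mono) auto
    also have "\<dots> = (1 / real N) ^ card E" by simp
    also have "\<dots> \<le> (1 / real N) ^ Suc (card (f ` J))"
      using lt N by (intro power_decreasing) auto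
    also have "\<dots> = (1 / real N) * (1 / real N) ^ card (f ` J)" by simp
    also have "\<dots> \<le> q * (1 / real N) ^ card (f ` J)"
      using q by (intro mult_right_mono) auto
    finally show ?thesis .
  qed
  finally show ?thesis by (simp add: e_def)
qed

lemma good_term_eq:
  assumes J: "finite J" and \<sigma>: "bij_betw \<sigma> J J" and f: "f \<in> J \<rightarrow>\<^sub>E {..<N}"
    and \<tau>: "\<tau> \<in> commuting_pairings J \<sigma>" and pf: "paired_by J \<tau> f"
  shows "expectation (\<lambda>\<omega>. \<Prod>s\<in>J. y (f s, f (\<sigma> s)) \<omega>) = \<mu> 2 ^ (card J div 2)"
proof -
  define e where "e s = (f s, f (\<sigma> s))" for s
  have \<sigma>J: "\<sigma> s \<in> J" if "s \<in> J" for s using bij_betwE[OF \<sigma>] that by blast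
  have t: "\<tau> s \<in> J" "\<tau> s \<noteq> s" "\<tau> (\<tau> s) = s" "\<tau> (\<sigma> s) = \<sigma> (\<tau> s)" if "s \<in> J" for s
    using \<tau> that by (auto simp: commuting_pairings_def permutes_in_image)
  have fib: "{s'\<in>J. e s' = e s} = {s, \<tau> s}" if s: "s \<in> J" for s
  proof -
    have same: "f (\<tau> s) = f s" if "s \<in> J" for s
      using pf that t(1)[OF that] unfolding paired_by_def by metis
    have "f (\<tau> s) = f s" by (rule same[OF s])
    moreover have "f (\<sigma> (\<tau> s)) = f (\<sigma> s)"
      using same[OF \<sigma>J[OF s]] t(4)[OF s] by metis
    moreover have "s' = s \<or> s' = \<tau> s" if "s' \<in> J" "f s' = f s" for s'
      using pf s that unfolding paired_by_def by metis
    ultimately show ?thesis using s t(1)[OF s] unfolding e_def by auto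
  qed
  have two: "card {s'\<in>J. e s' = x} = 2" if "x \<in> e ` J" for x
  proof -
    from that obtain s where s: "s \<in> J" "x = e s" by blast
    show ?thesis unfolding s(2) fib[OF s(1)] using t(2)[OF s(1)] by (simp add: card_insert_if)
  qed
  have "card J = (\<Sum>x\<in>e ` J. card {s\<in>J. e s = x})"
    using J sum.image_gen[OF J, of "\<lambda>_. 1 :: nat" e] by simp
  also have "\<dots> = 2 * card (e ` J)" using two by simp
  finally have c: "card (e ` J) = card J div 2" by simp
  have "expectation (\<lambda>\<omega>. \<Prod>s\<in>J. y (e s) \<omega>) = (\<Prod>x\<in>e ` J. \<mu> (card {s\<in>J. e s = x}))"
    using f \<sigma>J J by (subst expectation_prod_entries) (auto simp: e_def)
  also have "\<dots> = \<mu> 2 ^ (card J div 2)" using two c by simp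
  finally show ?thesis by (simp add: e_def)
qed

text \<open>
  Each commuting pairing \<open>\<tau>\<close> has about \<open>N\<close> to the number of pairs maps that it describes, all with
  the same expectation; maps described by no pairing contribute \<open>O(q)\<close> in total.
\<close>

theorem expectation_perm_trace_approx:
  fixes J :: "'s set"
  assumes J: "finite J" and \<sigma>: "bij_betw \<sigma> J J"
  defines "c \<equiv> card (commuting_pairings J \<sigma>)" and "n \<equiv> card J"
  shows "\<bar>expectation (perm_trace J \<sigma>) - real c * (real N * \<mu> 2) ^ (n div 2)\<bar> \<le> (1 + real c) * real (n + 1) ^ n * q"
proof -
  define S where "S = J \<rightarrow>\<^sub>E {..<N}"
  define F where "F \<tau> = {f \<in> S. paired_by J \<tau> f}" for \<tau>
  define G where "G = (\<Union>\<tau>\<in>commuting_pairings J \<sigma>. F \<tau>)"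
  define X where "X f = expectation (\<lambda>\<omega>. \<Prod>s\<in>J. y (f s, f (\<sigma> s)) \<omega>)" for f
  define C where "C = real (n + 1) ^ n"
  have finS: "finite S" using J by (simp add: S_def finite_PiE)
  have GS: "G \<subseteq> S" by (auto simp: G_def F_def)
  have \<sigma>J: "\<sigma> s \<in> J" if "s \<in> J" for s using bij_betwE[OF \<sigma>] that by blast
  have "expectation (perm_trace J \<sigma>) = (\<Sum>f\<in>S. X f)"
    unfolding perm_trace_def X_def S_def
    using \<sigma>J J by (intro Bochner_Integration.integral_sum prod_entries_integrable) auto
  also have "\<dots> = (\<Sum>f\<in>S - G. X f) + (\<Sum>f\<in>G. X f)"
    by (rule sum.subset_diff[OF GS finS])
  finally have split: "expectation (perm_trace J \<sigma>) = (\<Sum>f\<in>S - G. X f) + (\<Sum>f\<in>G. X f)" .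
  have "\<bar>\<Sum>f\<in>S - G. X f\<bar> \<le> (\<Sum>f\<in>S - G. q * (1 / real N) ^ card (f ` J))"
    unfolding X_def
    by (rule order_trans[OF sum_abs sum_mono], rule bad_term_le[OF J \<sigma>]) (auto simp: S_def G_def F_def)
  also have "\<dots> \<le> (\<Sum>f\<in>S. q * (1 / real N) ^ card (f ` J))"
    using finS q0 by (intro sum_mono2) auto
  also have "\<dots> \<le> q * C"
    unfolding sum_distrib_left[symmetric] S_def C_def n_def
    using q0 by (intro mult_left_mono sum_inverse_power_card_image_le J N) auto
  finally have bad: "\<bar>\<Sum>f\<in>S - G. X f\<bar> \<le> q * C" .
  have "(\<Sum>f\<in>G. X f) = (\<Sum>f\<in>G. \<mu> 2 ^ (n div 2))"
    using good_term_eq[OF J \<sigma>] unfolding X_def n_def by (intro sum.cong) (auto simp: G_def F_def S_def)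
  also have "\<dots> = real (card G) * \<mu> 2 ^ (n div 2)" by simp
  also have "card G = (\<Sum>\<tau>\<in>commuting_pairings J \<sigma>. card (F \<tau>))"
    unfolding G_def
  proof (rule card_UN_disjoint)
    show "\<forall>i\<in>commuting_pairings J \<sigma>. \<forall>j\<in>commuting_pairings J \<sigma>. i \<noteq> j \<longrightarrow> F i \<inter> F j = {}"
    proof (intro ballI impI)
      fix t t' assume t: "t \<in> commuting_pairings J \<sigma>" "t' \<in> commuting_pairings J \<sigma>" "t \<noteq> t'"
      show "F t \<inter> F t' = {}"
      proof (rule ccontr)
        assume "F t \<inter> F t' \<noteq> {}"
        then obtain f where f: "paired_by J t f" "paired_by J t' f" by (auto simp: F_def)
        have "t s = t' s" for s
        proof (cases "s \<in> J")
          case True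
          then have "t s \<in> J" "t s \<noteq> s" using t by (auto simp: commuting_pairings_def permutes_in_image)
          then show ?thesis using f True unfolding paired_by_def by metis
        next
          case False
          then show ?thesis using t by (auto simp: commuting_pairings_def permutes_def)
        qed
        then show False using t(3) by auto
      qed
    qed
  qed (use finS J in \<open>auto simp: F_def\<close>)
  finally have good: "(\<Sum>f\<in>G. X f) = (\<Sum>\<tau>\<in>commuting_pairings J \<sigma>. real (card (F \<tau>)) * \<mu> 2 ^ (n div 2))"
    by (simp add: sum_distrib_right)
  have each: "\<bar>real (card (F \<tau>)) * \<mu> 2 ^ (n div 2) - (real N * \<mu> 2) ^ (n div 2)\<bar> \<le> C * q"
    if \<tau>: "\<tau> \<in> commuting_pairings J \<sigma>" for \<tau>
  proof -
    define k where "k = card (pairs J \<tau>)"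
    have k: "2 * k = n" using card_pairs[OF J \<tau>] by (simp add: k_def n_def)
    define r where "r = real (card (F \<tau>)) / real N ^ k"
    have "finite (pairs J \<tau>)" using J by (simp add: pairs_def)
    then have "\<bar>r - 1\<bar> \<le> real (k + 1) ^ k / real N"
      unfolding r_def F_def S_def card_paired_by[OF J \<tau>] k_def
      by (rule card_inj_functions_approx) (rule N)
    also have "\<dots> \<le> C / real N"
    proof (rule divide_right_mono)
      have "real (k + 1) ^ k \<le> real (n + 1) ^ k" using k by (intro power_mono) auto
      also have "\<dots> \<le> C" unfolding C_def using k by (intro power_increasing) auto
      finally show "real (k + 1) ^ k \<le> C" .
    qed simp
    also have "\<dots> \<le> C * q" using q(1) mult_left_mono[of "1 / real N" q C] by (simp add: C_def)
    finally have r1: "\<bar>r - 1\<bar> \<le> C * q" .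
    have N\<mu>: "0 \<le> real N * \<mu> 2" "real N * \<mu> 2 \<le> 1"
      using \<mu>2 N by (auto simp: field_simps)
    have "real (card (F \<tau>)) * \<mu> 2 ^ k = r * (real N * \<mu> 2) ^ k"
      using N by (simp add: r_def power_mult_distrib)
    then have "\<bar>real (card (F \<tau>)) * \<mu> 2 ^ k - (real N * \<mu> 2) ^ k\<bar> = \<bar>r - 1\<bar> * (real N * \<mu> 2) ^ k"
    proof -
      define z where "z = (real N * \<mu> 2) ^ k"
      assume e: "real (card (F \<tau>)) * \<mu> 2 ^ k = r * (real N * \<mu> 2) ^ k"
      have "z \<ge> 0" using N\<mu> by (simp add: z_def)
      moreover have "r * z - z = (r - 1) * z" by (simp add: algebra_simps)
      ultimately show ?thesis unfolding e z_def[symmetric] by (simp add: abs_mult)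
    qed
    also have "\<dots> \<le> \<bar>r - 1\<bar> * 1"
      using N\<mu> by (intro mult_left_mono power_le_one) auto
    finally show ?thesis using r1 k by auto
  qed
  have "\<bar>(\<Sum>f\<in>G. X f) - real c * (real N * \<mu> 2) ^ (n div 2)\<bar>
     = \<bar>\<Sum>\<tau>\<in>commuting_pairings J \<sigma>. real (card (F \<tau>)) * \<mu> 2 ^ (n div 2) - (real N * \<mu> 2) ^ (n div 2)\<bar>"
    unfolding good sum_subtractf c_def by simp
  also have "\<dots> \<le> (\<Sum>\<tau>\<in>commuting_pairings J \<sigma>. C * q)"
    by (rule order_trans[OF sum_abs sum_mono]) (rule each)
  also have "\<dots> = real c * C * q" by (simp add: c_def)
  finally show ?thesis using bad unfolding split C_def[symmetric] by (simp add: algebra_simps)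
qed

end

section \<open>Counting commuting pairings\<close>

lemma commuting_pairings_cong:
  assumes "\<And>s. s \<in> J \<Longrightarrow> \<sigma> s = \<sigma>' s"
  shows "commuting_pairings J \<sigma> = commuting_pairings J \<sigma>'"
  using assms by (auto simp: commuting_pairings_def permutes_in_image)

lemma permutes_involution:
  assumes "\<And>s. s \<in> J \<Longrightarrow> p s \<in> J \<and> p (p s) = s" "\<And>s. s \<notin> J \<Longrightarrow> p s = s"
  shows "p permutes J"
  using assms by (intro bij_imp_permutes bij_betwI[where g = p]) auto

text \<open>
  A commuting pairing that preserves a union of cycles splits into its restrictions to that union
  and to the rest, and these can be chosen independently.
\<close>

lemma card_commuting_pairings_extending:
  assumes J: "J1 \<inter> J2 = {}" and \<sigma>: "\<And>s. s \<in> J1 \<Longrightarrow> \<sigma> s \<in> J1" "\<And>s. s \<in> J2 \<Longrightarrow> \<sigma> s \<in> J2"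
    and \<tau>1: "\<tau>1 \<in> commuting_pairings J1 \<sigma>"
  shows "card {\<tau> \<in> commuting_pairings (J1 \<union> J2) \<sigma>. \<forall>s\<in>J1. \<tau> s = \<tau>1 s} = card (commuting_pairings J2 \<sigma>)"
proof -
  have t1: "\<tau>1 s \<in> J1" "\<tau>1 s \<noteq> s" "\<tau>1 (\<tau>1 s) = s" "\<tau>1 (\<sigma> s) = \<sigma> (\<tau>1 s)" if "s \<in> J1" for s
    using \<tau>1 that by (auto simp: commuting_pairings_def permutes_in_image)
  let ?up = "\<lambda>\<tau> s. if s \<in> J1 then \<tau>1 s else \<tau> s"
  let ?down = "\<lambda>\<tau> s. if s \<in> J2 then \<tau> s else s"
  have "bij_betw ?up (commuting_pairings J2 \<sigma>) {\<tau> \<in> commuting_pairings (J1 \<union> J2) \<sigma>. \<forall>s\<in>J1. \<tau> s = \<tau>1 s}"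
  proof (rule bij_betwI[where g = ?down])
    show "?up \<in> commuting_pairings J2 \<sigma> \<rightarrow> {\<tau> \<in> commuting_pairings (J1 \<union> J2) \<sigma>. \<forall>s\<in>J1. \<tau> s = \<tau>1 s}"
    proof (rule funcsetI)
      fix \<tau> assume \<tau>: "\<tau> \<in> commuting_pairings J2 \<sigma>"
      have t: "\<tau> s \<in> J2 \<and> \<tau> s \<noteq> s \<and> \<tau> (\<tau> s) = s \<and> \<tau> (\<sigma> s) = \<sigma> (\<tau> s)" if "s \<in> J2" for s
        using that \<tau> by (auto simp: commuting_pairings_def permutes_in_image)
      have tid: "\<tau> s = s" if "s \<notin> J2" for s
        using that \<tau> by (auto simp: commuting_pairings_def permutes_not_in)
      have n1: "s \<notin> J1" if "s \<in> J2" for s using J that by blast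
      have main: "?up \<tau> s \<in> J1 \<union> J2 \<and> ?up \<tau> s \<noteq> s \<and> ?up \<tau> (?up \<tau> s) = s \<and> ?up \<tau> (\<sigma> s) = \<sigma> (?up \<tau> s)" if "s \<in> J1 \<union> J2" for s
      proof (cases "s \<in> J1")
        case True
        then show ?thesis using t1[OF True] \<sigma>(1)[OF True] by simp
      next
        case False
        then have s: "s \<in> J2" using that by blast
        then show ?thesis using False t[OF s] n1[OF s] n1[OF conjunct1[OF t[OF s]]] n1[OF \<sigma>(2)[OF s]] by simp
      qed
      have "?up \<tau> permutes (J1 \<union> J2)"
        by (rule permutes_involution) (use main tid in \<open>auto split: if_splits\<close>)
      then show "?up \<tau> \<in> {\<tau> \<in> commuting_pairings (J1 \<union> J2) \<sigma>. \<forall>s\<in>J1. \<tau> s = \<tau>1 s}"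
        using main by (simp add: commuting_pairings_def)
    qed
    show "?down \<in> {\<tau> \<in> commuting_pairings (J1 \<union> J2) \<sigma>. \<forall>s\<in>J1. \<tau> s = \<tau>1 s} \<rightarrow> commuting_pairings J2 \<sigma>"
    proof (rule funcsetI)
      fix \<tau> assume \<tau>: "\<tau> \<in> {\<tau> \<in> commuting_pairings (J1 \<union> J2) \<sigma>. \<forall>s\<in>J1. \<tau> s = \<tau>1 s}"
      then have p: "\<tau> permutes (J1 \<union> J2)"
        and q: "\<forall>s\<in>J1 \<union> J2. \<tau> s \<noteq> s \<and> \<tau> (\<tau> s) = s \<and> \<tau> (\<sigma> s) = \<sigma> (\<tau> s)"
        by (auto simp: commuting_pairings_def)
      have t: "\<tau> s \<in> J1 \<union> J2 \<and> \<tau> s \<noteq> s \<and> \<tau> (\<tau> s) = s \<and> \<tau> (\<sigma> s) = \<sigma> (\<tau> s)" if "s \<in> J1 \<union> J2" for s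
        using permutes_in_image[OF p, of s] q that by blast
      have t2: "\<tau> s \<in> J2" if s: "s \<in> J2" for s
      proof (rule ccontr)
        assume "\<tau> s \<notin> J2"
        then have "\<tau> s \<in> J1" using t s by blast
        then have "\<tau> (\<tau> s) \<in> J1" using \<tau> t1(1) by simp
        then show False using t[of s] s J by auto
      qed
      have main: "?down \<tau> s \<in> J2 \<and> ?down \<tau> s \<noteq> s \<and> ?down \<tau> (?down \<tau> s) = s \<and> ?down \<tau> (\<sigma> s) = \<sigma> (?down \<tau> s)"
        if "s \<in> J2" for s
        using t[of s] t2[OF that] that \<sigma>(2)[OF that] by simp
      have "?down \<tau> permutes J2"
        by (rule permutes_involution) (use main in blast, simp)
      then show "?down \<tau> \<in> commuting_pairings J2 \<sigma>"
        using main unfolding commuting_pairings_def by blast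
    qed
    show "?down (?up \<tau>) = \<tau>" if \<tau>: "\<tau> \<in> commuting_pairings J2 \<sigma>" for \<tau>
    proof
      fix s
      have "s \<notin> J1" if "s \<in> J2" using J that by blast
      moreover have "\<tau> s = s" if "s \<notin> J2"
        using \<tau> permutes_not_in[OF _ that, of \<tau>] by (simp add: commuting_pairings_def)
      ultimately show "?down (?up \<tau>) s = \<tau> s" by simp
    qed
    show "?up (?down \<tau>) = \<tau>" if "\<tau> \<in> {\<tau> \<in> commuting_pairings (J1 \<union> J2) \<sigma>. \<forall>s\<in>J1. \<tau> s = \<tau>1 s}" for \<tau>
    proof
      fix s
      have p: "\<tau> permutes (J1 \<union> J2)" and "\<forall>s\<in>J1. \<tau> s = \<tau>1 s" using that by (auto simp: commuting_pairings_def)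
      moreover have "\<tau> s = s" if "s \<notin> J1 \<union> J2" using p that by (rule permutes_not_in)
      ultimately show "?up (?down \<tau>) s = \<tau> s" by auto
    qed
  qed
  then show ?thesis by (simp add: bij_betw_same_card)
qed

text \<open>
  The vertices of disjoint cycles of lengths \<open>m a\<close>, for \<open>a \<in> A\<close>.
\<close>

definition slots :: "nat set \<Rightarrow> (nat \<Rightarrow> nat) \<Rightarrow> (nat \<times> nat) set" where
  "slots A m = (SIGMA a:A. {..<m a})"

definition rot :: "(nat \<Rightarrow> nat) \<Rightarrow> nat \<times> nat \<Rightarrow> nat \<times> nat" where
  "rot m s = (fst s, Suc (snd s) mod m (fst s))"

definition num_pairings :: "nat set \<Rightarrow> (nat \<Rightarrow> nat) \<Rightarrow> nat" where
  "num_pairings A m = card (commuting_pairings (slots A m) (rot m))"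

lemma finite_slots [simp]: "finite A \<Longrightarrow> finite (slots A m)"
  by (simp add: slots_def)

lemma rot_slots: "s \<in> slots A m \<Longrightarrow> rot m s \<in> slots A m"
  by (auto simp: slots_def rot_def intro: mod_less_divisor)

lemma mod_add_cancel_self: "(k + j) mod n = k \<Longrightarrow> n dvd j" for k j n :: nat
  by (metis add.commute add_diff_cancel_left' dvd_minus_mod dvd_triv_left mod_add_self2 mod_eq_dvd_iff_nat mod_mod_trivial le_add1 mod_less_eq_dividend)

lemma bij_betw_rot: "bij_betw (rot m) (slots A m) (slots A m)"
proof (rule bij_betwI[where g = "\<lambda>s. (fst s, (snd s + (m (fst s) - 1)) mod m (fst s))"])
  show "rot m \<in> slots A m \<rightarrow> slots A m" by (auto intro: rot_slots)
  show "(\<lambda>s. (fst s, (snd s + (m (fst s) - 1)) mod m (fst s))) \<in> slots A m \<rightarrow> slots A m"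
    by (auto simp: slots_def)
  show "(\<lambda>s. (fst s, (snd s + (m (fst s) - 1)) mod m (fst s))) (rot m s) = s" if sl: "s \<in> slots A m" for s
  proof -
    obtain a k where s: "s = (a, k)" "k < m a" using sl by (auto simp: slots_def)
    have "(Suc k mod m a + (m a - 1)) mod m a = (Suc k + (m a - 1)) mod m a" by (simp add: mod_add_left_eq)
    also have "Suc k + (m a - 1) = k + m a" using s(2) by simp
    finally show ?thesis using s by (simp add: rot_def)
  qed
  show "rot m ((\<lambda>s. (fst s, (snd s + (m (fst s) - 1)) mod m (fst s))) s) = s" if sl: "s \<in> slots A m" for s
  proof -
    obtain a k where s: "s = (a, k)" "k < m a" using sl by (auto simp: slots_def)
    have "Suc ((k + (m a - 1)) mod m a) mod m a = Suc (k + (m a - 1)) mod m a" by (simp add: mod_Suc_eq)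
    also have "Suc (k + (m a - 1)) = k + m a" using s(2) by simp
    finally show ?thesis using s by (simp add: rot_def)
  qed
qed

text \<open>
  Commuting with the rotation, a pairing is determined on a cycle by its value at one vertex.
\<close>

lemma commuting_pairing_on_cycle:
  assumes \<tau>: "\<tau> \<in> commuting_pairings (slots A m) (rot m)" and a: "a \<in> A" "m a \<ge> 1" "i < m a"
    and t: "\<tau> (a, i) = (b, k)" and b: "b \<in> A" "k < m b"
  shows "\<tau> (a, (i + j) mod m a) = (b, (k + j) mod m b)"
proof (induction j)
  case 0
  then show ?case using t a b by simp
next
  case (Suc j)
  have mem: "(a, (i + j) mod m a) \<in> slots A m" using a by (simp add: slots_def)
  have "\<tau> (a, (i + Suc j) mod m a) = \<tau> (rot m (a, (i + j) mod m a))"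
    by (simp add: rot_def mod_Suc_eq)
  also have "\<dots> = rot m (\<tau> (a, (i + j) mod m a))"
    using \<tau> mem by (auto simp: commuting_pairings_def)
  also have "\<dots> = (b, (k + Suc j) mod m b)"
    by (simp add: Suc.IH rot_def mod_Suc_eq)
  finally show ?case .
qed

text \<open>
  The value \<open>(b, k)\<close> at the first vertex determines the pairing on the cycles \<open>a\<close> and \<open>b\<close>. It maps
  the cycle \<open>a\<close> onto \<open>b\<close> by a rotation by \<open>k\<close>, which forces equal lengths; if \<open>b = a\<close>, then being a
  fixed-point-free involution forces the rotation by half the length.
\<close>

lemma card_pairings_first_to:
  assumes A: "finite A" "a \<in> A" "b \<in> A" and m: "\<And>c. c \<in> A \<Longrightarrow> m c \<ge> 1" and k: "k < m b"
  shows "card {\<tau> \<in> commuting_pairings (slots A m) (rot m). \<tau> (a, 0) = (b, k)} =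
    (if m b = m a \<and> (b = a \<longrightarrow> 2 * k = m a) then num_pairings (A - {a, b}) m else 0)"
proof (cases "m b = m a \<and> (b = a \<longrightarrow> 2 * k = m a)")
  case False
  have "{\<tau> \<in> commuting_pairings (slots A m) (rot m). \<tau> (a, 0) = (b, k)} = {}"
  proof (rule ccontr)
    assume "\<not> ?thesis"
    then obtain \<tau> where \<tau>: "\<tau> \<in> commuting_pairings (slots A m) (rot m)" and t: "\<tau> (a, 0) = (b, k)" by blast
    have a0: "(a, 0) \<in> slots A m" using A m[of a] by (simp add: slots_def)
    have tb: "\<tau> (b, k) = (a, 0)" and ne: "(b, k) \<noteq> (a, 0)"
      using \<tau> a0 t by (auto simp: commuting_pairings_def)
    have 1: "\<tau> (a, j mod m a) = (b, (k + j) mod m b)" for j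
      using commuting_pairing_on_cycle[OF \<tau> A(2) m[OF A(2)] _ t A(3) k, of j] m[OF A(2)] by simp
    have 2: "\<tau> (b, (k + j) mod m b) = (a, j mod m a)" for j
      using commuting_pairing_on_cycle[OF \<tau> A(3) m[OF A(3)] k tb A(2), of j] m[OF A(2)] by simp
    have "m b dvd m a" using 1[of "m a"] t by (intro mod_add_cancel_self[of k]) simp
    moreover have "m a dvd m b" using 2[of "m b"] tb k by (simp add: dvd_eq_mod_eq_0)
    ultimately have eq: "m b = m a" by (rule dvd_antisym)
    moreover have "2 * k = m a" if "b = a"
    proof -
      have "(k + k) mod m a = 0" using 1[of k] tb that k by simp
      then have "m a dvd 2 * k" by (simp add: dvd_eq_mod_eq_0 mult_2)
      then obtain c where c: "2 * k = m a * c" by (auto simp: dvd_def)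
      have "k > 0" using ne that by simp
      then have "c \<noteq> 0" using c by (intro notI) simp
      moreover have "m a * c < m a * 2" unfolding c[symmetric] using k that by simp
      then have "c < 2" by simp
      ultimately have "c = 1" by linarith
      then show ?thesis using c by simp
    qed
    ultimately show False using False by blast
  qed
  then show ?thesis using False by (simp only: card.empty if_False)
next
  case True
  then have mb: "m b = m a" and half: "b = a \<Longrightarrow> 2 * k = m a" by auto
  define M where "M = m a"
  have M: "M \<ge> 1" "m a = M" "m b = M" "k < M" using m[OF A(2)] mb k by (auto simp: M_def)
  define J1 where "J1 = slots {a, b} m"
  define J2 where "J2 = slots (A - {a, b}) m"
  \<comment> \<open>the only candidate on the two cycles: shift by \<open>k\<close> one way, and back the other way\<close>
  define \<tau>1 where "\<tau>1 s = (if s \<in> J1 then (if fst s = a then (b, (k + snd s) mod M) else (a, (snd s + (M - k)) mod M)) else s)" for s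
  have J12: "slots A m = J1 \<union> J2" "J1 \<inter> J2 = {}" using A by (auto simp: J1_def J2_def slots_def)
  have J1: "s \<in> J1 \<longleftrightarrow> (fst s = a \<or> fst s = b) \<and> snd s < M" for s
    using M by (cases s) (auto simp: J1_def slots_def)
  have bck: "((k + j) mod M + (M - k)) mod M = j" if "j < M" for j
  proof -
    have "((k + j) mod M + (M - k)) mod M = (k + j + (M - k)) mod M" by (rule mod_add_left_eq)
    also have "k + j + (M - k) = j + M" using M by simp
    finally show ?thesis using that by simp
  qed
  have bck': "(k + (j + (M - k)) mod M) mod M = j" if "j < M" for j
  proof -
    have "(k + (j + (M - k)) mod M) mod M = (k + (j + (M - k))) mod M" by (rule mod_add_right_eq)
    also have "k + (j + (M - k)) = j + M" using M by simp
    finally show ?thesis using that by simp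
  qed
  have inv: "\<tau>1 s \<in> J1 \<and> \<tau>1 s \<noteq> s \<and> \<tau>1 (\<tau>1 s) = s \<and> \<tau>1 (rot m s) = rot m (\<tau>1 s)" if s: "s \<in> J1" for s
  proof -
    obtain c j where cj: "s = (c, j)" "c = a \<or> c = b" "j < M" using s J1 by (cases s) auto
    have M0: "0 < M" using M by simp
    show ?thesis
    proof (cases "c = a")
      case True
      have 1: "\<tau>1 s = (b, (k + j) mod M)" using True cj s by (simp add: \<tau>1_def)
      have in1: "\<tau>1 s \<in> J1" using 1 M0 J1 by simp
      have ne: "\<tau>1 s \<noteq> s"
      proof
        assume e: "\<tau>1 s = s"
        then have "b = a" "(j + k) mod M = j" using 1 cj True by (auto simp: add.commute)
        then have "M dvd k" by (intro mod_add_cancel_self)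
        then show False using half[OF \<open>b = a\<close>] M by (auto dest: dvd_imp_le)
      qed
      have inv: "\<tau>1 (\<tau>1 s) = s"
      proof (cases "b = a")
        case ba: True
        have "M - k = k" using half[OF ba] M by simp
        then have "((k + j) mod M + k) mod M = j" using bck[OF cj(3)] by metis
        then have "(k + (k + j) mod M) mod M = j" by (simp only: add.commute)
        then show ?thesis using 1 in1 ba cj True by (simp add: \<tau>1_def)
      next
        case False
        then show ?thesis using 1 in1 bck[OF cj(3)] cj True by (simp add: \<tau>1_def)
      qed
      have r: "rot m s = (a, Suc j mod M)" using cj True M by (simp add: rot_def)
      have "\<tau>1 (rot m s) = (b, (k + Suc j mod M) mod M)" using r J1 M0 by (simp add: \<tau>1_def)
      also have "\<dots> = rot m (\<tau>1 s)" using 1 M by (simp add: rot_def mod_add_right_eq mod_Suc_eq)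
      finally show ?thesis using in1 ne inv by blast
    next
      case False
      then have cb: "c = b" "b \<noteq> a" using cj by auto
      have 1: "\<tau>1 s = (a, (j + (M - k)) mod M)" using cb cj s by (simp add: \<tau>1_def)
      have in1: "\<tau>1 s \<in> J1" using 1 M0 J1 by simp
      have inv: "\<tau>1 (\<tau>1 s) = s" using 1 in1 bck'[OF cj(3)] cj cb by (simp add: \<tau>1_def)
      have r: "rot m s = (b, Suc j mod M)" using cj cb M by (simp add: rot_def)
      have "\<tau>1 (rot m s) = (a, (Suc j mod M + (M - k)) mod M)" using r J1 M0 cb by (simp add: \<tau>1_def)
      also have "(a, (Suc j mod M + (M - k)) mod M) = rot m (\<tau>1 s)"
      proof -
        have "(Suc j mod M + d) mod M = Suc ((j + d) mod M) mod M" for d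
          by (simp add: mod_add_left_eq mod_Suc_eq)
        then show ?thesis unfolding 1 by (simp only: rot_def fst_conv snd_conv M(2))
      qed
      finally have "\<tau>1 (rot m s) = rot m (\<tau>1 s)" .
      moreover have "\<tau>1 s \<noteq> s" unfolding 1 using cj cb by simp
      ultimately show ?thesis using in1 inv by blast
    qed
  qed
  have "\<tau>1 permutes J1"
    by (rule permutes_involution) (use inv in blast, simp add: \<tau>1_def)
  then have \<tau>1: "\<tau>1 \<in> commuting_pairings J1 (rot m)" using inv unfolding commuting_pairings_def by blast
  have a0: "(a, 0) \<in> J1" using M J1 by simp
  have "{\<tau> \<in> commuting_pairings (slots A m) (rot m). \<tau> (a, 0) = (b, k)}
     = {\<tau> \<in> commuting_pairings (J1 \<union> J2) (rot m). \<forall>s\<in>J1. \<tau> s = \<tau>1 s}"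
    unfolding J12(1)[symmetric]
  proof (intro Collect_cong conj_cong refl iffI ballI)
    fix \<tau> s assume \<tau>: "\<tau> \<in> commuting_pairings (slots A m) (rot m)" and t: "\<tau> (a, 0) = (b, k)" and s: "s \<in> J1"
    obtain c j where cj: "s = (c, j)" "c = a \<or> c = b" "j < M" using s J1 by (cases s) auto
    have "(a, 0) \<in> slots A m" using a0 J12 by blast
    then have tb: "\<tau> (b, k) = (a, 0)" using \<tau> t by (auto simp: commuting_pairings_def)
    show "\<tau> s = \<tau>1 s"
    proof (cases "c = a")
      case True
      then show ?thesis
        using commuting_pairing_on_cycle[OF \<tau> A(2) m[OF A(2)] _ t A(3) k, of j] s cj M by (simp add: \<tau>1_def)
    next
      case False
      then show ?thesis
        using commuting_pairing_on_cycle[OF \<tau> A(3) m[OF A(3)] k tb A(2), of "(j + (M - k)) mod M"] s cj M bck'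
        by (simp add: \<tau>1_def)
    qed
  next
    fix \<tau> assume "\<forall>s\<in>J1. \<tau> s = \<tau>1 s"
    then show "\<tau> (a, 0) = (b, k)" using a0 M by (simp add: \<tau>1_def)
  qed
  then have "card {\<tau> \<in> commuting_pairings (slots A m) (rot m). \<tau> (a, 0) = (b, k)} = card (commuting_pairings J2 (rot m))"
    using card_commuting_pairings_extending[OF J12(2) _ _ \<tau>1] rot_slots by (simp add: J1_def J2_def)
  then show ?thesis unfolding if_P[OF True] num_pairings_def J2_def .
qed

text \<open>
  The first vertex of the cycle \<open>a\<close> is paired either within \<open>a\<close> or with any of the \<open>m a\<close> vertices of
  another cycle of the same length.
\<close>

theorem num_pairings_rec:
  assumes A: "finite A" "a \<notin> A" and m: "\<And>c. c \<in> insert a A \<Longrightarrow> m c \<ge> 1"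
  shows "num_pairings (insert a A) m =
    (if even (m a) then num_pairings A m else 0)
      + (\<Sum>b\<in>A. if m b = m a then m a * num_pairings (A - {b}) m else 0)"
proof -
  define C where "C = commuting_pairings (slots (insert a A) m) (rot m)"
  define X where "X t = card {\<tau> \<in> C. \<tau> (a, 0) = t}" for t
  have a0: "(a, 0) \<in> slots (insert a A) m" using m[of a] by (simp add: slots_def)
  have "num_pairings (insert a A) m = card (\<Union>t\<in>slots (insert a A) m. {\<tau> \<in> C. \<tau> (a, 0) = t})"
    unfolding num_pairings_def C_def[symmetric] using a0
    by (intro arg_cong[where f = card]) (auto simp: C_def commuting_pairings_def permutes_in_image)
  also have "\<dots> = (\<Sum>t\<in>slots (insert a A) m. X t)"
    unfolding X_def using A by (intro card_UN_disjoint) (auto simp: C_def)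
  also have "\<dots> = (\<Sum>b\<in>insert a A. \<Sum>k<m b. X (b, k))"
    unfolding slots_def using A by (subst sum.Sigma) auto
  also have "\<dots> = (\<Sum>k<m a. X (a, k)) + (\<Sum>b\<in>A. \<Sum>k<m b. X (b, k))"
    using A by (rule sum.insert)
  also have "(\<Sum>k<m a. X (a, k)) = (\<Sum>k<m a. if 2 * k = m a then num_pairings A m else 0)"
  proof (rule sum.cong)
    fix k assume k: "k \<in> {..<m a}"
    have "insert a A - {a, a} = A" using A by auto
    then show "X (a, k) = (if 2 * k = m a then num_pairings A m else 0)"
      unfolding X_def C_def using card_pairings_first_to[of "insert a A" a a m k] A m k by simp
  qed simp
  also have "\<dots> = (if even (m a) then num_pairings A m else 0)"
  proof (cases "even (m a)")
    case True
    then obtain c where c: "m a = 2 * c" by (elim evenE)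
    have "(\<Sum>k<m a. if 2 * k = m a then num_pairings A m else 0) = (\<Sum>k<m a. if k = c then num_pairings A m else 0)"
      by (intro sum.cong) (auto simp: c)
    also have "\<dots> = num_pairings A m" using m[of a] c by simp
    finally show ?thesis using True by simp
  next
    case False
    then have "2 * k \<noteq> m a" for k by (metis dvd_triv_left)
    then show ?thesis using False by simp
  qed
  also have "(\<Sum>b\<in>A. \<Sum>k<m b. X (b, k)) = (\<Sum>b\<in>A. if m b = m a then m a * num_pairings (A - {b}) m else 0)"
  proof (rule sum.cong)
    fix b assume b: "b \<in> A"
    then have ne: "b \<noteq> a" "insert a A - {a, b} = A - {b}" using A by auto
    have "(\<Sum>k<m b. X (b, k)) = (\<Sum>k<m b. if m b = m a then num_pairings (A - {b}) m else 0)"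
    proof (rule sum.cong)
      fix k assume "k \<in> {..<m b}"
      then show "X (b, k) = (if m b = m a then num_pairings (A - {b}) m else 0)"
        unfolding X_def C_def using card_pairings_first_to[of "insert a A" a b m k] A m b ne by simp
    qed simp
    then show "(\<Sum>k<m b. X (b, k)) = (if m b = m a then m a * num_pairings (A - {b}) m else 0)"
      by simp
  qed simp
  finally show ?thesis .
qed

lemma num_pairings_empty [simp]: "num_pairings {} m = 1"
proof -
  have "commuting_pairings {} (rot m) = {id}"
    by (auto simp: commuting_pairings_def permutes_empty)
  then show ?thesis by (simp add: num_pairings_def slots_def)
qed

lemma num_pairings_cong: "(\<And>a. a \<in> A \<Longrightarrow> m a = m' a) \<Longrightarrow> num_pairings A m = num_pairings A m'"
proof -
  assume eq: "\<And>a. a \<in> A \<Longrightarrow> m a = m' a"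
  then have "slots A m = slots A m'" by (auto simp: slots_def)
  moreover have "rot m s = rot m' s" if "s \<in> slots A m" for s
    using that eq by (auto simp: slots_def rot_def)
  ultimately show ?thesis unfolding num_pairings_def by (metis commuting_pairings_cong)
qed

text \<open>
  The moments of the normal law with mean \<open>a\<close> and variance \<open>v\<close>, through the recursion that
  integration by parts gives.
\<close>

fun gauss_moment :: "real \<Rightarrow> real \<Rightarrow> nat \<Rightarrow> real" where
  "gauss_moment a v 0 = 1"
| "gauss_moment a v (Suc 0) = a"
| "gauss_moment a v (Suc (Suc n)) = a * gauss_moment a v (Suc n) + real (Suc n) * v * gauss_moment a v n"

text \<open>
  Singling out one cycle turns \<open>num_pairings_rec\<close> into the recursion of the moments: folding it
  gives the mean, and gluing it to one of the remaining cycles gives the variance.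
\<close>

theorem sum_num_pairings_eq_gauss_moment:
  fixes t :: "nat \<Rightarrow> real"
  assumes S: "finite S" "\<And>l. l \<in> S \<Longrightarrow> l \<ge> 1" and A: "finite A"
  shows "(\<Sum>f\<in>A \<rightarrow>\<^sub>E S. (\<Prod>a\<in>A. t (f a)) * real (num_pairings A f))
    = gauss_moment (\<Sum>l\<in>S. if even l then t l else 0) (\<Sum>l\<in>S. real l * (t l)\<^sup>2) (card A)"
  using A
proof (induction "card A" arbitrary: A rule: less_induct)
  case less
  define mn where "mn = (\<Sum>l\<in>S. if even l then t l else 0)"
  define vr where "vr = (\<Sum>l\<in>S. real l * (t l)\<^sup>2)"
  define G where "G A = (\<Sum>f\<in>A \<rightarrow>\<^sub>E S. (\<Prod>a\<in>A. t (f a)) * real (num_pairings A f))" for A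
  show ?case
  proof (cases "A = {}")
    case True
    then show ?thesis by simp
  next
    case False
    then obtain a A' where A': "A = insert a A'" "a \<notin> A'" by (meson Set.set_insert all_not_in_conv)
    then have fin: "finite A'" using less.prems by simp
    have lt: "card A' < card A" using A' fin by simp
    have "G A = (\<Sum>v\<in>S. \<Sum>g\<in>A' \<rightarrow>\<^sub>E S. t v * (\<Prod>c\<in>A'. t (g c)) *
        (real (if even v then num_pairings A' g else 0)
          + (\<Sum>b\<in>A'. real (if g b = v then v * num_pairings (A' - {b}) g else 0))))"
      unfolding G_def A'(1) sum_PiE_insert[OF A'(2)]
    proof (intro sum.cong refl)
      fix v g assume v: "v \<in> S" and g: "g \<in> A' \<rightarrow>\<^sub>E S"
      define f where "f = g(a := v)"
      have fg: "f c = g c" if "c \<in> A'" for c using that A' by (auto simp: f_def)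
      have fa: "f a = v" by (simp add: f_def)
      have f1: "f c \<ge> 1" if "c \<in> insert a A'" for c
        using that fa fg v g S(2) by (auto simp: PiE_iff)
      have "num_pairings (insert a A') f = (if even v then num_pairings A' f else 0)
         + (\<Sum>b\<in>A'. if f b = v then v * num_pairings (A' - {b}) f else 0)"
        using num_pairings_rec[of A' a f, OF fin A'(2) f1] unfolding fa .
      also have "num_pairings A' f = num_pairings A' g" by (rule num_pairings_cong) (rule fg)
      also have "(\<Sum>b\<in>A'. if f b = v then v * num_pairings (A' - {b}) f else 0)
         = (\<Sum>b\<in>A'. if g b = v then v * num_pairings (A' - {b}) g else 0)"
      proof (rule sum.cong)
        fix b assume b: "b \<in> A'"
        have "num_pairings (A' - {b}) f = num_pairings (A' - {b}) g" by (rule num_pairings_cong) (simp add: fg)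
        then show "(if f b = v then v * num_pairings (A' - {b}) f else 0) = (if g b = v then v * num_pairings (A' - {b}) g else 0)"
          using fg[OF b] by simp
      qed simp
      finally have np: "num_pairings (insert a A') f = (if even v then num_pairings A' g else 0)
         + (\<Sum>b\<in>A'. if g b = v then v * num_pairings (A' - {b}) g else 0)" .
      have "(\<Prod>c\<in>insert a A'. t (f c)) = t v * (\<Prod>c\<in>A'. t (g c))"
        using fin A'(2) fa fg by simp
      then show "(\<Prod>c\<in>insert a A'. t ((g(a := v)) c)) * real (num_pairings (insert a A') (g(a := v)))
         = t v * (\<Prod>c\<in>A'. t (g c)) * (real (if even v then num_pairings A' g else 0)
          + (\<Sum>b\<in>A'. real (if g b = v then v * num_pairings (A' - {b}) g else 0)))"
        unfolding f_def[symmetric] np by simp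
    qed
    also have "\<dots> = (\<Sum>v\<in>S. \<Sum>g\<in>A' \<rightarrow>\<^sub>E S. (if even v then t v else 0) * ((\<Prod>c\<in>A'. t (g c)) * real (num_pairings A' g)))
       + (\<Sum>v\<in>S. \<Sum>g\<in>A' \<rightarrow>\<^sub>E S. \<Sum>b\<in>A'. if g b = v then t v * (\<Prod>c\<in>A'. t (g c)) * real v * real (num_pairings (A' - {b}) g) else 0)"
      unfolding sum.distrib[symmetric]
      by (intro sum.cong refl) (auto simp: distrib_left sum_distrib_left intro!: sum.cong)
    also have "(\<Sum>v\<in>S. \<Sum>g\<in>A' \<rightarrow>\<^sub>E S. (if even v then t v else 0) * ((\<Prod>c\<in>A'. t (g c)) * real (num_pairings A' g))) = mn * G A'"
      unfolding mn_def G_def sum_product ..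
    also have "(\<Sum>v\<in>S. \<Sum>g\<in>A' \<rightarrow>\<^sub>E S. \<Sum>b\<in>A'. if g b = v then t v * (\<Prod>c\<in>A'. t (g c)) * real v * real (num_pairings (A' - {b}) g) else 0)
       = (\<Sum>b\<in>A'. \<Sum>g\<in>A' \<rightarrow>\<^sub>E S. \<Sum>v\<in>S. if v = g b then t v * (\<Prod>c\<in>A'. t (g c)) * real v * real (num_pairings (A' - {b}) g) else 0)"
      by (subst sum.swap, subst (2) sum.swap, subst sum.swap) (auto intro!: sum.cong)
    also have "\<dots> = (\<Sum>b\<in>A'. vr * G (A' - {b}))"
    proof (rule sum.cong)
      fix b assume b: "b \<in> A'"
      define B where "B = A' - {b}"
      have B: "A' = insert b B" "b \<notin> B" "finite B" using b fin by (auto simp: B_def)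
      have "(\<Sum>g\<in>A' \<rightarrow>\<^sub>E S. \<Sum>v\<in>S. if v = g b then t v * (\<Prod>c\<in>A'. t (g c)) * real v * real (num_pairings B g) else 0)
        = (\<Sum>g\<in>A' \<rightarrow>\<^sub>E S. t (g b) * (\<Prod>c\<in>A'. t (g c)) * real (g b) * real (num_pairings B g))"
        using S(1) b by (intro sum.cong) (auto simp: PiE_iff)
      also have "\<dots> = (\<Sum>v\<in>S. \<Sum>h\<in>B \<rightarrow>\<^sub>E S. (real v * (t v)\<^sup>2) * ((\<Prod>c\<in>B. t (h c)) * real (num_pairings B h)))"
        unfolding B(1) sum_PiE_insert[OF B(2)]
      proof (intro sum.cong refl)
        fix v h
        have "(\<Prod>c\<in>insert b B. t ((h(b := v)) c)) = t v * (\<Prod>c\<in>B. t (h c))"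
          using B(2,3) by (subst prod.insert) (auto intro!: prod.cong)
        moreover have "num_pairings B (h(b := v)) = num_pairings B h"
          using B(2) by (intro num_pairings_cong) auto
        ultimately show "t ((h(b := v)) b) * (\<Prod>c\<in>insert b B. t ((h(b := v)) c)) * real ((h(b := v)) b) * real (num_pairings B (h(b := v)))
          = (real v * (t v)\<^sup>2) * ((\<Prod>c\<in>B. t (h c)) * real (num_pairings B h))"
          by (simp add: power2_eq_square)
      qed
      also have "\<dots> = vr * G B" unfolding vr_def G_def sum_product ..
      finally show "(\<Sum>g\<in>A' \<rightarrow>\<^sub>E S. \<Sum>v\<in>S. if v = g b then t v * (\<Prod>c\<in>A'. t (g c)) * real v * real (num_pairings (A' - {b}) g) else 0)
         = vr * G (A' - {b})" unfolding B_def .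
    qed simp
    also have "\<dots> = (\<Sum>b\<in>A'. vr * gauss_moment mn vr (card A' - 1))"
    proof (rule sum.cong)
      fix b assume b: "b \<in> A'"
      have "card (A' - {b}) < card A" using lt card_Diff1_le[of A' b] by simp
      then have "G (A' - {b}) = gauss_moment mn vr (card (A' - {b}))"
        unfolding G_def mn_def vr_def using fin by (intro less.hyps) auto
      then show "vr * G (A' - {b}) = vr * gauss_moment mn vr (card A' - 1)" using b fin by simp
    qed simp
    also have "\<dots> = real (card A') * vr * gauss_moment mn vr (card A' - 1)" by simp
    also have "G A' = gauss_moment mn vr (card A')"
      unfolding G_def mn_def vr_def by (rule less.hyps[OF lt fin])
    also have "mn * gauss_moment mn vr (card A') + real (card A') * vr * gauss_moment mn vr (card A' - 1)
       = gauss_moment mn vr (card A)"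
      using A' fin by (cases "card A'") simp_all
    finally show ?thesis by (simp add: G_def mn_def vr_def)
  qed
qed

section \<open>Gaussian limits of traces of powers\<close>

text \<open>
  Powers of an array as plain functions. Only indices below \<open>N\<close> are summed over, so that no
  matrix of a random variable has to be formed.
\<close>

fun arr_pow :: "nat \<Rightarrow> (nat \<times> nat \<Rightarrow> real) \<Rightarrow> nat \<Rightarrow> nat \<Rightarrow> nat \<Rightarrow> real" where
  "arr_pow N x 0 i j = (if i = j then 1 else 0)"
| "arr_pow N x (Suc n) i j = (\<Sum>k<N. arr_pow N x n i k * x (k, j))"

definition arr_trace :: "nat \<Rightarrow> (nat \<times> nat \<Rightarrow> real) \<Rightarrow> nat \<Rightarrow> real" where
  "arr_trace N x n = (\<Sum>i<N. arr_pow N x n i i)"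

lemma sum_paths_eq_arr_pow:
  "(\<Sum>f\<in>{..n} \<rightarrow>\<^sub>E {..<N}. (\<Prod>k<n. x (f k, f (Suc k))) * G (f 0) (f n))
     = (\<Sum>u<N. \<Sum>z<N. arr_pow N x n u z * G u z)"
proof (induction n arbitrary: G)
  case 0
  have "(\<Sum>f\<in>{..0::nat} \<rightarrow>\<^sub>E {..<N}. G (f 0) (f 0)) = (\<Sum>u<N. G u u)"
    using sum_PiE_insert[where a = "0::nat" and A = "{}" and T = "{..<N}" and F = "\<lambda>f. G (f 0) (f 0)"] by (simp add: atMost_0)
  moreover have "(\<Sum>u<N. \<Sum>z<N. (if u = z then 1 else 0) * G u z) = (\<Sum>u<N. G u u)"
    by (intro sum.cong refl) (simp add: if_distrib[of "\<lambda>c. c * _"] cong: if_cong)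
  ultimately show ?case by simp
next
  case (Suc n)
  have "(\<Sum>f\<in>{..Suc n} \<rightarrow>\<^sub>E {..<N}. (\<Prod>k<Suc n. x (f k, f (Suc k))) * G (f 0) (f (Suc n)))
      = (\<Sum>v<N. \<Sum>g\<in>{..n} \<rightarrow>\<^sub>E {..<N}. (\<Prod>k<n. x (g k, g (Suc k))) * (x (g n, v) * G (g 0) v))"
    unfolding atMost_Suc by (subst sum_PiE_insert) (auto intro!: sum.cong simp: mult.assoc)
  also have "\<dots> = (\<Sum>g\<in>{..n} \<rightarrow>\<^sub>E {..<N}. (\<Prod>k<n. x (g k, g (Suc k))) * (\<Sum>v<N. x (g n, v) * G (g 0) v))"
    by (subst sum.swap) (simp add: sum_distrib_left)
  also have "\<dots> = (\<Sum>u<N. \<Sum>w<N. arr_pow N x n u w * (\<Sum>v<N. x (w, v) * G u v))"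
    by (rule Suc.IH)
  also have "\<dots> = (\<Sum>u<N. \<Sum>v<N. \<Sum>w<N. arr_pow N x n u w * x (w, v) * G u v)"
    by (rule sum.cong[OF refl], subst sum.swap) (simp add: sum_distrib_left mult.assoc)
  finally show ?case by (simp add: sum_distrib_right)
qed

lemma arr_trace_eq_sum_closed_walks:
  assumes "n \<ge> 1"
  shows "arr_trace N x n = (\<Sum>f\<in>{..<n} \<rightarrow>\<^sub>E {..<N}. \<Prod>k<n. x (f k, f (Suc k mod n)))"
proof -
  obtain l where n: "n = Suc l" using assms by (cases n) auto
  have "(\<Sum>f\<in>{..<n} \<rightarrow>\<^sub>E {..<N}. \<Prod>k<n. x (f k, f (Suc k mod n)))
     = (\<Sum>f\<in>{..l} \<rightarrow>\<^sub>E {..<N}. (\<Prod>k<l. x (f k, f (Suc k))) * x (f l, f 0))"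
    unfolding n lessThan_Suc_atMost by (intro sum.cong refl) (simp add: lessThan_Suc_atMost[symmetric])
  also have "\<dots> = (\<Sum>u<N. \<Sum>z<N. arr_pow N x l u z * x (z, u))" by (rule sum_paths_eq_arr_pow)
  finally show ?thesis by (simp add: n arr_trace_def)
qed

text \<open>
  A family of closed walks, one for each \<open>a\<close>, is a single map on the disjoint union of the cycles.
\<close>

lemma prod_arr_trace:
  assumes A: "finite A" and m: "\<And>a. a \<in> A \<Longrightarrow> m a \<ge> 1"
  shows "(\<Prod>a\<in>A. arr_trace N x (m a))
     = (\<Sum>f\<in>slots A m \<rightarrow>\<^sub>E {..<N}. \<Prod>s\<in>slots A m. x (f s, f (rot m s)))"
proof -
  have "(\<Prod>a\<in>A. arr_trace N x (m a))
      = (\<Prod>a\<in>A. \<Sum>f\<in>{..<m a} \<rightarrow>\<^sub>E {..<N}. \<Prod>k<m a. x (f k, f (Suc k mod m a)))"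
    using m by (intro prod.cong) (auto simp: arr_trace_eq_sum_closed_walks)
  also have "\<dots> = (\<Sum>h\<in>(\<Pi>\<^sub>E a\<in>A. {..<m a} \<rightarrow>\<^sub>E {..<N}). \<Prod>a\<in>A. \<Prod>k<m a. x (h a k, h a (Suc k mod m a)))"
    using A by (intro prod_sum_PiE) (auto intro: finite_PiE)
  also have "\<dots> = (\<Sum>f\<in>slots A m \<rightarrow>\<^sub>E {..<N}. \<Prod>a\<in>A. \<Prod>k<m a. x (f (a, k), f (a, Suc k mod m a)))"
  proof (rule sum.reindex_bij_witness
      [where i = "\<lambda>f. \<lambda>a\<in>A. \<lambda>k\<in>{..<m a}. f (a, k)" and j = "\<lambda>h. \<lambda>s\<in>slots A m. h (fst s) (snd s)"])
    fix h assume h: "h \<in> (\<Pi>\<^sub>E a\<in>A. {..<m a} \<rightarrow>\<^sub>E {..<N})"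
    show "(\<lambda>a\<in>A. \<lambda>k\<in>{..<m a}. (\<lambda>s\<in>slots A m. h (fst s) (snd s)) (a, k)) = h"
    proof (rule extensionalityI[of _ A])
      fix a assume a: "a \<in> A"
      then have ha: "h a \<in> {..<m a} \<rightarrow>\<^sub>E {..<N}" using h by auto
      have "(\<lambda>k\<in>{..<m a}. (\<lambda>s\<in>slots A m. h (fst s) (snd s)) (a, k)) = h a"
        by (rule extensionalityI[of _ "{..<m a}"]) (use ha a in \<open>auto simp: slots_def PiE_iff\<close>)
      then show "(\<lambda>a\<in>A. \<lambda>k\<in>{..<m a}. (\<lambda>s\<in>slots A m. h (fst s) (snd s)) (a, k)) a = h a"
        using a by simp
    qed (use h in \<open>auto simp: PiE_iff\<close>)
    show "(\<lambda>s\<in>slots A m. h (fst s) (snd s)) \<in> slots A m \<rightarrow>\<^sub>E {..<N}"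
      using h by (auto simp: slots_def PiE_iff)
    show "(\<Prod>a\<in>A. \<Prod>k<m a. x ((\<lambda>s\<in>slots A m. h (fst s) (snd s)) (a, k), (\<lambda>s\<in>slots A m. h (fst s) (snd s)) (a, Suc k mod m a)))
        = (\<Prod>a\<in>A. \<Prod>k<m a. x (h a k, h a (Suc k mod m a)))"
    proof (intro prod.cong refl)
      fix a k assume ak: "a \<in> A" "k \<in> {..<m a}"
      then have "(a, k) \<in> slots A m" "(a, Suc k mod m a) \<in> slots A m" by (auto simp: slots_def)
      then show "x ((\<lambda>s\<in>slots A m. h (fst s) (snd s)) (a, k), (\<lambda>s\<in>slots A m. h (fst s) (snd s)) (a, Suc k mod m a))
         = x (h a k, h a (Suc k mod m a))" by simp
    qed
  next
    fix f assume f: "f \<in> slots A m \<rightarrow>\<^sub>E {..<N}"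
    show "(\<lambda>s\<in>slots A m. (\<lambda>a\<in>A. \<lambda>k\<in>{..<m a}. f (a, k)) (fst s) (snd s)) = f"
      by (rule extensionalityI[of _ "slots A m"]) (use f in \<open>auto simp: slots_def PiE_iff\<close>)
    show "(\<lambda>a\<in>A. \<lambda>k\<in>{..<m a}. f (a, k)) \<in> (\<Pi>\<^sub>E a\<in>A. {..<m a} \<rightarrow>\<^sub>E {..<N})"
      using f by (auto simp: slots_def PiE_iff)
  qed
  also have "\<dots> = (\<Sum>f\<in>slots A m \<rightarrow>\<^sub>E {..<N}. \<Prod>s\<in>slots A m. x (f s, f (rot m s)))"
    unfolding slots_def using A
    by (intro sum.cong refl, subst prod.Sigma) (auto simp: rot_def case_prod_unfold)
  finally show ?thesis .
qed

context iid_array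
begin

lemma perm_trace_integrable:
  assumes "finite J" "bij_betw \<sigma> J J"
  shows "integrable M (perm_trace J \<sigma>)"
  unfolding perm_trace_def using assms bij_betwE[OF assms(2)]
  by (intro Bochner_Integration.integrable_sum prod_entries_integrable) auto

lemma arr_trace_moment:
  assumes S: "finite S" "\<And>l. l \<in> S \<Longrightarrow> l \<ge> 1"
  shows "integrable M (\<lambda>\<omega>. (\<Sum>l\<in>S. t l * arr_trace N (\<lambda>e. y e \<omega>) l) ^ r)" (is ?int)
    and "expectation (\<lambda>\<omega>. (\<Sum>l\<in>S. t l * arr_trace N (\<lambda>e. y e \<omega>) l) ^ r)
      = (\<Sum>f\<in>{..<r} \<rightarrow>\<^sub>E S. (\<Prod>a<r. t (f a)) * expectation (perm_trace (slots {..<r} f) (rot f)))" (is ?eq)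
proof -
  have eq: "(\<Sum>l\<in>S. t l * arr_trace N (\<lambda>e. y e \<omega>) l) ^ r
     = (\<Sum>f\<in>{..<r} \<rightarrow>\<^sub>E S. (\<Prod>a<r. t (f a)) * perm_trace (slots {..<r} f) (rot f) \<omega>)" for \<omega>
  proof -
    have "(\<Sum>l\<in>S. t l * arr_trace N (\<lambda>e. y e \<omega>) l) ^ r = (\<Prod>a<r. \<Sum>l\<in>S. t l * arr_trace N (\<lambda>e. y e \<omega>) l)"
      by simp
    also have "\<dots> = (\<Sum>f\<in>{..<r} \<rightarrow>\<^sub>E S. \<Prod>a<r. t (f a) * arr_trace N (\<lambda>e. y e \<omega>) (f a))"
      using S by (intro prod_sum_PiE) auto
    also have "\<dots> = (\<Sum>f\<in>{..<r} \<rightarrow>\<^sub>E S. (\<Prod>a<r. t (f a)) * perm_trace (slots {..<r} f) (rot f) \<omega>)"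
    proof (rule sum.cong)
      fix f assume f: "f \<in> {..<r} \<rightarrow>\<^sub>E S"
      have "(\<Prod>a<r. arr_trace N (\<lambda>e. y e \<omega>) (f a)) = perm_trace (slots {..<r} f) (rot f) \<omega>"
        unfolding perm_trace_def using f S(2) by (intro prod_arr_trace) (auto simp: PiE_iff)
      then show "(\<Prod>a<r. t (f a) * arr_trace N (\<lambda>e. y e \<omega>) (f a)) = (\<Prod>a<r. t (f a)) * perm_trace (slots {..<r} f) (rot f) \<omega>"
        by (simp add: prod.distrib)
    qed simp
    finally show ?thesis .
  qed
  have int: "integrable M (\<lambda>\<omega>. (\<Prod>a<r. t (f a)) * perm_trace (slots {..<r} f) (rot f) \<omega>)" for f
    by (intro integrable_mult_right perm_trace_integrable bij_betw_rot) auto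
  show ?int unfolding eq using int by (intro Bochner_Integration.integrable_sum) auto
  show ?eq unfolding eq using int by (subst Bochner_Integration.integral_sum) auto
qed

end

lemma perm_trace_moment_tendsto:
  fixes M :: "nat \<Rightarrow> 'b measure" and J :: "(nat \<times> nat) set"
  assumes ev: "\<forall>\<^sub>F N in sequentially. iid_array (M N) N (y N) (\<mu> N) (q N)"
    and q: "q \<longlonglongrightarrow> 0" and v: "(\<lambda>N. real N * \<mu> N 2) \<longlonglongrightarrow> 1"
    and J: "finite J" "bij_betw \<sigma> J J"
  shows "(\<lambda>N. \<integral>\<omega>. iid_array.perm_trace N (y N) J \<sigma> \<omega> \<partial>M N) \<longlonglongrightarrow> real (card (commuting_pairings J \<sigma>))"
proof -
  define c where "c = real (card (commuting_pairings J \<sigma>))"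
  define k where "k = card J div 2"
  define X where "X N = (\<integral>\<omega>. iid_array.perm_trace N (y N) J \<sigma> \<omega> \<partial>M N)" for N
  have "(\<lambda>N. X N - c * (real N * \<mu> N 2) ^ k) \<longlonglongrightarrow> 0"
  proof (rule Lim_null_comparison)
    show "\<forall>\<^sub>F N in sequentially. norm (X N - c * (real N * \<mu> N 2) ^ k) \<le> (1 + c) * real (card J + 1) ^ card J * q N"
      using ev
    proof eventually_elim
      case (elim N)
      then show ?case
        using iid_array.expectation_perm_trace_approx[OF elim J] by (simp add: X_def c_def k_def)
    qed
    show "(\<lambda>N. (1 + c) * real (card J + 1) ^ card J * q N) \<longlonglongrightarrow> 0"
      using tendsto_mult_right_zero[OF q] by simp
  qed
  moreover have "(\<lambda>N. c * (real N * \<mu> N 2) ^ k) \<longlonglongrightarrow> c * 1 ^ k"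
    by (intro tendsto_intros v)
  ultimately have "(\<lambda>N. (X N - c * (real N * \<mu> N 2) ^ k) + c * (real N * \<mu> N 2) ^ k) \<longlonglongrightarrow> 0 + c * 1 ^ k"
    by (rule tendsto_add)
  then show ?thesis by (simp add: X_def c_def)
qed

text \<open>
  Expanding the power of the linear combination gives one product of traces for each choice of
  \<open>r\<close> lengths, and each of these has a combinatorial limit.
\<close>

theorem trace_moments_tendsto:
  fixes M :: "nat \<Rightarrow> 'b measure"
  assumes ev: "\<forall>\<^sub>F N in sequentially. iid_array (M N) N (y N) (\<mu> N) (q N)"
    and q: "q \<longlonglongrightarrow> 0" and v: "(\<lambda>N. real N * \<mu> N 2) \<longlonglongrightarrow> 1"
    and S: "finite S" "\<And>l. l \<in> S \<Longrightarrow> l \<ge> 1"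
  shows "(\<lambda>N. \<integral>\<omega>. (\<Sum>l\<in>S. t l * arr_trace N (\<lambda>e. y N e \<omega>) l) ^ r \<partial>M N)
    \<longlonglongrightarrow> gauss_moment (\<Sum>l\<in>S. if even l then t l else 0) (\<Sum>l\<in>S. real l * (t l)\<^sup>2) r"
proof -
  have "(\<lambda>N. \<Sum>f\<in>{..<r} \<rightarrow>\<^sub>E S. (\<Prod>a<r. t (f a)) * (\<integral>\<omega>. iid_array.perm_trace N (y N) (slots {..<r} f) (rot f) \<omega> \<partial>M N))
     \<longlonglongrightarrow> (\<Sum>f\<in>{..<r} \<rightarrow>\<^sub>E S. (\<Prod>a<r. t (f a)) * real (num_pairings {..<r} f))"
    unfolding num_pairings_def
    by (intro tendsto_intros perm_trace_moment_tendsto[OF ev q v] bij_betw_rot) auto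
  also have "(\<Sum>f\<in>{..<r} \<rightarrow>\<^sub>E S. (\<Prod>a<r. t (f a)) * real (num_pairings {..<r} f))
    = gauss_moment (\<Sum>l\<in>S. if even l then t l else 0) (\<Sum>l\<in>S. real l * (t l)\<^sup>2) r"
    using sum_num_pairings_eq_gauss_moment[OF S, of "{..<r}" t] by simp
  finally show ?thesis
  proof (rule Lim_transform_eventually)
    show "\<forall>\<^sub>F N in sequentially. (\<Sum>f\<in>{..<r} \<rightarrow>\<^sub>E S. (\<Prod>a<r. t (f a)) * (\<integral>\<omega>. iid_array.perm_trace N (y N) (slots {..<r} f) (rot f) \<omega> \<partial>M N))
      = (\<integral>\<omega>. (\<Sum>l\<in>S. t l * arr_trace N (\<lambda>e. y N e \<omega>) l) ^ r \<partial>M N)"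
      using ev by eventually_elim (rule iid_array.arr_trace_moment(2)[symmetric], use S in auto)
  qed
qed

text \<open>
  The square root of the factorial makes the exponential series of the moments converge everywhere.
\<close>

lemma gauss_moment_le:
  assumes "v \<ge> 0"
  shows "\<bar>gauss_moment a v n\<bar> \<le> (\<bar>a\<bar> + v + 1) ^ n * sqrt (fact n)"
proof -
  define c where "c = \<bar>a\<bar> + v + 1"
  have c: "c \<ge> 1" "\<bar>a\<bar> + v \<le> c" using assms by (auto simp: c_def)
  have "\<bar>gauss_moment a v n\<bar> \<le> c ^ n * sqrt (fact n) \<and> \<bar>gauss_moment a v (Suc n)\<bar> \<le> c ^ Suc n * sqrt (fact (Suc n))"
  proof (induction n)
    case 0
    then show ?case using assms by (simp add: c_def)
  next
    case (Suc n)
    define w where "w = c ^ n * sqrt (fact n)"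
    have w: "w \<ge> 0" using c by (simp add: w_def)
    have s1: "sqrt (real (Suc n)) \<le> real (Suc n)"
      using real_sqrt_le_mono[of "real (Suc n)" "(real (Suc n))\<^sup>2"] by (simp add: power2_eq_square)
    have s2: "real (Suc n) \<le> sqrt (real (Suc n) * real (Suc (Suc n)))"
      by (rule real_le_rsqrt) (simp add: power2_eq_square)
    have g1: "\<bar>gauss_moment a v (Suc n)\<bar> \<le> c * w * real (Suc n)"
    proof -
      have "\<bar>gauss_moment a v (Suc n)\<bar> \<le> c * w * sqrt (real (Suc n))"
        using Suc.IH by (simp add: w_def real_sqrt_mult mult_ac)
      also have "\<dots> \<le> c * w * real (Suc n)" using s1 c w by (intro mult_left_mono) auto
      finally show ?thesis .
    qed
    have "\<bar>gauss_moment a v (Suc (Suc n))\<bar> \<le> \<bar>a\<bar> * \<bar>gauss_moment a v (Suc n)\<bar> + real (Suc n) * v * \<bar>gauss_moment a v n\<bar>"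
      using assms by (simp add: abs_mult order_trans[OF abs_triangle_ineq])
    also have "\<dots> \<le> \<bar>a\<bar> * (c * w * real (Suc n)) + real (Suc n) * v * (c * w)"
    proof (intro add_mono mult_left_mono g1)
      have "\<bar>gauss_moment a v n\<bar> \<le> 1 * w" using Suc.IH by (simp add: w_def)
      also have "\<dots> \<le> c * w" using c w by (intro mult_right_mono) auto
      finally show "\<bar>gauss_moment a v n\<bar> \<le> c * w" .
    qed (use assms in auto)
    also have "\<dots> = (\<bar>a\<bar> + v) * (c * w * real (Suc n))" by (simp add: algebra_simps)
    also have "\<dots> \<le> c * (c * w * sqrt (real (Suc n) * real (Suc (Suc n))))"
      using c w s2 assms by (intro mult_mono mult_left_mono) auto
    also have "\<dots> = c ^ Suc (Suc n) * sqrt (fact (Suc (Suc n)))"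
      by (simp add: w_def real_sqrt_mult mult_ac)
    finally show ?case using Suc.IH by simp
  qed
  then show ?thesis by (simp add: c_def)
qed

lemma summable_gauss_moment_series:
  fixes z :: complex
  assumes "v \<ge> 0"
  shows "summable (\<lambda>n. complex_of_real (gauss_moment a v n / fact n) * z ^ n)"
proof -
  define c where "c = (\<bar>a\<bar> + v + 1) * norm z"
  have c0: "c \<ge> 0" using assms by (simp add: c_def)
  have "summable (\<lambda>n. c ^ n / sqrt (fact n))"
  proof (rule summable_ratio_test[where c = "1 / 2" and N = "nat \<lceil>4 * c\<^sup>2\<rceil>"])
    fix n assume n: "nat \<lceil>4 * c\<^sup>2\<rceil> \<le> n"
    then have "4 * c\<^sup>2 \<le> real n" by (simp add: nat_ceiling_le_eq)
    then have "2 * c \<le> sqrt (real (Suc n))" by (intro real_le_rsqrt) (simp add: power_mult_distrib)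
    then have "c / sqrt (real (Suc n)) \<le> 1 / 2" by (simp add: divide_le_eq)
    then have "(c / sqrt (real (Suc n))) * (c ^ n / sqrt (fact n)) \<le> 1 / 2 * (c ^ n / sqrt (fact n))"
      using c0 by (intro mult_right_mono) auto
    then show "norm (c ^ Suc n / sqrt (fact (Suc n))) \<le> 1 / 2 * norm (c ^ n / sqrt (fact n))"
      using c0 by (simp add: real_sqrt_mult)
  qed simp
  then show ?thesis
  proof (rule summable_comparison_test'[where N = 0])
    fix n
    have "norm (complex_of_real (gauss_moment a v n / fact n) * z ^ n) = \<bar>gauss_moment a v n\<bar> / fact n * norm z ^ n"
      by (simp add: norm_mult norm_power norm_divide)
    also have "\<dots> \<le> ((\<bar>a\<bar> + v + 1) ^ n * sqrt (fact n)) / fact n * norm z ^ n"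
      by (intro mult_right_mono divide_right_mono gauss_moment_le assms) auto
    also have "\<dots> = c ^ n / sqrt (fact n)"
    proof -
      have "sqrt (fact n) / (fact n :: real) = 1 / sqrt (fact n)"
        by (simp add: field_simps flip: real_sqrt_mult)
      then have "(\<bar>a\<bar> + v + 1) ^ n * (sqrt (fact n) / fact n) * norm z ^ n
          = (\<bar>a\<bar> + v + 1) ^ n * (1 / sqrt (fact n)) * norm z ^ n" by (rule arg_cong)
      then show ?thesis by (simp add: c_def power_mult_distrib mult_ac)
    qed
    finally show "norm (complex_of_real (gauss_moment a v n / fact n) * z ^ n) \<le> c ^ n / sqrt (fact n)" .
  qed
qed

text \<open>
  The recursion of the moments says that the series \<open>F\<close> solves \<open>F' = (a + v z) F\<close>.
\<close>

lemma gauss_moment_series: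
  fixes z :: complex
  assumes v: "v \<ge> 0"
  shows "(\<Sum>n. complex_of_real (gauss_moment a v n / fact n) * z ^ n) = exp (of_real a * z + of_real v * z\<^sup>2 / 2)"
proof -
  define b where "b n = complex_of_real (gauss_moment a v n / fact n)" for n
  have sm: "summable (\<lambda>n. b n * z ^ n)" for z :: complex
    unfolding b_def by (rule summable_gauss_moment_series[OF v])
  define F where "F z = (\<Sum>n. b n * z ^ n)" for z
  have b: "diffs b 0 = of_real a * b 0" "diffs b (Suc n) = of_real a * b (Suc n) + of_real v * b n" for n
  proof -
    show "diffs b 0 = of_real a * b 0" by (simp add: diffs_def b_def)
    have "real (Suc (Suc n)) * (gauss_moment a v (Suc (Suc n)) / fact (Suc (Suc n)))
      = a * (gauss_moment a v (Suc n) / fact (Suc n)) + v * (gauss_moment a v n / fact n)"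
      by (simp add: field_simps del: of_nat_Suc)
    from arg_cong[OF this, of complex_of_real]
    show "diffs b (Suc n) = of_real a * b (Suc n) + of_real v * b n"
      by (simp add: diffs_def b_def del: gauss_moment.simps fact_Suc)
  qed
  have F': "(F has_field_derivative (of_real a + of_real v * z) * F z) (at z)" for z :: complex
  proof -
    have "(F has_field_derivative (\<Sum>n. diffs b n * z ^ n)) (at z)"
      unfolding F_def by (rule termdiffs_strong_converges_everywhere[OF sm])
    moreover have "(\<lambda>n. diffs b n * z ^ n) sums ((of_real a + of_real v * z) * F z)"
    proof -
      define D where "D n = (case n of 0 \<Rightarrow> 0 | Suc k \<Rightarrow> of_real v * z * (b k * z ^ k))" for n
      have "(\<lambda>n. D (Suc n)) sums (of_real v * z * F z)"
        using sums_mult[OF summable_sums[OF sm[of z]], of "of_real v * z"] by (simp add: D_def F_def)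
      then have "D sums (of_real v * z * F z + D 0)" by (rule sums_Suc)
      then have "D sums (of_real v * z * F z)" by (simp add: D_def)
      then have "(\<lambda>n. of_real a * (b n * z ^ n) + D n)
         sums (of_real a * F z + of_real v * z * F z)"
        unfolding F_def by (intro sums_add sums_mult summable_sums sm)
      moreover have "of_real a * (b n * z ^ n) + D n = diffs b n * z ^ n" for n
        by (cases n) (simp_all add: b D_def algebra_simps)
      ultimately show ?thesis by (simp add: distrib_right)
    qed
    ultimately show ?thesis by (simp add: sums_iff)
  qed
  define E where "E z = exp (- (of_real a * z + of_real v * z\<^sup>2 / 2))" for z :: complex
  have E': "(E has_field_derivative - (of_real a + of_real v * z) * E z) (at z)" for z
    unfolding E_def by (auto intro!: derivative_eq_intros simp: power2_eq_square)
  have "((\<lambda>z. F z * E z) has_field_derivative 0) (at z)" for z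
    by (rule DERIV_cong[OF DERIV_mult[OF F' E']]) (simp add: algebra_simps)
  then have "\<exists>c. \<forall>z\<in>UNIV. F z * E z = c"
    by (intro has_field_derivative_zero_constant) auto
  then obtain c where c: "\<And>z. F z * E z = c" by auto
  have "F 0 = b 0" unfolding F_def using powser_zero[of b] by simp
  then have "c = 1" using c[of 0] by (simp add: E_def b_def)
  then have "F z = 1 / E z" using c[of z] by (simp add: E_def field_simps)
  also have "\<dots> = exp (of_real a * z + of_real v * z\<^sup>2 / 2)" unfolding E_def by (simp only: exp_minus inverse_inverse_eq divide_inverse mult_1)
  finally show ?thesis by (simp add: F_def b_def)
qed

text \<open>
  The characteristic function differs from its Taylor polynomial of even order \<open>n\<close> by at most
  \<open>2 E X\<^sup>n / n!\<close>. In the limit these moments are terms of a convergent series, so a large fixed \<open>n\<close>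
  makes the error small, and only finitely many moments have to be close to their limits.
\<close>

theorem char_tendsto_if_moments_tendsto:
  fixes M :: "nat \<Rightarrow> 'b measure"
  assumes ev: "\<forall>\<^sub>F N in sequentially. prob_space (M N) \<and> X N \<in> borel_measurable (M N) \<and> (\<forall>r. integrable (M N) (\<lambda>\<omega>. X N \<omega> ^ r))"
    and mom: "\<And>r. (\<lambda>N. \<integral>\<omega>. X N \<omega> ^ r \<partial>M N) \<longlonglongrightarrow> gauss_moment a v r" and v: "v \<ge> 0"
  shows "(\<lambda>N. \<integral>\<omega>. cis (X N \<omega>) \<partial>M N) \<longlonglongrightarrow> exp (\<i> * of_real a - of_real v / 2)"
proof (rule tendstoI)
  fix e :: real assume e: "e > 0"
  define L where "L = exp (\<i> * of_real a - complex_of_real v / 2)"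
  define b where "b n = complex_of_real (gauss_moment a v n / fact n)" for n
  have bs: "(\<lambda>n. b n * \<i> ^ n) sums L"
  proof -
    have "(\<Sum>n. b n * \<i> ^ n) = exp (of_real a * \<i> + of_real v * \<i>\<^sup>2 / 2)"
      unfolding b_def by (rule gauss_moment_series[OF v])
    also have "\<dots> = L" by (simp add: L_def mult.commute)
    finally show ?thesis using summable_sums[OF summable_gauss_moment_series[OF v, of a \<i>]] by (simp add: b_def)
  qed
  have "(\<lambda>n. \<Sum>k\<le>n. b k * \<i> ^ k) \<longlonglongrightarrow> L" using bs by (simp add: sums_def_le)
  then have "\<forall>\<^sub>F n in sequentially. dist (\<Sum>k\<le>n. b k * \<i> ^ k) L < e / 4" using e by (intro tendstoD) auto
  moreover have "(\<lambda>n. b n * \<i> ^ n) \<longlonglongrightarrow> 0" using bs by (intro summable_LIMSEQ_zero sums_summable)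
  then have "\<forall>\<^sub>F n in sequentially. dist (b n * \<i> ^ n) 0 < e / 8" using e by (intro tendstoD) auto
  ultimately have "\<forall>\<^sub>F n in sequentially. dist (\<Sum>k\<le>n. b k * \<i> ^ k) L < e / 4 \<and> dist (b n * \<i> ^ n) 0 < e / 8"
    by eventually_elim simp
  then obtain n0 where n0: "\<And>n. n \<ge> n0 \<Longrightarrow> dist (\<Sum>k\<le>n. b k * \<i> ^ k) L < e / 4 \<and> dist (b n * \<i> ^ n) 0 < e / 8"
    by (auto simp: eventually_sequentially)
  define n where "n = 2 * n0"
  have n: "even n" "dist (\<Sum>k\<le>n. b k * \<i> ^ k) L < e / 4" "gauss_moment a v n / fact n < e / 8"
  proof -
    have "n \<ge> n0" by (simp add: n_def)
    note * = n0[OF this]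
    show "even n" by (simp add: n_def)
    show "dist (\<Sum>k\<le>n. b k * \<i> ^ k) L < e / 4" using * by blast
    have "norm (b n * \<i> ^ n) = norm (b n)" by (simp add: norm_mult norm_power)
    also have "norm (b n) = \<bar>gauss_moment a v n / fact n\<bar>" unfolding b_def by (rule norm_of_real)
    finally have "\<bar>gauss_moment a v n / fact n\<bar> < e / 8" using * by (simp only: dist_norm diff_zero)
    then show "gauss_moment a v n / fact n < e / 8" by linarith
  qed
  have "(\<lambda>N. \<Sum>k\<le>n. \<i> ^ k / fact k * complex_of_real (\<integral>\<omega>. X N \<omega> ^ k \<partial>M N)) \<longlonglongrightarrow> (\<Sum>k\<le>n. \<i> ^ k / fact k * complex_of_real (gauss_moment a v k))"
    by (intro tendsto_intros mom)
  also have "(\<Sum>k\<le>n. \<i> ^ k / fact k * complex_of_real (gauss_moment a v k)) = (\<Sum>k\<le>n. b k * \<i> ^ k)"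
    by (simp add: b_def mult.commute)
  finally have "\<forall>\<^sub>F N in sequentially. dist (\<Sum>k\<le>n. \<i> ^ k / fact k * complex_of_real (\<integral>\<omega>. X N \<omega> ^ k \<partial>M N)) (\<Sum>k\<le>n. b k * \<i> ^ k) < e / 4"
    using e by (intro tendstoD) auto
  moreover have "(\<lambda>N. (\<integral>\<omega>. X N \<omega> ^ n \<partial>M N) / fact n) \<longlonglongrightarrow> gauss_moment a v n / fact n"
    by (intro tendsto_intros mom) simp
  then have "\<forall>\<^sub>F N in sequentially. (\<integral>\<omega>. X N \<omega> ^ n \<partial>M N) / fact n < e / 8"
    using n(3) by (rule order_tendstoD(2))
  ultimately show "\<forall>\<^sub>F N in sequentially. dist (\<integral>\<omega>. cis (X N \<omega>) \<partial>M N) L < e"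
    using ev
  proof eventually_elim
    case (elim N)
    interpret prob_space "M N" using elim by simp
    define S where "S = (\<Sum>k\<le>n. \<i> ^ k / fact k * complex_of_real (\<integral>\<omega>. X N \<omega> ^ k \<partial>M N))"
    have meas: "X N \<in> borel_measurable (M N)" using elim by simp
    have "char (distr (M N) borel (X N)) 1 = (\<integral>\<omega>. cis (X N \<omega>) \<partial>M N)"
      unfolding char_def using meas by (subst integral_distr) (auto simp: cis_conv_exp)
    moreover have "cmod (char (distr (M N) borel (X N)) 1 - S) \<le> 2 / fact n * (\<integral>\<omega>. \<bar>X N \<omega>\<bar> ^ n \<partial>M N)"
      using char_approx1'[OF _ meas refl, of n 1] elim by (simp add: S_def)
    moreover have "(\<integral>\<omega>. \<bar>X N \<omega>\<bar> ^ n \<partial>M N) = (\<integral>\<omega>. X N \<omega> ^ n \<partial>M N)"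
      using n(1) by (simp add: power_even_abs)
    ultimately have "dist (\<integral>\<omega>. cis (X N \<omega>) \<partial>M N) S \<le> 2 * ((\<integral>\<omega>. X N \<omega> ^ n \<partial>M N) / fact n)"
      by (simp add: dist_norm)
    then have "dist (\<integral>\<omega>. cis (X N \<omega>) \<partial>M N) S < e / 4" using elim(2) by linarith
    moreover have "dist S (\<Sum>k\<le>n. b k * \<i> ^ k) < e / 4" using elim(1) by (simp add: S_def)
    ultimately show ?case using n(2) dist_triangle[of "\<integral>\<omega>. cis (X N \<omega>) \<partial>M N" L S]
        dist_triangle[of S L "\<Sum>k\<le>n. b k * \<i> ^ k"] e by linarith
  qed
qed

section \<open>The Frobenius norm of a high power\<close>

lemma walk_sum_mono_valid:
  "u < N \<Longrightarrow> (\<And>w z. length w = n \<Longrightarrow> set w \<subseteq> {..<N} \<times> {..<N} \<Longrightarrow> z < N \<Longrightarrow> \<phi> w z \<le> \<psi> w z)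
    \<Longrightarrow> walk_sum N n u \<phi> \<le> walk_sum N n u \<psi>"
  by (induction n arbitrary: u \<phi> \<psi>) (auto intro!: sum_mono)

text \<open>
  Walks are built from their first step on, powers from their last step on; \<open>left\<close> reconciles the two.
\<close>

lemma walk_sum_eq_arr_pow:
  "u < N \<Longrightarrow> walk_sum N n u (\<lambda>w z. prod_list (map x w) * G z) = (\<Sum>z<N. arr_pow N x n u z * G z)"
proof (induction n arbitrary: u G)
  case 0
  then show ?case by (simp add: if_distrib[of "\<lambda>c. c * _"] cong: if_cong)
next
  case (Suc n)
  have left: "(\<Sum>v<N. x (u, v) * arr_pow N x n v z) = arr_pow N x (Suc n) u z" if "u < N" "z < N" for u z n
    using that
  proof (induction n arbitrary: u z)
    case 0
    have "(\<Sum>v<N. x (u, v) * (if v = z then 1 else 0)) = x (u, z)"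
      using 0 by (simp add: if_distrib[of "\<lambda>c. _ * c"] cong: if_cong)
    moreover have "(\<Sum>k<N. (if u = k then 1 else 0) * x (k, z)) = x (u, z)"
      using 0 by (simp add: if_distrib[of "\<lambda>c. c * _"] cong: if_cong)
    ultimately show ?case by simp
  next
    case (Suc n)
    have "(\<Sum>v<N. x (u, v) * arr_pow N x (Suc n) v z) = (\<Sum>v<N. \<Sum>k<N. x (u, v) * arr_pow N x n v k * x (k, z))"
      by (simp add: sum_distrib_left mult.assoc)
    also have "\<dots> = (\<Sum>k<N. (\<Sum>v<N. x (u, v) * arr_pow N x n v k) * x (k, z))"
      by (subst sum.swap) (simp add: sum_distrib_right)
    also have "\<dots> = (\<Sum>k<N. arr_pow N x (Suc n) u k * x (k, z))"
      using Suc by (intro sum.cong) auto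
    finally show ?case by simp
  qed
  have "walk_sum N (Suc n) u (\<lambda>w z. prod_list (map x w) * G z)
    = (\<Sum>v<N. walk_sum N n v (\<lambda>w z. prod_list (map x w) * (x (u, v) * G z)))"
    by (simp add: mult_ac)
  also have "\<dots> = (\<Sum>v<N. \<Sum>z<N. arr_pow N x n v z * (x (u, v) * G z))"
    by (intro sum.cong Suc.IH) auto
  also have "\<dots> = (\<Sum>z<N. (\<Sum>v<N. x (u, v) * arr_pow N x n v z) * G z)"
    by (subst sum.swap) (simp add: sum_distrib_right sum_distrib_left mult_ac)
  also have "\<dots> = (\<Sum>z<N. arr_pow N x (Suc n) u z * G z)"
    using left[OF Suc.prems] by (intro sum.cong) auto
  finally show ?case .
qed

lemma count_list_eq_card: "count_list w x = card {s \<in> {0..<length w}. w ! s = x}"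
  by (simp add: count_list_eq_length_filter length_filter_conv_card eq_commute[of x])

definition frobenius_sq :: "nat \<Rightarrow> (nat \<times> nat \<Rightarrow> real) \<Rightarrow> nat \<Rightarrow> real" where
  "frobenius_sq N x n = (\<Sum>u<N. \<Sum>z<N. (arr_pow N x n u z)\<^sup>2)"

lemma frobenius_sq_eq_walk_sum:
  "frobenius_sq N x n = (\<Sum>u<N. walk_sum N n u (\<lambda>w z. walk_sum N n u (\<lambda>w' z'.
      prod_list (map x (w @ w')) * (if z' = z then 1 else 0))))"
  unfolding frobenius_sq_def
proof (rule sum.cong[OF refl])
  fix u assume "u \<in> {..<N}"
  then have u: "u < N" by simp
  have "(\<Sum>z<N. (arr_pow N x n u z)\<^sup>2) = (\<Sum>z<N. arr_pow N x n u z * arr_pow N x n u z)"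
    by (simp add: power2_eq_square)
  also have "\<dots> = walk_sum N n u (\<lambda>w z. prod_list (map x w) * arr_pow N x n u z)"
    by (rule walk_sum_eq_arr_pow[OF u, symmetric])
  also have "\<dots> = walk_sum N n u (\<lambda>w z. walk_sum N n u (\<lambda>w' z'.
      prod_list (map x (w @ w')) * (if z' = z then 1 else 0)))"
  proof -
    have eq: "prod_list (map x w) * arr_pow N x n u z = walk_sum N n u (\<lambda>w' z'.
      prod_list (map x (w @ w')) * (if z' = z then 1 else 0))" if "z < N" for w z
    proof -
      have "walk_sum N n u (\<lambda>w' z'. prod_list (map x (w @ w')) * (if z' = z then 1 else 0))
        = prod_list (map x w) * walk_sum N n u (\<lambda>w' z'. prod_list (map x w') * (if z' = z then 1 else 0))"
        unfolding walk_sum_cmult[symmetric] by (simp add: mult.assoc)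
      also have "walk_sum N n u (\<lambda>w' z'. prod_list (map x w') * (if z' = z then 1 else 0)) = arr_pow N x n u z"
        unfolding walk_sum_eq_arr_pow[OF u] using that
        by (simp add: if_distrib[of "\<lambda>c. _ * c"] cong: if_cong)
      finally show ?thesis by simp
    qed
    show ?thesis
      by (intro antisym walk_sum_mono_valid[OF u]) (use eq in simp_all)
  qed
  finally show "(\<Sum>z<N. (arr_pow N x n u z)\<^sup>2) = walk_sum N n u (\<lambda>w z. walk_sum N n u (\<lambda>w' z'.
      prod_list (map x (w @ w')) * (if z' = z then 1 else 0)))" .
qed

lemma integral_walk_sum:
  fixes F :: "(nat \<times> nat) list \<Rightarrow> nat \<Rightarrow> 'b \<Rightarrow> real"
  shows "u < N \<Longrightarrow> (\<And>w z. set w \<subseteq> {..<N} \<times> {..<N} \<Longrightarrow> z < N \<Longrightarrow> integrable M (F w z)) \<Longrightarrow>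
    integrable M (\<lambda>\<omega>. walk_sum N n u (\<lambda>w z. F w z \<omega>)) \<and>
    (\<integral>\<omega>. walk_sum N n u (\<lambda>w z. F w z \<omega>) \<partial>M) = walk_sum N n u (\<lambda>w z. \<integral>\<omega>. F w z \<omega> \<partial>M)"
proof (induction n arbitrary: u F)
  case (Suc n)
  have IH: "integrable M (\<lambda>\<omega>. walk_sum N n v (\<lambda>w z. F ((u, v) # w) z \<omega>)) \<and>
    (\<integral>\<omega>. walk_sum N n v (\<lambda>w z. F ((u, v) # w) z \<omega>) \<partial>M) = walk_sum N n v (\<lambda>w z. \<integral>\<omega>. F ((u, v) # w) z \<omega> \<partial>M)"
    if "v < N" for v
    using that Suc.prems by (intro Suc.IH) auto
  have "integrable M (\<lambda>\<omega>. \<Sum>v<N. walk_sum N n v (\<lambda>w z. F ((u, v) # w) z \<omega>))"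
    using IH by (intro Bochner_Integration.integrable_sum) auto
  moreover have "(\<integral>\<omega>. (\<Sum>v<N. walk_sum N n v (\<lambda>w z. F ((u, v) # w) z \<omega>)) \<partial>M)
    = (\<Sum>v<N. walk_sum N n v (\<lambda>w z. \<integral>\<omega>. F ((u, v) # w) z \<omega> \<partial>M))"
    using IH by (subst Bochner_Integration.integral_sum) auto
  ultimately show ?case by simp
qed simp

context iid_array
begin

lemma abs_expectation_prod_list_le:
  assumes "set w \<subseteq> {..<N} \<times> {..<N}"
  shows "integrable M (\<lambda>\<omega>. prod_list (map (\<lambda>e. y e \<omega>) w))"
    and "\<bar>expectation (\<lambda>\<omega>. prod_list (map (\<lambda>e. y e \<omega>) w))\<bar> \<le> edge_weight N q w"
proof -
  have eq: "prod_list (map (\<lambda>e. y e \<omega>) w) = (\<Prod>s\<in>{0..<length w}. y (w ! s) \<omega>)" for \<omega>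
    by (simp add: prod.list_conv_set_nth)
  have im: "(!) w ` {0..<length w} = set w" by (auto simp: set_conv_nth)
  show "integrable M (\<lambda>\<omega>. prod_list (map (\<lambda>e. y e \<omega>) w))"
    unfolding eq using assms im by (intro prod_entries_integrable) auto
  have "expectation (\<lambda>\<omega>. prod_list (map (\<lambda>e. y e \<omega>) w)) = (\<Prod>x\<in>set w. \<mu> (count_list w x))"
    unfolding eq using assms im by (subst expectation_prod_entries) (auto simp: count_list_eq_card)
  also have "\<bar>\<dots>\<bar> \<le> edge_weight N q w"
    unfolding abs_prod edge_weight_def
  proof (intro prod_mono conjI \<mu>_le abs_ge_zero)
    fix x assume "x \<in> set w"
    then show "1 \<le> count_list w x" by (simp add: Suc_le_eq count_list_0_iff flip: neq0_conv)
  qed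
  finally show "\<bar>expectation (\<lambda>\<omega>. prod_list (map (\<lambda>e. y e \<omega>) w))\<bar> \<le> edge_weight N q w" .
qed

text \<open>
  The squared Frobenius norm is a sum over pairs of walks with common ends. By independence the
  expectation of each product of entries is at most the edge weight of the joint history.
\<close>

theorem expectation_frobenius_sq_le:
  assumes \<eta>: "0 < \<eta>" and n: "n \<ge> 1" and qn: "4 * real n * q \<le> 1"
    and D: "32 * real n ^ 3 * (1 + \<eta>) \<le> \<eta>\<^sup>2 * real N"
  shows "integrable M (\<lambda>\<omega>. frobenius_sq N (\<lambda>e. y e \<omega>) n)"
    and "expectation (\<lambda>\<omega>. frobenius_sq N (\<lambda>e. y e \<omega>) n)
      \<le> real N * ((16 * real n ^ 2 * (1 + \<eta>) / \<eta>) * (1 + \<eta>) ^ (2 * n))"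
proof -
  define F where "F w z w' z' \<omega> = prod_list (map (\<lambda>e. y e \<omega>) (w @ w')) * (if z' = z then 1 else 0)"
    for w w' :: "(nat \<times> nat) list" and z z' :: nat and \<omega>
  have F: "integrable M (F w z w' z')" "expectation (F w z w' z') \<le> edge_weight N q (w @ w')"
    if "set w \<subseteq> {..<N} \<times> {..<N}" "set w' \<subseteq> {..<N} \<times> {..<N}" for w z w' z'
  proof -
    have "set (w @ w') \<subseteq> {..<N} \<times> {..<N}" using that by simp
    note * = abs_expectation_prod_list_le[OF this]
    show "integrable M (F w z w' z')" unfolding F_def by (intro integrable_mult_left *)
    show "expectation (F w z w' z') \<le> edge_weight N q (w @ w')"
      using *(2) edge_weight_nonneg[of q N "w @ w'"] q0 unfolding F_def by (cases "z' = z") auto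
  qed
  have eq: "frobenius_sq N (\<lambda>e. y e \<omega>) n = (\<Sum>u<N. walk_sum N n u (\<lambda>w z. walk_sum N n u (\<lambda>w' z'. F w z w' z' \<omega>)))" for \<omega>
    unfolding F_def by (rule frobenius_sq_eq_walk_sum)
  have inner: "integrable M (\<lambda>\<omega>. walk_sum N n u (\<lambda>w' z'. F w z w' z' \<omega>)) \<and>
     expectation (\<lambda>\<omega>. walk_sum N n u (\<lambda>w' z'. F w z w' z' \<omega>)) = walk_sum N n u (\<lambda>w' z'. expectation (F w z w' z'))"
    if "set w \<subseteq> {..<N} \<times> {..<N}" "u < N" for w z u
    using that F(1) by (intro integral_walk_sum) auto
  have outer: "integrable M (\<lambda>\<omega>. walk_sum N n u (\<lambda>w z. walk_sum N n u (\<lambda>w' z'. F w z w' z' \<omega>))) \<and>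
     expectation (\<lambda>\<omega>. walk_sum N n u (\<lambda>w z. walk_sum N n u (\<lambda>w' z'. F w z w' z' \<omega>)))
      = walk_sum N n u (\<lambda>w z. expectation (\<lambda>\<omega>. walk_sum N n u (\<lambda>w' z'. F w z w' z' \<omega>)))"
    if "u < N" for u
    using that inner by (intro integral_walk_sum) auto
  show "integrable M (\<lambda>\<omega>. frobenius_sq N (\<lambda>e. y e \<omega>) n)"
    unfolding eq using outer by (intro Bochner_Integration.integrable_sum) auto
  have "expectation (\<lambda>\<omega>. frobenius_sq N (\<lambda>e. y e \<omega>) n)
    = (\<Sum>u<N. walk_sum N n u (\<lambda>w z. expectation (\<lambda>\<omega>. walk_sum N n u (\<lambda>w' z'. F w z w' z' \<omega>))))"
    unfolding eq using outer by (subst Bochner_Integration.integral_sum) auto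
  also have "\<dots> \<le> (\<Sum>u<N. (16 * real n ^ 2 * (1 + \<eta>) / \<eta>) * (1 + \<eta>) ^ (2 * n))"
  proof (rule sum_mono)
    fix u assume "u \<in> {..<N}"
    then have u: "u < N" by simp
    have "walk_sum N n u (\<lambda>w z. expectation (\<lambda>\<omega>. walk_sum N n u (\<lambda>w' z'. F w z w' z' \<omega>)))
       \<le> walk_sum N n u (\<lambda>w z. walk_sum N n u (\<lambda>w' z'. edge_weight N q (w @ w')))"
    proof (rule walk_sum_mono_valid[OF u])
      fix w z assume w: "set (w :: (nat \<times> nat) list) \<subseteq> {..<N} \<times> {..<N}"
      have "expectation (\<lambda>\<omega>. walk_sum N n u (\<lambda>w' z'. F w z w' z' \<omega>)) = walk_sum N n u (\<lambda>w' z'. expectation (F w z w' z'))"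
        using inner[OF w u] by blast
      also have "\<dots> \<le> walk_sum N n u (\<lambda>w' z'. edge_weight N q (w @ w'))"
        by (rule walk_sum_mono_valid[OF u]) (rule F(2)[OF w])
      finally show "expectation (\<lambda>\<omega>. walk_sum N n u (\<lambda>w' z'. F w z w' z' \<omega>))
        \<le> walk_sum N n u (\<lambda>w' z'. edge_weight N q (w @ w'))" .
    qed
    also have "\<dots> \<le> (16 * real n ^ 2 * (1 + \<eta>) / \<eta>) * (1 + \<eta>) ^ (2 * n)"
      by (rule double_walk_sum_le[OF N less_imp_le[OF q0] qn \<eta> n D])
    finally show "walk_sum N n u (\<lambda>w z. expectation (\<lambda>\<omega>. walk_sum N n u (\<lambda>w' z'. F w z w' z' \<omega>)))
       \<le> (16 * real n ^ 2 * (1 + \<eta>) / \<eta>) * (1 + \<eta>) ^ (2 * n)" .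
  qed
  also have "\<dots> = real N * ((16 * real n ^ 2 * (1 + \<eta>) / \<eta>) * (1 + \<eta>) ^ (2 * n))" by simp
  finally show "expectation (\<lambda>\<omega>. frobenius_sq N (\<lambda>e. y e \<omega>) n)
      \<le> real N * ((16 * real n ^ 2 * (1 + \<eta>) / \<eta>) * (1 + \<eta>) ^ (2 * n))" .
qed

end

section \<open>The second moment of a characteristic polynomial\<close>

text \<open>
  The determinant of \<open>t - x\<close> as a sum over permutations. The signs \<open>s\<close> are kept abstract, because only
  their absolute values matter for second moments.
\<close>

definition char_det :: "nat \<Rightarrow> ((nat \<Rightarrow> nat) \<Rightarrow> complex) \<Rightarrow> (nat \<times> nat \<Rightarrow> real) \<Rightarrow> complex \<Rightarrow> complex" where
  "char_det N s x t = (\<Sum>p\<in>{p. p permutes {..<N}}. s p * (\<Prod>i<N. (if p i = i then t else 0) - of_real (x (i, p i))))"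

lemma sum_Pow_card:
  assumes "finite A"
  shows "(\<Sum>S\<in>Pow A. g (card S)) = (\<Sum>k\<le>card A. of_nat (card A choose k) * (g k :: real))"
proof -
  have "(\<Sum>S\<in>Pow A. g (card S)) = (\<Sum>k\<le>card A. \<Sum>S\<in>{S\<in>Pow A. card S = k}. g (card S))"
    using assms by (intro sum.group[symmetric]) (auto intro: card_mono)
  also have "\<dots> = (\<Sum>k\<le>card A. of_nat (card {S. S \<subseteq> A \<and> card S = k}) * g k)"
    by (intro sum.cong) auto
  finally show ?thesis using assms by (simp add: n_subsets)
qed

text \<open>
  Expanding the product over a set \<open>S\<close> of prescribed fixed points leaves \<open>(N - card S)!\<close> permutations,
  so the sets of size \<open>k\<close> contribute at most \<open>(N choose k) (N - k)! N\<^bsup>k - N\<^esup> b\<^sup>k \<le> b\<^sup>k\<close>.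
\<close>

lemma sum_permutations_prod_fixpoints_le:
  fixes b :: real
  assumes b: "b > 1" and N: "N \<ge> 1"
  shows "(\<Sum>p\<in>{p. p permutes {..<N}}. \<Prod>i<N. (if p i = i then b else 0) + 1 / real N) \<le> b ^ N / (1 - 1 / b)"
proof -
  let ?P = "{p. p permutes {..<N}}"
  have finP: "finite ?P" by (simp add: finite_permutations)
  have "(\<Sum>p\<in>?P. \<Prod>i<N. (if p i = i then b else 0) + 1 / real N)
     = (\<Sum>p\<in>?P. \<Sum>S\<in>Pow {..<N}. (\<Prod>i\<in>S. if p i = i then b else 0) * (1 / real N) ^ (N - card S))"
    unfolding prod_add[OF finite_lessThan] by (intro sum.cong) (auto simp: card_Diff_subset finite_subset)
  also have "\<dots> = (\<Sum>S\<in>Pow {..<N}. \<Sum>p\<in>?P. (\<Prod>i\<in>S. if p i = i then b else 0) * (1 / real N) ^ (N - card S))"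
    by (rule sum.swap)
  also have "\<dots> = (\<Sum>S\<in>Pow {..<N}. fact (N - card S) * b ^ card S * (1 / real N) ^ (N - card S))"
  proof (rule sum.cong[OF refl])
    fix S assume S: "S \<in> Pow {..<N}"
    then have finS: "finite S" by (auto intro: finite_subset)
    have "(\<Sum>p\<in>?P. (\<Prod>i\<in>S. if p i = i then b else 0))
        = (\<Sum>p\<in>?P. if \<forall>i\<in>S. p i = i then b ^ card S else 0)"
      using finS by (intro sum.cong) (auto intro: prod_zero)
    also have "\<dots> = real (card (?P \<inter> {p. \<forall>i\<in>S. p i = i})) * b ^ card S"
      using finP by (simp add: sum.If_cases)
    also have "?P \<inter> {p. \<forall>i\<in>S. p i = i} = {p. p permutes ({..<N} - S)}"
    proof (intro Set.set_eqI iffI)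
      fix p assume "p \<in> ?P \<inter> {p. \<forall>i\<in>S. p i = i}"
      then show "p \<in> {p. p permutes ({..<N} - S)}"
        using permutes_superset[of p "{..<N}" "{..<N} - S"] by blast
    next
      fix p assume "p \<in> {p. p permutes ({..<N} - S)}"
      then have p: "p permutes ({..<N} - S)" by simp
      have "p permutes {..<N}" by (rule permutes_subset[OF p]) blast
      moreover have "p i = i" if "i \<in> S" for i by (rule permutes_not_in[OF p]) (use that in blast)
      ultimately show "p \<in> ?P \<inter> {p. \<forall>i\<in>S. p i = i}" by blast
    qed
    also have "card \<dots> = fact (N - card S)"
      using S finS by (intro card_permutations) (auto simp: card_Diff_subset)
    finally show "(\<Sum>p\<in>?P. (\<Prod>i\<in>S. if p i = i then b else 0) * (1 / real N) ^ (N - card S))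
       = fact (N - card S) * b ^ card S * (1 / real N) ^ (N - card S)"
      by (simp add: sum_distrib_right[symmetric])
  qed
  also have "\<dots> = (\<Sum>k\<le>N. of_nat (N choose k) * (fact (N - k) * b ^ k * (1 / real N) ^ (N - k)))"
    using sum_Pow_card[of "{..<N}" "\<lambda>k. fact (N - k) * b ^ k * (1 / real N) ^ (N - k)"] by simp
  also have "\<dots> \<le> (\<Sum>k\<le>N. b ^ k)"
  proof (rule sum_mono)
    fix k assume k: "k \<in> {..N}"
    have "real ((N choose (N - k)) * fact (N - k)) \<le> real (N ^ (N - k))"
      by (intro of_nat_mono binomial_fact_pow)
    then have "real (N choose k) * fact (N - k) \<le> real N ^ (N - k)"
      using k by (simp add: binomial_symmetric[symmetric])
    then have "real (N choose k) * fact (N - k) * (1 / real N) ^ (N - k) \<le> 1"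
      using N by (simp add: power_one_over divide_le_eq)
    then have "b ^ k * (real (N choose k) * fact (N - k) * (1 / real N) ^ (N - k)) \<le> b ^ k * 1"
      using b by (intro mult_left_mono) auto
    then show "of_nat (N choose k) * (fact (N - k) * b ^ k * (1 / real N) ^ (N - k)) \<le> b ^ k"
      by (simp add: mult_ac)
  qed
  also have "\<dots> = (b ^ Suc N - 1) / (b - 1)"
    using geometric_sum[of b "Suc N"] b unfolding lessThan_Suc_atMost by simp
  also have "\<dots> \<le> b ^ Suc N / (b - 1)" using b by (intro divide_right_mono) auto
  also have "\<dots> = b ^ N / (1 - 1 / b)" using b by (simp add: field_simps)
  finally show ?thesis .
qed

text \<open>
  For two different permutations some entry occurs in only one of the two products, off the diagonal,
  and its mean is zero. Hence only the squares of the single terms remain.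
\<close>

theorem (in prob_space) expectation_char_det_sq_le:
  fixes x :: "nat \<times> nat \<Rightarrow> 'a \<Rightarrow> real" and t :: complex
  assumes indep: "indep_vars (\<lambda>_. borel) x ({..<N} \<times> {..<N})"
    and sq: "\<And>e. e \<in> {..<N} \<times> {..<N} \<Longrightarrow> integrable M (\<lambda>\<omega>. (x e \<omega>)\<^sup>2)"
    and mean: "\<And>e. e \<in> {..<N} \<times> {..<N} \<Longrightarrow> expectation (x e) = 0"
    and var: "\<And>e. e \<in> {..<N} \<times> {..<N} \<Longrightarrow> expectation (\<lambda>\<omega>. (x e \<omega>)\<^sup>2) = 1 / real N"
    and s: "\<And>p. norm (s p) = 1" and N: "N \<ge> 1" and t: "norm t > 1"
  shows "integrable M (\<lambda>\<omega>. (norm (char_det N s (\<lambda>e. x e \<omega>) t))\<^sup>2)"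
    and "expectation (\<lambda>\<omega>. (norm (char_det N s (\<lambda>e. x e \<omega>) t))\<^sup>2) \<le> (norm t) ^ (2 * N) / (1 - 1 / (norm t)\<^sup>2)"
proof -
  define I where "I = {..<N} \<times> {..<N}"
  let ?P = "{p. p permutes {..<N}}"
  have finI: "finite I" and finP: "finite ?P" by (auto simp: I_def finite_permutations)
  have meas [measurable]: "x e \<in> borel_measurable M" if "e \<in> I" for e
    using indep that by (auto simp: indep_vars_def I_def)
  have int1: "integrable M (x e)" if "e \<in> I" for e
    using sq[of e] meas[OF that] that by (auto simp: I_def intro: square_integrable_imp_integrable)
  \<comment> \<open>the factor of the product for \<open>p\<close> that involves the entry \<open>e\<close>\<close>
  define h where "h p e u = (if p (fst e) = snd e then (if snd e = fst e then t else 0) - of_real u else 1)"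
    for p :: "nat \<Rightarrow> nat" and e :: "nat \<times> nat" and u :: real
  have prodh: "(\<Prod>i<N. (if p i = i then t else 0) - of_real (u (i, p i))) = (\<Prod>e\<in>I. h p e (u e))"
    if "p permutes {..<N}" for p u
  proof -
    have "(\<Prod>e\<in>I. h p e (u e)) = (\<Prod>i<N. \<Prod>j<N. h p (i, j) (u (i, j)))"
      unfolding I_def by (subst prod.cartesian_product) (simp add: case_prod_unfold)
    also have "\<dots> = (\<Prod>i<N. (if p i = i then t else 0) - of_real (u (i, p i)))"
    proof (rule prod.cong[OF refl])
      fix i assume i: "i \<in> {..<N}"
      then have pi: "p i \<in> {..<N}" using that by (simp only: permutes_in_image)
      have "(\<Prod>j<N. h p (i, j) (u (i, j))) = h p (i, p i) (u (i, p i)) * (\<Prod>j\<in>{..<N} - {p i}. h p (i, j) (u (i, j)))"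
        using pi by (intro prod.remove) auto
      also have "(\<Prod>j\<in>{..<N} - {p i}. h p (i, j) (u (i, j))) = 1"
        by (intro prod.neutral) (auto simp: h_def)
      finally show "(\<Prod>j<N. h p (i, j) (u (i, j))) = (if p i = i then t else 0) - of_real (u (i, p i))"
        by (simp add: h_def)
    qed
    finally show ?thesis by simp
  qed
  \<comment> \<open>the factor for the entry \<open>e\<close> in the product of two terms of the expanded square\<close>
  define g where "g p p' e u = h p e u * cnj (h p' e u)" for p p' e u
  have gm: "g p p' e \<in> borel_measurable borel" for p p' e
    unfolding g_def h_def
    by (cases "p (fst e) = snd e"; cases "p' (fst e) = snd e")
      (auto intro!: borel_measurable_continuous_onI continuous_intros)
  have gcases: "integrable M (\<lambda>\<omega>. g p p' e (x e \<omega>))"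
    "expectation (\<lambda>\<omega>. g p p' e (x e \<omega>)) =
      (if p (fst e) = snd e \<and> p' (fst e) = snd e then of_real ((if snd e = fst e then (norm t)\<^sup>2 else 0) + 1 / real N)
       else if p (fst e) = snd e then (if snd e = fst e then t else 0)
       else if p' (fst e) = snd e then (if snd e = fst e then cnj t else 0) else 1)" if e: "e \<in> I" for p p' e
  proof -
    define d where "d = (if snd e = fst e then t else 0)"
    have dd: "d * cnj d = of_real (if snd e = fst e then (norm t)\<^sup>2 else 0)"
      by (simp only: d_def complex_norm_square split: if_split) simp
    have expand2: "(d - of_real u) * cnj (d - of_real u) = d * cnj d - (d + cnj d) * of_real u + of_real (u\<^sup>2)" for u
      by (simp add: algebra_simps power2_eq_square)
    have i1: "integrable M (\<lambda>\<omega>. complex_of_real (x e \<omega>))" "integrable M (\<lambda>\<omega>. complex_of_real ((x e \<omega>)\<^sup>2))"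
      unfolding complex_of_real_integrable_eq using int1[OF e] sq[of e] e by (auto simp only: I_def)
    have m1: "expectation (\<lambda>\<omega>. complex_of_real (x e \<omega>)) = 0" "expectation (\<lambda>\<omega>. complex_of_real ((x e \<omega>)\<^sup>2)) = of_real (1 / real N)"
      using mean[of e] var[of e] e by (simp_all only: I_def integral_complex_of_real of_real_0)
    consider (both) "p (fst e) = snd e" "p' (fst e) = snd e" | (left) "p (fst e) = snd e" "p' (fst e) \<noteq> snd e"
      | (right) "p (fst e) \<noteq> snd e" "p' (fst e) = snd e" | (none) "p (fst e) \<noteq> snd e" "p' (fst e) \<noteq> snd e" by blast
    then have "integrable M (\<lambda>\<omega>. g p p' e (x e \<omega>)) \<and> expectation (\<lambda>\<omega>. g p p' e (x e \<omega>)) =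
      (if p (fst e) = snd e \<and> p' (fst e) = snd e then d * cnj d + of_real (1 / real N)
       else if p (fst e) = snd e then d else if p' (fst e) = snd e then cnj d else 1)"
    proof cases
      case both
      have "g p p' e u = d * cnj d - (d + cnj d) * of_real u + of_real (u\<^sup>2)" for u
        unfolding expand2[symmetric] using both by (simp add: g_def h_def d_def)
      then show ?thesis using both i1 m1 by (simp add: prob_space del: of_real_power)
    next
      case left
      have "g p p' e u = d - of_real u" for u using left by (simp add: g_def h_def d_def)
      then show ?thesis using left i1 m1 by (simp add: prob_space)
    next
      case right
      have "g p p' e u = cnj d - of_real u" for u using right by (simp add: g_def h_def d_def)
      then show ?thesis using right i1 m1 by (simp add: prob_space)
    next
      case none
      have "g p p' e u = 1" for u using none by (simp add: g_def h_def)
      then show ?thesis using none by (simp add: prob_space)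
    qed
    then show "integrable M (\<lambda>\<omega>. g p p' e (x e \<omega>))"
      "expectation (\<lambda>\<omega>. g p p' e (x e \<omega>)) =
      (if p (fst e) = snd e \<and> p' (fst e) = snd e then of_real ((if snd e = fst e then (norm t)\<^sup>2 else 0) + 1 / real N)
       else if p (fst e) = snd e then (if snd e = fst e then t else 0)
       else if p' (fst e) = snd e then (if snd e = fst e then cnj t else 0) else 1)"
      unfolding dd by (auto simp: d_def)
  qed
  have ind: "indep_vars (\<lambda>_. borel) (\<lambda>e \<omega>. g p p' e (x e \<omega>)) I" for p p'
    using indep unfolding I_def by (rule indep_vars_compose2) (rule gm)
  have prod_int: "integrable M (\<lambda>\<omega>. \<Prod>e\<in>I. g p p' e (x e \<omega>))" for p p'
    using finI ind gcases(1) by (rule indep_vars_integrable)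
  have prod_eq: "expectation (\<lambda>\<omega>. \<Prod>e\<in>I. g p p' e (x e \<omega>)) = (\<Prod>e\<in>I. expectation (\<lambda>\<omega>. g p p' e (x e \<omega>)))" for p p'
    using finI ind gcases(1) by (rule indep_vars_lebesgue_integral)
  \<comment> \<open>distinct permutations are uncorrelated: some row meets two different columns, not both diagonal\<close>
  have off: "expectation (\<lambda>\<omega>. \<Prod>e\<in>I. g p p' e (x e \<omega>)) = 0"
    if p: "p permutes {..<N}" "p' permutes {..<N}" "p \<noteq> p'" for p p'
  proof -
    obtain i where i: "p i \<noteq> p' i" using p(3) by auto
    then have iN: "i \<in> {..<N}" using p permutes_not_in by metis
    then have pi: "p i \<in> {..<N}" "p' i \<in> {..<N}" using p by (simp_all only: permutes_in_image)
    have "\<exists>e\<in>I. expectation (\<lambda>\<omega>. g p p' e (x e \<omega>)) = 0"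
    proof (cases "p i = i")
      case True
      have e: "(i, p' i) \<in> I" using iN pi by (simp add: I_def)
      have "expectation (\<lambda>\<omega>. g p p' (i, p' i) (x (i, p' i) \<omega>)) = 0"
        unfolding gcases(2)[OF e] using i True by simp
      then show ?thesis using e by blast
    next
      case False
      have e: "(i, p i) \<in> I" using iN pi by (simp add: I_def)
      have "expectation (\<lambda>\<omega>. g p p' (i, p i) (x (i, p i) \<omega>)) = 0"
        unfolding gcases(2)[OF e] using i False by simp
      then show ?thesis using e by blast
    qed
    then show ?thesis unfolding prod_eq using finI by (simp add: prod_zero_iff)
  qed
  have diag: "expectation (\<lambda>\<omega>. \<Prod>e\<in>I. g p p e (x e \<omega>)) = of_real (\<Prod>i<N. (if p i = i then (norm t)\<^sup>2 else 0) + 1 / real N)"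
    if p: "p permutes {..<N}" for p
  proof -
    have "expectation (\<lambda>\<omega>. \<Prod>e\<in>I. g p p e (x e \<omega>))
      = (\<Prod>e\<in>I. if p (fst e) = snd e then of_real ((if snd e = fst e then (norm t)\<^sup>2 else 0) + 1 / real N) else 1)"
      unfolding prod_eq by (intro prod.cong) (auto simp: gcases(2))
    also have "\<dots> = (\<Prod>i<N. \<Prod>j<N. if p i = j then of_real ((if j = i then (norm t)\<^sup>2 else 0) + 1 / real N) else 1)"
      unfolding I_def by (subst prod.cartesian_product) (simp add: case_prod_unfold)
    also have "\<dots> = (\<Prod>i<N. of_real ((if p i = i then (norm t)\<^sup>2 else 0) + 1 / real N))"
    proof (rule prod.cong[OF refl])
      fix i assume i: "i \<in> {..<N}"
      then have "p i \<in> {..<N}" using p by (simp only: permutes_in_image)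
      then show "(\<Prod>j<N. if p i = j then complex_of_real ((if j = i then (norm t)\<^sup>2 else 0) + 1 / real N) else 1)
        = of_real ((if p i = i then (norm t)\<^sup>2 else 0) + 1 / real N)"
        by (subst prod.delta') auto
    qed
    finally show ?thesis by (simp only: of_real_prod)
  qed
  have expand: "complex_of_real ((norm (char_det N s (\<lambda>e. x e \<omega>) t))\<^sup>2)
    = (\<Sum>p\<in>?P. \<Sum>p'\<in>?P. (s p * cnj (s p')) * (\<Prod>e\<in>I. g p p' e (x e \<omega>)))" for \<omega>
  proof -
    have cd: "char_det N s (\<lambda>e. x e \<omega>) t = (\<Sum>p\<in>?P. s p * (\<Prod>e\<in>I. h p e (x e \<omega>)))"
      unfolding char_det_def using prodh[of _ "\<lambda>e. x e \<omega>"] by (intro sum.cong) auto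
    show ?thesis unfolding complex_norm_square cd
      by (simp add: sum_product g_def prod.distrib mult_ac)
  qed
  have int_c: "integrable M (\<lambda>\<omega>. complex_of_real ((norm (char_det N s (\<lambda>e. x e \<omega>) t))\<^sup>2))"
    unfolding expand by (intro Bochner_Integration.integrable_sum integrable_mult_right prod_int)
  then show int: "integrable M (\<lambda>\<omega>. (norm (char_det N s (\<lambda>e. x e \<omega>) t))\<^sup>2)"
    by (simp only: complex_of_real_integrable_eq)
  have "complex_of_real (expectation (\<lambda>\<omega>. (norm (char_det N s (\<lambda>e. x e \<omega>) t))\<^sup>2))
    = (\<Sum>p\<in>?P. \<Sum>p'\<in>?P. (s p * cnj (s p')) * expectation (\<lambda>\<omega>. \<Prod>e\<in>I. g p p' e (x e \<omega>)))"
    unfolding integral_complex_of_real[symmetric] expand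
    by (simp add: Bochner_Integration.integral_sum Bochner_Integration.integrable_sum integrable_mult_right prod_int)
  also have "\<dots> = (\<Sum>p\<in>?P. \<Sum>p'\<in>?P. if p' = p then of_real (\<Prod>i<N. (if p i = i then (norm t)\<^sup>2 else 0) + 1 / real N) else 0)"
  proof (intro sum.cong refl)
    fix p p' assume p: "p \<in> ?P" "p' \<in> ?P"
    have "s p * cnj (s p) = 1" using s[of p] by (simp flip: complex_norm_square)
    then show "(s p * cnj (s p')) * expectation (\<lambda>\<omega>. \<Prod>e\<in>I. g p p' e (x e \<omega>))
      = (if p' = p then of_real (\<Prod>i<N. (if p i = i then (norm t)\<^sup>2 else 0) + 1 / real N) else 0)"
      using p off[of p p'] diag[of p] by auto
  qed
  also have "\<dots> = of_real (\<Sum>p\<in>?P. \<Prod>i<N. (if p i = i then (norm t)\<^sup>2 else 0) + 1 / real N)"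
    using finP by simp
  finally have "expectation (\<lambda>\<omega>. (norm (char_det N s (\<lambda>e. x e \<omega>) t))\<^sup>2)
    = (\<Sum>p\<in>?P. \<Prod>i<N. (if p i = i then (norm t)\<^sup>2 else 0) + 1 / real N)"
    by (simp only: of_real_eq_iff)
  also have "\<dots> \<le> ((norm t)\<^sup>2) ^ N / (1 - 1 / (norm t)\<^sup>2)"
    using t N by (intro sum_permutations_prod_fixpoints_le) (auto simp: one_less_power)
  finally show "expectation (\<lambda>\<omega>. (norm (char_det N s (\<lambda>e. x e \<omega>) t))\<^sup>2) \<le> (norm t) ^ (2 * N) / (1 - 1 / (norm t)\<^sup>2)"
    by (simp add: power_mult)
qed

section \<open>Power sums and the size of a polynomial on a circle\<close>

lemma sum_cis_roots_of_unity:
  assumes "n \<ge> 1"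
  shows "(\<Sum>j<n. cis (2 * pi * of_int l * real j / real n)) = (if int n dvd l then of_nat n else 0)"
proof -
  define w where "w = cis (2 * pi * of_int l / real n)"
  have pw: "cis (2 * pi * of_int l * real j / real n) = w ^ j" for j
    by (simp add: w_def Complex.DeMoivre mult_ac)
  show ?thesis
  proof (cases "int n dvd l")
    case True
    then obtain k where k: "l = int n * k" by blast
    have "2 * pi * of_int l / real n = 2 * pi * of_int k" using assms by (simp add: k)
    then have "w = cis (2 * pi * of_int k)" by (simp only: w_def)
    then have "w = 1" by (simp only: cis_multiple_2pi Ints_of_int)
    then show ?thesis using True unfolding pw by simp
  next
    case False
    have "w \<noteq> 1"
    proof
      assume "w = 1"
      then have "cos (2 * pi * of_int l / real n) = 1" unfolding w_def by (metis cis.simps(1) one_complex.simps(1))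
      then obtain k :: int where "2 * pi * of_int l / real n = of_int k * 2 * pi"
        unfolding cos_one_2pi_int by blast
      then have "of_int l = (of_int (int n * k) :: real)" using assms by (simp add: field_simps)
      then show False using False by (metis dvd_triv_left of_int_eq_iff)
    qed
    moreover have "w ^ n = cis (2 * pi * of_int l)" using assms by (simp add: w_def Complex.DeMoivre)
    then have "w ^ n = 1" by (simp only: cis_multiple_2pi Ints_of_int)
    ultimately show ?thesis using False unfolding pw by (simp add: geometric_sum)
  qed
qed

text \<open>
  The real part of the power series of the logarithm, with an error uniform on a smaller disk.
\<close>

lemma ln_norm_one_minus_approx:
  assumes "\<rho> < 1" "e > 0"
  shows "\<exists>K0. \<forall>K\<ge>K0. \<forall>u::complex. norm u \<le> \<rho> \<longrightarrow> \<bar>ln (norm (1 - u)) + (\<Sum>k=1..K. Re (u ^ k) / real k)\<bar> \<le> e"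
proof -
  define f :: "nat \<Rightarrow> complex \<Rightarrow> complex" where "f n u = u ^ n / of_nat n" for n u
  have "uniform_limit (cball 0 (max 0 \<rho>)) (\<lambda>n u. \<Sum>i<n. f i u) (\<lambda>u. suminf (\<lambda>i. f i u)) sequentially"
  proof (rule Weierstrass_m_test)
    show "norm (f n u) \<le> max 0 \<rho> ^ n" if "u \<in> cball 0 (max 0 \<rho>)" for n u
    proof (cases "n = 0")
      case False
      have "norm (f n u) = norm u ^ n / real n" by (simp add: f_def norm_divide norm_power)
      also have "\<dots> \<le> norm u ^ n" using False by (simp add: divide_le_eq mult_le_cancel_left1)
      also have "\<dots> \<le> max 0 \<rho> ^ n" using that by (intro power_mono) auto
      finally show ?thesis .
    qed (simp add: f_def)
    show "summable (\<lambda>n. max 0 \<rho> ^ n)" using assms by (intro summable_geometric) auto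
  qed
  then obtain K0 where K: "\<And>u n. n \<ge> K0 \<Longrightarrow> u \<in> cball 0 (max 0 \<rho>) \<Longrightarrow> dist (\<Sum>i<n. f i u) (suminf (\<lambda>i. f i u)) < e"
    using assms(2) unfolding uniform_limit_sequentially_iff by metis
  show ?thesis
  proof (intro exI[of _ K0] allI impI)
    fix K and u :: complex assume KK: "K0 \<le> K" and u: "norm u \<le> \<rho>"
    then have u1: "norm u < 1" using assms by simp
    have "(\<lambda>n. (- 1) ^ Suc n / of_nat n * (- u) ^ n) sums ln (1 + (- u))"
      using u1 by (intro Ln_series) simp
    moreover have "(- 1) ^ Suc n / of_nat n * (- u) ^ n = - f n u" for n
      by (cases "even n") (simp_all add: f_def)
    ultimately have "(\<lambda>n. - f n u) sums ln (1 - u)" by simp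
    then have sm: "suminf (\<lambda>i. f i u) = - ln (1 - u)"
      using sums_minus sums_unique by fastforce
    have "u \<in> cball 0 (max 0 \<rho>)" using u by simp
    then have "dist (\<Sum>i<Suc K. f i u) (suminf (\<lambda>i. f i u)) < e" using KK by (intro K) auto
    then have "norm ((\<Sum>i<Suc K. f i u) + ln (1 - u)) < e" by (simp add: sm dist_norm)
    moreover have "\<bar>Re ((\<Sum>i<Suc K. f i u) + ln (1 - u))\<bar> \<le> norm ((\<Sum>i<Suc K. f i u) + ln (1 - u))"
      by (rule abs_Re_le_cmod)
    moreover have "u \<noteq> 1" using u1 by auto
    then have "Re (ln (1 - u)) = ln (norm (1 - u))" by simp
    moreover have "Re (\<Sum>i<Suc K. f i u) = (\<Sum>k=1..K. Re (u ^ k) / real k)"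
    proof -
      have "(\<Sum>i<Suc K. Re (f i u)) = (\<Sum>k=1..K. Re (f k u))"
        by (rule sum.mono_neutral_right) (auto simp: f_def not_less_eq_eq)
      then show ?thesis by (simp add: f_def)
    qed
    ultimately show "\<bar>ln (norm (1 - u)) + (\<Sum>k=1..K. Re (u ^ k) / real k)\<bar> \<le> e" by simp
  qed
qed

text \<open>
  The Fourier coefficients of \<open>ln (cmod (1 - w cis (- \<theta>)))\<close>, with the integral over the circle replaced by
  the average over the \<open>n\<close>-th roots of unity. After cutting the logarithmic series at \<open>K\<close>, only the
  frequency \<open>m\<close> survives once \<open>n\<close> exceeds \<open>K + m\<close>.
\<close>

lemma average_ln_norm_approx:
  assumes \<rho>: "\<rho> < 1" and e: "e > 0"
  shows "\<exists>n0. \<forall>n\<ge>n0. \<forall>w::complex. norm w \<le> \<rho> \<longrightarrow>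
    norm ((\<Sum>j<n. of_real (ln (norm (1 - w * cis (- (2 * pi * real j / real n))))) * cis (2 * pi * real m * real j / real n)) / of_nat n
      + (if m = 0 then 0 else w ^ m / (2 * of_nat m))) \<le> e"
proof -
  obtain K0 where K0: "\<And>K u. K \<ge> K0 \<Longrightarrow> norm (u::complex) \<le> \<rho> \<Longrightarrow> \<bar>ln (norm (1 - u)) + (\<Sum>k=1..K. Re (u ^ k) / real k)\<bar> \<le> e"
    using ln_norm_one_minus_approx[OF assms] by blast
  define K where "K = max K0 m"
  have K: "\<bar>ln (norm (1 - u)) + (\<Sum>k=1..K. Re (u ^ k) / real k)\<bar> \<le> e" if "norm (u::complex) \<le> \<rho>" for u
    using K0[of K u] that by (simp add: K_def)
  show ?thesis
  proof (intro exI[of _ "K + m + 1"] allI impI)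
    fix n and w :: complex assume n: "K + m + 1 \<le> n" and w: "norm w \<le> \<rho>"
    have n1: "n \<ge> 1" using n by simp
    define z where "z j = cis (2 * pi * real m * real j / real n)" for j
    define v where "v j = w * cis (- (2 * pi * real j / real n))" for j
    define P where "P j = (\<Sum>k=1..K. Re (v j ^ k) / real k)" for j
    define c where "c = (if m = 0 then 0 else w ^ m / (2 * of_nat m))"
    have vk: "of_real (Re (v j ^ k)) * z j
       = (w ^ k * cis (2 * pi * of_int (int m - int k) * real j / real n) + cnj (w ^ k) * cis (2 * pi * of_int (int m + int k) * real j / real n)) / 2" for j k
    proof -
      define a where "a = 2 * pi * real j / real n"
      have vv: "v j ^ k = w ^ k * cis (- (real k * a))"
        by (simp add: v_def a_def power_mult_distrib Complex.DeMoivre)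
      have re: "of_real (Re u) = (u + cnj u) / 2" for u by (simp add: complex_eq_iff)
      have "of_real (Re (v j ^ k)) = (w ^ k * cis (- (real k * a)) + cnj (w ^ k) * cis (real k * a)) / 2"
        unfolding re vv complex_cnj_mult cis_cnj minus_minus ..
      then have "of_real (Re (v j ^ k)) * z j
        = (w ^ k * (cis (- (real k * a)) * z j) + cnj (w ^ k) * (cis (real k * a) * z j)) / 2"
        by (simp only: distrib_right times_divide_eq_left mult.assoc)
      moreover have "z j = cis (real m * a)" by (simp add: z_def a_def mult_ac)
      moreover have "2 * pi * of_int (int m - int k) * real j / real n = - (real k * a) + real m * a"
        "2 * pi * of_int (int m + int k) * real j / real n = real k * a + real m * a"
        by (simp_all add: a_def diff_divide_distrib add_divide_distrib algebra_simps)
      ultimately show ?thesis by (simp only: cis_mult)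
    qed
    have inner: "(\<Sum>j<n. of_real (Re (v j ^ k)) * z j) = (if k = m then of_nat n * w ^ m / 2 else 0)"
      if k: "k \<in> {1..K}" for k
    proof -
      have d1: "int n dvd int m - int k \<longleftrightarrow> k = m"
      proof
        assume "int n dvd int m - int k"
        moreover have "\<bar>int m - int k\<bar> < int n" using k n by auto
        ultimately have "int m - int k = 0" using dvd_imp_le_int[of "int m - int k" "int n"] by auto
        then show "k = m" by simp
      qed simp
      have d2: "\<not> int n dvd int m + int k"
        using k n by (auto dest!: zdvd_imp_le)
      have "(\<Sum>j<n. of_real (Re (v j ^ k)) * z j)
        = (w ^ k * (\<Sum>j<n. cis (2 * pi * of_int (int m - int k) * real j / real n))
          + cnj (w ^ k) * (\<Sum>j<n. cis (2 * pi * of_int (int m + int k) * real j / real n))) / 2"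
        unfolding vk sum_divide_distrib[symmetric] sum.distrib sum_distrib_left ..
      then show ?thesis unfolding sum_cis_roots_of_unity[OF n1] using d1 d2 by (cases "k = m") simp_all
    qed
    have "(\<Sum>j<n. of_real (P j) * z j) = (\<Sum>k=1..K. (\<Sum>j<n. of_real (Re (v j ^ k)) * z j) / of_nat k)"
      unfolding P_def of_real_sum sum_distrib_right
      by (subst sum.swap) (simp add: sum_divide_distrib)
    also have "\<dots> = (\<Sum>k=1..K. if k = m then of_nat n * w ^ m / (2 * of_nat m) else 0)"
      by (intro sum.cong refl) (simp add: inner)
    also have "\<dots> = of_nat n * c"
      by (simp add: c_def K_def)
    finally have main: "(\<Sum>j<n. of_real (P j) * z j) / of_nat n = c" using n1 by simp
    have nv: "norm (v j) \<le> \<rho>" for j using w by (simp add: v_def norm_mult)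
    have "(\<Sum>j<n. of_real (ln (norm (1 - v j))) * z j) / of_nat n + c
      = (\<Sum>j<n. of_real (ln (norm (1 - v j)) + P j) * z j) / of_nat n"
      unfolding main[symmetric] by (simp add: distrib_right sum.distrib add_divide_distrib)
    also have "norm \<dots> \<le> (\<Sum>j<n. e) / real n"
      unfolding norm_divide norm_of_nat
    proof (rule divide_right_mono[OF sum_norm_le])
      fix j
      show "norm (of_real (ln (norm (1 - v j)) + P j) * z j) \<le> e"
        using K[OF nv[of j]] by (simp add: norm_mult z_def P_def del: of_real_add)
    qed simp
    also have "\<dots> = e" using n1 by simp
    finally show "norm ((\<Sum>j<n. of_real (ln (norm (1 - w * cis (- (2 * pi * real j / real n))))) * cis (2 * pi * real m * real j / real n)) / of_nat n
      + (if m = 0 then 0 else w ^ m / (2 * of_nat m))) \<le> e"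
      by (simp only: v_def z_def c_def)
  qed
qed

text \<open>
  Let \<open>a\<close> be the logarithm of the product over \<open>I\<close>, normalized by \<open>R\<close> to the number of factors.
  Its \<open>m\<close>-th Fourier coefficient is the power sum divided by \<open>- 2 m R\<^sup>m\<close>, and its mean vanishes. The
  pointwise bound \<open>a \<le> exp (2 a)\<close> gives \<open>\<bar>a\<bar> \<le> 2 exp (2 a) - a\<close>, whose average is twice the average of
  the squared product. Averages over roots of unity satisfy all this up to errors that vanish
  uniformly in the points.
\<close>

theorem power_sum_le_average_sq:
  fixes I :: "'i set"
  assumes I: "finite I" and R: "0 \<le> R'" "R' < R" and m: "m \<ge> 1" and e: "e > 0"
  shows "\<exists>n0. \<forall>n\<ge>n0. \<forall>l. (\<forall>i\<in>I. norm (l i) \<le> R') \<longrightarrow>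
    norm (\<Sum>i\<in>I. l i ^ m) \<le> 4 * real m * R ^ m * ((\<Sum>j<n. (norm (\<Prod>i\<in>I. of_real R * cis (2 * pi * real j / real n) - l i) / R ^ card I)\<^sup>2) / real n) + e"
proof -
  define \<rho> where "\<rho> = R' / R"
  have R0: "R > 0" using R by simp
  have \<rho>: "\<rho> < 1" using R by (simp add: \<rho>_def)
  \<comment> \<open>the accuracy per factor that leaves a total error of \<open>e\<close>\<close>
  define d where "d = e / (4 * real m * R ^ m * (real (card I) + 1))"
  have d: "d > 0" using e R0 m by (simp add: d_def)
  have dI: "4 * real m * R ^ m * (real (card I) * d) \<le> e"
  proof -
    have "4 * real m * R ^ m * (real (card I) * d) = e * (real (card I) / (real (card I) + 1))"
    proof -
      define C where "C = 4 * real m * R ^ m"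
      have "C \<noteq> 0" using R0 m by (simp add: C_def)
      then show ?thesis unfolding d_def C_def[symmetric] by simp
    qed
    also have "\<dots> \<le> e * 1" using e by (intro mult_left_mono) auto
    finally show ?thesis by simp
  qed
  obtain n1 where n1: "\<And>n w. n \<ge> n1 \<Longrightarrow> norm (w::complex) \<le> \<rho> \<Longrightarrow>
    norm ((\<Sum>j<n. of_real (ln (norm (1 - w * cis (- (2 * pi * real j / real n))))) * cis (2 * pi * real m * real j / real n)) / of_nat n
      + w ^ m / (2 * of_nat m)) \<le> d"
    using average_ln_norm_approx[OF \<rho> d, of m] m by auto
  obtain n2 where n2: "\<And>n w. n \<ge> n2 \<Longrightarrow> norm (w::complex) \<le> \<rho> \<Longrightarrow>
    norm ((\<Sum>j<n. of_real (ln (norm (1 - w * cis (- (2 * pi * real j / real n)))))) / complex_of_nat n) \<le> d"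
    using average_ln_norm_approx[OF \<rho> d, of 0] by auto
  show ?thesis
  proof (intro exI[of _ "max 1 (max n1 n2)"] allI impI)
    fix n and l :: "'i \<Rightarrow> complex" assume n: "max 1 (max n1 n2) \<le> n" and l: "\<forall>i\<in>I. norm (l i) \<le> R'"
    have n0: "n > 0" using n by simp
    define w where "w i = l i / of_real R" for i
    have w: "norm (w i) \<le> \<rho>" if "i \<in> I" for i
      using l that R0 by (simp add: w_def \<rho>_def norm_divide divide_right_mono)
    define z where "z j = cis (2 * pi * real m * real j / real n)" for j
    define b where "b i j = ln (norm (1 - w i * cis (- (2 * pi * real j / real n))))" for i j
    define a where "a j = (\<Sum>i\<in>I. b i j)" for j
    define x where "x j = norm (\<Prod>i\<in>I. of_real R * cis (2 * pi * real j / real n) - l i) / R ^ card I" for j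
    have xa: "a j = ln (x j) \<and> x j > 0" for j
    proof -
      have fac: "of_real R * cis (2 * pi * real j / real n) - l i
        = of_real R * cis (2 * pi * real j / real n) * (1 - w i * cis (- (2 * pi * real j / real n)))" for i
        using R0 by (simp add: w_def right_diff_distrib cis_mult mult_ac)
      have x: "x j = (\<Prod>i\<in>I. norm (1 - w i * cis (- (2 * pi * real j / real n))))"
        unfolding x_def fac using R0
        by (simp add: norm_mult norm_power prod_norm[symmetric] prod.distrib)
      have pos: "norm (1 - w i * cis (- (2 * pi * real j / real n))) > 0" if "i \<in> I" for i
      proof -
        have "norm (w i * cis (- (2 * pi * real j / real n))) < 1" using w[OF that] \<rho> by (simp add: norm_mult)
        then have "w i * cis (- (2 * pi * real j / real n)) \<noteq> 1" by auto
        then show ?thesis by simp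
      qed
      show ?thesis using pos I unfolding x a_def b_def by (simp add: ln_prod prod_pos)
    qed
    define S where "S = (\<Sum>j<n. of_real (a j) * z j) / complex_of_nat n"
    have S1: "norm (S + (\<Sum>i\<in>I. w i ^ m / (2 * of_nat m))) \<le> real (card I) * d"
    proof -
      have "S + (\<Sum>i\<in>I. w i ^ m / (2 * of_nat m)) = (\<Sum>i\<in>I. (\<Sum>j<n. of_real (b i j) * z j) / of_nat n + w i ^ m / (2 * of_nat m))"
        unfolding S_def a_def of_real_sum sum_distrib_right
        by (subst sum.swap) (simp add: sum.distrib sum_divide_distrib)
      also have "norm \<dots> \<le> (\<Sum>i\<in>I. d)"
        using n1[of n] n w unfolding b_def z_def by (intro sum_norm_le) auto
      finally show ?thesis by simp
    qed
    have S0: "\<bar>(\<Sum>j<n. a j) / real n\<bar> \<le> real (card I) * d"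
    proof -
      have "complex_of_real ((\<Sum>j<n. a j) / real n) = (\<Sum>i\<in>I. (\<Sum>j<n. of_real (b i j)) / of_nat n)"
        unfolding a_def by (subst sum.swap) (simp add: sum_divide_distrib)
      also have "norm \<dots> \<le> (\<Sum>i\<in>I. d)"
        using n2[of n] n w unfolding b_def by (intro sum_norm_le) auto
      finally show ?thesis by (simp only: norm_of_real) simp
    qed
    define H where "H = (\<Sum>j<n. (x j)\<^sup>2) / real n"
    have "norm S \<le> (\<Sum>j<n. \<bar>a j\<bar>) / real n"
      unfolding S_def norm_divide norm_of_nat
      by (intro divide_right_mono sum_norm_le) (simp_all add: norm_mult z_def)
    also have "\<dots> \<le> (\<Sum>j<n. 2 * (x j)\<^sup>2 - a j) / real n"
    proof (intro divide_right_mono sum_mono)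
      fix j
      have "ln (x j) \<le> x j - 1" using xa[of j] by (intro ln_le_minus_one) auto
      moreover have "x j - 1 \<le> (x j)\<^sup>2" using zero_le_power2[of "x j - 1 / 2"] by (simp add: power2_eq_square algebra_simps)
      ultimately have "a j \<le> (x j)\<^sup>2" using xa[of j] by linarith
      then show "\<bar>a j\<bar> \<le> 2 * (x j)\<^sup>2 - a j" using zero_le_power2[of "x j"] unfolding abs_le_iff by linarith
    qed simp
    also have "\<dots> = 2 * H - (\<Sum>j<n. a j) / real n"
      by (simp add: H_def sum_subtractf diff_divide_distrib sum_distrib_left)
    also have "\<dots> \<le> 2 * H + real (card I) * d" using S0 by linarith
    finally have S2: "norm S \<le> 2 * H + real (card I) * d" .
    have "(\<Sum>i\<in>I. w i ^ m / (2 * of_nat m)) = (\<Sum>i\<in>I. l i ^ m) / (2 * of_nat m * of_real R ^ m)"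
      by (simp add: w_def power_divide sum_divide_distrib mult.commute)
    then have "(\<Sum>i\<in>I. l i ^ m) = of_real (2 * real m * R ^ m) * (\<Sum>i\<in>I. w i ^ m / (2 * of_nat m))"
      using m R0 by simp
    then have "norm (\<Sum>i\<in>I. l i ^ m) = (2 * real m * R ^ m) * norm (\<Sum>i\<in>I. w i ^ m / (2 * of_nat m))"
      using R0 by (simp add: norm_mult norm_power)
    also have "\<dots> \<le> (2 * real m * R ^ m) * (2 * H + 2 * (real (card I) * d))"
    proof (rule mult_left_mono)
      have "norm (\<Sum>i\<in>I. w i ^ m / (2 * of_nat m)) \<le> norm S + real (card I) * d"
        using S1 norm_triangle_ineq4[of "S + (\<Sum>i\<in>I. w i ^ m / (2 * of_nat m))" S] by simp
      then show "norm (\<Sum>i\<in>I. w i ^ m / (2 * of_nat m)) \<le> 2 * H + 2 * (real (card I) * d)"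
        using S2 by linarith
    qed (use R0 in simp)
    also have "\<dots> = 4 * real m * R ^ m * H + 4 * real m * R ^ m * (real (card I) * d)" by (simp add: algebra_simps)
    also have "\<dots> \<le> 4 * real m * R ^ m * H + e" using dI by simp
    finally show "norm (\<Sum>i\<in>I. l i ^ m) \<le> 4 * real m * R ^ m * ((\<Sum>j<n. (norm (\<Prod>i\<in>I. of_real R * cis (2 * pi * real j / real n) - l i) / R ^ card I)\<^sup>2) / real n) + e"
      by (simp add: H_def x_def)
  qed
qed

section \<open>Measurability of sums over roots\<close>

text \<open>
  Monic polynomials of a fixed degree, parametrized by their lower coefficients so that continuity
  and measurability in the coefficients can be stated.
\<close>

definition monic_poly :: "nat \<Rightarrow> (nat \<Rightarrow> complex) \<Rightarrow> complex poly" where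
  "monic_poly N c = (\<Sum>k<N. monom (c k) k) + monom 1 N"

lemma coeff_monic_poly: "coeff (monic_poly N c) k = (if k < N then c k else if k = N then 1 else 0)"
  by (auto simp: monic_poly_def coeff_sum)

lemma degree_monic_poly: "degree (monic_poly N c) = N"
proof (rule antisym)
  show "degree (monic_poly N c) \<le> N" by (rule degree_le) (auto simp: coeff_monic_poly)
  show "N \<le> degree (monic_poly N c)" by (rule le_degree) (simp add: coeff_monic_poly)
qed

lemma monic_poly_coeff: "degree p = N \<Longrightarrow> coeff p N = 1 \<Longrightarrow> monic_poly N (coeff p) = p"
  by (rule poly_eqI) (auto simp: coeff_monic_poly coeff_eq_0)

lemma monic_poly_root_bound:
  assumes "poly (monic_poly N c) z = 0"
  shows "norm z \<le> 1 + (\<Sum>k<N. norm (c k))"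
proof (rule ccontr)
  assume "\<not> ?thesis"
  then have z: "norm z > 1 + (\<Sum>k<N. norm (c k))" by simp
  have s0: "(\<Sum>k<N. norm (c k)) \<ge> 0" by (simp add: sum_nonneg)
  then have z1: "norm z > 1" using z by linarith
  have "poly (monic_poly N c) z = (\<Sum>k<N. c k * z ^ k) + z ^ N"
    by (simp add: monic_poly_def poly_sum poly_monom)
  then have eq: "z ^ N = - (\<Sum>k<N. c k * z ^ k)" using assms by (simp add: eq_neg_iff_add_eq_0 add.commute)
  show False
  proof (cases N)
    case 0
    then show ?thesis using eq by simp
  next
    case (Suc n)
    have "norm z ^ N = norm (\<Sum>k<N. c k * z ^ k)" using arg_cong[OF eq, of norm] by (simp add: norm_power)
    also have "\<dots> \<le> (\<Sum>k<N. norm (c k) * norm z ^ n)"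
      using z1 Suc by (intro sum_norm_le) (auto simp: norm_mult norm_power intro!: mult_left_mono power_increasing)
    also have "\<dots> = (\<Sum>k<N. norm (c k)) * norm z ^ n" by (simp add: sum_distrib_right)
    also have "\<dots> < norm z * norm z ^ n"
      using z z1 by (intro mult_strict_right_mono zero_less_power) linarith+
    finally show False using Suc by simp
  qed
qed

lemma convergent_subseq_finite:
  fixes X :: "nat \<Rightarrow> nat \<Rightarrow> complex"
  assumes "\<And>n i. i < N \<Longrightarrow> norm (X n i) \<le> B"
  shows "\<exists>r l. strict_mono r \<and> (\<forall>i<N. (\<lambda>n. X (r n) i) \<longlonglongrightarrow> l i)"
  using assms
proof (induction N)
  case 0
  show ?case by (intro exI[of _ id]) (simp add: strict_mono_id)
next
  case (Suc N)
  then obtain r l where r: "strict_mono r" "\<And>i. i < N \<Longrightarrow> (\<lambda>n. X (r n) i) \<longlonglongrightarrow> l i" by fastforce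
  have "bounded (range (\<lambda>n. X (r n) N))" using Suc.prems[of N] by (auto simp: bounded_iff)
  then obtain s l' where s: "strict_mono s" "((\<lambda>n. X (r n) N) \<circ> s) \<longlonglongrightarrow> l'"
    using bounded_imp_convergent_subsequence by blast
  show ?case
  proof (intro exI conjI allI impI)
    show "strict_mono (r \<circ> s)" using r(1) s(1) by (rule strict_mono_o)
    fix i assume "i < Suc N"
    then consider "i < N" | "i = N" by linarith
    then show "(\<lambda>n. X ((r \<circ> s) n) i) \<longlonglongrightarrow> (l(N := l')) i"
    proof cases
      case 1
      then show ?thesis using LIMSEQ_subseq_LIMSEQ[OF r(2)[OF 1] s(1)] by (simp add: o_def)
    next
      case 2
      then show ?thesis using s(2) by (simp add: o_def)
    qed
  qed
qed

lemma tendsto_if_subseq_tendsto: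
  fixes X :: "nat \<Rightarrow> 'a::metric_space"
  assumes "\<And>s :: nat \<Rightarrow> nat. strict_mono s \<Longrightarrow> \<exists>r :: nat \<Rightarrow> nat. strict_mono r \<and> (\<lambda>n. X (s (r n))) \<longlonglongrightarrow> L"
  shows "X \<longlonglongrightarrow> L"
proof (rule ccontr)
  assume "\<not> X \<longlonglongrightarrow> L"
  then obtain e where e: "e > 0" and "\<And>n0. \<exists>n\<ge>n0. dist (X n) L \<ge> e"
    unfolding LIMSEQ_def by (meson not_le)
  then have "infinite {n. dist (X n) L \<ge> e}"
    by (metis (mono_tags, lifting) finite_nat_set_iff_bounded mem_Collect_eq not_le)
  then obtain s :: "nat \<Rightarrow> nat" where s: "strict_mono s" "\<And>n. s n \<in> {n. dist (X n) L \<ge> e}"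
    using infinite_enumerate by blast
  from assms[OF s(1)] obtain r where "(\<lambda>n. X (s (r n))) \<longlonglongrightarrow> L" by blast
  then have "\<forall>\<^sub>F n in sequentially. dist (X (s (r n))) L < e" using e by (rule tendstoD)
  then obtain n where "dist (X (s (r n))) L < e" by (auto simp: eventually_sequentially)
  then show False using s(2)[of "r n"] by simp
qed

lemma sum_count_scaleR:
  fixes h :: "'a \<Rightarrow> 'b::real_vector"
  assumes "finite S" "set_mset A \<subseteq> S"
  shows "(\<Sum>a\<in>S. real (count A a) *\<^sub>R h a) = (\<Sum>a\<in>#A. h a)"
  using assms(2)
proof (induction A)
  case (add x A)
  have "(\<Sum>a\<in>S. real (count (add_mset x A) a) *\<^sub>R h a)
      = (\<Sum>a\<in>S. (if a = x then h x else 0) + real (count A a) *\<^sub>R h a)"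
    by (intro sum.cong) (auto simp: algebra_simps)
  also have "\<dots> = h x + (\<Sum>a\<in>S. real (count A a) *\<^sub>R h a)"
    using add.prems assms(1) by (simp add: sum.distrib)
  finally show ?case using add by simp
qed simp

lemma sum_mset_sum_singletons:
  fixes g :: "'a \<Rightarrow> 'b::comm_monoid_add"
  shows "(\<Sum>z\<in>#(\<Sum>i<N. {#l i#}). g z) = (\<Sum>i<(N::nat). g (l i))"
  by (induction N) (simp_all add: add.commute)

text \<open>
  The roots of a monic polynomial depend continuously on its coefficients: they stay bounded, and
  along any subsequence for which they converge, their limits are the roots of the limit.
\<close>

lemma sum_roots_tendsto:
  fixes g :: "complex \<Rightarrow> 'b::real_normed_vector"
  assumes c: "\<And>k. (\<lambda>n. c n k) \<longlonglongrightarrow> c' k" and g: "continuous_on UNIV g"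
  shows "(\<lambda>n. \<Sum>z\<in>#proots (monic_poly N (c n)). g z) \<longlonglongrightarrow> (\<Sum>z\<in>#proots (monic_poly N c'). g z)"
proof (rule tendsto_if_subseq_tendsto)
  fix s :: "nat \<Rightarrow> nat" assume s: "strict_mono s"
  define d where "d n = c (s n)" for n
  have d: "(\<lambda>n. d n k) \<longlonglongrightarrow> c' k" for k
    using LIMSEQ_subseq_LIMSEQ[OF c s] by (simp add: d_def o_def)
  have "\<exists>ls. mset ls = proots (monic_poly N (d n))" for n by (rule ex_mset)
  then obtain ls where ls: "\<And>n. mset (ls n) = proots (monic_poly N (d n))" by metis
  have len: "length (ls n) = N" for n
    using ls[of n] by (metis degree_monic_poly size_mset size_proots_complex)
  have fac: "monic_poly N (d n) = (\<Prod>i<N. [:- (ls n ! i), 1:])" for n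
  proof -
    have "monic_poly N (d n) = Polynomial.smult (lead_coeff (monic_poly N (d n))) (\<Prod>x\<in>#proots (monic_poly N (d n)). [:- x, 1:])"
      by (rule complex_poly_decompose_multiset[symmetric])
    also have "lead_coeff (monic_poly N (d n)) = 1" by (simp add: degree_monic_poly coeff_monic_poly)
    also have "(\<Prod>x\<in>#proots (monic_poly N (d n)). [:- x, 1:]) = (\<Prod>x\<leftarrow>ls n. [:- x, 1:])"
      by (simp only: ls[symmetric] mset_map[symmetric] prod_mset_prod_list)
    also have "\<dots> = (\<Prod>i<N. [:- (ls n ! i), 1:])"
      using len[of n] by (simp add: prod.list_conv_set_nth atLeast0LessThan)
    finally show ?thesis by simp
  qed
  have sumg: "(\<Sum>z\<in>#proots (monic_poly N (d n)). g z) = (\<Sum>i<N. g (ls n ! i))" for n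
  proof -
    have "(\<Sum>z\<in>#proots (monic_poly N (d n)). g z) = sum_list (map g (ls n))"
      by (simp only: ls[symmetric] mset_map[symmetric] sum_mset_sum_list)
    then show ?thesis using len[of n] by (simp add: sum_list_sum_nth atLeast0LessThan)
  qed
  have "\<exists>B. \<forall>n. norm (d n k) \<le> B" for k
  proof -
    have "Bseq (\<lambda>n. d n k)" using d by (intro convergent_imp_Bseq convergentI)
    then show ?thesis by (auto simp: Bseq_def)
  qed
  then obtain B where B: "\<And>k n. norm (d n k) \<le> B k" by metis
  have bd: "norm (ls n ! i) \<le> 1 + (\<Sum>k<N. B k)" if i: "i < N" for n i
  proof -
    have "poly (monic_poly N (d n)) (ls n ! i) = 0"
      unfolding fac poly_prod using i by (intro prod_zero) auto
    then have "norm (ls n ! i) \<le> 1 + (\<Sum>k<N. norm (d n k))" by (rule monic_poly_root_bound)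
    also have "\<dots> \<le> 1 + (\<Sum>k<N. B k)" by (intro add_left_mono sum_mono B)
    finally show ?thesis .
  qed
  obtain r l where r: "strict_mono r" and l: "\<And>i. i < N \<Longrightarrow> (\<lambda>n. ls (r n) ! i) \<longlonglongrightarrow> l i"
    using convergent_subseq_finite[of N "\<lambda>n i. ls n ! i", OF bd] by blast
  have lim: "monic_poly N c' = (\<Prod>i<N. [:- l i, 1:])"
  proof (rule poly_eq_poly_eq_iff[THEN iffD1], rule ext)
    fix t
    have "(\<lambda>n. poly (monic_poly N (d (r n))) t) \<longlonglongrightarrow> poly (monic_poly N c') t"
      using LIMSEQ_subseq_LIMSEQ[OF d r] unfolding monic_poly_def poly_add poly_sum poly_monom o_def
      by (intro tendsto_intros)
    moreover have "(\<lambda>n. poly (monic_poly N (d (r n))) t) \<longlonglongrightarrow> poly (\<Prod>i<N. [:- l i, 1:]) t"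
      unfolding fac poly_prod using l by (auto intro!: tendsto_intros)
    ultimately show "poly (monic_poly N c') t = poly (\<Prod>i<N. [:- l i, 1:]) t" by (rule LIMSEQ_unique)
  qed
  have "proots (monic_poly N c') = (\<Sum>i<N. {#l i#})"
    unfolding lim by (subst proots_prod) (auto simp: proots_linear_factor)
  then have sl: "(\<Sum>z\<in>#proots (monic_poly N c'). g z) = (\<Sum>i<N. g (l i))"
    by (simp only: sum_mset_sum_singletons)
  have "(\<lambda>n. \<Sum>i<N. g (ls (r n) ! i)) \<longlonglongrightarrow> (\<Sum>i<N. g (l i))"
    using l by (intro tendsto_sum continuous_on_tendsto_compose[OF g]) auto
  then have "(\<lambda>n. \<Sum>z\<in>#proots (monic_poly N (d (r n))). g z) \<longlonglongrightarrow> (\<Sum>z\<in>#proots (monic_poly N c'). g z)"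
    unfolding sl sumg .
  then show "\<exists>r. strict_mono r \<and> (\<lambda>n. \<Sum>z\<in>#proots (monic_poly N (c (s (r n)))). g z) \<longlonglongrightarrow> (\<Sum>z\<in>#proots (monic_poly N c'). g z)"
    using r unfolding d_def by blast
qed

lemma sum_roots_continuous:
  fixes g :: "complex \<Rightarrow> 'b::real_normed_vector"
  assumes "continuous_on UNIV g"
  shows "continuous_on UNIV (\<lambda>c. \<Sum>z\<in>#proots (monic_poly N c). g z)"
  unfolding continuous_on_sequentially
proof (intro allI ballI impI)
  fix X :: "nat \<Rightarrow> nat \<Rightarrow> complex" and a assume X: "(\<forall>n. X n \<in> UNIV) \<and> X \<longlonglongrightarrow> a"
  have "(\<lambda>n. X n k) \<longlonglongrightarrow> a k" for k
  proof (rule continuous_on_tendsto_compose[where f = "\<lambda>x. x k" and g = X and s = UNIV])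
    show "continuous_on UNIV (\<lambda>x :: nat \<Rightarrow> complex. x k)" by (rule continuous_on_product_coordinates)
  qed (use X in simp_all)
  then show "((\<lambda>c. \<Sum>z\<in>#proots (monic_poly N c). g z) \<circ> X) \<longlonglongrightarrow> (\<Sum>z\<in>#proots (monic_poly N a). g z)"
    unfolding o_def by (rule sum_roots_tendsto[OF _ assms])
qed

text \<open>
  The normalised root-counting measure is a measurable kernel, since open sets are limits of
  continuous functions; integrals against a measurable kernel are measurable.
\<close>

theorem sum_roots_measurable:
  fixes f :: "complex \<Rightarrow> complex"
  assumes f: "f \<in> borel_measurable borel"
    and c: "\<And>k. (\<lambda>\<omega>. c \<omega> k) \<in> borel_measurable M"
  shows "(\<lambda>\<omega>. \<Sum>z\<in>#proots (monic_poly N (c \<omega>)). f z) \<in> borel_measurable M"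
proof (cases "N = 0")
  case True
  have "monic_poly 0 c = 1" for c by (simp add: monic_poly_def)
  then show ?thesis using True by simp
next
  case False
  define rt where "rt \<omega> = proots (monic_poly N (c \<omega>))" for \<omega>
  have size: "size (rt \<omega>) = N" for \<omega> by (simp add: rt_def size_proots_complex degree_monic_poly)
  have ne: "rt \<omega> \<noteq> {#}" for \<omega> using size[of \<omega>] False by auto
  \<comment> \<open>the law of a uniformly chosen root\<close>
  define K :: "_ \<Rightarrow> complex measure" where "K \<omega> = distr (measure_pmf (pmf_of_multiset (rt \<omega>))) borel (\<lambda>z. z)" for \<omega>
  have int: "(\<integral>z. h z \<partial>K \<omega>) = (\<Sum>z\<in>#rt \<omega>. h z) /\<^sub>R real N" if h: "h \<in> borel_measurable borel"
    for h :: "complex \<Rightarrow> 'b::{banach, second_countable_topology}" and \<omega>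
  proof -
    have "(\<integral>z. h z \<partial>K \<omega>) = (\<integral>z. h z \<partial>measure_pmf (pmf_of_multiset (rt \<omega>)))"
      unfolding K_def using h by (subst integral_distr) auto
    also have "\<dots> = (\<Sum>a\<in>set_mset (rt \<omega>). pmf (pmf_of_multiset (rt \<omega>)) a *\<^sub>R h a)"
      using ne by (intro integral_measure_pmf) (auto simp: set_pmf_of_multiset)
    also have "\<dots> = (\<Sum>a\<in>set_mset (rt \<omega>). real (count (rt \<omega>) a) *\<^sub>R h a) /\<^sub>R real N"
      using ne size by (simp add: pmf_of_multiset scaleR_sum_right divide_inverse mult.commute)
    also have "(\<Sum>a\<in>set_mset (rt \<omega>). real (count (rt \<omega>) a) *\<^sub>R h a) = (\<Sum>z\<in>#rt \<omega>. h z)"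
      by (rule sum_count_scaleR) auto
    finally show ?thesis .
  qed
  have prob: "prob_space (K \<omega>)" for \<omega>
    unfolding K_def by (intro prob_space.prob_space_distr measure_pmf.prob_space_axioms) auto
  have cm: "c \<in> borel_measurable M" using c by (rule measurable_coordinatewise_then_product)
  have cont: "(\<lambda>\<omega>. \<Sum>z\<in>#rt \<omega>. g z) \<in> borel_measurable M" if "continuous_on UNIV g" for g :: "complex \<Rightarrow> real"
    unfolding rt_def using cm borel_measurable_continuous_onI[OF sum_roots_continuous[OF that]]
    by (rule measurable_compose)
  have "K \<in> M \<rightarrow>\<^sub>M subprob_algebra borel"
  proof (rule measurable_subprob_algebra_generated[where \<Omega> = UNIV and G = "Collect open"])
    show "sets borel = sigma_sets UNIV (Collect (open :: complex set \<Rightarrow> bool))" by (rule borel_def[THEN arg_cong[of _ _ sets], simplified])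
    show "Int_stable (Collect (open :: complex set \<Rightarrow> bool))" by (auto simp: Int_stable_def)
    show "subprob_space (K \<omega>)" for \<omega> using prob by (rule prob_space_imp_subprob_space)
    show "sets (K \<omega>) = sets borel" for \<omega> by (simp add: K_def)
    have em: "(\<lambda>\<omega>. emeasure (K \<omega>) U) \<in> borel_measurable M" if U: "open U" for U
    proof -
      \<comment> \<open>continuous approximations of the indicator of \<open>U\<close>; \<open>g'\<close> treats \<open>U = UNIV\<close>, where \<open>infdist\<close> to the empty complement is 0\<close>
      define g where "g n z = min 1 (real n * infdist z (- U))" for n z
      have cg: "continuous_on UNIV (g n)" for n unfolding g_def by (intro continuous_intros)
      define g' where "g' n z = (if U = UNIV then 1 else g n z)" for n z
      have cg': "continuous_on UNIV (g' n)" for n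
        unfolding g'_def using cg[of n] by (cases "U = UNIV") simp_all
      have lim: "(\<lambda>n. g' n z) \<longlonglongrightarrow> indicat_real U z" for z
      proof (cases "z \<in> U")
        case False
        then have "g' n z = 0" for n by (auto simp: g'_def g_def infdist_zero)
        then show ?thesis using False by simp
      next
        case True
        have "\<forall>\<^sub>F n in sequentially. g' n z = 1"
        proof (cases "U = UNIV")
          case True then show ?thesis by (simp add: g'_def)
        next
          case ne: False
          have "infdist z (- U) > 0"
            using True ne U infdist_pos_not_in_closed[of "- U" z] by (auto simp: closed_def)
          then obtain n0 where "real n0 * infdist z (- U) > 1" using reals_Archimedean3 by blast
          then have "real n * infdist z (- U) > 1" if "n \<ge> n0" for n
            using that \<open>infdist z (- U) > 0\<close> mult_right_mono[of "real n0" "real n" "infdist z (- U)"] by linarith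
          then show ?thesis using ne unfolding eventually_sequentially
            by (intro exI[of _ n0]) (auto simp: g'_def g_def)
        qed
        then show ?thesis using True by (simp add: tendsto_eventually)
      qed
      have lims: "(\<lambda>n. (\<Sum>z\<in>#A. g' n z)) \<longlonglongrightarrow> (\<Sum>z\<in>#A. indicat_real U z)" for A
        by (induction A) (auto intro!: tendsto_add lim)
      have ms: "(\<lambda>\<omega>. \<Sum>z\<in>#rt \<omega>. indicat_real U z) \<in> borel_measurable M"
        by (rule borel_measurable_LIMSEQ_real[OF lims cont[OF cg']])
      have me: "measure (K \<omega>) U = inverse (real N) * (\<Sum>z\<in>#rt \<omega>. indicat_real U z)" for \<omega>
      proof -
        have "measure (K \<omega>) U = (\<integral>z. indicat_real U z \<partial>K \<omega>)"
          using U by (simp add: K_def)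
        also have "\<dots> = (\<Sum>z\<in>#rt \<omega>. indicat_real U z) /\<^sub>R real N"
          using U by (intro int) (auto intro: borel_open)
        finally show ?thesis unfolding real_scaleR_def .
      qed
      have "(\<lambda>\<omega>. measure (K \<omega>) U) \<in> borel_measurable M"
        unfolding me by (intro borel_measurable_times borel_measurable_const ms)
      moreover have "emeasure (K \<omega>) U = ennreal (measure (K \<omega>) U)" for \<omega>
        using prob[of \<omega>] by (simp add: finite_measure.emeasure_eq_measure prob_space_def)
      ultimately show ?thesis by simp
    qed
    show "(\<lambda>\<omega>. emeasure (K \<omega>) U) \<in> borel_measurable M" if "U \<in> Collect open" for U using em that by simp
    show "(\<lambda>\<omega>. emeasure (K \<omega>) UNIV) \<in> borel_measurable M" by (rule em) simp
  qed simp
  then have "(\<lambda>\<omega>. \<integral>z. f z \<partial>K \<omega>) \<in> borel_measurable M"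
    using integral_measurable_subprob_algebra[OF f] by (rule measurable_compose)
  then have "(\<lambda>\<omega>. real N *\<^sub>R (\<integral>z. f z \<partial>K \<omega>)) \<in> borel_measurable M" by simp
  then show ?thesis using False unfolding int[OF f] rt_def by simp
qed

section \<open>The contour integral as a power series\<close>

text \<open>
  Cauchy's formula for derivatives along a loop with arbitrary winding number. Splitting off the value
  at the pole lowers the order of the pole and shifts the Taylor series.
\<close>

lemma has_contour_integral_taylor_coeff:
  assumes U: "open U" and p: "p \<in> U" and \<gamma>: "valid_path \<gamma>" "path_image \<gamma> \<subseteq> U - {p}" "pathfinish \<gamma> = pathstart \<gamma>"
    and wn: "\<And>w. w \<notin> U \<Longrightarrow> winding_number \<gamma> w = 0"
  shows "f holomorphic_on U \<Longrightarrow> (\<lambda>x. f (p + x)) has_fps_expansion F \<Longrightarrow>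
    ((\<lambda>z. f z / (z - p) ^ Suc k) has_contour_integral 2 * pi * \<i> * winding_number \<gamma> p * fps_nth F k) \<gamma>"
proof (induction k arbitrary: f F)
  case 0
  have "fps_nth F 0 = f p" using fps_nth_fps_expansion[OF 0(2), of 0] by simp
  then show ?case
    using Cauchy_integral_formula_global[OF U 0(1) p \<gamma> wn] by simp
next
  case (Suc k)
  define h where "h z = (if z = p then deriv f p else (f z - f p) / (z - p))" for z
  have F0: "fps_nth F 0 = f p" using fps_nth_fps_expansion[OF Suc.prems(2), of 0] by simp
  have F1: "fps_nth F 1 = deriv f p"
  proof -
    have "fps_nth F 1 = deriv (\<lambda>x. f (p + x)) 0" using fps_nth_fps_expansion[OF Suc.prems(2), of 1] by simp
    also have "\<dots> = deriv f p" by (simp only: deriv_shift_0[of f p] o_def)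
    finally show ?thesis .
  qed
  have hol: "h holomorphic_on U"
    unfolding h_def using Suc.prems(1) p U by (intro pole_lemma) (simp_all add: interior_open)
  define G where "G = F - fps_const (f p)"
  have G: "(\<lambda>x. f (p + x) - f p) has_fps_expansion G"
    unfolding G_def by (intro fps_expansion_intros Suc.prems)
  have G1: "deriv f p = fps_nth G 1" by (simp add: G_def F1 del: One_nat_def)
  have hG: "(\<lambda>x. h (p + x)) has_fps_expansion fps_shift 1 G"
  proof (cases "G = 0")
    case False
    have "fps_nth G 0 = 0" by (simp add: G_def F0)
    then have "1 \<le> subdegree G" using False by (metis One_nat_def Suc_leI gr0I nth_subdegree_nonzero)
    then have "(\<lambda>x. if x = 0 then deriv f p else (f (p + x) - f p) / x ^ 1) has_fps_expansion fps_shift 1 G"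
      by (rule has_fps_expansion_shift[OF G _ G1])
    also have "(\<lambda>x. if x = 0 then deriv f p else (f (p + x) - f p) / x ^ 1) = (\<lambda>x. h (p + x))"
      by (auto simp: h_def)
    finally show ?thesis .
  next
    case True
    then have "\<forall>\<^sub>F x in nhds 0. f (p + x) - f p = 0"
      using G by (auto simp: has_fps_expansion_def elim: eventually_mono)
    moreover have "deriv f p = 0" using True G1 by simp
    ultimately have "\<forall>\<^sub>F x in nhds 0. h (p + x) = 0"
      by (auto simp: h_def elim: eventually_mono)
    then have "(\<lambda>x. h (p + x)) has_fps_expansion 0"
      by (subst has_fps_expansion_cong[where g = "\<lambda>_. 0" and G = 0]) (auto intro: fps_expansion_intros)
    then show ?thesis using True by simp
  qed
  have "((\<lambda>z. h z / (z - p) ^ Suc k) has_contour_integral 2 * pi * \<i> * winding_number \<gamma> p * fps_nth (fps_shift 1 G) k) \<gamma>"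
    by (rule Suc.IH[OF hol hG])
  moreover have "((\<lambda>z. f p * (1 / (z - p) ^ Suc (Suc k))) has_contour_integral f p * 0) \<gamma>"
  proof (rule has_contour_integral_lmul, rule Cauchy_theorem_primitive[where S = "- {p}"])
    fix x :: complex assume x: "x \<in> - {p}"
    define d where "d = x - p"
    have d: "d \<noteq> 0" using x by (simp add: d_def)
    have "((\<lambda>z. z - p) has_field_derivative 1) (at x within - {p})"
      by (auto intro!: derivative_eq_intros)
    from DERIV_power_Suc[OF this, of k]
    have "((\<lambda>z. (z - p) ^ Suc k) has_field_derivative of_nat (Suc k) * d ^ k) (at x within - {p})"
      by (simp add: d_def)
    note deriv = DERIV_cmult[OF DERIV_inverse'[OF this], of "- (1 / of_nat (Suc k))"]
    show "((\<lambda>z. - (1 / of_nat (Suc k)) * inverse ((z - p) ^ Suc k)) has_field_derivative 1 / (x - p) ^ Suc (Suc k)) (at x within - {p})"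
    proof (rule DERIV_cong[OF deriv])
      have "- (1 / m) * - (inverse (d * e) * (m * e) * inverse (d * e)) = 1 / (d * (d * e))"
        if "m \<noteq> 0" "e \<noteq> 0" for m e :: complex
        using that d by (simp add: field_simps)
      from this[of "of_nat (Suc k)" "d ^ k"] d
      show "- (1 / of_nat (Suc k)) * - (inverse ((x - p) ^ Suc k) * (of_nat (Suc k) * d ^ k) * inverse ((x - p) ^ Suc k)) = 1 / (x - p) ^ Suc (Suc k)"
        unfolding d_def[symmetric] power_Suc by (simp del: of_nat_Suc)
    qed (use d in \<open>simp add: d_def\<close>)
  qed (use \<gamma> in auto)
  ultimately have "((\<lambda>z. h z / (z - p) ^ Suc k + f p * (1 / (z - p) ^ Suc (Suc k))) has_contour_integral
      2 * pi * \<i> * winding_number \<gamma> p * fps_nth (fps_shift 1 G) k + f p * 0) \<gamma>"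
    by (rule has_contour_integral_add)
  then have "((\<lambda>z. f z / (z - p) ^ Suc (Suc k)) has_contour_integral
      2 * pi * \<i> * winding_number \<gamma> p * fps_nth (fps_shift 1 G) k + f p * 0) \<gamma>"
  proof (rule has_contour_integral_eq)
    fix z assume "z \<in> path_image \<gamma>"
    then have "z \<noteq> p" using \<gamma> by auto
    then show "h z / (z - p) ^ Suc k + f p * (1 / (z - p) ^ Suc (Suc k)) = f z / (z - p) ^ Suc (Suc k)"
      by (simp add: h_def diff_divide_distrib)
  qed
  then show ?case by (simp add: G_def)
qed

lemma polynomial_path_derivative_bounded:
  fixes p :: "real \<Rightarrow> complex"
  assumes "polynomial_function p"
  shows "\<exists>B. \<forall>t\<in>{0..1}. norm (vector_derivative p (at t)) \<le> B"
proof -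
  obtain p' where p': "polynomial_function p'" "\<And>x. (p has_vector_derivative p' x) (at x)"
    using has_vector_derivative_polynomial_function[OF assms] by blast
  have "compact (p' ` {0..1})"
    using p'(1) by (intro compact_continuous_image continuous_on_polymonial_function) auto
  then obtain B where "\<And>t. t \<in> {0..1} \<Longrightarrow> norm (p' t) \<le> B"
    by (meson bounded_iff compact_imp_bounded imageI)
  then show ?thesis using vector_derivative_at[OF p'(2)] by (intro exI[of _ B]) auto
qed

text \<open>
  The inner integral picks the derivative of \<open>f\<close> at the point \<open>1 / w\<close>, which lies in the unit disk.
  Expanding this derivative at 0 turns the outer integral into Cauchy integrals for the Taylor
  coefficients of \<open>g\<close>. The winding number \<open>n\<close> occurs twice, and \<open>n * n = 1\<close> for either orientation.
\<close>

theorem double_contour_integral_sums: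
  fixes f g :: "complex \<Rightarrow> complex"
  assumes r: "r > 1" and fr: "f holomorphic_on ball 0 r"
    and f: "f analytic_on (path_image \<gamma> \<union> inside (path_image \<gamma>))"
    and g: "g analytic_on (path_image \<gamma> \<union> inside (path_image \<gamma>))"
    and \<gamma>: "valid_path \<gamma>" "simple_path \<gamma>" "pathfinish \<gamma> = pathstart \<gamma>"
    and disk: "cball 0 1 \<subseteq> inside (path_image \<gamma>)"
  defines "a \<equiv> \<lambda>k. (deriv ^^ k) f 0 / fact k" and "b \<equiv> \<lambda>k. (deriv ^^ k) g 0 / fact k"
  shows "(\<lambda>k. of_nat k * (a k * b k)) sums
    (- (1 / (4 * of_real pi ^ 2)) * contour_integral \<gamma> (\<lambda>w. contour_integral \<gamma> (\<lambda>z. f z * g w * (1 - z * w) powi (-2))))"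
proof -
  define A where "A = path_image \<gamma> \<union> inside (path_image \<gamma>)"
  obtain Uf where Uf: "open Uf" "A \<subseteq> Uf" "f holomorphic_on Uf" using f unfolding analytic_on_holomorphic A_def by blast
  obtain Ug where Ug: "open Ug" "A \<subseteq> Ug" "g holomorphic_on Ug" using g unfolding analytic_on_holomorphic A_def by blast
  define n where "n = winding_number \<gamma> 0"
  have path: "path \<gamma>" using \<gamma>(2) by (rule simple_path_imp_path)
  have out: "winding_number \<gamma> w = 0" if "w \<notin> A" for w
  proof (rule winding_number_zero_in_outside[OF path \<gamma>(3)])
    show "w \<in> outside (path_image \<gamma>)" using that unfolding A_def outside_inside by blast
  qed
  have in1: "z \<in> inside (path_image \<gamma>)" if "norm z \<le> 1" for z using disk that by auto
  have big: "norm z > 1" if "z \<in> path_image \<gamma>" for z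
  proof (rule ccontr)
    assume "\<not> norm z > 1"
    then have "z \<in> inside (path_image \<gamma>)" using in1 by simp
    then show False using that inside_no_overlap by blast
  qed
  have nz: "winding_number \<gamma> z = n" if "norm z \<le> 1" for z
    unfolding n_def
  proof (rule winding_number_eq[OF path \<gamma>(3)])
    show "cball 0 1 \<inter> path_image \<gamma> = {}" using big by force
  qed (use that in \<open>auto intro: convex_connected\<close>)
  have n2: "n * n = 1"
    using simple_closed_path_winding_number_inside[OF \<gamma>(2)] in1[of 0] unfolding n_def by (metis mult_minus_left mult_minus_right minus_minus mult_1 norm_zero zero_le_one)
  have Uf0: "0 \<in> Uf" and Ug0: "0 \<in> Ug" using Uf Ug in1[of 0] by (auto simp: A_def)
  \<comment> \<open>inner integral: a double pole at \<open>1 / w\<close>\<close>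
  have inner: "contour_integral \<gamma> (\<lambda>z. f z * g w * (1 - z * w) powi (-2)) = 2 * pi * \<i> * n * (g w * (deriv f (1 / w) / w\<^sup>2))"
    if w: "norm w > 1" for w
  proof -
    have w0: "w \<noteq> 0" using w by auto
    have p1: "norm (1 / w) \<le> 1" using w by (simp add: norm_divide divide_le_eq)
    then have pU: "1 / w \<in> Uf" using in1 Uf(2) by (auto simp: A_def)
    have pi: "path_image \<gamma> \<subseteq> Uf - {1 / w}" using Uf(2) big p1 by (force simp: A_def)
    have hol0: "(\<lambda>x. f (1 / w + x)) has_fps_expansion fps_expansion (\<lambda>x. f (1 / w + x)) 0"
    proof (rule has_fps_expansion_fps_expansion)
      show "open ((\<lambda>x. x - 1 / w) ` Uf)" using Uf(1) by (rule open_translation_subtract)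
      show "0 \<in> (\<lambda>x. x - 1 / w) ` Uf" using pU by force
      show "(\<lambda>x. f (1 / w + x)) holomorphic_on (\<lambda>x. x - 1 / w) ` Uf"
        using Uf(3) by (auto intro!: holomorphic_on_compose_gen[unfolded o_def, of "\<lambda>x. 1 / w + x" _ f Uf] holomorphic_intros)
    qed
    have c: "fps_nth (fps_expansion (\<lambda>x. f (1 / w + x)) 0) 1 = deriv f (1 / w)"
    proof -
      have "fps_nth (fps_expansion (\<lambda>x. f (1 / w + x)) 0) 1 = deriv (\<lambda>x. f (1 / w + x)) 0"
        using fps_nth_fps_expansion[OF hol0, of 1] by simp
      also have "\<dots> = deriv f (1 / w)" by (simp only: deriv_shift_0[of f "1 / w"] o_def)
      finally show ?thesis .
    qed
    have "((\<lambda>z. f z / (z - 1 / w) ^ Suc 1) has_contour_integral 2 * pi * \<i> * winding_number \<gamma> (1 / w) * fps_nth (fps_expansion (\<lambda>x. f (1 / w + x)) 0) 1) \<gamma>"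
      using out Uf(2) by (intro has_contour_integral_taylor_coeff[OF Uf(1) pU \<gamma>(1) pi \<gamma>(3) _ Uf(3) hol0]) auto
    then have "((\<lambda>z. (g w / w\<^sup>2) * (f z / (z - 1 / w) ^ Suc 1)) has_contour_integral (g w / w\<^sup>2) * (2 * pi * \<i> * n * deriv f (1 / w))) \<gamma>"
      unfolding c nz[OF p1] by (rule has_contour_integral_lmul)
    then have "((\<lambda>z. f z * g w * (1 - z * w) powi (-2)) has_contour_integral (g w / w\<^sup>2) * (2 * pi * \<i> * n * deriv f (1 / w))) \<gamma>"
    proof (rule has_contour_integral_eq)
      fix z
      have "1 - z * w = - w * (z - 1 / w)" using w0 by (simp add: field_simps)
      then have "(1 - z * w)\<^sup>2 = w\<^sup>2 * (z - 1 / w)\<^sup>2" by (simp add: power_mult_distrib)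
      then show "g w / w\<^sup>2 * (f z / (z - 1 / w) ^ Suc 1) = f z * g w * (1 - z * w) powi (-2)"
        by (simp add: power_int_minus power2_eq_square divide_inverse)
    qed
    then show ?thesis by (simp add: contour_integral_unique)
  qed
  \<comment> \<open>outer integral: the interchange with the series needs a loop with bounded derivative, which a nearby polynomial loop has\<close>
  define s where "s = 1 / r"
  have s: "0 < s" "s < 1" using r by (auto simp: s_def)
  define D where "D = Ug - cball 0 s"
  have D: "open D" unfolding D_def using Ug(1) by (intro open_Diff) auto
  have \<gamma>D: "path_image \<gamma> \<subseteq> D"
  proof
    fix w assume w: "w \<in> path_image \<gamma>"
    then have "w \<in> Ug" using Ug(2) by (auto simp: A_def)
    moreover have "norm w > s" using big[OF w] s by linarith
    ultimately show "w \<in> D" by (simp add: D_def)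
  qed
  obtain d where d: "d > 0" and near: "\<forall>g h. valid_path g \<and> valid_path h \<and> (\<forall>t\<in>{0..1}. norm (g t - \<gamma> t) < d \<and> norm (h t - \<gamma> t) < d)
      \<and> pathfinish g = pathstart g \<and> pathfinish h = pathstart h \<longrightarrow>
      path_image g \<subseteq> D \<and> path_image h \<subseteq> D \<and> (\<forall>f. f holomorphic_on D \<longrightarrow> contour_integral h f = contour_integral g f)"
    using contour_integral_nearby_loops[OF D path \<gamma>D] by blast
  obtain q where q: "polynomial_function q" "pathstart q = pathstart \<gamma>" "pathfinish q = pathfinish \<gamma>"
      "\<And>t. t \<in> {0..1} \<Longrightarrow> norm (q t - \<gamma> t) < d"
    using path_approx_polynomial_function[OF path d] by blast
  have vq: "valid_path q" using q(1) by (rule valid_path_polynomial_function)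
  have qD: "path_image q \<subseteq> D" and q\<gamma>: "\<And>h. h holomorphic_on D \<Longrightarrow> contour_integral \<gamma> h = contour_integral q h"
    using near[rule_format, of q \<gamma>] vq \<gamma>(1,3) q d by simp_all
  obtain B where B: "\<And>t. t \<in> {0..1} \<Longrightarrow> norm (vector_derivative q (at t)) \<le> B"
    using polynomial_path_derivative_bounded[OF q(1)] by blast
  have D0: "w \<noteq> 0" if "w \<in> D" for w using that s by (auto simp: D_def)
  define \<Phi> where "\<Phi> w = g w * (deriv f (1 / w) / w\<^sup>2)" for w
  have inv: "1 / w \<in> ball 0 r" if "w \<in> D" for w
  proof -
    have "norm w > s" using that by (simp add: D_def)
    then show ?thesis using s r D0[OF that] by (simp add: s_def norm_divide field_simps)
  qed
  have gD: "g holomorphic_on D" using Ug(3) by (rule holomorphic_on_subset) (auto simp: D_def)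
  have \<Phi>: "\<Phi> holomorphic_on D"
  proof -
    have "deriv f holomorphic_on ball 0 r" using fr by (intro holomorphic_deriv) auto
    then have "(\<lambda>w. deriv f (1 / w)) holomorphic_on D"
      using inv D0 by (intro holomorphic_on_compose_gen[unfolded o_def, of "\<lambda>w. 1 / w" D "deriv f" "ball 0 r"])
        (auto intro!: holomorphic_intros)
    then show ?thesis unfolding \<Phi>_def using gD D0 by (intro holomorphic_intros) auto
  qed
  define F where "F m w = (\<Sum>k<m. of_nat k * a k * (g w / w ^ Suc k))" for m w
  have gk: "(\<lambda>w. g w / w ^ Suc k) holomorphic_on D" for k
    using gD D0 by (intro holomorphic_intros) auto
  have gint: "contour_integral q (\<lambda>w. g w / w ^ Suc k) = 2 * pi * \<i> * n * b k" for k
  proof -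
    have e: "g has_fps_expansion fps_expansion g 0"
      by (rule has_fps_expansion_fps_expansion[OF Ug(1) Ug0 Ug(3)])
    have "((\<lambda>z. g z / (z - 0) ^ Suc k) has_contour_integral 2 * pi * \<i> * winding_number \<gamma> 0 * fps_nth (fps_expansion g 0) k) \<gamma>"
      using out Ug(2) big e by (intro has_contour_integral_taylor_coeff[OF Ug(1) Ug0 \<gamma>(1) _ \<gamma>(3) _ Ug(3)]) (force simp: A_def)+
    then have "contour_integral \<gamma> (\<lambda>w. g w / w ^ Suc k) = 2 * pi * \<i> * n * fps_nth (fps_expansion g 0) k"
      by (simp add: contour_integral_unique n_def)
    then show ?thesis using q\<gamma>[OF gk] fps_nth_fps_expansion[OF e, of k] by (simp add: b_def)
  qed
  have kint: "(\<lambda>w. g w / w ^ Suc k) contour_integrable_on q" for k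
    using contour_integrable_holomorphic_simple[OF gk D vq qD] .
  have Fint: "contour_integral q (F m) = 2 * pi * \<i> * n * (\<Sum>k<m. of_nat k * (a k * b k))" for m
  proof -
    have "contour_integral q (F m) = (\<Sum>k<m. of_nat k * a k * contour_integral q (\<lambda>w. g w / w ^ Suc k))"
    proof -
      have "contour_integral q (F m) = (\<Sum>k<m. contour_integral q (\<lambda>w. of_nat k * a k * (g w / w ^ Suc k)))"
        unfolding F_def by (rule contour_integral_sum) (simp_all only: finite_lessThan contour_integrable_lmul[OF kint])
      then show ?thesis by (simp only: contour_integral_lmul[OF kint])
    qed
    then show ?thesis unfolding gint sum_distrib_left by (simp only: mult_ac)
  qed
  have unif: "uniform_limit (path_image q) F \<Phi> sequentially"
  proof -
    have comp: "compact (path_image q)" and ne: "path_image q \<noteq> {}"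
      using vq by (simp_all add: compact_valid_path_image path_image_nonempty)
    have "continuous_on (path_image q) (\<lambda>w. norm (1 / w))"
      using qD D0 by (intro continuous_intros) auto
    then obtain w0 where w0: "w0 \<in> path_image q" "\<And>w. w \<in> path_image q \<Longrightarrow> norm (1 / w) \<le> norm (1 / w0)"
      using continuous_attains_sup[OF comp ne] by blast
    define t where "t = norm (1 / w0)"
    have t: "t < r" "0 \<le> t" using inv[of w0] w0 qD by (auto simp: t_def)
    have "continuous_on (path_image q) (\<lambda>w. g w / w\<^sup>2)"
      using qD D0 holomorphic_on_imp_continuous_on[OF gD]
      by (intro continuous_intros) (auto intro: continuous_on_subset)
    then have "bounded ((\<lambda>w. g w / w\<^sup>2) ` path_image q)"
      using comp by (intro compact_imp_bounded compact_continuous_image)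
    then obtain C where C: "\<And>w. w \<in> path_image q \<Longrightarrow> norm (g w / w\<^sup>2) \<le> C" "C > 0"
      by (auto simp: bounded_pos)
    define c where "c k = of_nat (Suc k) * a (Suc k)" for k
    have c_sums: "(\<lambda>k. c k * x ^ k) sums deriv f x" if "x \<in> ball 0 r" for x
    proof -
      have "deriv f holomorphic_on ball 0 r" using fr by (intro holomorphic_deriv) auto
      from holomorphic_power_series[OF this that]
      have "(\<lambda>k. (deriv ^^ k) (deriv f) 0 / fact k * x ^ k) sums deriv f x" by simp
      moreover have "(deriv ^^ k) (deriv f) 0 / fact k = c k" for k
        by (simp add: c_def a_def funpow_swap1 field_simps del: of_nat_Suc)
      ultimately show ?thesis by simp
    qed
    define u where "u k w = of_nat k * a k * (g w / w ^ Suc k)" for k w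
    have u: "u 0 w = 0" "u (Suc k) w = (g w / w\<^sup>2) * (c k * (1 / w) ^ k)" for k w
      by (simp_all add: u_def c_def power2_eq_square power_divide mult_ac del: of_nat_Suc)
    have u_sums: "(\<lambda>k. u k w) sums \<Phi> w" if "w \<in> path_image q" for w
    proof -
      have "1 / w \<in> ball 0 r" using inv qD that by blast
      then have "(\<lambda>k. (g w / w\<^sup>2) * (c k * (1 / w) ^ k)) sums ((g w / w\<^sup>2) * deriv f (1 / w))"
        by (intro sums_mult c_sums)
      then have "(\<lambda>k. u (Suc k) w) sums \<Phi> w" by (simp add: u \<Phi>_def)
      then have "(\<lambda>k. u k w) sums (\<Phi> w + u 0 w)" by (rule sums_Suc)
      then show ?thesis by (simp add: u)
    qed
    have sm: "summable (\<lambda>k. norm (c k * of_real t ^ k))"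
    proof (rule powser_insidea)
      show "summable (\<lambda>k. c k * of_real ((t + r) / 2) ^ k)"
        using t by (intro sums_summable[OF c_sums]) (simp del: of_real_add of_real_divide)
      show "norm (complex_of_real t) < norm (complex_of_real ((t + r) / 2))"
        using t by (simp del: of_real_add of_real_divide)
    qed
    define Mb where "Mb k = (case k of 0 \<Rightarrow> 0 | Suc n \<Rightarrow> C * norm (c n * of_real t ^ n))" for k
    have "summable (\<lambda>k. Mb (Suc k))" using sm by (simp add: Mb_def summable_mult)
    then have "summable Mb" by (simp add: summable_Suc_iff)
    moreover have "norm (u k w) \<le> Mb k" if w: "w \<in> path_image q" for k w
    proof (cases k)
      case (Suc n)
      have "norm (u k w) = norm (g w / w\<^sup>2) * (norm (c n) * norm (1 / w) ^ n)"
        unfolding Suc u norm_mult norm_power ..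
      also have "\<dots> \<le> C * (norm (c n) * t ^ n)"
        using C w0(2)[OF w] C(1)[OF w] by (intro mult_mono mult_left_mono power_mono) (auto simp: t_def)
      also have "\<dots> = Mb k" using t by (simp add: Suc Mb_def norm_mult norm_power)
      finally show ?thesis .
    qed (simp add: u Mb_def)
    ultimately have "uniform_limit (path_image q) (\<lambda>m w. \<Sum>k<m. u k w) (\<lambda>w. suminf (\<lambda>k. u k w)) sequentially"
      by (intro Weierstrass_m_test)
    moreover have "suminf (\<lambda>k. u k w) = \<Phi> w" if "w \<in> path_image q" for w
      using sums_unique[OF u_sums[OF that]] by simp
    moreover have "F = (\<lambda>m w. \<Sum>k<m. u k w)" by (intro ext) (simp only: F_def u_def)
    ultimately show ?thesis by (simp cong: uniform_limit_cong')
  qed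
  have "(\<lambda>m. contour_integral q (F m)) \<longlonglongrightarrow> contour_integral q \<Phi>"
  proof (rule contour_integral_uniform_limit(2)[OF _ unif B vq])
    show "\<forall>\<^sub>F m in sequentially. F m contour_integrable_on q"
      unfolding F_def by (intro always_eventually allI contour_integrable_sum contour_integrable_lmul kint) auto
  qed auto
  then have "(\<lambda>m. 2 * pi * \<i> * n * (\<Sum>k<m. of_nat k * (a k * b k))) \<longlonglongrightarrow> contour_integral \<gamma> \<Phi>"
    unfolding Fint q\<gamma>[OF \<Phi>] .
  then have "(\<lambda>m. (2 * pi * \<i> * n) * (2 * pi * \<i> * n * (\<Sum>k<m. of_nat k * (a k * b k)))) \<longlonglongrightarrow> (2 * pi * \<i> * n) * contour_integral \<gamma> \<Phi>"
    by (rule tendsto_mult_left)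
  moreover have "(2 * pi * \<i> * n) * contour_integral \<gamma> \<Phi> = contour_integral \<gamma> (\<lambda>w. contour_integral \<gamma> (\<lambda>z. f z * g w * (1 - z * w) powi (-2)))"
  proof -
    have "\<Phi> contour_integrable_on \<gamma>" by (rule contour_integrable_holomorphic_simple[OF \<Phi> D \<gamma>(1) \<gamma>D])
    then have "(2 * pi * \<i> * n) * contour_integral \<gamma> \<Phi> = contour_integral \<gamma> (\<lambda>w. (2 * pi * \<i> * n) * \<Phi> w)"
      by (simp add: contour_integral_lmul)
    also have "\<dots> = contour_integral \<gamma> (\<lambda>w. contour_integral \<gamma> (\<lambda>z. f z * g w * (1 - z * w) powi (-2)))"
      using inner big by (intro contour_integral_eq) (simp add: \<Phi>_def)
    finally show ?thesis .
  qed
  ultimately have lim: "(\<lambda>m. (2 * pi * \<i> * n) * (2 * pi * \<i> * n * (\<Sum>k<m. of_nat k * (a k * b k)))) \<longlonglongrightarrow> contour_integral \<gamma> (\<lambda>w. contour_integral \<gamma> (\<lambda>z. f z * g w * (1 - z * w) powi (-2)))"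
    by (simp only:)
  have "- (1 / (4 * complex_of_real pi ^ 2)) * ((2 * pi * \<i> * n) * (2 * pi * \<i> * n * x)) = x" for x
  proof -
    define c where "c = complex_of_real pi"
    have c: "c \<noteq> 0" "complex_of_real (2 * pi) = 2 * c" by (simp_all add: c_def)
    have "(2 * c * j * m) * (2 * c * j * m * x) = (j * j) * (4 * c ^ 2 * x * (m * m))" for j m :: complex
      by (simp add: power2_eq_square mult_ac)
    then have "(2 * c * \<i> * n) * (2 * c * \<i> * n * x) = (\<i> * \<i>) * (4 * c ^ 2 * x * (n * n))" .
    also have "\<dots> = - (4 * c ^ 2 * x)" by (simp only: i_squared n2 mult_1_right) simp
    finally have "(2 * c * \<i> * n) * (2 * c * \<i> * n * x) = - (4 * c ^ 2 * x)" .
    moreover have "- (1 / (4 * c ^ 2)) * - (4 * c ^ 2 * x) = x" using c(1) by simp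
    ultimately show ?thesis unfolding c(2) c_def[symmetric] by (simp only:)
  qed
  then show ?thesis
    using tendsto_mult_left[OF lim, of "- (1 / (4 * complex_of_real pi ^ 2))"] unfolding sums_def by (simp only:)
qed

section \<open>Gaussian laws with prescribed covariance\<close>

lemma borel_measurable_cis [measurable (raw)]:
  "f \<in> borel_measurable M \<Longrightarrow> (\<lambda>x. cis (f x)) \<in> borel_measurable M"
  by (rule borel_measurable_continuous_on) (auto intro!: continuous_intros)

abbreviation std_normals :: "(nat \<Rightarrow> real) measure" where
  "std_normals \<equiv> \<Pi>\<^sub>M i\<in>UNIV. std_normal_distribution"

lemma prob_space_std_normals: "prob_space std_normals"
  by (intro prob_space_PiM) (use real_dist_normal_dist in \<open>auto simp: real_distribution_def\<close>)

lemma distr_std_normals: "distr std_normals borel (\<lambda>x. x i) = std_normal_distribution"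
proof -
  have "distr std_normals std_normal_distribution (\<lambda>x. x i) = std_normal_distribution"
    by (rule distr_PiM_component) (use real_dist_normal_dist in \<open>auto simp: real_distribution_def\<close>)
  moreover have "distr std_normals std_normal_distribution (\<lambda>x. x i) = distr std_normals borel (\<lambda>x. x i)"
    by (rule distr_cong) auto
  ultimately show ?thesis by simp
qed

lemma std_normals_component [measurable]: "(\<lambda>x. x i) \<in> borel_measurable std_normals"
proof -
  have "(\<lambda>x. x i) \<in> measurable std_normals (std_normal_distribution)"
    by (rule measurable_component_singleton) auto
  thus ?thesis by (simp cong: measurable_cong_sets)
qed

lemma indep_std_normals: "prob_space.indep_vars std_normals (\<lambda>_. borel) (\<lambda>i x. x i) UNIV"
proof -
  interpret prob_space std_normals by (rule prob_space_std_normals)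
  have "distr std_normals (\<Pi>\<^sub>M i\<in>UNIV. borel) (\<lambda>x. \<lambda>i\<in>UNIV. x i) = distr std_normals std_normals (\<lambda>x. x)"
    by (intro distr_cong refl) (auto intro!: sets_PiM_cong)
  also have "\<dots> = std_normals" by (rule distr_id)
  also have "\<dots> = (\<Pi>\<^sub>M i\<in>UNIV. distr std_normals borel (\<lambda>x. x i))"
    by (simp add: distr_std_normals)
  finally show ?thesis
    by (subst indep_vars_iff_distr_eq_PiM') auto
qed

text \<open>
  The expectation of the sum of the norms is finite.
\<close>

lemma AE_summable_std_normals:
  fixes c :: "nat \<Rightarrow> 'a::euclidean_space"
  assumes c: "summable (\<lambda>m. norm (c m))"
  shows "AE x in std_normals. summable (\<lambda>m. norm (x m *\<^sub>R c m))"
proof -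
  interpret prob_space std_normals by (rule prob_space_std_normals)
  define K where "K = (\<integral>x. \<bar>x\<bar> \<partial>std_normal_distribution)"
  have K: "(\<integral>\<^sup>+x. ennreal \<bar>x i\<bar> \<partial>std_normals) = ennreal K" for i
  proof -
    have "(\<integral>\<^sup>+x. ennreal \<bar>x i\<bar> \<partial>std_normals) = (\<integral>\<^sup>+x. ennreal \<bar>x\<bar> \<partial>distr std_normals borel (\<lambda>x. x i))"
      by (subst nn_integral_distr) auto
    also have "\<dots> = ennreal K"
      unfolding distr_std_normals K_def
      using integrable_std_normal_distribution_moment[of 1] by (intro nn_integral_eq_integral) auto
    finally show ?thesis .
  qed
  have "(\<integral>\<^sup>+x. (\<Sum>m. ennreal (norm (x m *\<^sub>R c m))) \<partial>std_normals) = (\<Sum>m. \<integral>\<^sup>+x. ennreal (norm (x m *\<^sub>R c m)) \<partial>std_normals)"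
    by (rule nn_integral_suminf) measurable
  also have "\<dots> = (\<Sum>m. ennreal (K * norm (c m)))"
    by (intro suminf_cong) (simp add: ennreal_mult' nn_integral_multc K mult.commute K_def)
  also have "\<dots> = ennreal (\<Sum>m. K * norm (c m))"
    by (intro suminf_ennreal2 summable_mult c) (auto simp: K_def)
  finally have "(\<integral>\<^sup>+x. (\<Sum>m. ennreal (norm (x m *\<^sub>R c m))) \<partial>std_normals) \<noteq> \<infinity>" by simp
  then have "AE x in std_normals. (\<Sum>m. ennreal (norm (x m *\<^sub>R c m))) \<noteq> \<infinity>"
    by (intro nn_integral_PInf_AE) measurable
  thus ?thesis by eventually_elim (auto intro!: summable_suminf_not_top)
qed

lemma char_scaled_std_normal:
  "(\<integral>x. cis (u * x) \<partial>std_normal_distribution) = of_real (exp (- (u\<^sup>2 / 2)))"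
  using fun_cong[OF char_std_normal_distribution, of u] by (simp add: char_def cis_conv_exp)

lemma normal_law_if_char:
  assumes M: "prob_space M" "sets M = sets borel"
    and ch: "\<And>u. (\<integral>x. cis (u * x) \<partial>M) = of_real (exp (- (u\<^sup>2 * s / 2)))" and s: "s \<ge> 0"
  shows "M = distr std_normal_distribution borel (\<lambda>x. sqrt s * x)"
proof (rule Levy_uniqueness)
  interpret S: real_distribution std_normal_distribution by (rule real_dist_normal_dist)
  interpret prob_space M by fact
  show "real_distribution M"
    using M sets_eq_imp_space_eq[OF M(2)] by (auto simp: real_distribution_def real_distribution_axioms_def)
  show "real_distribution (distr std_normal_distribution borel (\<lambda>x. sqrt s * x))"
    by (auto simp: real_distribution_def real_distribution_axioms_def intro!: S.prob_space_distr)
  show "char M = char (distr std_normal_distribution borel (\<lambda>x. sqrt s * x))"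
  proof
    fix u
    have "char M u = of_real (exp (- (u\<^sup>2 * s / 2)))" using ch[of u] by (simp add: char_def cis_conv_exp)
    also have "\<dots> = (\<integral>x. cis ((u * sqrt s) * x) \<partial>std_normal_distribution)"
      using s by (simp add: char_scaled_std_normal power_mult_distrib)
    also have "\<dots> = char (distr std_normal_distribution borel (\<lambda>x. sqrt s * x)) u"
      unfolding char_def by (subst integral_distr) (auto simp: cis_conv_exp mult_ac)
    finally show "char M u = char (distr std_normal_distribution borel (\<lambda>x. sqrt s * x)) u" .
  qed
qed

lemma distr_scaled_std_normal:
  assumes s0: "s \<ge> 0"
  shows "distr std_normal_distribution borel (\<lambda>x. sqrt s * x) = (if sqrt s = 0 then return borel 0
           else density lborel (\<lambda>x. ennreal (normal_density 0 (sqrt s) x)))"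
proof (cases "s = 0")
  case True
  interpret S: real_distribution std_normal_distribution by (rule real_dist_normal_dist)
  have "distr std_normal_distribution borel (\<lambda>x. 0 :: real) = return borel 0"
    by (rule measure_eqI) (auto simp: emeasure_distr S.emeasure_space_1[simplified] indicator_def)
  thus ?thesis using True by simp
next
  case False
  hence pos: "s > 0" using s0 by simp
  interpret S: real_distribution std_normal_distribution by (rule real_dist_normal_dist)
  have d: "distributed std_normal_distribution lborel (\<lambda>x. x) std_normal_density"
    by (auto simp: distributed_def distr_id2)
  have "distributed std_normal_distribution lborel (\<lambda>x. 0 + sqrt s * x) (normal_density (0 + sqrt s * 0) (\<bar>sqrt s\<bar> * 1))"
    using pos by (intro S.normal_density_affine d) auto
  hence "distr std_normal_distribution lborel (\<lambda>x. sqrt s * x) = density lborel (\<lambda>x. ennreal (normal_density 0 (sqrt s) x))"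
    using pos by (simp add: distributed_def)
  moreover have "distr std_normal_distribution lborel (\<lambda>x. sqrt s * x) = distr std_normal_distribution borel (\<lambda>x. sqrt s * x)"
    by (rule distr_cong) auto
  ultimately show ?thesis using False s0 by simp
qed

lemma scaled_std_normal_moments:
  assumes s: "s \<ge> 0"
  defines "D \<equiv> distr std_normal_distribution borel (\<lambda>x. sqrt s * x)"
  shows "integrable D (\<lambda>x. x)" "(\<integral>x. x \<partial>D) = 0" "integrable D (\<lambda>x. x\<^sup>2)" "(\<integral>x. x\<^sup>2 \<partial>D) = s"
proof -
  have m: "(\<lambda>x. sqrt s * x) \<in> borel_measurable std_normal_distribution" by simp
  have i: "integrable std_normal_distribution (\<lambda>x. x)" "(\<integral>x. x \<partial>std_normal_distribution) = 0"
    using integrable_std_normal_distribution_moment[of 1] integral_std_normal_distribution_moment_odd[OF odd_one]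
    by (simp_all only: power_one_right)
  have i2: "(\<integral>x. x\<^sup>2 \<partial>std_normal_distribution) = 1"
    using std_normal_distribution_even_moments(1)[of 1] by (simp add: fact_2)
  show "integrable D (\<lambda>x. x)"
    unfolding D_def by (rule iffD2[OF integrable_distr_eq[OF m, of "\<lambda>x. x"]]) (simp, rule integrable_mult_right[OF i(1)])
  show "(\<integral>x. x \<partial>D) = 0"
    unfolding D_def by (rule trans[OF integral_distr[OF m, of "\<lambda>x. x"]]) (simp, simp add: i(2) del: integral_density)
  show "integrable D (\<lambda>x. x\<^sup>2)"
    unfolding D_def by (rule iffD2[OF integrable_distr_eq[OF m, of "\<lambda>x. x\<^sup>2"]])
      (simp, simp only: power_mult_distrib, rule integrable_mult_right[OF integrable_std_normal_distribution_moment])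
  show "(\<integral>x. x\<^sup>2 \<partial>D) = s"
    unfolding D_def by (rule trans[OF integral_distr[OF m, of "\<lambda>x. x\<^sup>2"]]) (simp, simp add: i2 power_mult_distrib s)
qed

text \<open>
  The law is that of the random series \<open>\<Sum>m. g\<^sub>m c\<^sub>m\<close> with independent standard normal
  coefficients, which converges absolutely almost surely. Everything else is read off its
  characteristic function.
\<close>

theorem gaussian_law_with_covariance:
  fixes c :: "nat \<Rightarrow> 'a::euclidean_space"
  assumes c: "summable (\<lambda>m. norm (c m))"
  shows "\<exists>\<nu>. gaussian_law \<nu> \<and> integrable \<nu> norm \<and> (\<forall>t. (\<integral>x. t \<bullet> x \<partial>\<nu>) = 0) \<and>
     (\<forall>t u. (\<lambda>m. (t \<bullet> c m) * (u \<bullet> c m)) sums (\<integral>x. (t \<bullet> x) * (u \<bullet> x) \<partial>\<nu>)) \<and>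
     (\<forall>t. (\<integral>x. cis (t \<bullet> x) \<partial>\<nu>) = of_real (exp (- ((\<Sum>m. (t \<bullet> c m)\<^sup>2) / 2))))"
proof -
  interpret G: prob_space std_normals by (rule prob_space_std_normals)
  define X where "X x = (\<Sum>m. x m *\<^sub>R c m)" for x :: "nat \<Rightarrow> real"
  have X[measurable]: "X \<in> borel_measurable std_normals"
    unfolding X_def by measurable
  define \<nu> where "\<nu> = distr std_normals borel X"
  have ps: "prob_space \<nu>" unfolding \<nu>_def by (rule G.prob_space_distr) measurable
  interpret prob_space \<nu> by fact
  have [simp, measurable_cong]: "sets \<nu> = sets borel" by (simp add: \<nu>_def)
  define s where "s t = (\<Sum>m. (t \<bullet> c m)\<^sup>2)" for t
  have abs_sum: "summable (\<lambda>m. \<bar>t \<bullet> c m\<bar>)" for t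
    by (rule summable_comparison_test'[OF summable_mult[OF c, of "norm t"]]) (auto simp: Cauchy_Schwarz_ineq2)
  have c0: "c \<longlonglongrightarrow> 0" using summable_LIMSEQ_zero[OF c] by (simp add: tendsto_norm_zero_iff)
  then have "Bseq c" by (meson convergentI convergent_imp_Bseq)
  then obtain B where B: "\<And>m. norm (c m) \<le> B" by (auto simp: Bseq_def)
  have prod_sum: "summable (\<lambda>m. (t \<bullet> c m) * (u \<bullet> c m))" for t u
  proof (rule summable_comparison_test'[OF summable_mult[OF abs_sum[of t], of "norm u * B"]])
    fix m
    have "\<bar>u \<bullet> c m\<bar> \<le> norm u * B"
      using Cauchy_Schwarz_ineq2[of u "c m"] B[of m] by (meson mult_left_mono norm_ge_zero order_trans)
    thus "norm ((t \<bullet> c m) * (u \<bullet> c m)) \<le> norm u * B * \<bar>t \<bullet> c m\<bar>"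
      using mult_right_mono[of "\<bar>u \<bullet> c m\<bar>" "norm u * B" "\<bar>t \<bullet> c m\<bar>"] by (simp add: abs_mult mult.commute)
  qed
  have s_sums: "(\<lambda>m. (t \<bullet> c m)\<^sup>2) sums s t" for t
    unfolding s_def using prod_sum[of t t] by (simp add: power2_eq_square summable_sums)
  have s0: "s t \<ge> 0" for t unfolding s_def by (rule suminf_nonneg) (use s_sums in \<open>auto simp: sums_iff\<close>)
  have char: "(\<integral>x. cis (t \<bullet> x) \<partial>\<nu>) = of_real (exp (- (s t / 2)))" for t
  proof -
    have "(\<integral>x. cis (t \<bullet> x) \<partial>\<nu>) = (\<integral>x. cis (t \<bullet> X x) \<partial>std_normals)"
      unfolding \<nu>_def by (subst integral_distr) auto
    have partial: "(\<integral>x. cis (t \<bullet> (\<Sum>m<n. x m *\<^sub>R c m)) \<partial>std_normals)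
        = of_real (exp (- ((\<Sum>m<n. (t \<bullet> c m)\<^sup>2) / 2)))" for n
    proof -
      have "(\<integral>x. cis (t \<bullet> (\<Sum>m<n. x m *\<^sub>R c m)) \<partial>std_normals)
          = (\<integral>x. (\<Prod>m<n. cis ((t \<bullet> c m) * x m)) \<partial>std_normals)"
        by (simp add: inner_sum_right cis_conv_exp exp_sum sum_distrib_left mult_ac)
      also have "\<dots> = (\<Prod>m<n. \<integral>x. cis ((t \<bullet> c m) * x m) \<partial>std_normals)"
      proof (rule G.indep_vars_lebesgue_integral)
        show "G.indep_vars (\<lambda>_. borel) (\<lambda>m x. cis ((t \<bullet> c m) * x m)) {..<n}"
          by (rule G.indep_vars_compose2[OF G.indep_vars_subset[OF indep_std_normals]]) auto
        show "integrable std_normals (\<lambda>x. cis ((t \<bullet> c m) * x m))" for m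
          by (rule G.integrable_const_bound[where B=1]) auto
      qed auto
      also have "\<dots> = (\<Prod>m<n. of_real (exp (- ((t \<bullet> c m)\<^sup>2 / 2))))"
      proof (rule prod.cong[OF refl])
        fix m
        have "(\<integral>x. cis ((t \<bullet> c m) * x m) \<partial>std_normals) = (\<integral>x. cis ((t \<bullet> c m) * x) \<partial>distr std_normals borel (\<lambda>x. x m))"
          by (subst integral_distr) auto
        thus "(\<integral>x. cis ((t \<bullet> c m) * x m) \<partial>std_normals) = of_real (exp (- ((t \<bullet> c m)\<^sup>2 / 2)))"
          by (simp only: distr_std_normals char_scaled_std_normal)
      qed
      also have "\<dots> = of_real (exp (- ((\<Sum>m<n. (t \<bullet> c m)\<^sup>2) / 2)))"
        by (simp add: exp_sum sum_divide_distrib flip: of_real_prod sum_negf)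
      finally show ?thesis .
    qed
    have "(\<lambda>n. \<integral>x. cis (t \<bullet> (\<Sum>m<n. x m *\<^sub>R c m)) \<partial>std_normals) \<longlonglongrightarrow> (\<integral>x. cis (t \<bullet> X x) \<partial>std_normals)"
    proof (rule integral_dominated_convergence[where w="\<lambda>_. 1"])
      show "AE x in std_normals. (\<lambda>n. cis (t \<bullet> (\<Sum>m<n. x m *\<^sub>R c m))) \<longlonglongrightarrow> cis (t \<bullet> X x)"
        using AE_summable_std_normals[OF c]
      proof eventually_elim
        case (elim x)
        have "(\<lambda>n. \<Sum>m<n. x m *\<^sub>R c m) \<longlonglongrightarrow> X x"
          unfolding X_def using summable_LIMSEQ[OF summable_norm_cancel[OF elim]] .
        thus ?case by (intro tendsto_cis tendsto_inner tendsto_const)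
      qed
    qed auto
    moreover have "(\<lambda>n. of_real (exp (- ((\<Sum>m<n. (t \<bullet> c m)\<^sup>2) / 2)))) \<longlonglongrightarrow> (of_real (exp (- (s t / 2))) :: complex)"
      using s_sums[of t] by (intro tendsto_intros) (auto simp: sums_def)
    ultimately have "(\<integral>x. cis (t \<bullet> X x) \<partial>std_normals) = of_real (exp (- (s t / 2)))"
      unfolding partial by (rule LIMSEQ_unique)
    thus ?thesis unfolding \<nu>_def by (subst integral_distr) auto
  qed
  have law: "distr \<nu> borel (\<lambda>x. t \<bullet> x) = distr std_normal_distribution borel (\<lambda>x. sqrt (s t) * x)" for t
  proof (rule normal_law_if_char)
    show "prob_space (distr \<nu> borel (\<lambda>x. t \<bullet> x))" by (rule prob_space_distr) measurable
    fix u
    have "s (u *\<^sub>R t) = u\<^sup>2 * s t"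
      unfolding s_def using s_sums[of t] by (simp add: power_mult_distrib sums_iff suminf_mult)
    thus "(\<integral>x. cis (u * x) \<partial>distr \<nu> borel (\<lambda>x. t \<bullet> x)) = of_real (exp (- (u\<^sup>2 * s t / 2)))"
      using char[of "u *\<^sub>R t"] by (subst integral_distr) auto
  qed (auto simp: s0)
  have gauss: "gaussian_law \<nu>"
    unfolding gaussian_law_def
  proof (intro conjI allI ps)
    fix t
    show "\<exists>m s. 0 \<le> s \<and> distr \<nu> borel (\<lambda>x. t \<bullet> x) = (if s = 0 then return borel m
           else density lborel (\<lambda>x. ennreal (normal_density m s x)))"
      unfolding law by (rule_tac exI[of _ 0], rule_tac exI[of _ "sqrt (s t)"]) (rule conjI[OF real_sqrt_ge_zero[OF s0] distr_scaled_std_normal[OF s0]])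
  qed simp
  have int1: "integrable \<nu> (\<lambda>x. t \<bullet> x)" and mean: "(\<integral>x. t \<bullet> x \<partial>\<nu>) = 0"
    and int2: "integrable \<nu> (\<lambda>x. (t \<bullet> x)\<^sup>2)" and var: "(\<integral>x. (t \<bullet> x)\<^sup>2 \<partial>\<nu>) = s t" for t
  proof -
    note N = scaled_std_normal_moments[OF s0[of t], folded law]
    have m: "(\<lambda>x. t \<bullet> x) \<in> measurable \<nu> borel" by simp
    have b: "(\<lambda>x. x) \<in> borel_measurable borel" "(\<lambda>x :: real. x\<^sup>2) \<in> borel_measurable borel" by simp_all
    show "integrable \<nu> (\<lambda>x. t \<bullet> x)" by (rule iffD1[OF integrable_distr_eq[OF m b(1)] N(1)])
    show "(\<integral>x. t \<bullet> x \<partial>\<nu>) = 0" by (rule trans[OF sym[OF integral_distr[OF m b(1)]] N(2)])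
    show "integrable \<nu> (\<lambda>x. (t \<bullet> x)\<^sup>2)" by (rule iffD1[OF integrable_distr_eq[OF m b(2)] N(3)])
    show "(\<integral>x. (t \<bullet> x)\<^sup>2 \<partial>\<nu>) = s t" by (rule trans[OF sym[OF integral_distr[OF m b(2)]] N(4)])
  qed
  have cov: "(\<lambda>m. (t \<bullet> c m) * (u \<bullet> c m)) sums (\<integral>x. (t \<bullet> x) * (u \<bullet> x) \<partial>\<nu>)" for t u
  proof -
    \<comment> \<open>polarization reduces covariances to variances of one-dimensional images\<close>
    have *: "(a * b) = (((a + b)\<^sup>2 - (a - b)\<^sup>2) / 4)" for a b :: real by (simp add: power2_eq_square algebra_simps)
    have "(\<integral>x. (t \<bullet> x) * (u \<bullet> x) \<partial>\<nu>) = (\<integral>x. (((t + u) \<bullet> x)\<^sup>2 - ((t - u) \<bullet> x)\<^sup>2) / 4 \<partial>\<nu>)"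
      by (subst *) (simp add: inner_add_left inner_diff_left)
    also have "\<dots> = (s (t + u) - s (t - u)) / 4"
      by (simp add: int2 var)
    finally have eq: "(\<integral>x. (t \<bullet> x) * (u \<bullet> x) \<partial>\<nu>) = (s (t + u) - s (t - u)) / 4" .
    have "(\<lambda>m. (((t + u) \<bullet> c m)\<^sup>2 - ((t - u) \<bullet> c m)\<^sup>2) / 4) sums ((s (t + u) - s (t - u)) / 4)"
      by (intro sums_divide sums_diff s_sums)
    thus ?thesis unfolding eq by (subst *) (simp add: inner_add_left inner_diff_left)
  qed
  have "integrable \<nu> norm"
  proof (rule Bochner_Integration.integrable_bound)
    show "integrable \<nu> (\<lambda>x. \<Sum>b\<in>Basis. \<bar>b \<bullet> x\<bar>)" by (intro Bochner_Integration.integrable_sum integrable_abs int1)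
    show "AE x in \<nu>. norm (norm x) \<le> norm (\<Sum>b\<in>Basis. \<bar>b \<bullet> x\<bar>)"
      using norm_le_l1 by (auto simp: inner_commute intro!: AE_I2 order_trans[OF norm_le_l1])
  qed simp
  thus ?thesis using gauss mean cov char by (intro exI[of _ \<nu>]) (auto simp: s_def)
qed

section \<open>Eigenvalues of an array\<close>

text \<open>
  The matrix of an array. The array is the primary object, because independence and moments are
  stated for its entries.
\<close>

definition arr_mat :: "nat \<Rightarrow> (nat \<times> nat \<Rightarrow> real) \<Rightarrow> complex mat" where
  "arr_mat N x = mat N N (\<lambda>e. complex_of_real (x e))"

lemma arr_mat_carrier [simp]: "arr_mat N x \<in> carrier_mat N N"
  by (simp add: arr_mat_def)

lemma char_poly_arr_mat:
  "char_poly (arr_mat N x) = (\<Sum>p\<in>{p. p permutes {..<N}}. signof p *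
     (\<Prod>i<N. (if p i = i then [:0, 1:] else 0) + [:- complex_of_real (x (i, p i)):]))"
proof -
  have "char_poly (arr_mat N x) = (\<Sum>p\<in>{p. p permutes {0..<N}}. signof p *
     (\<Prod>i = 0..<N. char_poly_matrix (arr_mat N x) $$ (i, p i)))"
    unfolding char_poly_def by (intro det_def' char_poly_matrix_closed arr_mat_carrier)
  also have "\<dots> = (\<Sum>p\<in>{p. p permutes {..<N}}. signof p *
     (\<Prod>i<N. (if p i = i then [:0, 1:] else 0) + [:- complex_of_real (x (i, p i)):]))"
    unfolding lessThan_atLeast0
  proof (intro sum.cong[OF refl] arg_cong2[of _ _ _ _ "(*)"] refl prod.cong[OF refl])
    fix p i assume "p \<in> {p. p permutes {0..<N}}" and i: "i \<in> {0..<N}"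
    then have "p i \<in> {0..<N}" using permutes_in_image by fastforce
    with i show "char_poly_matrix (arr_mat N x) $$ (i, p i) = (if p i = i then [:0, 1:] else 0) + [:- complex_of_real (x (i, p i)):]"
      by (auto simp: char_poly_matrix_def arr_mat_def)
  qed
  finally show ?thesis .
qed

lemma poly_char_poly_arr_mat: "poly (char_poly (arr_mat N x)) t = char_det N signof x t"
  unfolding char_poly_arr_mat char_det_def poly_sum
proof (rule sum.cong[OF refl])
  fix p
  have "poly (signof p) t = signof p" using signof_pm_one[of p] by auto
  thus "poly (signof p * (\<Prod>i<N. (if p i = i then [:0, 1:] else 0) + [:- complex_of_real (x (i, p i)):])) t
    = signof p * (\<Prod>i<N. (if p i = i then t else 0) - complex_of_real (x (i, p i)))"
    unfolding poly_mult poly_prod by (auto intro!: prod.cong)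
qed

text \<open>
  The coefficients are sums of products of entries; the class of random polynomials with measurable
  coefficients is closed under products.
\<close>

lemma coeff_char_poly_measurable:
  fixes x :: "'b \<Rightarrow> nat \<times> nat \<Rightarrow> real"
  assumes "\<And>e. e \<in> {..<N} \<times> {..<N} \<Longrightarrow> (\<lambda>\<omega>. x \<omega> e) \<in> borel_measurable M"
  shows "(\<lambda>\<omega>. coeff (char_poly (arr_mat N (x \<omega>))) k) \<in> borel_measurable M"
proof -
  let ?pm = "\<lambda>p :: 'b \<Rightarrow> complex poly. \<forall>k. (\<lambda>\<omega>. coeff (p \<omega>) k) \<in> borel_measurable M"
  have mult: "?pm (\<lambda>\<omega>. p \<omega> * q \<omega>)" if pq: "?pm p" "?pm q" for p q
  proof
    fix k
    have [measurable]: "(\<lambda>\<omega>. coeff (p \<omega>) i) \<in> borel_measurable M" "(\<lambda>\<omega>. coeff (q \<omega>) i) \<in> borel_measurable M" for i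
      using pq by auto
    show "(\<lambda>\<omega>. coeff (p \<omega> * q \<omega>) k) \<in> borel_measurable M" by (simp add: coeff_mult)
  qed
  have prod: "?pm (\<lambda>\<omega>. \<Prod>i\<in>A. p i \<omega>)" if "finite A" "\<And>i. i \<in> A \<Longrightarrow> ?pm (p i)" for A :: "nat set" and p
    using that
  proof (induction A rule: finite_induct)
    case (insert a A)
    thus ?case using mult[of "p a" "\<lambda>\<omega>. \<Prod>i\<in>A. p i \<omega>"] by simp
  qed simp
  have entry: "?pm (\<lambda>\<omega>. (if p i = i then [:0, 1:] else 0) + [:- complex_of_real (x \<omega> (i, p i)):])"
    if "p permutes {..<N}" "i < N" for p i
  proof
    fix k
    have "p i < N" using that permutes_in_image[of p "{..<N}" i] by simp
    then have [measurable]: "(\<lambda>\<omega>. x \<omega> (i, p i)) \<in> borel_measurable M" using assms that by simp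
    show "(\<lambda>\<omega>. coeff ((if p i = i then [:0, 1:] else 0) + [:- complex_of_real (x \<omega> (i, p i)):]) k) \<in> borel_measurable M"
      by (cases k) auto
  qed
  show ?thesis
    unfolding char_poly_arr_mat coeff_sum
  proof (rule borel_measurable_sum)
    fix p assume "p \<in> {p. p permutes {..<N}}"
    then have "?pm (\<lambda>\<omega>. \<Prod>i<N. (if p i = i then [:0, 1:] else 0) + [:- complex_of_real (x \<omega> (i, p i)):])"
      by (intro prod finite_lessThan entry) auto
    then have "?pm (\<lambda>\<omega>. signof p * (\<Prod>i<N. (if p i = i then [:0, 1:] else 0) + [:- complex_of_real (x \<omega> (i, p i)):]))"
      by (rule mult[rotated]) simp
    thus "(\<lambda>\<omega>. coeff (signof p * (\<Prod>i<N. (if p i = i then [:0, 1:] else 0) + [:- complex_of_real (x \<omega> (i, p i)):])) k) \<in> borel_measurable M"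
      by blast
  qed
qed

lemma trace_fun_measurable:
  fixes x :: "'b \<Rightarrow> nat \<times> nat \<Rightarrow> real"
  assumes "f \<in> borel_measurable borel"
    and "\<And>e. e \<in> {..<N} \<times> {..<N} \<Longrightarrow> (\<lambda>\<omega>. x \<omega> e) \<in> borel_measurable M"
  shows "(\<lambda>\<omega>. trace_fun f (arr_mat N (x \<omega>))) \<in> borel_measurable M"
proof -
  have "monic_poly N (coeff (char_poly (arr_mat N (x \<omega>)))) = char_poly (arr_mat N (x \<omega>))" for \<omega>
    using degree_monic_char_poly[OF arr_mat_carrier] by (intro monic_poly_coeff) auto
  thus ?thesis
    using sum_roots_measurable[OF assms(1), of "\<lambda>\<omega>. coeff (char_poly (arr_mat N (x \<omega>)))" M N, OF coeff_char_poly_measurable]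
      assms(2) by (simp add: trace_fun_def)
qed

text \<open>
  The eigenvalues as one family indexed below \<open>N\<close>. Traces of powers become power sums because a Schur
  form has the eigenvalues on its diagonal and powers of triangular matrices are triangular. The
  bound by the Frobenius norm is the Cauchy-Schwarz inequality for the \<open>n\<close>-th power applied to an
  eigenvector.
\<close>

lemma char_poly_arr_mat_roots:
  obtains l :: "nat \<Rightarrow> complex"
  where "\<And>t. char_det N signof x t = (\<Prod>i<N. t - l i)"
    and "\<And>f. trace_fun f (arr_mat N x) = (\<Sum>i<N. f (l i))"
    and "\<And>m. (\<Sum>i<N. l i ^ m) = of_real (arr_trace N x m)"
    and "\<And>i n. i < N \<Longrightarrow> norm (l i) ^ (2 * n) \<le> frobenius_sq N x n"
proof -
  define A where "A = arr_mat N x"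
  have A: "A \<in> carrier_mat N N" by (simp add: A_def)
  obtain es where es: "char_poly A = (\<Prod>a\<leftarrow>es. [:- a, 1:])" and len: "length es = N"
    using char_poly_factorized[OF A] by blast
  have pow: "A ^\<^sub>m n = mat N N (\<lambda>(i, j). complex_of_real (arr_pow N x n i j))" for n
  proof (induction n)
    case 0
    show ?case using A by (intro eq_matI) auto
  next
    case (Suc n)
    have "A ^\<^sub>m Suc n = A ^\<^sub>m n * A" by simp
    also have "\<dots> = mat N N (\<lambda>(i, j). complex_of_real (arr_pow N x (Suc n) i j))"
      unfolding Suc.IH by (intro eq_matI) (auto simp: scalar_prod_def A_def arr_mat_def lessThan_atLeast0)
    finally show ?case .
  qed
  show thesis
  proof
    fix t
    have "char_det N signof x t = (\<Prod>a\<leftarrow>es. t - a)"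
      unfolding poly_char_poly_arr_mat[symmetric] A_def[symmetric] es poly_prod_list by (simp add: o_def)
    thus "char_det N signof x t = (\<Prod>i<N. t - es ! i)"
      by (simp add: prod.list_conv_set_nth len lessThan_atLeast0)
  next
    fix f
    have "proots (\<Prod>a\<leftarrow>as. [:- a, 1:]) = mset as" for as :: "complex list"
    proof (induction as)
      case (Cons a as)
      have "(\<Prod>a\<leftarrow>as. [:- a, 1:]) \<noteq> 0" by (simp add: prod_list_zero_iff image_iff)
      thus ?case using Cons by (simp add: proots_mult del: mult_pCons_left)
    qed simp
    then have "trace_fun f A = sum_list (map f es)" by (simp add: trace_fun_def es sum_mset_sum_list flip: mset_map)
    thus "trace_fun f (arr_mat N x) = (\<Sum>i<N. f (es ! i))"
      by (simp add: A_def sum.list_conv_set_nth len lessThan_atLeast0)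
  next
    fix m
    obtain B P Q where "schur_decomposition A es = (B, P, Q)" by (metis prod_cases3)
    from schur_decomposition[OF A es this]
    have wit: "similar_mat_wit A B P Q" and ut: "upper_triangular B" and diag: "diag_mat B = es" by auto
    note W = similar_mat_witD2[OF A wit]
    have B_diag: "B $$ (i, i) = es ! i" if "i < N" for i
      using diag W(5) that by (auto simp: diag_mat_def)
    have Bm: "B ^\<^sub>m m \<in> carrier_mat N N" for m using W(5) by (rule pow_carrier_mat)
    have tri: "(\<forall>i<N. \<forall>j<i. (B ^\<^sub>m m) $$ (i, j) = 0) \<and> (\<forall>i<N. (B ^\<^sub>m m) $$ (i, i) = es ! i ^ m)" for m
    proof (induction m)
      case 0
      show ?case using W(5) by auto
    next
      case (Suc m)
      have e: "(B ^\<^sub>m Suc m) $$ (i, j) = (\<Sum>k<N. (B ^\<^sub>m m) $$ (i, k) * B $$ (k, j))" if "i < N" "j < N" for i j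
        using that Bm[of m] W(5) by (simp add: scalar_prod_def lessThan_atLeast0)
      have Bz: "B $$ (k, j) = 0" if "j < k" "k < N" for k j
        using ut W(5) that by (auto simp: upper_triangular_def)
      show ?case
      proof (intro conjI allI impI)
        fix i j assume ij: "i < N" "j < i"
        have "(B ^\<^sub>m m) $$ (i, k) * B $$ (k, j) = 0" if "k < N" for k
          using Suc.IH Bz[of j k] ij that by (cases "k < i") auto
        thus "(B ^\<^sub>m Suc m) $$ (i, j) = 0" using ij by (subst e) (auto intro!: sum.neutral)
      next
        fix i assume i: "i < N"
        have "(B ^\<^sub>m Suc m) $$ (i, i) = (\<Sum>k<N. (B ^\<^sub>m m) $$ (i, k) * B $$ (k, i))" by (rule e[OF i i])
        also have "\<dots> = (\<Sum>k<N. if k = i then es ! i ^ m * es ! i else 0)"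
        proof (rule sum.cong[OF refl])
          fix k assume "k \<in> {..<N}"
          thus "(B ^\<^sub>m m) $$ (i, k) * B $$ (k, i) = (if k = i then es ! i ^ m * es ! i else 0)"
            using Suc.IH Bz[of i k] B_diag[of i] i by (cases rule: linorder_cases[of k i]) auto
        qed
        finally show "(B ^\<^sub>m Suc m) $$ (i, i) = es ! i ^ Suc m" using i by simp
      qed
    qed
    have "of_real (arr_trace N x m) = (\<Sum>i<N. (A ^\<^sub>m m) $$ (i, i))"
      unfolding pow by (simp add: arr_trace_def)
    also have "\<dots> = (\<Sum>i<N. \<Sum>j<N. (P * B ^\<^sub>m m) $$ (i, j) * Q $$ (j, i))"
      unfolding similar_mat_wit_pow_id[OF wit] using W Bm[of m]
      by (intro sum.cong[OF refl]) (auto simp: scalar_prod_def lessThan_atLeast0)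
    also have "\<dots> = (\<Sum>j<N. \<Sum>i<N. Q $$ (j, i) * (P * B ^\<^sub>m m) $$ (i, j))"
      by (subst sum.swap) (simp add: mult.commute)
    also have "\<dots> = (\<Sum>j<N. (Q * (P * B ^\<^sub>m m)) $$ (j, j))"
      using W Bm[of m] by (intro sum.cong[OF refl]) (auto simp: scalar_prod_def lessThan_atLeast0)
    also have "Q * (P * B ^\<^sub>m m) = B ^\<^sub>m m"
      using assoc_mult_mat[OF W(7) W(6) Bm[of m]] left_mult_one_mat[OF Bm[of m]] unfolding W(2) by (rule trans[OF sym])
    also have "(\<Sum>j<N. (B ^\<^sub>m m) $$ (j, j)) = (\<Sum>j<N. es ! j ^ m)" using tri[of m] by (intro sum.cong[OF refl]) auto
    finally show "(\<Sum>i<N. es ! i ^ m) = of_real (arr_trace N x m)" by simp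
  next
    fix i n assume i: "i < N"
    define a where "a = es ! i"
    have "poly (char_poly A) a = 0"
      unfolding es poly_prod_list using i len by (auto simp: a_def prod_list_zero_iff o_def)
    then obtain v where "eigenvector A v a"
      using eigenvalue_root_char_poly[OF A] by (auto simp: eigenvalue_def)
    then have v: "v \<in> carrier_vec N" "v \<noteq> 0\<^sub>v N" "A *\<^sub>v v = a \<cdot>\<^sub>v v" using A by (auto simp: eigenvector_def)
    have step: "(\<Sum>j<N. complex_of_real (x (k, j)) * vec_index v j) = a * vec_index v k" if "k < N" for k
    proof -
      have "vec_index (A *\<^sub>v v) k = (\<Sum>j<N. complex_of_real (x (k, j)) * vec_index v j)"
        using v(1) that by (simp add: A_def arr_mat_def scalar_prod_def lessThan_atLeast0)
      thus ?thesis using v that by simp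
    qed
    have vn: "(\<Sum>j<N. complex_of_real (arr_pow N x n k j) * vec_index v j) = a ^ n * vec_index v k" if "k < N" for k n
    proof (induction n)
      case 0
      have "(\<Sum>j<N. complex_of_real (arr_pow N x 0 k j) * vec_index v j) = (\<Sum>j<N. if j = k then vec_index v k else 0)"
        by (intro sum.cong) auto
      thus ?case using that by simp
    next
      case (Suc n)
      have "(\<Sum>j<N. complex_of_real (arr_pow N x (Suc n) k j) * vec_index v j)
         = (\<Sum>m<N. complex_of_real (arr_pow N x n k m) * (\<Sum>j<N. complex_of_real (x (m, j)) * vec_index v j))"
        by (simp add: sum_distrib_left sum_distrib_right mult.assoc) (rule sum.swap)
      also have "\<dots> = (\<Sum>m<N. complex_of_real (arr_pow N x n k m) * (a * vec_index v m))"
        using step by (intro sum.cong[OF refl]) auto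
      also have "\<dots> = a * (\<Sum>m<N. complex_of_real (arr_pow N x n k m) * vec_index v m)"
        by (simp add: sum_distrib_left mult_ac)
      finally show ?case using Suc.IH by simp
    qed
    define V where "V = (\<Sum>j<N. (cmod (vec_index v j))\<^sup>2)"
    obtain j0 where "j0 < N" "vec_index v j0 \<noteq> 0"
      using v by (metis carrier_vecD eq_vecI index_zero_vec)
    then have V: "V > 0" unfolding V_def by (intro sum_pos2[of _ j0]) auto
    have "norm a ^ (2 * n) * V = (\<Sum>k<N. (norm (a ^ n * vec_index v k))\<^sup>2)"
      by (simp add: V_def sum_distrib_left norm_mult norm_power power_mult_distrib power_mult[symmetric] mult.commute)
    also have "\<dots> \<le> (\<Sum>k<N. (\<Sum>j<N. (arr_pow N x n k j)\<^sup>2) * V)"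
    proof (rule sum_mono)
      fix k assume "k \<in> {..<N}"
      then have "norm (a ^ n * vec_index v k) = norm (\<Sum>j<N. complex_of_real (arr_pow N x n k j) * vec_index v j)"
        using vn[of k n] by simp
      also have "\<dots> \<le> (\<Sum>j<N. \<bar>arr_pow N x n k j\<bar> * norm (vec_index v j))"
        by (rule order_trans[OF norm_sum]) (simp add: norm_mult)
      finally have "(norm (a ^ n * vec_index v k))\<^sup>2 \<le> (\<Sum>j<N. \<bar>arr_pow N x n k j\<bar> * norm (vec_index v j))\<^sup>2"
        by (intro power_mono) auto
      also have "\<dots> \<le> (\<Sum>j<N. \<bar>arr_pow N x n k j\<bar>\<^sup>2) * V"
        unfolding V_def by (rule Cauchy_Schwarz_ineq_sum)
      finally show "(norm (a ^ n * vec_index v k))\<^sup>2 \<le> (\<Sum>j<N. (arr_pow N x n k j)\<^sup>2) * V" by simp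
    qed
    also have "\<dots> = frobenius_sq N x n * V" by (simp add: frobenius_sq_def sum_distrib_right)
    finally show "norm (es ! i) ^ (2 * n) \<le> frobenius_sq N x n" using V unfolding a_def by simp
  qed
qed

section \<open>Truncating an iid matrix\<close>

definition trunc :: "real \<Rightarrow> real \<Rightarrow> real" where
  "trunc b t = (if \<bar>t\<bar> \<le> b then t else 0)"

lemma trunc_measurable [measurable]: "trunc b \<in> borel_measurable borel"
  unfolding trunc_def by measurable

lemma abs_trunc_le: "b \<ge> 0 \<Longrightarrow> \<bar>trunc b t\<bar> \<le> b"
  by (simp add: trunc_def)

text \<open>
  The model: an atom variable with slightly more than six moments, and for each size a matrix of
  independent copies of it.
\<close>

locale iid_matrix_model = P: prob_space P
  for P :: "'a measure" +
  fixes \<xi> :: "'a \<Rightarrow> real" and \<tau> :: real and M :: "nat \<Rightarrow> 'b measure" and Y :: "nat \<Rightarrow> 'b \<Rightarrow> real mat"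
  assumes \<xi> [measurable]: "\<xi> \<in> borel_measurable P"
    and mean: "P.expectation \<xi> = 0" and var: "P.variance \<xi> = 1"
    and \<tau>: "\<tau> > 0" and moment: "integrable P (\<lambda>\<omega>. \<bar>\<xi> \<omega>\<bar> powr (6 + \<tau>))"
    and Y: "\<And>N. N \<ge> 1 \<Longrightarrow> iid_random_matrix P \<xi> N (M N) (Y N)"
begin

definition scaled_entry :: "nat \<Rightarrow> nat \<times> nat \<Rightarrow> 'b \<Rightarrow> real" where
  "scaled_entry N e \<omega> = Y N \<omega> $$ e / sqrt (real N)"

text \<open>
  Chosen so that \<open>N\<^sup>3\<close> times the tail bound at the cutoff, of order
  \<open>N powr (- (1 / 2 - \<epsilon>) * (6 + \<tau>))\<close>, is \<open>N powr (- \<tau> / 4)\<close>.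
\<close>

definition \<epsilon> :: real where "\<epsilon> = \<tau> / (4 * (6 + \<tau>))"

definition cutoff :: "nat \<Rightarrow> real" where "cutoff N = real N powr (1 / 2 - \<epsilon>)"

definition trunc_entry :: "nat \<Rightarrow> nat \<times> nat \<Rightarrow> 'b \<Rightarrow> real" where
  "trunc_entry N e \<omega> = trunc (cutoff N) (Y N \<omega> $$ e) / sqrt (real N)"

definition q :: "nat \<Rightarrow> real" where "q N = real N powr (- \<epsilon>)"

definition \<mu> :: "nat \<Rightarrow> nat \<Rightarrow> real" where
  "\<mu> N p = (\<integral>\<omega>. (trunc (cutoff N) (\<xi> \<omega>) / sqrt (real N)) ^ p \<partial>P)"

definition high_moment :: real where "high_moment = (\<integral>\<omega>. \<bar>\<xi> \<omega>\<bar> powr (6 + \<tau>) \<partial>P)"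

lemma \<epsilon>: "0 < \<epsilon>" "\<epsilon> < 1 / 4"
  using \<tau> by (simp_all add: \<epsilon>_def field_simps)

lemma prob_space_M: "N \<ge> 1 \<Longrightarrow> prob_space (M N)"
  using Y by (simp add: iid_random_matrix_def)

lemma entries_indep: "N \<ge> 1 \<Longrightarrow> prob_space.indep_vars (M N) (\<lambda>_. borel) (\<lambda>e \<omega>. Y N \<omega> $$ e) ({..<N} \<times> {..<N})"
  using Y[of N] by (simp add: iid_random_matrix_def)

lemma entry_measurable: "e \<in> {..<N} \<times> {..<N} \<Longrightarrow> (\<lambda>\<omega>. Y N \<omega> $$ e) \<in> borel_measurable (M N)"
proof -
  assume e: "e \<in> {..<N} \<times> {..<N}"
  hence N: "N \<ge> 1" by auto
  interpret prob_space "M N" by (rule prob_space_M[OF N])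
  show ?thesis using entries_indep[OF N] e unfolding indep_vars_def by blast
qed

lemma entry_distr: "e \<in> {..<N} \<times> {..<N} \<Longrightarrow> distr (M N) borel (\<lambda>\<omega>. Y N \<omega> $$ e) = distr P borel \<xi>"
  using Y[of N] by (cases "N = 0") (auto simp: iid_random_matrix_def)

lemma entry_integral:
  fixes g :: "real \<Rightarrow> real"
  assumes e: "e \<in> {..<N} \<times> {..<N}" and g [measurable]: "g \<in> borel_measurable borel"
  shows "(\<integral>\<omega>. g (Y N \<omega> $$ e) \<partial>M N) = (\<integral>\<omega>. g (\<xi> \<omega>) \<partial>P)"
    and "integrable (M N) (\<lambda>\<omega>. g (Y N \<omega> $$ e)) \<longleftrightarrow> integrable P (\<lambda>\<omega>. g (\<xi> \<omega>))"
  using integral_distr[OF entry_measurable[OF e] g] integral_distr[OF \<xi> g]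
    integrable_distr_eq[OF entry_measurable[OF e] g] integrable_distr_eq[OF \<xi> g] entry_distr[OF e] by simp_all

lemma \<xi>_power_integrable: "p \<le> 6 \<Longrightarrow> integrable P (\<lambda>\<omega>. \<xi> \<omega> ^ p)"
proof (rule Bochner_Integration.integrable_bound)
  assume p: "p \<le> 6"
  show "integrable P (\<lambda>\<omega>. 1 + \<bar>\<xi> \<omega>\<bar> powr (6 + \<tau>))" using moment by simp
  show "AE \<omega> in P. norm (\<xi> \<omega> ^ p) \<le> norm (1 + \<bar>\<xi> \<omega>\<bar> powr (6 + \<tau>))"
  proof (rule AE_I2)
    fix \<omega>
    show "norm (\<xi> \<omega> ^ p) \<le> norm (1 + \<bar>\<xi> \<omega>\<bar> powr (6 + \<tau>))"
    proof (cases "\<bar>\<xi> \<omega>\<bar> \<le> 1")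
      case True
      then have "\<bar>\<xi> \<omega>\<bar> ^ p \<le> 1" by (intro power_le_one) auto
      also have "\<dots> \<le> 1 + \<bar>\<xi> \<omega>\<bar> powr (6 + \<tau>)" by simp
      finally show ?thesis by (simp add: power_abs)
    next
      case False
      have "\<bar>\<xi> \<omega>\<bar> ^ p = \<bar>\<xi> \<omega>\<bar> powr real p" using False by (simp add: powr_realpow)
      also have "\<dots> \<le> \<bar>\<xi> \<omega>\<bar> powr (6 + \<tau>)" using False p \<tau> by (intro powr_mono) auto
      finally show ?thesis by (simp add: power_abs)
    qed
  qed
qed measurable

lemma \<xi>_sq: "(\<integral>\<omega>. (\<xi> \<omega>)\<^sup>2 \<partial>P) = 1"
  using var mean by simp

lemma cutoff_pos: "N \<ge> 1 \<Longrightarrow> cutoff N > 0"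
  by (simp add: cutoff_def)

lemma tail_le:
  assumes b: "b > 0" and s: "0 \<le> s" "s \<le> 6 + \<tau>" and t: "\<bar>t\<bar> > b"
  shows "\<bar>t\<bar> powr s \<le> b powr (s - (6 + \<tau>)) * \<bar>t\<bar> powr (6 + \<tau>)"
proof -
  have "\<bar>t\<bar> powr s = \<bar>t\<bar> powr (s - (6 + \<tau>)) * \<bar>t\<bar> powr (6 + \<tau>)" by (simp flip: powr_add)
  also have "\<dots> \<le> b powr (s - (6 + \<tau>)) * \<bar>t\<bar> powr (6 + \<tau>)"
    using assms by (intro mult_right_mono powr_mono2') auto
  finally show ?thesis .
qed

lemma prob_tail_le:
  assumes b: "b > 0"
  shows "P.prob {\<omega> \<in> space P. \<bar>\<xi> \<omega>\<bar> > b} \<le> high_moment * b powr (- (6 + \<tau>))"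
proof -
  have "P.prob {\<omega> \<in> space P. \<bar>\<xi> \<omega>\<bar> > b} = (\<integral>\<omega>. indicator {\<omega> \<in> space P. \<bar>\<xi> \<omega>\<bar> > b} \<omega> \<partial>P)"
    by simp
  also have "\<dots> \<le> (\<integral>\<omega>. b powr (0 - (6 + \<tau>)) * \<bar>\<xi> \<omega>\<bar> powr (6 + \<tau>) \<partial>P)"
  proof (rule integral_mono)
    show "integrable P (\<lambda>\<omega>. indicator {\<omega> \<in> space P. \<bar>\<xi> \<omega>\<bar> > b} \<omega> :: real)"
      by (rule integrable_real_indicator) (auto simp: P.emeasure_eq_measure)
    show "integrable P (\<lambda>\<omega>. b powr (0 - (6 + \<tau>)) * \<bar>\<xi> \<omega>\<bar> powr (6 + \<tau>))"
      using moment by (rule integrable_mult_right)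
    show "indicator {\<omega> \<in> space P. \<bar>\<xi> \<omega>\<bar> > b} \<omega> \<le> b powr (0 - (6 + \<tau>)) * \<bar>\<xi> \<omega>\<bar> powr (6 + \<tau>)" for \<omega>
      using tail_le[OF b, of 0 "\<xi> \<omega>"] \<tau> b by (auto simp: indicator_def split: if_splits)
  qed
  finally show ?thesis by (simp add: high_moment_def mult.commute)
qed

text \<open>
  The atom variable is centered, so the mean of the truncated variable is minus that of the cut tail.
\<close>

lemma trunc_mean_le:
  assumes b: "b > 0"
  shows "\<bar>\<integral>\<omega>. trunc b (\<xi> \<omega>) \<partial>P\<bar> \<le> high_moment * b powr (- (5 + \<tau>))"
proof -
  have i: "integrable P \<xi>" using \<xi>_power_integrable[of 1] by simp
  have it: "integrable P (\<lambda>\<omega>. trunc b (\<xi> \<omega>))"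
    by (rule P.integrable_const_bound[of _ b]) (use b in \<open>auto simp: abs_trunc_le\<close>)
  have "(\<integral>\<omega>. trunc b (\<xi> \<omega>) \<partial>P) = (\<integral>\<omega>. trunc b (\<xi> \<omega>) - \<xi> \<omega> \<partial>P)"
    using i it mean by simp
  also have "\<bar>\<dots>\<bar> \<le> (\<integral>\<omega>. b powr (1 - (6 + \<tau>)) * \<bar>\<xi> \<omega>\<bar> powr (6 + \<tau>) \<partial>P)"
  proof (rule order_trans[OF integral_abs_bound integral_mono])
    show "integrable P (\<lambda>\<omega>. \<bar>trunc b (\<xi> \<omega>) - \<xi> \<omega>\<bar>)" using i it by simp
    show "integrable P (\<lambda>\<omega>. b powr (1 - (6 + \<tau>)) * \<bar>\<xi> \<omega>\<bar> powr (6 + \<tau>))"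
      using moment by (rule integrable_mult_right)
    show "\<bar>trunc b (\<xi> \<omega>) - \<xi> \<omega>\<bar> \<le> b powr (1 - (6 + \<tau>)) * \<bar>\<xi> \<omega>\<bar> powr (6 + \<tau>)" for \<omega>
      using tail_le[OF b, of 1 "\<xi> \<omega>"] \<tau> b by (auto simp: trunc_def)
  qed
  also have "\<dots> = high_moment * b powr (- (5 + \<tau>))" by (simp add: high_moment_def mult.commute)
  finally show ?thesis .
qed

lemma q_tendsto: "q \<longlonglongrightarrow> 0"
  unfolding q_def using \<epsilon>(1) by (intro tendsto_neg_powr filterlim_real_sequentially) auto

lemma trunc_entry_abs_le: "N \<ge> 1 \<Longrightarrow> \<bar>trunc (cutoff N) t / sqrt (real N)\<bar> \<le> q N"
proof -
  assume N: "N \<ge> 1"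
  have "\<bar>trunc (cutoff N) t / sqrt (real N)\<bar> \<le> cutoff N / sqrt (real N)"
    using abs_trunc_le[of "cutoff N" t] cutoff_pos[OF N] N by (simp add: divide_right_mono)
  also have "\<dots> = q N"
    using N unfolding cutoff_def q_def powr_half_sqrt[symmetric, OF of_nat_0_le_iff] by (simp flip: powr_diff)
  finally show ?thesis .
qed

lemma cutoff_powr: "N \<ge> 1 \<Longrightarrow> cutoff N powr s = real N powr ((1 / 2 - \<epsilon>) * s)"
  by (simp add: cutoff_def powr_powr)

text \<open>
  Only the bound on the mean needs \<open>N\<close> to be large. Moments beyond the second are bounded by powers of
  the largest entry times the second moment.
\<close>

lemma iid_array_eventually: "\<forall>\<^sub>F N in sequentially. iid_array (M N) N (trunc_entry N) (\<mu> N) (q N)"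
proof -
  \<comment> \<open>the exponent of \<open>N\<close> in the ratio of the two sides of the bound on the mean\<close>
  define d where "d = - ((1 / 2 - \<epsilon>) * (5 + \<tau>)) - 1 / 2 + \<epsilon> + 1"
  have "(1 / 4) * 5 \<le> (1 / 2 - \<epsilon>) * (5 + \<tau>)" using \<epsilon> \<tau> by (intro mult_mono) auto
  then have d: "d < 0" using \<epsilon> by (simp add: d_def)
  have "(\<lambda>N. high_moment * real N powr d) \<longlonglongrightarrow> high_moment * 0"
    using d by (intro tendsto_mult tendsto_const tendsto_neg_powr filterlim_real_sequentially)
  then have "\<forall>\<^sub>F N in sequentially. high_moment * real N powr d < 1"
    by (rule order_tendstoD) simp
  then show ?thesis
    using eventually_ge_at_top[of 1]
  proof eventually_elim
    case (elim N)
    then have N: "N \<ge> 1" and Kd: "high_moment * real N powr d < 1" by auto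
    interpret prob_space "M N" by (rule prob_space_M[OF N])
    have q1: "q N \<le> 1"
      using N \<epsilon> powr_mono[of "- \<epsilon>" 0 "real N"] by (simp add: q_def)
    have bI: "\<bar>trunc (cutoff N) (\<xi> \<omega>) / sqrt (real N)\<bar> \<le> q N" for \<omega> by (rule trunc_entry_abs_le[OF N])
    have int: "integrable P (\<lambda>\<omega>. (trunc (cutoff N) (\<xi> \<omega>) / sqrt (real N)) ^ p)" for p
    proof (rule P.integrable_const_bound[of _ 1])
      show "AE \<omega> in P. norm ((trunc (cutoff N) (\<xi> \<omega>) / sqrt (real N)) ^ p) \<le> 1"
      proof (rule AE_I2)
        fix \<omega>
        have "\<bar>trunc (cutoff N) (\<xi> \<omega>) / sqrt (real N)\<bar> ^ p \<le> 1"
          using bI[of \<omega>] q1 by (intro power_le_one) auto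
        thus "norm ((trunc (cutoff N) (\<xi> \<omega>) / sqrt (real N)) ^ p) \<le> 1" unfolding real_norm_def power_abs .
      qed
    qed measurable
    have \<mu>2: "\<mu> N 2 \<le> 1 / real N"
    proof -
      have "\<mu> N 2 \<le> (\<integral>\<omega>. (\<xi> \<omega>)\<^sup>2 / real N \<partial>P)"
        unfolding \<mu>_def using \<xi>_power_integrable[of 2]
        by (intro integral_mono int) (auto simp: trunc_def power_divide)
      thus ?thesis using \<xi>_sq by simp
    qed
    show ?case
    proof
      show "N \<ge> 1" by fact
      show "indep_vars (\<lambda>_. borel) (trunc_entry N) ({..<N} \<times> {..<N})"
        unfolding trunc_entry_def by (rule indep_vars_compose2[OF entries_indep[OF N]]) auto
      show "\<exists>C. \<forall>e\<in>{..<N} \<times> {..<N}. \<forall>\<omega>\<in>space (M N). \<bar>trunc_entry N e \<omega>\<bar> \<le> C"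
        using trunc_entry_abs_le[OF N] by (auto simp: trunc_entry_def)
      show "expectation (\<lambda>\<omega>. trunc_entry N e \<omega> ^ p) = \<mu> N p" if e: "e \<in> {..<N} \<times> {..<N}" for e p
        unfolding trunc_entry_def \<mu>_def by (rule entry_integral(1)[OF e]) measurable
      show "1 / real N \<le> q N"
      proof -
        have "1 / real N = real N powr (-1)" using N by (simp add: powr_minus_divide)
        also have "\<dots> \<le> q N" unfolding q_def using N \<epsilon> by (intro powr_mono) auto
        finally show ?thesis .
      qed
      show "q N \<le> 1" by fact
      show "\<bar>\<mu> N 1\<bar> \<le> q N / real N"
      proof -
        have "\<bar>\<mu> N 1\<bar> = \<bar>\<integral>\<omega>. trunc (cutoff N) (\<xi> \<omega>) \<partial>P\<bar> / sqrt (real N)"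
          by (simp add: \<mu>_def abs_divide)
        also have "\<dots> \<le> high_moment * cutoff N powr (- (5 + \<tau>)) / sqrt (real N)"
          using trunc_mean_le[OF cutoff_pos[OF N]] by (intro divide_right_mono) auto
        also have "\<dots> = high_moment * real N powr d * (q N / real N)"
        proof -
          have "real N powr ((1 / 2 - \<epsilon>) * (- (5 + \<tau>))) / real N powr (1 / 2)
             = real N powr d * (real N powr (- \<epsilon>) / real N powr 1)"
            unfolding powr_add[symmetric] powr_diff[symmetric] by (rule arg_cong[where f="\<lambda>s. real N powr s"]) (simp add: d_def algebra_simps)
          hence "cutoff N powr (- (5 + \<tau>)) / sqrt (real N) = real N powr d * (q N / real N)"
            using N by (simp only: cutoff_powr[OF N] q_def powr_half_sqrt[OF of_nat_0_le_iff] powr_one[OF of_nat_0_le_iff])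
          thus ?thesis by (simp only: times_divide_eq_right[symmetric] mult.assoc)
        qed
        also have "\<dots> \<le> 1 * (q N / real N)"
          using Kd by (intro mult_right_mono) (auto simp: q_def)
        finally show ?thesis by simp
      qed
      show "0 \<le> \<mu> N 2" by (simp add: \<mu>_def)
      show "\<mu> N 2 \<le> 1 / real N" by fact
      show "\<bar>\<mu> N p\<bar> \<le> q N ^ (p - 2) / real N" if p: "p \<ge> 3" for p
      proof -
        have "\<bar>\<mu> N p\<bar> \<le> (\<integral>\<omega>. \<bar>(trunc (cutoff N) (\<xi> \<omega>) / sqrt (real N)) ^ p\<bar> \<partial>P)"
          unfolding \<mu>_def by (rule integral_abs_bound)
        also have "\<dots> \<le> (\<integral>\<omega>. q N ^ (p - 2) * (trunc (cutoff N) (\<xi> \<omega>) / sqrt (real N)) ^ 2 \<partial>P)"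
        proof (rule integral_mono)
          fix \<omega>
          let ?z = "trunc (cutoff N) (\<xi> \<omega>) / sqrt (real N)"
          have "\<bar>?z ^ p\<bar> = \<bar>?z\<bar> ^ (p - 2) * ?z ^ 2"
          proof -
            have "p = (p - 2) + 2" using p by simp
            hence "\<bar>?z ^ p\<bar> = \<bar>?z\<bar> ^ ((p - 2) + 2)" unfolding power_abs by (rule arg_cong)
            thus ?thesis unfolding power_add power2_abs .
          qed
          also have "\<dots> \<le> q N ^ (p - 2) * ?z ^ 2"
            using bI[of \<omega>] by (intro mult_right_mono power_mono) auto
          finally show "\<bar>?z ^ p\<bar> \<le> q N ^ (p - 2) * ?z ^ 2" .
        qed (intro integrable_abs integrable_mult_right int)+
        also have "\<dots> = q N ^ (p - 2) * \<mu> N 2" by (simp add: \<mu>_def)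
        also have "\<dots> \<le> q N ^ (p - 2) * (1 / real N)"
          using \<mu>2 by (intro mult_left_mono) (auto simp: q_def)
        finally show ?thesis by simp
      qed
    qed
  qed
qed

lemma cutoff_at_top: "filterlim cutoff at_top sequentially"
  unfolding cutoff_def using \<epsilon> by real_asymp

lemma second_moment_tendsto: "(\<lambda>N. real N * \<mu> N 2) \<longlonglongrightarrow> 1"
proof -
  have "(\<lambda>N. \<integral>\<omega>. (trunc (cutoff N) (\<xi> \<omega>))\<^sup>2 \<partial>P) \<longlonglongrightarrow> (\<integral>\<omega>. (\<xi> \<omega>)\<^sup>2 \<partial>P)"
  proof (rule integral_dominated_convergence[where w="\<lambda>\<omega>. (\<xi> \<omega>)\<^sup>2"])
    show "AE \<omega> in P. (\<lambda>N. (trunc (cutoff N) (\<xi> \<omega>))\<^sup>2) \<longlonglongrightarrow> (\<xi> \<omega>)\<^sup>2"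
    proof (rule AE_I2)
      fix \<omega>
      have "\<forall>\<^sub>F N in sequentially. \<bar>\<xi> \<omega>\<bar> \<le> cutoff N"
        using cutoff_at_top by (simp add: filterlim_at_top)
      then have "\<forall>\<^sub>F N in sequentially. (trunc (cutoff N) (\<xi> \<omega>))\<^sup>2 = (\<xi> \<omega>)\<^sup>2"
        by eventually_elim (simp add: trunc_def)
      thus "(\<lambda>N. (trunc (cutoff N) (\<xi> \<omega>))\<^sup>2) \<longlonglongrightarrow> (\<xi> \<omega>)\<^sup>2" by (rule tendsto_eventually)
    qed
    show "integrable P (\<lambda>\<omega>. (\<xi> \<omega>)\<^sup>2)" using \<xi>_power_integrable[of 2] by simp
  qed (auto simp: trunc_def)
  moreover have "\<forall>\<^sub>F N in sequentially. (\<integral>\<omega>. (trunc (cutoff N) (\<xi> \<omega>))\<^sup>2 \<partial>P) = real N * \<mu> N 2"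
    using eventually_ge_at_top[of 1] by eventually_elim (simp add: \<mu>_def power_divide)
  ultimately show ?thesis unfolding \<xi>_sq by (rule Lim_transform_eventually)
qed

text \<open>
  A union bound over the \<open>N\<^sup>2\<close> entries. The additional factor \<open>N\<close> is the one that the size of the
  statistics costs later.
\<close>

lemma prob_truncated_tendsto:
  "(\<lambda>N. real N * measure (M N) {\<omega> \<in> space (M N). \<exists>e\<in>{..<N} \<times> {..<N}. \<bar>Y N \<omega> $$ e\<bar> > cutoff N}) \<longlonglongrightarrow> 0"
proof (rule tendsto_sandwich[of "\<lambda>_. 0" _ _ "\<lambda>N. high_moment * real N powr (- (\<tau> / 4))"])
  show "(\<lambda>N. high_moment * real N powr (- (\<tau> / 4))) \<longlonglongrightarrow> 0"
    using \<tau> by (intro tendsto_mult_right_zero tendsto_neg_powr filterlim_real_sequentially) auto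
  show "\<forall>\<^sub>F N in sequentially. real N * measure (M N) {\<omega> \<in> space (M N). \<exists>e\<in>{..<N} \<times> {..<N}. \<bar>Y N \<omega> $$ e\<bar> > cutoff N}
     \<le> high_moment * real N powr (- (\<tau> / 4))"
    using eventually_ge_at_top[of 1]
  proof eventually_elim
    case (elim N)
    interpret prob_space "M N" by (rule prob_space_M[OF elim])
    let ?I = "{..<N} \<times> {..<N}"
    have [measurable]: "(\<lambda>\<omega>. Y N \<omega> $$ e) \<in> borel_measurable (M N)" if "e \<in> ?I" for e
      by (rule entry_measurable[OF that])
    have "{\<omega> \<in> space (M N). \<exists>e\<in>?I. \<bar>Y N \<omega> $$ e\<bar> > cutoff N} = (\<Union>e\<in>?I. {\<omega> \<in> space (M N). \<bar>Y N \<omega> $$ e\<bar> > cutoff N})"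
      by auto
    then have "prob {\<omega> \<in> space (M N). \<exists>e\<in>?I. \<bar>Y N \<omega> $$ e\<bar> > cutoff N} \<le> (\<Sum>e\<in>?I. prob {\<omega> \<in> space (M N). \<bar>Y N \<omega> $$ e\<bar> > cutoff N})"
      by (simp only:) (intro measure_UNION_le; measurable)
    also have "\<dots> \<le> (\<Sum>e\<in>?I. high_moment * cutoff N powr (- (6 + \<tau>)))"
    proof (rule sum_mono)
      fix e assume e: "e \<in> ?I"
      have "prob {\<omega> \<in> space (M N). \<bar>Y N \<omega> $$ e\<bar> > cutoff N} = measure (distr (M N) borel (\<lambda>\<omega>. Y N \<omega> $$ e)) {t. \<bar>t\<bar> > cutoff N}"
        using entry_measurable[OF e] by (subst measure_distr) (auto intro!: arg_cong[where f=prob])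
      also have "\<dots> = P.prob {\<omega> \<in> space P. \<bar>\<xi> \<omega>\<bar> > cutoff N}"
        unfolding entry_distr[OF e] by (subst measure_distr) (auto intro!: arg_cong[where f=P.prob])
      also have "\<dots> \<le> high_moment * cutoff N powr (- (6 + \<tau>))" by (rule prob_tail_le[OF cutoff_pos[OF elim]])
      finally show "prob {\<omega> \<in> space (M N). \<bar>Y N \<omega> $$ e\<bar> > cutoff N} \<le> high_moment * cutoff N powr (- (6 + \<tau>))" .
    qed
    finally have "real N * prob {\<omega> \<in> space (M N). \<exists>e\<in>?I. \<bar>Y N \<omega> $$ e\<bar> > cutoff N}
        \<le> real N * (\<Sum>e\<in>?I. high_moment * cutoff N powr (- (6 + \<tau>)))" by (rule mult_left_mono) simp
    also have "\<dots> = high_moment * (real N powr 3 * real N powr ((1 / 2 - \<epsilon>) * (- (6 + \<tau>))))"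
      using elim by (simp add: cutoff_powr[OF elim] powr_numeral power3_eq_cube)
    also have "\<dots> = high_moment * real N powr (- (\<tau> / 4))"
      unfolding powr_add[symmetric]
    proof (rule arg_cong[where f="\<lambda>s. high_moment * real N powr s"])
      have "\<epsilon> * (6 + \<tau>) = \<tau> / 4" using \<tau> by (simp add: \<epsilon>_def divide_simps)
      thus "3 + (1 / 2 - \<epsilon>) * (- (6 + \<tau>)) = - (\<tau> / 4)" by (simp add: algebra_simps)
    qed
    finally show ?case .
  qed
qed auto

end

section \<open>A bound on the eigenvalues with high probability\<close>

lemma arr_pow_cong:
  assumes "\<And>e. e \<in> {..<N} \<times> {..<N} \<Longrightarrow> x e = x' e"
  shows "j < N \<Longrightarrow> arr_pow N x n i j = arr_pow N x' n i j"
  by (induction n arbitrary: j) (auto intro!: sum.cong simp: assms)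

lemma arr_trace_cong:
  assumes "\<And>e. e \<in> {..<N} \<times> {..<N} \<Longrightarrow> x e = x' e"
  shows "arr_trace N x n = arr_trace N x' n"
  unfolding arr_trace_def by (intro sum.cong refl arr_pow_cong assms) auto

context iid_matrix_model
begin

text \<open>
  Long enough that \<open>\<rho>\<close> to this power beats every power of \<open>N\<close> for each \<open>\<rho> < 1\<close>, and shorter than
  every power of \<open>N\<close>.
\<close>

definition walk_length :: "nat \<Rightarrow> nat" where "walk_length N = nat \<lceil>(ln (real N))\<^sup>2\<rceil> + 1"

text \<open>
  No entry is truncated, and a power of the matrix is small. The second condition bounds the
  eigenvalues by \<open>r\<close> and, unlike that bound itself, is polynomial in the entries, so that
  its measurability is immediate.
\<close>

definition good_event :: "real \<Rightarrow> nat \<Rightarrow> 'b set" where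
  "good_event r N = {\<omega> \<in> space (M N). (\<forall>e\<in>{..<N} \<times> {..<N}. \<bar>Y N \<omega> $$ e\<bar> \<le> cutoff N) \<and>
     frobenius_sq N (\<lambda>e. trunc_entry N e \<omega>) (walk_length N) \<le> r ^ (2 * walk_length N)}"

lemma trunc_entry_measurable: "e \<in> {..<N} \<times> {..<N} \<Longrightarrow> trunc_entry N e \<in> borel_measurable (M N)"
  unfolding trunc_entry_def using entry_measurable by measurable

lemma arr_pow_measurable: "j < N \<Longrightarrow> i < N \<Longrightarrow> (\<lambda>\<omega>. arr_pow N (\<lambda>e. trunc_entry N e \<omega>) n i j) \<in> borel_measurable (M N)"
proof (induction n arbitrary: j)
  case (Suc n)
  have [measurable]: "trunc_entry N (k, j) \<in> borel_measurable (M N)" if "k < N" for k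
    using that Suc.prems by (intro trunc_entry_measurable) auto
  show ?case using Suc by (auto intro!: borel_measurable_sum borel_measurable_times)
qed simp

lemma frobenius_sq_measurable: "(\<lambda>\<omega>. frobenius_sq N (\<lambda>e. trunc_entry N e \<omega>) n) \<in> borel_measurable (M N)"
  unfolding frobenius_sq_def by (intro borel_measurable_sum borel_measurable_power arr_pow_measurable) auto

lemma arr_trace_measurable: "(\<lambda>\<omega>. arr_trace N (\<lambda>e. trunc_entry N e \<omega>) n) \<in> borel_measurable (M N)"
  unfolding arr_trace_def by (intro borel_measurable_sum arr_pow_measurable) auto

lemma sets_good_event [measurable]: "good_event r N \<in> sets (M N)"
proof -
  have [measurable]: "(\<lambda>\<omega>. Y N \<omega> $$ e) \<in> borel_measurable (M N)" if "e \<in> {..<N} \<times> {..<N}" for e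
    by (rule entry_measurable[OF that])
  note frobenius_sq_measurable [measurable]
  show ?thesis unfolding good_event_def by measurable
qed

lemma good_event_entries: "\<omega> \<in> good_event r N \<Longrightarrow> e \<in> {..<N} \<times> {..<N} \<Longrightarrow> trunc_entry N e \<omega> = scaled_entry N e \<omega>"
  by (auto simp: good_event_def scaled_entry_def trunc_entry_def trunc_def)

text \<open>
  Markov's inequality, with \<open>1 + \<eta>\<close> between 1 and \<open>r\<close>.
\<close>

lemma prob_frobenius_tendsto:
  assumes r: "r > 1"
  shows "(\<lambda>N. real N * measure (M N) {\<omega> \<in> space (M N). frobenius_sq N (\<lambda>e. trunc_entry N e \<omega>) (walk_length N) > r ^ (2 * walk_length N)}) \<longlonglongrightarrow> 0"
proof -
  define \<eta> where "\<eta> = (r - 1) / 2"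
  have \<eta>: "\<eta> > 0" "1 + \<eta> < r" using r by (auto simp: \<eta>_def field_simps)
  define \<rho> where "\<rho> = (1 + \<eta>) / r"
  have \<rho>: "0 < \<rho>" "\<rho> < 1" using \<eta> r by (auto simp: \<rho>_def)
  define \<kappa> where "\<kappa> = - 2 * ln \<rho>"
  have \<kappa>: "\<kappa> > 0" using \<rho> by (simp add: \<kappa>_def)
  define c where "c = 16 * (1 + \<eta>) / \<eta>"
  have c: "c > 0" using \<eta> by (simp add: c_def)
  have l: "(ln (real N))\<^sup>2 \<le> real (walk_length N)" "real (walk_length N) \<le> (ln (real N))\<^sup>2 + 2" for N
  proof -
    have "real (nat \<lceil>(ln (real N))\<^sup>2\<rceil>) = of_int \<lceil>(ln (real N))\<^sup>2\<rceil>"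
      by (rule of_nat_nat) (use zero_le_power2[of "ln (real N)"] in linarith)
    thus "(ln (real N))\<^sup>2 \<le> real (walk_length N)" "real (walk_length N) \<le> (ln (real N))\<^sup>2 + 2"
      unfolding walk_length_def of_nat_add by linarith+
  qed
  have \<epsilon>0: "\<epsilon> > 0" by (rule \<epsilon>)
  define D where "D = 32 * (1 + \<eta>) / \<eta>\<^sup>2"
  have D: "D > 0" using \<eta> by (simp add: D_def)
  have "(\<lambda>N. 4 * ((ln (real N))\<^sup>2 + 2) * real N powr (- \<epsilon>)) \<longlonglongrightarrow> 0" using \<epsilon>0 by real_asymp
  then have ev1: "\<forall>\<^sub>F N in sequentially. 4 * ((ln (real N))\<^sup>2 + 2) * real N powr (- \<epsilon>) < 1"
    by (rule order_tendstoD) simp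
  have "(\<lambda>N. D * ((ln (real N))\<^sup>2 + 2) ^ 3 / real N) \<longlonglongrightarrow> 0" by real_asymp
  then have ev2: "\<forall>\<^sub>F N in sequentially. D * ((ln (real N))\<^sup>2 + 2) ^ 3 / real N < 1"
    by (rule order_tendstoD) simp
  show ?thesis
  proof (rule tendsto_sandwich[of "\<lambda>_. 0" _ _ "\<lambda>N. real N * (real N * (c * ((ln (real N))\<^sup>2 + 2)\<^sup>2 * exp (- \<kappa> * (ln (real N))\<^sup>2)))"])
    show "(\<lambda>N. real N * (real N * (c * ((ln (real N))\<^sup>2 + 2)\<^sup>2 * exp (- \<kappa> * (ln (real N))\<^sup>2)))) \<longlonglongrightarrow> 0"
      using \<kappa> by real_asymp
    show "\<forall>\<^sub>F N in sequentially. real N * measure (M N) {\<omega> \<in> space (M N). frobenius_sq N (\<lambda>e. trunc_entry N e \<omega>) (walk_length N) > r ^ (2 * walk_length N)}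
      \<le> real N * (real N * (c * ((ln (real N))\<^sup>2 + 2)\<^sup>2 * exp (- \<kappa> * (ln (real N))\<^sup>2)))"
      using iid_array_eventually ev1 ev2 eventually_ge_at_top[of 1]
    proof eventually_elim
      case (elim N)
      interpret A: iid_array "M N" N "trunc_entry N" "\<mu> N" "q N" by (rule elim(1))
      define n where "n = walk_length N"
      have n1: "n \<ge> 1" by (simp add: n_def walk_length_def)
      note ln = l[of N, folded n_def]
      have "4 * real n * q N \<le> 4 * ((ln (real N))\<^sup>2 + 2) * real N powr (- \<epsilon>)"
        unfolding q_def using ln by (intro mult_right_mono) auto
      hence c1: "4 * real n * q N \<le> 1" using elim(2) by simp
      have "D * real n ^ 3 \<le> D * ((ln (real N))\<^sup>2 + 2) ^ 3"
        using ln D by (intro mult_left_mono power_mono) auto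
      also have "\<dots> \<le> real N" using elim(3,4) by (simp add: field_simps)
      finally have c2: "32 * real n ^ 3 * (1 + \<eta>) \<le> \<eta>\<^sup>2 * real N"
        using \<eta> by (simp add: D_def field_simps)
      note F = A.expectation_frobenius_sq_le[OF \<eta>(1) n1 c1 c2]
      have rn: "r ^ (2 * n) > 0" using r by simp
      have "A.prob {\<omega> \<in> space (M N). frobenius_sq N (\<lambda>e. trunc_entry N e \<omega>) n > r ^ (2 * n)}
          \<le> A.prob {\<omega> \<in> space (M N). frobenius_sq N (\<lambda>e. trunc_entry N e \<omega>) n \<ge> r ^ (2 * n)}"
        using frobenius_sq_measurable[of N n] by (intro A.finite_measure_mono) auto
      also have "\<dots> \<le> A.expectation (\<lambda>\<omega>. frobenius_sq N (\<lambda>e. trunc_entry N e \<omega>) n) / r ^ (2 * n)"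
        using rn by (intro integral_Markov_inequality_measure[OF F(1) sets.empty_sets]) (auto simp: frobenius_sq_def intro!: sum_nonneg)
      also have "\<dots> \<le> real N * ((16 * real n ^ 2 * (1 + \<eta>) / \<eta>) * (1 + \<eta>) ^ (2 * n)) / r ^ (2 * n)"
        using rn by (intro divide_right_mono F(2)) auto
      also have "\<dots> = real N * (c * real n ^ 2 * \<rho> ^ (2 * n))"
        by (simp add: c_def \<rho>_def power_divide)
      also have "\<dots> \<le> real N * (c * ((ln (real N))\<^sup>2 + 2)\<^sup>2 * exp (- \<kappa> * (ln (real N))\<^sup>2))"
      proof (intro mult_left_mono mult_mono power_mono)
        have "\<rho> ^ (2 * n) = exp (real (2 * n) * ln \<rho>)" using \<rho> by (simp only: exp_of_nat_mult exp_ln)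
        also have "\<dots> = exp (- \<kappa> * real n)" by (simp add: \<kappa>_def)
        also have "\<dots> \<le> exp (- \<kappa> * (ln (real N))\<^sup>2)" using \<kappa> ln by simp
        finally show "\<rho> ^ (2 * n) \<le> exp (- \<kappa> * (ln (real N))\<^sup>2)" .
      qed (use ln c \<rho> in auto)
      finally show ?case unfolding n_def by (rule mult_left_mono) simp
    qed
  qed auto
qed

lemma prob_bad_tendsto:
  assumes r: "r > 1"
  shows "(\<lambda>N. real N * measure (M N) (space (M N) - good_event r N)) \<longlonglongrightarrow> 0"
proof -
  let ?A = "\<lambda>N. {\<omega> \<in> space (M N). \<exists>e\<in>{..<N} \<times> {..<N}. \<bar>Y N \<omega> $$ e\<bar> > cutoff N}"
  let ?B = "\<lambda>N. {\<omega> \<in> space (M N). frobenius_sq N (\<lambda>e. trunc_entry N e \<omega>) (walk_length N) > r ^ (2 * walk_length N)}"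
  have lim: "(\<lambda>N. real N * measure (M N) (?A N) + real N * measure (M N) (?B N)) \<longlonglongrightarrow> 0"
    by (rule tendsto_add_zero[OF prob_truncated_tendsto prob_frobenius_tendsto[OF r]])
  show ?thesis
  proof (rule tendsto_sandwich[OF _ _ tendsto_const lim])
    show "\<forall>\<^sub>F N in sequentially. real N * measure (M N) (space (M N) - good_event r N)
        \<le> real N * measure (M N) (?A N) + real N * measure (M N) (?B N)"
      using eventually_ge_at_top[of 1]
    proof eventually_elim
      case (elim N)
      interpret prob_space "M N" by (rule prob_space_M[OF elim])
      have [measurable]: "(\<lambda>\<omega>. Y N \<omega> $$ e) \<in> borel_measurable (M N)" if "e \<in> {..<N} \<times> {..<N}" for e
        by (rule entry_measurable[OF that])
      note frobenius_sq_measurable [measurable]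
      have s: "?A N \<in> sets (M N)" "?B N \<in> sets (M N)" by measurable
      have "space (M N) - good_event r N = ?A N \<union> ?B N"
        unfolding good_event_def by (auto simp only: not_le[symmetric])
      hence "prob (space (M N) - good_event r N) \<le> prob (?A N) + prob (?B N)"
        using measure_Un_le[OF s] by (simp only:)
      hence "real N * prob (space (M N) - good_event r N) \<le> real N * (prob (?A N) + prob (?B N))"
        by (rule mult_left_mono) simp
      thus ?case by (simp only: distrib_left)
    qed
  qed auto
qed

end

section \<open>Approximating a linear statistic by traces of powers\<close>

context iid_matrix_model
begin

lemma scaled_matrix_eq:
  assumes "N \<ge> 1" "\<omega> \<in> space (M N)"
  shows "scaled_matrix N (Y N \<omega>) = arr_mat N (\<lambda>e. scaled_entry N e \<omega>)"
proof -
  have "Y N \<omega> \<in> carrier_mat N N" using Y[OF assms(1)] assms(2) by (simp add: iid_random_matrix_def)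
  thus ?thesis by (intro eq_matI) (auto simp: scaled_matrix_def arr_mat_def scaled_entry_def)
qed

lemma scaled_entry_measurable: "e \<in> {..<N} \<times> {..<N} \<Longrightarrow> scaled_entry N e \<in> borel_measurable (M N)"
  unfolding scaled_entry_def using entry_measurable by measurable

lemma trace_statistic_measurable:
  assumes "N \<ge> 1" "f \<in> borel_measurable borel"
  shows "(\<lambda>\<omega>. trace_fun f (scaled_matrix N (Y N \<omega>))) \<in> borel_measurable (M N)"
proof -
  have "(\<lambda>\<omega>. trace_fun f (arr_mat N (\<lambda>e. scaled_entry N e \<omega>))) \<in> borel_measurable (M N)"
    by (rule trace_fun_measurable[OF assms(2) scaled_entry_measurable])
  thus ?thesis by (rule measurable_cong[THEN iffD1, rotated]) (simp add: scaled_matrix_eq[OF assms(1)])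
qed

text \<open>
  On the good event the truncated and the original array agree, so the same numbers describe the
  determinant of the original array and the traces of the truncated one.
\<close>

lemma good_event_roots:
  assumes \<omega>: "\<omega> \<in> good_event r N" and r: "r \<ge> 0"
  obtains l :: "nat \<Rightarrow> complex"
  where "\<And>t. char_det N (\<lambda>p. of_int (sign p)) (\<lambda>e. scaled_entry N e \<omega>) t = (\<Prod>i<N. t - l i)"
    and "\<And>f. trace_fun f (arr_mat N (\<lambda>e. scaled_entry N e \<omega>)) = (\<Sum>i<N. f (l i))"
    and "\<And>m. (\<Sum>i<N. l i ^ m) = of_real (arr_trace N (\<lambda>e. trunc_entry N e \<omega>) m)"
    and "\<And>i. i < N \<Longrightarrow> norm (l i) \<le> r"
proof -
  obtain l :: "nat \<Rightarrow> complex" where l: "\<And>t. char_det N (\<lambda>p. of_int (sign p)) (\<lambda>e. scaled_entry N e \<omega>) t = (\<Prod>i<N. t - l i)"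
    "\<And>f. trace_fun f (arr_mat N (\<lambda>e. scaled_entry N e \<omega>)) = (\<Sum>i<N. f (l i))"
    "\<And>m. (\<Sum>i<N. l i ^ m) = of_real (arr_trace N (\<lambda>e. scaled_entry N e \<omega>) m)"
    "\<And>i n. i < N \<Longrightarrow> norm (l i) ^ (2 * n) \<le> frobenius_sq N (\<lambda>e. scaled_entry N e \<omega>) n"
    using char_poly_arr_mat_roots[of N "\<lambda>e. scaled_entry N e \<omega>"] by metis
  note xy = good_event_entries[OF \<omega>]
  have "frobenius_sq N (\<lambda>e. scaled_entry N e \<omega>) n = frobenius_sq N (\<lambda>e. trunc_entry N e \<omega>) n" for n
    unfolding frobenius_sq_def using arr_pow_cong[of N "\<lambda>e. trunc_entry N e \<omega>" "\<lambda>e. scaled_entry N e \<omega>", OF xy] by (intro sum.cong refl) auto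
  moreover have "frobenius_sq N (\<lambda>e. trunc_entry N e \<omega>) (walk_length N) \<le> r ^ (2 * walk_length N)"
    using \<omega> by (simp add: good_event_def)
  ultimately have "norm (l i) ^ (2 * walk_length N) \<le> r ^ (2 * walk_length N)" if "i < N" for i
    using l(4)[OF that, of "walk_length N"] by simp
  then have lr: "norm (l i) \<le> r" if "i < N" for i
    using that power_le_imp_le_base[of "norm (l i)" "2 * walk_length N - 1" r] r by (simp add: walk_length_def)
  have tr: "(\<Sum>i<N. l i ^ m) = of_real (arr_trace N (\<lambda>e. trunc_entry N e \<omega>) m)" for m
    unfolding l(3)[of m] using arr_trace_cong[of N "\<lambda>e. trunc_entry N e \<omega>" "\<lambda>e. scaled_entry N e \<omega>" m, OF xy] by simp
  show thesis by (rule that[OF l(1,2) tr lr])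
qed

text \<open>
  The power sum is bounded by averages of squared determinants, and these have bounded expectation.
  The determinant belongs to the original entries, which are exactly centered with variance \<open>1 / N\<close>,
  while the trace belongs to the truncated ones. The error \<open>e\<close> absorbs the discretization of the circle.
\<close>

lemma expectation_trace_good_le:
  assumes N: "N \<ge> 1" and m: "m \<ge> 1" and r: "1 < r" "r < R"
  shows "(\<integral>\<^sup>+\<omega>. ennreal \<bar>arr_trace N (\<lambda>e. trunc_entry N e \<omega>) m\<bar> * indicator (good_event r N) \<omega> \<partial>M N)
    \<le> ennreal (4 * real m * R ^ m / (1 - 1 / R\<^sup>2))"
proof -
  interpret prob_space "M N" by (rule prob_space_M[OF N])
  have R: "R > 1" and r0: "r \<ge> 0" using r by simp_all
  have "R\<^sup>2 > 1" using R by (simp add: one_less_power)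
  then have R2: "1 - 1 / R\<^sup>2 > 0" by (simp add: divide_simps)
  have R2N: "R ^ (2 * N) > 0" using R by simp
  have sq: "(scaled_entry N e \<omega>)\<^sup>2 = (Y N \<omega> $$ e)\<^sup>2 / real N" for e \<omega> by (simp add: scaled_entry_def power_divide)
  let ?D = "\<lambda>t \<omega>. (norm (char_det N (\<lambda>p. of_int (sign p)) (\<lambda>e. scaled_entry N e \<omega>) t))\<^sup>2"
  have D: "integrable (M N) (?D t)" "expectation (?D t) \<le> norm t ^ (2 * N) / (1 - 1 / (norm t)\<^sup>2)" if "norm t > 1" for t
  proof -
    have ind: "indep_vars (\<lambda>_. borel) (scaled_entry N) ({..<N} \<times> {..<N})"
      unfolding scaled_entry_def by (rule indep_vars_compose2[OF entries_indep[OF N]]) auto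
    have i: "integrable (M N) (\<lambda>\<omega>. (scaled_entry N e \<omega>)\<^sup>2)" if "e \<in> {..<N} \<times> {..<N}" for e
      unfolding sq using entry_integral(2)[OF that, of "\<lambda>t. t\<^sup>2 / real N"] \<xi>_power_integrable[of 2] by simp
    have me: "expectation (scaled_entry N e) = 0" if "e \<in> {..<N} \<times> {..<N}" for e
      unfolding scaled_entry_def using entry_integral(1)[OF that, of "\<lambda>t. t / sqrt (real N)"] mean by simp
    have v: "expectation (\<lambda>\<omega>. (scaled_entry N e \<omega>)\<^sup>2) = 1 / real N" if "e \<in> {..<N} \<times> {..<N}" for e
      unfolding sq using entry_integral(1)[OF that, of "\<lambda>t. t\<^sup>2 / real N"] \<xi>_sq by simp
    have s: "norm (of_int (sign p) :: complex) = 1" for p :: "nat \<Rightarrow> nat" by (cases rule: sign_cases[of p]) auto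
    show "integrable (M N) (?D t)" "expectation (?D t) \<le> norm t ^ (2 * N) / (1 - 1 / (norm t)\<^sup>2)"
      by (rule expectation_char_det_sq_le[OF ind i me v s N that]; assumption)+
  qed
  show ?thesis
  proof (rule ennreal_le_epsilon)
    fix e :: real assume e: "e > 0"
    obtain n0 where n0: "\<And>n l. n \<ge> n0 \<Longrightarrow> (\<And>i. i < N \<Longrightarrow> norm (l i) \<le> r) \<Longrightarrow>
      norm (\<Sum>i<N. l i ^ m) \<le> 4 * real m * R ^ m * ((\<Sum>j<n. (norm (\<Prod>i<N. of_real R * cis (2 * pi * real j / real n) - l i) / R ^ N)\<^sup>2) / real n) + e"
    proof -
      have "\<exists>n0. \<forall>n\<ge>n0. \<forall>l. (\<forall>i\<in>{..<N}. norm (l i) \<le> r) \<longrightarrow>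
        norm (\<Sum>i<N. l i ^ m) \<le> 4 * real m * R ^ m * ((\<Sum>j<n. (norm (\<Prod>i<N. of_real R * cis (2 * pi * real j / real n) - l i) / R ^ N)\<^sup>2) / real n) + e"
        using power_sum_le_average_sq[of "{..<N}" r R m e] r m e by (simp only: finite_lessThan card_lessThan simp_thms)
      then show thesis using that by (meson lessThan_iff)
    qed
    define n where "n = max n0 1"
    have n: "n \<ge> n0" "n \<ge> 1" by (auto simp: n_def)
    let ?t = "\<lambda>j. of_real R * cis (2 * pi * real j / real n)"
    have nt: "norm (?t j) = R" for j using R by (simp add: norm_mult)
    define H where "H \<omega> = 4 * real m * R ^ m * ((\<Sum>j<n. ?D (?t j) \<omega> / R ^ (2 * N)) / real n) + e" for \<omega>
    have Hi: "integrable (M N) H"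
      unfolding H_def using D(1) nt R by (intro Bochner_Integration.integrable_add integrable_mult_right integrable_divide Bochner_Integration.integrable_sum) auto
    have Hle: "\<bar>arr_trace N (\<lambda>e. trunc_entry N e \<omega>) m\<bar> \<le> H \<omega>" if \<omega>: "\<omega> \<in> good_event r N" for \<omega>
    proof -
      obtain l :: "nat \<Rightarrow> complex" where l: "\<And>t. char_det N (\<lambda>p. of_int (sign p)) (\<lambda>e. scaled_entry N e \<omega>) t = (\<Prod>i<N. t - l i)"
        "\<And>f. trace_fun f (arr_mat N (\<lambda>e. scaled_entry N e \<omega>)) = (\<Sum>i<N. f (l i))"
        "\<And>m. (\<Sum>i<N. l i ^ m) = of_real (arr_trace N (\<lambda>e. trunc_entry N e \<omega>) m)" "\<And>i. i < N \<Longrightarrow> norm (l i) \<le> r"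
        using good_event_roots[OF \<omega> r0] by metis
      have "\<bar>arr_trace N (\<lambda>e. trunc_entry N e \<omega>) m\<bar> = norm (\<Sum>i<N. l i ^ m)" by (simp add: l(3))
      also have "\<dots> \<le> 4 * real m * R ^ m * ((\<Sum>j<n. (norm (\<Prod>i<N. ?t j - l i) / R ^ N)\<^sup>2) / real n) + e"
        by (rule n0[OF n(1) l(4)])
      also have "\<dots> = H \<omega>" by (simp add: H_def l(1) power_divide power_mult mult.commute[of 2])
      finally show ?thesis .
    qed
    have H0: "H \<omega> \<ge> 0" for \<omega> unfolding H_def using R e by (intro add_nonneg_nonneg mult_nonneg_nonneg divide_nonneg_nonneg sum_nonneg) auto
    have "(\<integral>\<^sup>+\<omega>. ennreal \<bar>arr_trace N (\<lambda>e. trunc_entry N e \<omega>) m\<bar> * indicator (good_event r N) \<omega> \<partial>M N) \<le> (\<integral>\<^sup>+\<omega>. ennreal (H \<omega>) \<partial>M N)"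
      by (rule nn_integral_mono) (auto simp: indicator_def intro!: ennreal_leI Hle)
    also have "\<dots> = ennreal (expectation H)" by (rule nn_integral_eq_integral[OF Hi]) (simp add: H0)
    also have "ennreal (expectation H) \<le> ennreal (4 * real m * R ^ m / (1 - 1 / R\<^sup>2)) + ennreal e"
    proof -
      have "expectation H = 4 * real m * R ^ m * ((\<Sum>j<n. expectation (?D (?t j)) / R ^ (2 * N)) / real n) + e"
        unfolding H_def using D(1) nt R by (simp add: prob_space)
      also have "\<dots> \<le> 4 * real m * R ^ m * ((\<Sum>j<n. 1 / (1 - 1 / R\<^sup>2)) / real n) + e"
      proof -
        have "expectation (?D (?t j)) / R ^ (2 * N) \<le> 1 / (1 - 1 / R\<^sup>2)" for j
          using D(2)[of "?t j"] R R2N R2 unfolding nt by (simp add: divide_simps mult.commute)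
        thus ?thesis using R by (intro add_right_mono mult_left_mono divide_right_mono sum_mono) auto
      qed
      also have "\<dots> = 4 * real m * R ^ m / (1 - 1 / R\<^sup>2) + e" using n by simp
      finally have "expectation H \<le> 4 * real m * R ^ m / (1 - 1 / R\<^sup>2) + e" .
      thus ?thesis using e R R2 by (simp add: ennreal_leI flip: ennreal_plus)
    qed
    finally show "(\<integral>\<^sup>+\<omega>. ennreal \<bar>arr_trace N (\<lambda>e. trunc_entry N e \<omega>) m\<bar> * indicator (good_event r N) \<omega> \<partial>M N)
      \<le> ennreal (4 * real m * R ^ m / (1 - 1 / R\<^sup>2)) + ennreal e" .
  qed
qed


lemma trace_tail_on_good:
  fixes a :: "nat \<Rightarrow> real" and f :: "complex \<Rightarrow> complex"
  assumes N: "N \<ge> 1" and r: "1 < r" and \<omega>: "\<omega> \<in> good_event r N"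
    and f: "\<And>z. norm z \<le> r \<Longrightarrow> (\<lambda>m. of_real (a m) * z ^ m) sums f z"
    and a: "summable (\<lambda>m. \<bar>a m\<bar> * r ^ m)"
  shows "ennreal (norm (trace_fun f (scaled_matrix N (Y N \<omega>)) - of_nat N * f 0
        - of_real (\<Sum>m\<in>{1..L}. a m * arr_trace N (\<lambda>e. trunc_entry N e \<omega>) m)))
    \<le> (\<Sum>m. ennreal (\<bar>a (m + Suc L)\<bar> * \<bar>arr_trace N (\<lambda>e. trunc_entry N e \<omega>) (m + Suc L)\<bar>))"
proof -
  have r0: "r \<ge> 0" using r by simp
  have sp: "\<omega> \<in> space (M N)" using \<omega> by (simp add: good_event_def)
  obtain l :: "nat \<Rightarrow> complex" where l: "\<And>t. char_det N (\<lambda>p. of_int (sign p)) (\<lambda>e. scaled_entry N e \<omega>) t = (\<Prod>i<N. t - l i)"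
    "\<And>f. trace_fun f (arr_mat N (\<lambda>e. scaled_entry N e \<omega>)) = (\<Sum>i<N. f (l i))"
    "\<And>m. (\<Sum>i<N. l i ^ m) = of_real (arr_trace N (\<lambda>e. trunc_entry N e \<omega>) m)" "\<And>i. i < N \<Longrightarrow> norm (l i) \<le> r"
    using good_event_roots[OF \<omega> r0] by metis
  define T where "T m = arr_trace N (\<lambda>e. trunc_entry N e \<omega>) m" for m
  have T: "(\<Sum>i<N. l i ^ m) = of_real (T m)" for m by (simp add: T_def l(3))
  have "complex_of_real (T 0) = of_real (real N)" using T[of 0] by simp
  then have T0: "T 0 = real N" by (rule of_real_eq_iff[THEN iffD1])
  have Tle: "\<bar>T m\<bar> \<le> real N * r ^ m" for m
  proof -
    have "\<bar>T m\<bar> = norm (\<Sum>i<N. l i ^ m)" by (simp add: T)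
    also have "\<dots> \<le> (\<Sum>i<N. r ^ m)" by (rule sum_norm_le) (auto simp: norm_power intro!: power_mono l(4))
    finally show ?thesis by simp
  qed
  have sumT: "summable (\<lambda>m. \<bar>a m\<bar> * \<bar>T m\<bar>)"
  proof (rule summable_comparison_test'[OF summable_mult[OF a, of "real N"]])
    fix m show "norm (\<bar>a m\<bar> * \<bar>T m\<bar>) \<le> real N * (\<bar>a m\<bar> * r ^ m)"
      using mult_left_mono[OF Tle[of m], of "\<bar>a m\<bar>"] by (simp add: abs_mult mult_ac)
  qed
  have "(\<lambda>m. \<Sum>i<N. of_real (a m) * l i ^ m) sums (\<Sum>i<N. f (l i))"
    by (intro sums_sum f l(4)) auto
  then have s: "(\<lambda>m. of_real (a m * T m)) sums (\<Sum>i<N. f (l i))"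
    by (simp add: T flip: sum_distrib_left)
  have f0: "f 0 = of_real (a 0)"
  proof -
    have "(\<lambda>m. of_real (a m) * 0 ^ m) sums f 0" using r by (intro f) simp
    moreover have "(\<lambda>m. of_real (a m) * 0 ^ m) sums (of_real (a 0) :: complex)"
      using powser_sums_zero[of "\<lambda>m. complex_of_real (a m)"] by simp
    ultimately show ?thesis by (rule sums_unique2)
  qed
  have "(\<lambda>m. of_real (a (m + Suc L) * T (m + Suc L))) sums ((\<Sum>i<N. f (l i)) - (\<Sum>m<Suc L. complex_of_real (a m * T m)))"
    using s by (subst sums_iff_shift) simp
  moreover have "(\<Sum>m<Suc L. complex_of_real (a m * T m)) = of_nat N * f 0 + of_real (\<Sum>m\<in>{1..L}. a m * T m)"
  proof -
    have "{..<Suc L} = insert 0 {1..L}" by auto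
    thus ?thesis by (simp add: T0 f0 mult.commute)
  qed
  ultimately have "(\<lambda>m. complex_of_real (a (m + Suc L) * T (m + Suc L))) sums ((\<Sum>i<N. f (l i)) - of_nat N * f 0 - of_real (\<Sum>m\<in>{1..L}. a m * T m))"
    by (simp add: diff_diff_eq)
  then have eq: "(\<Sum>i<N. f (l i)) - of_nat N * f 0 - of_real (\<Sum>m\<in>{1..L}. a m * T m) = (\<Sum>m. complex_of_real (a (m + Suc L) * T (m + Suc L)))"
    by (rule sums_unique)
  have sumT': "summable (\<lambda>m. \<bar>a (m + Suc L)\<bar> * \<bar>T (m + Suc L)\<bar>)"
    by (rule summable_ignore_initial_segment[OF sumT])
  have "norm (\<Sum>m. complex_of_real (a (m + Suc L) * T (m + Suc L))) \<le> (\<Sum>m. \<bar>a (m + Suc L)\<bar> * \<bar>T (m + Suc L)\<bar>)"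
    using summable_norm[of "\<lambda>m. complex_of_real (a (m + Suc L) * T (m + Suc L))"] sumT' by (simp add: norm_mult)
  then have "ennreal (norm (\<Sum>m. complex_of_real (a (m + Suc L) * T (m + Suc L)))) \<le> ennreal (\<Sum>m. \<bar>a (m + Suc L)\<bar> * \<bar>T (m + Suc L)\<bar>)"
    by (rule ennreal_leI)
  also have "\<dots> = (\<Sum>m. ennreal (\<bar>a (m + Suc L)\<bar> * \<bar>T (m + Suc L)\<bar>))"
    by (rule suminf_ennreal2[symmetric, OF _ sumT']) simp
  finally show ?thesis
    unfolding scaled_matrix_eq[OF N sp] l(2) T_def[symmetric] eq .
qed


lemma trunc_trace_sum_moment:
  fixes t :: "nat \<Rightarrow> real"
  assumes "finite S" "\<And>l. l \<in> S \<Longrightarrow> l \<ge> 1"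
  shows "(\<lambda>N. \<integral>\<omega>. (\<Sum>l\<in>S. t l * arr_trace N (\<lambda>e. trunc_entry N e \<omega>) l) ^ r \<partial>M N)
    \<longlonglongrightarrow> gauss_moment (\<Sum>l\<in>S. if even l then t l else 0) (\<Sum>l\<in>S. real l * (t l)\<^sup>2) r"
  by (rule trace_moments_tendsto[OF iid_array_eventually q_tendsto second_moment_tendsto assms])

lemma trunc_trace_sum_integrable:
  fixes t :: "nat \<Rightarrow> real"
  assumes "finite S" "\<And>l. l \<in> S \<Longrightarrow> l \<ge> 1"
  shows "\<forall>\<^sub>F N in sequentially. \<forall>r. integrable (M N) (\<lambda>\<omega>. (\<Sum>l\<in>S. t l * arr_trace N (\<lambda>e. trunc_entry N e \<omega>) l) ^ r)"
  using iid_array_eventually by eventually_elim (use iid_array.arr_trace_moment(1) assms in blast)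

text \<open>
  On the good event the statistic differs from the truncated power series by its tail; off the
  good event the statistic is at most of order \<open>N\<close>, while that event has probability
  \<open>o(1/N)\<close>.
\<close>

theorem linear_statistic_approx:
  fixes a :: "nat \<Rightarrow> real" and f :: "complex \<Rightarrow> complex"
  assumes r: "1 < r" "r < R" and fb: "f \<in> borel_measurable borel"
    and f: "\<And>z. norm z \<le> r \<Longrightarrow> (\<lambda>m. of_real (a m) * z ^ m) sums f z"
    and a: "summable (\<lambda>m. \<bar>a m\<bar> * real m * R ^ m)" and C: "\<And>z. norm (f z) \<le> C" and e: "e > 0"
  shows "\<exists>L0. \<forall>L\<ge>L0. \<forall>\<^sub>F N in sequentially.
    integrable (M N) (\<lambda>\<omega>. norm (trace_fun f (scaled_matrix N (Y N \<omega>)) - of_nat N * f 0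
        - of_real (\<Sum>m\<in>{1..L}. a m * arr_trace N (\<lambda>e. trunc_entry N e \<omega>) m))) \<and>
    (\<integral>\<omega>. norm (trace_fun f (scaled_matrix N (Y N \<omega>)) - of_nat N * f 0
        - of_real (\<Sum>m\<in>{1..L}. a m * arr_trace N (\<lambda>e. trunc_entry N e \<omega>) m)) \<partial>M N) \<le> e"
proof -
  have R: "R > 1" using r by simp
  have "R\<^sup>2 > 1" using R by (simp add: one_less_power)
  then have R2: "1 - 1 / R\<^sup>2 > 0" by (simp add: divide_simps)
  have C0: "C \<ge> 0" using C[of 0] norm_ge_zero order_trans by blast
  define c where "c = 4 / (1 - 1 / R\<^sup>2)"
  have c: "c > 0" using R2 by (simp add: c_def)
  define b where "b m = c * (\<bar>a m\<bar> * real m * R ^ m)" for m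
  have bs: "summable b" unfolding b_def by (intro summable_mult a)
  have b0: "b m \<ge> 0" for m using c R by (simp add: b_def)
  have ar: "summable (\<lambda>m. \<bar>a m\<bar> * r ^ m)"
  proof (rule summable_comparison_test_ev[OF _ a])
    show "\<forall>\<^sub>F m in sequentially. norm (\<bar>a m\<bar> * r ^ m) \<le> \<bar>a m\<bar> * real m * R ^ m"
      using eventually_ge_at_top[of 1]
    proof eventually_elim
      case (elim m)
      have "1 * r ^ m \<le> real m * R ^ m" using elim r by (intro mult_mono power_mono) auto
      thus ?case using r mult_left_mono[of "r ^ m" "real m * R ^ m" "\<bar>a m\<bar>"] by (simp add: abs_mult mult.assoc)
    qed
  qed
  have "(\<lambda>L. \<Sum>m. b (m + Suc L)) \<longlonglongrightarrow> 0"
    using suminf_exist_split2[OF bs] by (rule LIMSEQ_Suc)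
  then have "\<forall>\<^sub>F L in sequentially. (\<Sum>m. b (m + Suc L)) < e / 2" using e by (intro order_tendstoD) auto
  then obtain L0 where L0: "\<And>L. L \<ge> L0 \<Longrightarrow> (\<Sum>m. b (m + Suc L)) < e / 2" by (auto simp: eventually_sequentially)
  show ?thesis
  proof (intro exI[of _ L0] allI impI)
    fix L assume L: "L \<ge> L0"
    define U where "U N \<omega> = (\<Sum>m\<in>{1..L}. a m * arr_trace N (\<lambda>e. trunc_entry N e \<omega>) m)" for N \<omega>
    define D where "D N \<omega> = norm (trace_fun f (scaled_matrix N (Y N \<omega>)) - of_nat N * f 0 - of_real (U N \<omega>))" for N \<omega>
    define p where "p N = measure (M N) (space (M N) - good_event r N)" for N
    have mom: "(\<lambda>N. (\<integral>\<omega>. (U N \<omega>)\<^sup>2 \<partial>M N) / real N + (2 * C + 1) * (real N * p N)) \<longlonglongrightarrow> 0 + (2 * C + 1) * 0"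
      unfolding p_def U_def
      by (intro tendsto_add tendsto_mult tendsto_const prob_bad_tendsto r(1)
        tendsto_divide_0[OF trunc_trace_sum_moment] filterlim_real_sequentially[THEN filterlim_mono[OF _ at_top_le_at_infinity order_refl]]) auto
    then have ev: "\<forall>\<^sub>F N in sequentially. (\<integral>\<omega>. (U N \<omega>)\<^sup>2 \<partial>M N) / real N + (2 * C + 1) * (real N * p N) < e / 2"
      using e by (intro order_tendstoD) auto
    have Ui: "\<forall>\<^sub>F N in sequentially. \<forall>r. integrable (M N) (\<lambda>\<omega>. U N \<omega> ^ r)"
      unfolding U_def by (rule trunc_trace_sum_integrable) auto
    have "\<forall>\<^sub>F N in sequentially. integrable (M N) (D N) \<and> (\<integral>\<omega>. D N \<omega> \<partial>M N) \<le> e"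
      using ev Ui eventually_ge_at_top[of 1]
    proof eventually_elim
      case (elim N)
      interpret prob_space "M N" by (rule prob_space_M[OF elim(3)])
      note arr_trace_measurable [measurable] trace_statistic_measurable[OF elim(3) fb, measurable]
      have [measurable]: "U N \<in> borel_measurable (M N)" unfolding U_def by measurable
      have [measurable]: "D N \<in> borel_measurable (M N)" unfolding D_def by measurable
      let ?G = "good_event r N" and ?B = "space (M N) - good_event r N"
      let ?t = "\<lambda>m \<omega>. ennreal (\<bar>a (m + Suc L)\<bar> * \<bar>arr_trace N (\<lambda>e. trunc_entry N e \<omega>) (m + Suc L)\<bar>)"
      have bad: "D N \<omega> \<le> (U N \<omega>)\<^sup>2 / real N + (2 * C + 1) * real N" if sp: "\<omega> \<in> space (M N)" for \<omega>
      proof -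
        obtain l :: "nat \<Rightarrow> complex" where l: "\<And>t. char_det N (\<lambda>p. of_int (sign p)) (\<lambda>e. scaled_entry N e \<omega>) t = (\<Prod>i<N. t - l i)"
          "\<And>f. trace_fun f (arr_mat N (\<lambda>e. scaled_entry N e \<omega>)) = (\<Sum>i<N. f (l i))"
          using char_poly_arr_mat_roots[of N "\<lambda>e. scaled_entry N e \<omega>"] by metis
        have "norm (\<Sum>i<N. f (l i)) \<le> (\<Sum>i<N. C)" by (rule sum_norm_le) (rule C)
        moreover have "norm (of_nat N * f 0) \<le> real N * C" by (simp add: norm_mult mult_left_mono C)
        \<comment> \<open>trading \<open>\<bar>U\<bar>\<close> for \<open>U\<^sup>2 / N\<close> plus a constant of order \<open>N\<close> makes bounded second moments enough\<close>
        moreover have "\<bar>U N \<omega>\<bar> \<le> (U N \<omega>)\<^sup>2 / real N + real N"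
        proof (cases "\<bar>U N \<omega>\<bar> \<le> real N")
          case False
          have "\<bar>U N \<omega>\<bar> * real N \<le> \<bar>U N \<omega>\<bar> * \<bar>U N \<omega>\<bar>" using False by (intro mult_left_mono) auto
          then have "\<bar>U N \<omega>\<bar> \<le> (U N \<omega>)\<^sup>2 / real N" using elim(3) by (simp add: divide_simps power2_eq_square)
          thus ?thesis by simp
        qed (simp add: add_increasing)
        ultimately have "norm (\<Sum>i<N. f (l i)) + norm (of_nat N * f 0) + norm (complex_of_real (U N \<omega>)) \<le> (U N \<omega>)\<^sup>2 / real N + (2 * C + 1) * real N"
          by (simp add: algebra_simps)
        moreover have "D N \<omega> \<le> norm (\<Sum>i<N. f (l i)) + norm (of_nat N * f 0) + norm (complex_of_real (U N \<omega>))"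
          unfolding D_def scaled_matrix_eq[OF elim(3) sp] l(2)
          using norm_triangle_ineq4[of "\<Sum>i<N. f (l i)" "of_nat N * f 0"]
            norm_triangle_ineq4[of "(\<Sum>i<N. f (l i)) - of_nat N * f 0" "complex_of_real (U N \<omega>)"] by linarith
        ultimately show ?thesis by simp
      qed
      have ptw: "ennreal (D N \<omega>) \<le> (\<Sum>m. ?t m \<omega> * indicator ?G \<omega>)
          + ennreal ((U N \<omega>)\<^sup>2 / real N + (2 * C + 1) * real N * indicator ?B \<omega>)" if sp: "\<omega> \<in> space (M N)" for \<omega>
      proof (cases "\<omega> \<in> ?G")
        case True
        have "ennreal (D N \<omega>) \<le> (\<Sum>m. ?t m \<omega>)"
          unfolding D_def U_def by (rule trace_tail_on_good[OF elim(3) r(1) True f ar])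
        thus ?thesis using True by (simp add: add_increasing2)
      next
        case False
        thus ?thesis using ennreal_leI[OF bad[OF sp]] sp by simp
      qed
      have "(\<integral>\<^sup>+\<omega>. ennreal (D N \<omega>) \<partial>M N) \<le> (\<integral>\<^sup>+\<omega>. (\<Sum>m. ?t m \<omega> * indicator ?G \<omega>)
          + ennreal ((U N \<omega>)\<^sup>2 / real N + (2 * C + 1) * real N * indicator ?B \<omega>) \<partial>M N)"
        by (rule nn_integral_mono) (rule ptw)
      also have "\<dots> = (\<integral>\<^sup>+\<omega>. (\<Sum>m. ?t m \<omega> * indicator ?G \<omega>) \<partial>M N)
          + (\<integral>\<^sup>+\<omega>. ennreal ((U N \<omega>)\<^sup>2 / real N + (2 * C + 1) * real N * indicator ?B \<omega>) \<partial>M N)"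
        by (rule nn_integral_add) measurable
      also have "\<dots> \<le> ennreal (e / 2) + ennreal (e / 2)"
      proof (rule add_mono)
        show "(\<integral>\<^sup>+\<omega>. (\<Sum>m. ?t m \<omega> * indicator ?G \<omega>) \<partial>M N) \<le> ennreal (e / 2)"
        proof -
          have "(\<integral>\<^sup>+\<omega>. (\<Sum>m. ?t m \<omega> * indicator ?G \<omega>) \<partial>M N) = (\<Sum>m. \<integral>\<^sup>+\<omega>. ?t m \<omega> * indicator ?G \<omega> \<partial>M N)"
            by (rule nn_integral_suminf) measurable
          also have "\<dots> \<le> (\<Sum>m. ennreal (b (m + Suc L)))"
          proof (rule suminf_le)
            fix m
            have "(\<integral>\<^sup>+\<omega>. ?t m \<omega> * indicator ?G \<omega> \<partial>M N)
                = (\<integral>\<^sup>+\<omega>. ennreal \<bar>a (m + Suc L)\<bar> * (ennreal \<bar>arr_trace N (\<lambda>e. trunc_entry N e \<omega>) (m + Suc L)\<bar> * indicator ?G \<omega>) \<partial>M N)"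
              by (intro nn_integral_cong) (simp only: ennreal_mult[OF abs_ge_zero abs_ge_zero] mult.assoc)
            also have "\<dots> = ennreal \<bar>a (m + Suc L)\<bar> * (\<integral>\<^sup>+\<omega>. ennreal \<bar>arr_trace N (\<lambda>e. trunc_entry N e \<omega>) (m + Suc L)\<bar> * indicator ?G \<omega> \<partial>M N)"
              by (rule nn_integral_cmult) measurable
            also have "\<dots> \<le> ennreal \<bar>a (m + Suc L)\<bar> * ennreal (4 * real (m + Suc L) * R ^ (m + Suc L) / (1 - 1 / R\<^sup>2))"
              by (intro mult_left_mono expectation_trace_good_le[OF elim(3) _ r]) auto
            also have "\<dots> = ennreal (b (m + Suc L))"
              using R R2 by (subst ennreal_mult[symmetric]) (auto simp: b_def c_def)
            finally show "(\<integral>\<^sup>+\<omega>. ?t m \<omega> * indicator ?G \<omega> \<partial>M N) \<le> ennreal (b (m + Suc L))" .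
          qed auto
          also have "\<dots> = ennreal (\<Sum>m. b (m + Suc L))"
            by (intro suminf_ennreal2 b0 summable_ignore_initial_segment bs)
          also have "\<dots> \<le> ennreal (e / 2)" using L0[OF L] by (intro ennreal_leI) simp
          finally show ?thesis .
        qed
        show "(\<integral>\<^sup>+\<omega>. ennreal ((U N \<omega>)\<^sup>2 / real N + (2 * C + 1) * real N * indicator ?B \<omega>) \<partial>M N) \<le> ennreal (e / 2)"
        proof -
          have i1: "integrable (M N) (\<lambda>\<omega>. (U N \<omega>)\<^sup>2 / real N)" using elim(2) by (intro integrable_divide) blast
          have i2: "integrable (M N) (\<lambda>\<omega>. (2 * C + 1) * real N * indicator ?B \<omega>)"
            by (intro integrable_mult_right integrable_real_indicator) (auto simp: emeasure_eq_measure)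
          have "(\<integral>\<^sup>+\<omega>. ennreal ((U N \<omega>)\<^sup>2 / real N + (2 * C + 1) * real N * indicator ?B \<omega>) \<partial>M N)
              = ennreal (\<integral>\<omega>. (U N \<omega>)\<^sup>2 / real N + (2 * C + 1) * real N * indicator ?B \<omega> \<partial>M N)"
            using i1 i2 C0 by (intro nn_integral_eq_integral Bochner_Integration.integrable_add) auto
          also have "(\<integral>\<omega>. (U N \<omega>)\<^sup>2 / real N + (2 * C + 1) * real N * indicator ?B \<omega> \<partial>M N)
              = (\<integral>\<omega>. (U N \<omega>)\<^sup>2 \<partial>M N) / real N + (2 * C + 1) * (real N * p N)"
            unfolding Bochner_Integration.integral_add[OF i1 i2] by (simp add: p_def)
          finally show ?thesis using elim(1) by (simp add: ennreal_leI)
        qed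
      qed
      finally have le: "(\<integral>\<^sup>+\<omega>. ennreal (D N \<omega>) \<partial>M N) \<le> ennreal e"
        using e by (simp flip: ennreal_plus)
      have D0: "D N \<omega> \<ge> 0" for \<omega> by (simp add: D_def)
      have int: "integrable (M N) (D N)"
        using le D0 by (intro integrableI_nonneg) (auto simp: le_less_trans[OF _ ennreal_less_top])
      moreover have "ennreal (\<integral>\<omega>. D N \<omega> \<partial>M N) \<le> ennreal e"
        using nn_integral_eq_integral[OF int] D0 le by simp
      ultimately show ?case using e by (simp add: ennreal_le_iff)
    qed
    thus "\<forall>\<^sub>F N in sequentially.
    integrable (M N) (\<lambda>\<omega>. norm (trace_fun f (scaled_matrix N (Y N \<omega>)) - of_nat N * f 0
        - of_real (\<Sum>m\<in>{1..L}. a m * arr_trace N (\<lambda>e. trunc_entry N e \<omega>) m))) \<and>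
    (\<integral>\<omega>. norm (trace_fun f (scaled_matrix N (Y N \<omega>)) - of_nat N * f 0
        - of_real (\<Sum>m\<in>{1..L}. a m * arr_trace N (\<lambda>e. trunc_entry N e \<omega>) m)) \<partial>M N) \<le> e"
      unfolding D_def U_def .
  qed
qed

end

section \<open>Characteristic functions of the statistics\<close>

lemma norm_cis_diff_le: "norm (cis a - cis b) \<le> \<bar>a - b\<bar>"
proof -
  have "cis a - cis b = cis b * (cis (a - b) - 1)" by (simp add: algebra_simps cis_mult)
  then have "norm (cis a - cis b) = norm (exp (\<i> * of_real (a - b)) - 1)"
    by (simp add: norm_mult cis_conv_exp)
  also have "\<dots> \<le> \<bar>a - b\<bar>" using iexp_approx1[of "a - b" 0] by simp
  finally show ?thesis .
qed

context iid_matrix_model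
begin

text \<open>
  The value at 0 is subtracted so that the power series of the statistic starts at \<open>m = 1\<close>; a constant
  disappears in the centering.
\<close>

definition stat :: "(complex \<Rightarrow> complex) \<Rightarrow> nat \<Rightarrow> 'b \<Rightarrow> complex" where
  "stat h N \<omega> = trace_fun h (scaled_matrix N (Y N \<omega>)) - of_nat N * h 0"

definition partial_stat :: "(nat \<Rightarrow> real) \<Rightarrow> nat \<Rightarrow> nat \<Rightarrow> 'b \<Rightarrow> real" where
  "partial_stat c L N \<omega> = (\<Sum>m\<in>{1..L}. c m * arr_trace N (\<lambda>e. trunc_entry N e \<omega>) m)"

definition err :: "(complex \<Rightarrow> complex) \<Rightarrow> (nat \<Rightarrow> real) \<Rightarrow> nat \<Rightarrow> nat \<Rightarrow> 'b \<Rightarrow> complex" where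
  "err h c L N \<omega> = stat h N \<omega> - of_real (partial_stat c L N \<omega>)"

context
  fixes f :: "'k::finite \<Rightarrow> complex \<Rightarrow> complex" and a :: "'k \<Rightarrow> nat \<Rightarrow> real" and r R :: real and C :: "'k \<Rightarrow> real"
  assumes r: "1 < r" "r < R" and fb: "\<And>j. f j \<in> borel_measurable borel"
    and f: "\<And>j z. norm z \<le> r \<Longrightarrow> (\<lambda>m. of_real (a j m) * z ^ m) sums f j z"
    and a: "\<And>j. summable (\<lambda>m. \<bar>a j m\<bar> * real m * R ^ m)" and C: "\<And>j z. norm (f j z) \<le> C j"
begin

lemma stat_integrable:
  assumes N: "N \<ge> 1"
  shows "integrable (M N) (stat (f j) N)" "integrable (M N) (\<lambda>\<omega>. trace_fun (f j) (scaled_matrix N (Y N \<omega>)))"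
proof -
  interpret prob_space "M N" by (rule prob_space_M[OF N])
  show i: "integrable (M N) (\<lambda>\<omega>. trace_fun (f j) (scaled_matrix N (Y N \<omega>)))"
  proof (rule integrable_const_bound[of _ "real N * C j"])
    show "AE \<omega> in M N. norm (trace_fun (f j) (scaled_matrix N (Y N \<omega>))) \<le> real N * C j"
    proof (rule AE_I2)
      fix \<omega> assume sp: "\<omega> \<in> space (M N)"
      obtain l :: "nat \<Rightarrow> complex" where l: "\<And>t. char_det N (\<lambda>p. of_int (sign p)) (\<lambda>e. scaled_entry N e \<omega>) t = (\<Prod>i<N. t - l i)"
        "\<And>f. trace_fun f (arr_mat N (\<lambda>e. scaled_entry N e \<omega>)) = (\<Sum>i<N. f (l i))"
        using char_poly_arr_mat_roots[of N "\<lambda>e. scaled_entry N e \<omega>"] by metis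
      have "norm (\<Sum>i<N. f j (l i)) \<le> (\<Sum>i<N. C j)" by (rule sum_norm_le) (rule C)
      thus "norm (trace_fun (f j) (scaled_matrix N (Y N \<omega>))) \<le> real N * C j"
        unfolding scaled_matrix_eq[OF N sp] l(2) by simp
    qed
    show "(\<lambda>\<omega>. trace_fun (f j) (scaled_matrix N (Y N \<omega>))) \<in> borel_measurable (M N)"
      by (rule trace_statistic_measurable[OF N fb])
  qed
  thus "integrable (M N) (stat (f j) N)" unfolding stat_def by (rule Bochner_Integration.integrable_diff) simp
qed

lemma centered_statistics_eq:
  assumes N: "N \<ge> 1"
  shows "centered_statistics f N (M N) (Y N) \<omega> $ j = stat (f j) N \<omega> - (\<integral>\<omega>. stat (f j) N \<omega> \<partial>M N)"
proof -
  interpret prob_space "M N" by (rule prob_space_M[OF N])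
  show ?thesis
    using stat_integrable(2)[OF N, of j] by (simp add: centered_statistics_def prob_space stat_def)
qed

lemma centered_statistics_measurable:
  assumes N: "N \<ge> 1"
  shows "integrable (M N) (\<lambda>\<omega>. centered_statistics f N (M N) (Y N) \<omega> $ j)"
    and "centered_statistics f N (M N) (Y N) \<in> borel_measurable (M N)"
proof -
  interpret prob_space "M N" by (rule prob_space_M[OF N])
  let ?Z = "centered_statistics f N (M N) (Y N)"
  show Zi: "integrable (M N) (\<lambda>\<omega>. ?Z \<omega> $ j)" for j
    unfolding centered_statistics_eq[OF N] using stat_integrable(1)[OF N] by simp
  show "?Z \<in> borel_measurable (M N)"
  proof (subst borel_measurable_euclidean_space, intro ballI)
    fix b :: "complex ^ 'k" assume "b \<in> Basis"
    then obtain j u where b: "b = axis j u" by (auto simp: Basis_vec_def)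
    have [measurable]: "(\<lambda>\<omega>. ?Z \<omega> $ j) \<in> borel_measurable (M N)" using Zi by auto
    show "(\<lambda>\<omega>. ?Z \<omega> \<bullet> b) \<in> borel_measurable (M N)" unfolding b inner_axis by measurable
  qed
qed

lemma err_bound:
  assumes "e > 0"
  shows "\<forall>\<^sub>F L in sequentially. \<forall>\<^sub>F N in sequentially. \<forall>j. integrable (M N) (\<lambda>\<omega>. norm (err (f j) (a j) L N \<omega>)) \<and> (\<integral>\<omega>. norm (err (f j) (a j) L N \<omega>) \<partial>M N) \<le> e"
proof -
  have "\<forall>\<^sub>F L in sequentially. \<forall>j. \<forall>\<^sub>F N in sequentially. integrable (M N) (\<lambda>\<omega>. norm (err (f j) (a j) L N \<omega>)) \<and> (\<integral>\<omega>. norm (err (f j) (a j) L N \<omega>) \<partial>M N) \<le> e"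
  proof (rule eventually_all_finite)
    fix j
    have "\<exists>L0. \<forall>L\<ge>L0. \<forall>\<^sub>F N in sequentially. integrable (M N) (\<lambda>\<omega>. norm (err (f j) (a j) L N \<omega>)) \<and> (\<integral>\<omega>. norm (err (f j) (a j) L N \<omega>) \<partial>M N) \<le> e"
      unfolding err_def stat_def partial_stat_def by (rule linear_statistic_approx[OF r fb f a C assms])
    thus "\<forall>\<^sub>F L in sequentially. \<forall>\<^sub>F N in sequentially. integrable (M N) (\<lambda>\<omega>. norm (err (f j) (a j) L N \<omega>)) \<and> (\<integral>\<omega>. norm (err (f j) (a j) L N \<omega>) \<partial>M N) \<le> e"
      by (rule eventually_sequentially[THEN iffD2])
  qed
  thus ?thesis by (rule eventually_mono) (rule eventually_all_finite, rule spec)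
qed

lemma partial_stat_integrable: "\<forall>\<^sub>F N in sequentially. \<forall>j. \<forall>n. integrable (M N) (\<lambda>\<omega>. partial_stat (a j) L N \<omega> ^ n)"
  unfolding partial_stat_def by (rule eventually_all_finite, rule trunc_trace_sum_integrable) auto

text \<open>
  Each statistic is within a bounded \<open>L\<^sup>1\<close> distance of a fixed partial sum, whose second moment converges.
\<close>

lemma norm_statistics_bounded:
  "\<exists>B. \<forall>\<^sub>F N in sequentially. integrable (M N) (\<lambda>\<omega>. norm (centered_statistics f N (M N) (Y N) \<omega>)) \<and>
     (\<integral>\<omega>. norm (centered_statistics f N (M N) (Y N) \<omega>) \<partial>M N) \<le> B"
proof -
  have "\<exists>L. \<forall>\<^sub>F N in sequentially. \<forall>j. integrable (M N) (\<lambda>\<omega>. norm (err (f j) (a j) L N \<omega>)) \<and> (\<integral>\<omega>. norm (err (f j) (a j) L N \<omega>) \<partial>M N) \<le> 1"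
    by (rule eventually_happens'[OF sequentially_bot err_bound]) simp
  then obtain L where L: "\<forall>\<^sub>F N in sequentially. \<forall>j. integrable (M N) (\<lambda>\<omega>. norm (err (f j) (a j) L N \<omega>)) \<and> (\<integral>\<omega>. norm (err (f j) (a j) L N \<omega>) \<partial>M N) \<le> 1" ..
  have "\<forall>j. \<exists>K. \<forall>\<^sub>F N in sequentially. (\<integral>\<omega>. (partial_stat (a j) L N \<omega>)\<^sup>2 \<partial>M N) \<le> K"
  proof
    fix j
    have "(\<lambda>N. \<integral>\<omega>. (partial_stat (a j) L N \<omega>)\<^sup>2 \<partial>M N) \<longlonglongrightarrow> gauss_moment (\<Sum>l\<in>{1..L}. if even l then a j l else 0) (\<Sum>l\<in>{1..L}. real l * (a j l)\<^sup>2) 2" (is "_ \<longlonglongrightarrow> ?g")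
      unfolding partial_stat_def by (rule trunc_trace_sum_moment) auto
    then have "\<forall>\<^sub>F N in sequentially. (\<integral>\<omega>. (partial_stat (a j) L N \<omega>)\<^sup>2 \<partial>M N) < ?g + 1" by (rule order_tendstoD) simp
    thus "\<exists>K. \<forall>\<^sub>F N in sequentially. (\<integral>\<omega>. (partial_stat (a j) L N \<omega>)\<^sup>2 \<partial>M N) \<le> K"
      by (intro exI[of _ "?g + 1"]) (auto elim: eventually_mono)
  qed
  from choice[OF this] obtain K where K: "\<forall>j. \<forall>\<^sub>F N in sequentially. (\<integral>\<omega>. (partial_stat (a j) L N \<omega>)\<^sup>2 \<partial>M N) \<le> K j" ..
  have K': "\<forall>\<^sub>F N in sequentially. \<forall>j. (\<integral>\<omega>. (partial_stat (a j) L N \<omega>)\<^sup>2 \<partial>M N) \<le> K j"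
    by (rule eventually_all_finite) (rule spec[OF K])
  show ?thesis
  proof (intro exI[of _ "\<Sum>j\<in>UNIV. 2 * (2 + K j)"])
    show "\<forall>\<^sub>F N in sequentially. integrable (M N) (\<lambda>\<omega>. norm (centered_statistics f N (M N) (Y N) \<omega>)) \<and>
     (\<integral>\<omega>. norm (centered_statistics f N (M N) (Y N) \<omega>) \<partial>M N) \<le> (\<Sum>j\<in>UNIV. 2 * (2 + K j))"
      using L K' partial_stat_integrable[of L] eventually_ge_at_top[of 1]
    proof eventually_elim
      case (elim N)
      interpret prob_space "M N" by (rule prob_space_M[OF elim(4)])
      let ?Z = "centered_statistics f N (M N) (Y N)"
      have U2: "integrable (M N) (\<lambda>\<omega>. (partial_stat (a j) L N \<omega>)\<^sup>2)" for j using elim(3) by blast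
      note Zi = centered_statistics_measurable(1)[OF elim(4)] and Zm = centered_statistics_measurable(2)[OF elim(4)]
      have le: "norm (?Z \<omega>) \<le> (\<Sum>j\<in>UNIV. norm (?Z \<omega> $ j))" for \<omega>
        unfolding norm_vec_def by (rule L2_set_le_sum) simp
      have int: "integrable (M N) (\<lambda>\<omega>. norm (?Z \<omega>))"
        by (rule Bochner_Integration.integrable_bound[of _ "\<lambda>\<omega>. \<Sum>j\<in>UNIV. norm (?Z \<omega> $ j)"])
          (use Zi Zm le in \<open>auto intro!: AE_I2 order_trans[OF le] simp: sum_nonneg\<close>)
      have "(\<integral>\<omega>. norm (?Z \<omega>) \<partial>M N) \<le> (\<integral>\<omega>. (\<Sum>j\<in>UNIV. norm (?Z \<omega> $ j)) \<partial>M N)"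
        by (intro integral_mono int Bochner_Integration.integrable_sum integrable_norm Zi le)
      also have "\<dots> = (\<Sum>j\<in>UNIV. \<integral>\<omega>. norm (?Z \<omega> $ j) \<partial>M N)"
        using Zi by (intro Bochner_Integration.integral_sum) simp
      also have "\<dots> \<le> (\<Sum>j\<in>UNIV. 2 * (2 + K j))"
      proof (rule sum_mono)
        fix j
        have W: "integrable (M N) (\<lambda>\<omega>. norm (stat (f j) N \<omega>))" using stat_integrable(1)[OF elim(4), of j] by (rule integrable_norm)
        have e: "integrable (M N) (\<lambda>\<omega>. norm (err (f j) (a j) L N \<omega>))" "expectation (\<lambda>\<omega>. norm (err (f j) (a j) L N \<omega>)) \<le> 1" using elim(1) by auto
        have "expectation (\<lambda>\<omega>. norm (stat (f j) N \<omega>)) \<le> expectation (\<lambda>\<omega>. norm (err (f j) (a j) L N \<omega>) + (1 + (partial_stat (a j) L N \<omega>)\<^sup>2))"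
        proof (rule integral_mono[OF W])
          show "integrable (M N) (\<lambda>\<omega>. norm (err (f j) (a j) L N \<omega>) + (1 + (partial_stat (a j) L N \<omega>)\<^sup>2))" using e U2[of j] by simp
          fix \<omega>
          have "\<bar>partial_stat (a j) L N \<omega>\<bar> \<le> 1 + (partial_stat (a j) L N \<omega>)\<^sup>2"
            using zero_le_power2[of "\<bar>partial_stat (a j) L N \<omega>\<bar> - 1"] zero_le_power2[of "partial_stat (a j) L N \<omega>"] unfolding power2_diff power2_abs one_power2 by linarith
          moreover have "norm (stat (f j) N \<omega>) \<le> norm (err (f j) (a j) L N \<omega>) + norm (complex_of_real (partial_stat (a j) L N \<omega>))"
            unfolding err_def using norm_triangle_sub[of "stat (f j) N \<omega>" "complex_of_real (partial_stat (a j) L N \<omega>)"] by linarith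
          ultimately show "norm (stat (f j) N \<omega>) \<le> norm (err (f j) (a j) L N \<omega>) + (1 + (partial_stat (a j) L N \<omega>)\<^sup>2)"
            unfolding norm_of_real by linarith
        qed
        also have "\<dots> = expectation (\<lambda>\<omega>. norm (err (f j) (a j) L N \<omega>)) + (1 + expectation (\<lambda>\<omega>. (partial_stat (a j) L N \<omega>)\<^sup>2))"
          using e(1) U2[of j] by (simp add: prob_space)
        also have "\<dots> \<le> 2 + K j" using e(2) elim(2)[rule_format, of j] by simp
        finally have Wle: "expectation (\<lambda>\<omega>. norm (stat (f j) N \<omega>)) \<le> 2 + K j" .
        have "expectation (\<lambda>\<omega>. norm (?Z \<omega> $ j)) \<le> expectation (\<lambda>\<omega>. norm (stat (f j) N \<omega>) + norm (expectation (stat (f j) N)))"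
          by (rule integral_mono) (use Zi W in \<open>auto simp: centered_statistics_eq[OF elim(4)] intro: norm_triangle_ineq4\<close>)
        also have "\<dots> = expectation (\<lambda>\<omega>. norm (stat (f j) N \<omega>)) + norm (expectation (stat (f j) N))"
          using W by (simp add: prob_space)
        also have "\<dots> \<le> 2 * (2 + K j)"
          by (rule order_trans[OF add_mono[OF Wle order_trans[OF integral_norm_bound Wle]]]) simp
        finally show "expectation (\<lambda>\<omega>. norm (?Z \<omega> $ j)) \<le> 2 * (2 + K j)" .
      qed
      finally show ?case using int by blast
    qed
  qed
qed


text \<open>
  Centering removes the mean of the limit, since first moments converge as well.
\<close>

lemma char_partial_tendsto:
  fixes t :: "nat \<Rightarrow> real"
  shows "(\<lambda>N. \<integral>\<omega>. cis (partial_stat t L N \<omega> - (\<integral>\<omega>. partial_stat t L N \<omega> \<partial>M N)) \<partial>M N)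
    \<longlonglongrightarrow> of_real (exp (- ((\<Sum>m\<in>{1..L}. real m * (t m)\<^sup>2) / 2)))"
proof -
  define \<alpha> where "\<alpha> = (\<Sum>m\<in>{1..L}. if even m then t m else 0)"
  define v where "v = (\<Sum>m\<in>{1..L}. real m * (t m)\<^sup>2)"
  have mom: "(\<lambda>N. \<integral>\<omega>. partial_stat t L N \<omega> ^ n \<partial>M N) \<longlonglongrightarrow> gauss_moment \<alpha> v n" for n
    unfolding partial_stat_def \<alpha>_def v_def by (rule trunc_trace_sum_moment) auto
  have int: "\<forall>\<^sub>F N in sequentially. \<forall>n. integrable (M N) (\<lambda>\<omega>. partial_stat t L N \<omega> ^ n)"
    unfolding partial_stat_def by (rule trunc_trace_sum_integrable) auto
  have "\<forall>\<^sub>F N in sequentially. prob_space (M N) \<and> partial_stat t L N \<in> borel_measurable (M N) \<and> (\<forall>n. integrable (M N) (\<lambda>\<omega>. partial_stat t L N \<omega> ^ n))"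
    using int eventually_ge_at_top[of 1]
  proof eventually_elim
    case (elim N)
    have "partial_stat t L N \<in> borel_measurable (M N)"
      unfolding partial_stat_def using arr_trace_measurable by measurable
    thus ?case using elim prob_space_M[of N] by blast
  qed
  moreover have "v \<ge> 0" unfolding v_def by (intro sum_nonneg) auto
  ultimately have "(\<lambda>N. \<integral>\<omega>. cis (partial_stat t L N \<omega>) \<partial>M N) \<longlonglongrightarrow> exp (\<i> * of_real \<alpha> - of_real v / 2)"
    by (intro char_tendsto_if_moments_tendsto mom)
  moreover have "(\<lambda>N. \<integral>\<omega>. partial_stat t L N \<omega> \<partial>M N) \<longlonglongrightarrow> \<alpha>" using mom[of 1] by simp
  ultimately have "(\<lambda>N. cis (- (\<integral>\<omega>. partial_stat t L N \<omega> \<partial>M N)) * (\<integral>\<omega>. cis (partial_stat t L N \<omega>) \<partial>M N))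
     \<longlonglongrightarrow> cis (- \<alpha>) * exp (\<i> * of_real \<alpha> - of_real v / 2)"
    by (intro tendsto_mult tendsto_cis tendsto_minus)
  also have "(\<lambda>N. cis (- (\<integral>\<omega>. partial_stat t L N \<omega> \<partial>M N)) * (\<integral>\<omega>. cis (partial_stat t L N \<omega>) \<partial>M N))
      = (\<lambda>N. \<integral>\<omega>. cis (partial_stat t L N \<omega> - (\<integral>\<omega>. partial_stat t L N \<omega> \<partial>M N)) \<partial>M N)"
    by (rule ext, subst integral_mult_right_zero[symmetric]) (simp add: cis_mult)
  also have "cis (- \<alpha>) * exp (\<i> * of_real \<alpha> - of_real v / 2) = of_real (exp (- (v / 2)))"
    by (simp add: cis_conv_exp flip: exp_add exp_of_real)
  finally show ?thesis unfolding v_def .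
qed

text \<open>
  The inner product of \<open>\<theta>\<close> with the centered statistics differs from a centered combination of finitely
  many traces by an amount that is small in \<open>L\<^sup>1\<close>, uniformly for large \<open>N\<close>, and \<open>cis\<close> is Lipschitz. Only the
  real parts of \<open>\<theta>\<close> survive because the traces are real.
\<close>

theorem char_statistics_tendsto:
  fixes \<theta> :: "complex ^ 'k"
  defines "t \<equiv> \<lambda>m. \<Sum>j\<in>UNIV. Re (\<theta> $ j) * a j m"
  assumes v: "(\<lambda>m. real m * (t m)\<^sup>2) sums v"
  shows "(\<lambda>N. \<integral>\<omega>. cis (\<theta> \<bullet> centered_statistics f N (M N) (Y N) \<omega>) \<partial>M N) \<longlonglongrightarrow> of_real (exp (- (v / 2)))"
proof (rule tendstoI)
  fix e :: real assume e: "e > 0"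
  define B where "B = (\<Sum>j\<in>UNIV. norm (\<theta> $ j))"
  have B: "B \<ge> 0" unfolding B_def by (intro sum_nonneg) auto
  define d where "d = e / (6 * (B + 1))"
  have d: "d > 0" using e B by (simp add: d_def)
  have Bd: "2 * B * d < e / 2"
  proof -
    have "6 * (c * (e / (6 * c))) = e" if "c > 0" for c using that by simp
    from this[of "B + 1"] have "6 * ((B + 1) * d) = e" using B by (simp only: d_def)
    moreover have "B * d \<le> (B + 1) * d" using d by (intro mult_right_mono) auto
    ultimately show ?thesis using e by (simp add: mult.assoc)
  qed
  have "(\<lambda>L. \<Sum>m\<in>{1..L}. real m * (t m)\<^sup>2) \<longlonglongrightarrow> v"
  proof -
    have "(\<lambda>L. \<Sum>m<Suc L. real m * (t m)\<^sup>2) \<longlonglongrightarrow> v" using v unfolding sums_def by (rule LIMSEQ_Suc)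
    moreover have "(\<Sum>m<Suc L. real m * (t m)\<^sup>2) = (\<Sum>m\<in>{1..L}. real m * (t m)\<^sup>2)" for L
      by (rule sum.mono_neutral_cong_right) auto
    ultimately show ?thesis by (simp only:)
  qed
  then have "(\<lambda>L. complex_of_real (exp (- ((\<Sum>m\<in>{1..L}. real m * (t m)\<^sup>2) / 2)))) \<longlonglongrightarrow> of_real (exp (- (v / 2)))"
    by (intro tendsto_intros) auto
  then have "\<forall>\<^sub>F L in sequentially. dist (complex_of_real (exp (- ((\<Sum>m\<in>{1..L}. real m * (t m)\<^sup>2) / 2)))) (of_real (exp (- (v / 2)))) < e / 4"
    by (rule tendstoD) (use e in simp)
  from eventually_happens'[OF sequentially_bot eventually_conj[OF this err_bound[OF d]]]
  obtain L where L1: "dist (complex_of_real (exp (- ((\<Sum>m\<in>{1..L}. real m * (t m)\<^sup>2) / 2)))) (of_real (exp (- (v / 2)))) < e / 4"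
    and L2: "\<forall>\<^sub>F N in sequentially. \<forall>j. integrable (M N) (\<lambda>\<omega>. norm (err (f j) (a j) L N \<omega>)) \<and> (\<integral>\<omega>. norm (err (f j) (a j) L N \<omega>) \<partial>M N) \<le> d"
    by (elim exE conjE)
  have "\<forall>\<^sub>F N in sequentially. dist (\<integral>\<omega>. cis (partial_stat t L N \<omega> - (\<integral>\<omega>. partial_stat t L N \<omega> \<partial>M N)) \<partial>M N)
      (complex_of_real (exp (- ((\<Sum>m\<in>{1..L}. real m * (t m)\<^sup>2) / 2)))) < e / 4"
    by (rule tendstoD[OF char_partial_tendsto]) (use e in simp)
  then show "\<forall>\<^sub>F N in sequentially. dist (\<integral>\<omega>. cis (\<theta> \<bullet> centered_statistics f N (M N) (Y N) \<omega>) \<partial>M N) (of_real (exp (- (v / 2)))) < e"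
    using L2 eventually_ge_at_top[of 1] partial_stat_integrable[of L]
  proof eventually_elim
    case (elim N)
    interpret prob_space "M N" by (rule prob_space_M[OF elim(3)])
    let ?Z = "centered_statistics f N (M N) (Y N)"
    let ?V = "\<lambda>\<omega>. partial_stat t L N \<omega> - expectation (partial_stat t L N)"
    let ?E = "\<lambda>j \<omega>. err (f j) (a j) L N \<omega>"
    have Ui: "integrable (M N) (partial_stat (a j) L N)" for j
      using elim(4)[rule_format, of j 1] by simp
    have Ei: "integrable (M N) (?E j)" for j
      unfolding err_def using stat_integrable(1)[OF elim(3), of j] Ui[of j] by (intro Bochner_Integration.integrable_diff integrable_of_real) auto
    have V: "partial_stat t L N \<omega> = (\<Sum>j\<in>UNIV. \<theta> $ j \<bullet> complex_of_real (partial_stat (a j) L N \<omega>))" for \<omega>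
      unfolding partial_stat_def t_def
      by (simp add: inner_complex_def sum_distrib_left sum_distrib_right mult.assoc) (rule sum.swap)
    have diff: "\<theta> \<bullet> ?Z \<omega> - ?V \<omega> = (\<Sum>j\<in>UNIV. \<theta> $ j \<bullet> (?E j \<omega> - expectation (?E j)))" for \<omega>
    proof -
      have ex: "expectation (partial_stat t L N) = (\<Sum>j\<in>UNIV. \<theta> $ j \<bullet> complex_of_real (expectation (partial_stat (a j) L N)))"
        unfolding V using Ui by (subst Bochner_Integration.integral_sum) (auto simp: inner_complex_def)
      have ee: "expectation (?E j) = expectation (stat (f j) N) - complex_of_real (expectation (partial_stat (a j) L N))" for j
        unfolding err_def using stat_integrable(1)[OF elim(3), of j] Ui[of j]
        by (subst Bochner_Integration.integral_diff) auto
      have "\<theta> \<bullet> ?Z \<omega> - ?V \<omega> = (\<Sum>j\<in>UNIV. \<theta> $ j \<bullet> (?Z \<omega> $ j)) - ((\<Sum>j\<in>UNIV. \<theta> $ j \<bullet> complex_of_real (partial_stat (a j) L N \<omega>)) - (\<Sum>j\<in>UNIV. \<theta> $ j \<bullet> complex_of_real (expectation (partial_stat (a j) L N))))"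
        unfolding ex V inner_vec_def ..
      also have "\<dots> = (\<Sum>j\<in>UNIV. \<theta> $ j \<bullet> (?E j \<omega> - expectation (?E j)))"
        unfolding sum_subtractf[symmetric] inner_diff_right[symmetric] centered_statistics_eq[OF elim(3)] ee
        by (simp add: err_def algebra_simps)
      finally show ?thesis .
    qed
    have Zm: "(\<lambda>\<omega>. \<theta> \<bullet> ?Z \<omega>) \<in> borel_measurable (M N)"
      using centered_statistics_measurable(2)[OF elim(3)] by measurable
    have Vm: "?V \<in> borel_measurable (M N)"
      unfolding V using Ui by (intro borel_measurable_diff borel_measurable_sum borel_measurable_inner) auto
    have i1: "integrable (M N) (\<lambda>\<omega>. cis (\<theta> \<bullet> ?Z \<omega>))" by (rule integrable_const_bound[of _ 1]) (use Zm in auto)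
    have i2: "integrable (M N) (\<lambda>\<omega>. cis (?V \<omega>))" by (rule integrable_const_bound[of _ 1]) (use Vm in auto)
    have bnd: "norm (cis (\<theta> \<bullet> ?Z \<omega>) - cis (?V \<omega>)) \<le> (\<Sum>j\<in>UNIV. norm (\<theta> $ j) * (norm (?E j \<omega>) + d))" for \<omega>
    proof -
      have "norm (cis (\<theta> \<bullet> ?Z \<omega>) - cis (?V \<omega>)) \<le> \<bar>\<Sum>j\<in>UNIV. \<theta> $ j \<bullet> (?E j \<omega> - expectation (?E j))\<bar>"
        unfolding diff[symmetric] by (rule norm_cis_diff_le)
      also have "\<dots> \<le> (\<Sum>j\<in>UNIV. norm (\<theta> $ j) * (norm (?E j \<omega>) + d))"
      proof (rule order_trans[OF sum_abs sum_mono])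
        fix j
        have "\<bar>\<theta> $ j \<bullet> (?E j \<omega> - expectation (?E j))\<bar> \<le> norm (\<theta> $ j) * norm (?E j \<omega> - expectation (?E j))"
          by (rule Cauchy_Schwarz_ineq2)
        also have "\<dots> \<le> norm (\<theta> $ j) * (norm (?E j \<omega>) + d)"
        proof (rule mult_left_mono)
          have "norm (expectation (?E j)) \<le> expectation (\<lambda>\<omega>. norm (?E j \<omega>))" by (rule integral_norm_bound)
          also have "\<dots> \<le> d" using elim(2) by blast
          finally show "norm (?E j \<omega> - expectation (?E j)) \<le> norm (?E j \<omega>) + d"
            by (intro order_trans[OF norm_triangle_ineq4] add_left_mono)
        qed simp
        finally show "\<bar>\<theta> $ j \<bullet> (?E j \<omega> - expectation (?E j))\<bar> \<le> norm (\<theta> $ j) * (norm (?E j \<omega>) + d)" .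
      qed
      finally show ?thesis .
    qed
    have "dist (\<integral>\<omega>. cis (\<theta> \<bullet> ?Z \<omega>) \<partial>M N) (\<integral>\<omega>. cis (?V \<omega>) \<partial>M N) = norm (\<integral>\<omega>. cis (\<theta> \<bullet> ?Z \<omega>) - cis (?V \<omega>) \<partial>M N)"
      by (simp add: dist_norm Bochner_Integration.integral_diff[OF i1 i2])
    also have "\<dots> \<le> (\<integral>\<omega>. norm (cis (\<theta> \<bullet> ?Z \<omega>) - cis (?V \<omega>)) \<partial>M N)" by (rule integral_norm_bound)
    also have "\<dots> \<le> (\<integral>\<omega>. (\<Sum>j\<in>UNIV. norm (\<theta> $ j) * (norm (?E j \<omega>) + d)) \<partial>M N)"
      by (rule integral_mono[OF _ _ bnd]) (use i1 i2 elim(2) in \<open>auto intro!: Bochner_Integration.integrable_sum integrable_mult_right Bochner_Integration.integrable_add\<close>)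
    also have "\<dots> = (\<Sum>j\<in>UNIV. norm (\<theta> $ j) * (expectation (\<lambda>\<omega>. norm (?E j \<omega>)) + d))"
      using elim(2) by (subst Bochner_Integration.integral_sum) (auto simp: prob_space)
    also have "\<dots> \<le> (\<Sum>j\<in>UNIV. norm (\<theta> $ j) * (2 * d))"
      using elim(2) by (intro sum_mono mult_left_mono) auto
    also have "\<dots> = 2 * B * d" by (simp only: B_def sum_distrib_left sum_distrib_right mult_ac)
    also note Bd
    finally have "dist (\<integral>\<omega>. cis (\<theta> \<bullet> ?Z \<omega>) \<partial>M N) (\<integral>\<omega>. cis (?V \<omega>) \<partial>M N) < e / 2" .
    with elim(1) L1 show ?case
      using dist_triangle[of "\<integral>\<omega>. cis (\<theta> \<bullet> ?Z \<omega>) \<partial>M N" "of_real (exp (- (v / 2)))" "\<integral>\<omega>. cis (?V \<omega>) \<partial>M N"]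
        dist_triangle[of "\<integral>\<omega>. cis (?V \<omega>) \<partial>M N" "of_real (exp (- (v / 2)))" "complex_of_real (exp (- ((\<Sum>m\<in>{1..L}. real m * (t m)\<^sup>2) / 2)))"]
      by linarith
  qed
qed

end

end

section \<open>The central limit theorem\<close>

text \<open>
  The imaginary parts of the coefficients form a real power series that vanishes on an interval.
\<close>

lemma taylor_coeff_real:
  assumes r: "r > 0" and f: "\<And>z. norm z < r \<Longrightarrow> (\<lambda>m. A m * z ^ m) sums f z"
    and real: "\<And>x :: real. \<bar>x\<bar> < r \<Longrightarrow> f (of_real x) \<in> \<real>"
  shows "A m = of_real (Re (A m))"
proof -
  have s: "(\<lambda>m. Im (A m) * (x - 0) ^ m) sums (0 :: real)" if "norm (x - 0) < r" for x
  proof -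
    have "(\<lambda>m. Im (A m * of_real x ^ m)) sums Im (f (of_real x))"
      by (rule sums_Im) (use that in \<open>auto intro: f\<close>)
    moreover have "Im (f (of_real x)) = 0" using real[of x] that by (simp add: complex_is_Real_iff)
    moreover have "Im (A m * of_real x ^ m) = Im (A m) * (x - 0) ^ m" for m by (simp flip: of_real_power)
    ultimately show ?thesis by simp
  qed
  have "Im (A m) = 0"
  proof (cases "m = 0")
    case True
    have "(\<lambda>m. Im (A m) * 0 ^ m) sums 0" using s[of 0] r by simp
    then have "Im (A 0) = 0" using powser_sums_zero[of "\<lambda>m. Im (A m)"] by (rule sums_unique2[symmetric])
    thus ?thesis using True by simp
  next
    case False
    show ?thesis
    proof (rule ccontr)
      assume "Im (A m) \<noteq> 0"
      then obtain s where "0 < s" "\<And>z :: real. z \<in> cball 0 s - {0} \<Longrightarrow> (0 :: real) \<noteq> 0"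
        using powser_0_nonzero[OF r s, of m] False by auto
      from this(2)[of s] this(1) show False by simp
    qed
  qed
  thus ?thesis by (simp add: complex_eq_iff)
qed

lemma summable_powser_times_index:
  fixes A :: "nat \<Rightarrow> real"
  assumes f: "\<And>x :: real. \<bar>x\<bar> < K \<Longrightarrow> summable (\<lambda>m. A m * x ^ m)" and R: "0 < R" "R < K"
  shows "summable (\<lambda>m. \<bar>A m\<bar> * real m * R ^ m)"
proof -
  have "summable (\<lambda>m. diffs (\<lambda>m. \<bar>A m\<bar>) m * R ^ m)"
  proof (rule termdiff_converges[of _ K])
    fix x :: real assume x: "norm x < K"
    then obtain x' where x': "norm x < x'" "x' < K" using dense by blast
    have "\<bar>x'\<bar> < K" using x' by (smt (verit) norm_ge_zero)
    have "summable (\<lambda>m. norm (A m * x ^ m))"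
      by (rule powser_insidea[OF f[OF \<open>\<bar>x'\<bar> < K\<close>]]) (use x' in auto)
    thus "summable (\<lambda>m. \<bar>A m\<bar> * x ^ m)"
      by (rule summable_norm_cancel[OF summable_cong[THEN iffD1, rotated]]) (simp add: abs_mult)
  qed (use R in auto)
  then have "summable (\<lambda>m. R * (diffs (\<lambda>m. \<bar>A m\<bar>) m * R ^ m))" by (rule summable_mult)
  also have "(\<lambda>m. R * (diffs (\<lambda>m. \<bar>A m\<bar>) m * R ^ m)) = (\<lambda>m. \<bar>A (Suc m)\<bar> * real (Suc m) * R ^ Suc m)"
    by (simp add: diffs_def mult_ac)
  finally show ?thesis by (subst (asm) summable_Suc_iff)
qed

theorem corollary2p6:
  fixes P :: "'a measure" and \<xi> :: "'a \<Rightarrow> real" and \<tau> \<delta> :: real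
    and M :: "nat \<Rightarrow> 'b measure" and Y :: "nat \<Rightarrow> 'b \<Rightarrow> real mat"
    and f :: "'k::finite \<Rightarrow> complex \<Rightarrow> complex"
    and \<gamma> :: "real \<Rightarrow> complex" and V :: "complex set"
  assumes "prob_space P" and "\<xi> \<in> borel_measurable P"
    and "prob_space.expectation P \<xi> = 0" and "prob_space.variance P \<xi> = 1"
    and "\<tau> > 0" and "integrable P (\<lambda>\<omega>. \<bar>\<xi> \<omega>\<bar> powr (6 + \<tau>))"
    and "\<And>N. N \<ge> 1 \<Longrightarrow> iid_random_matrix P \<xi> N (M N) (Y N)"
    and "\<And>j. f j \<in> borel_measurable borel"
    and "\<delta> > 0"
    and "\<And>j. f j analytic_on cball 0 (1 + \<delta>)"
    and "\<And>j. bounded (f j ` {z. cmod z > 1 + \<delta>})"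
    and "open V" and "cball 0 1 \<subseteq> V"
    and "\<And>j z. z \<in> V \<Longrightarrow> f j z + f j (cnj z) \<in> \<real>"
    and "valid_path \<gamma>" and "simple_path \<gamma>" and "pathfinish \<gamma> = pathstart \<gamma>"
    and "\<And>j. f j analytic_on (path_image \<gamma> \<union> inside (path_image \<gamma>))"
    and "cball 0 1 \<subseteq> inside (path_image \<gamma>)"
  shows "\<exists>\<nu> :: (real ^ 'k) measure.
      gaussian_law \<nu> \<and>
      (\<forall>i. (\<integral>x. x $ i \<partial>\<nu>) = 0) \<and>
      (\<forall>i j. complex_of_real (\<integral>x. x $ i * x $ j \<partial>\<nu>) =
         - (1 / (4 * complex_of_real pi ^ 2)) *
           contour_integral \<gamma> (\<lambda>w. contour_integral \<gamma> (\<lambda>z.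
             f i z * f j w * (1 - z * w) powi (-2)))) \<and>
      converges_weakly
        (\<lambda>N. distr (M N) borel (centered_statistics f N (M N) (Y N)))
        (distr \<nu> borel (\<lambda>x. \<chi> j. complex_of_real (x $ j)))"
proof -
  interpret iid_matrix_model P \<xi> \<tau> M Y
    by (intro iid_matrix_model.intro iid_matrix_model_axioms.intro assms(1-7))
  define A where "A j m = (deriv ^^ m) (f j) 0 / fact m" for j m
  define a where "a j m = Re (A j m)" for j m
  \<comment> \<open>\<open>r\<close> bounds the eigenvalues on the good event; the circle of radius \<open>R\<close> surrounds them inside the disk of convergence\<close>
  define r R where "r = 1 + \<delta> / 4" and "R = 1 + \<delta> / 2"
  have rR: "1 < r" "r < R" "R < 1 + \<delta>" using \<open>\<delta> > 0\<close> by (auto simp: r_def R_def)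
  have hol: "f j holomorphic_on ball 0 (1 + \<delta>)" for j
    using analytic_imp_holomorphic[OF assms(10)[of j]] by (rule holomorphic_on_subset) auto
  have As: "(\<lambda>m. A j m * z ^ m) sums f j z" if "norm z < 1 + \<delta>" for j z
    unfolding A_def using holomorphic_power_series[OF hol, of z j] that by simp
  have Aa: "A j m = of_real (a j m)" for j m
    unfolding a_def
  proof (rule taylor_coeff_real[where f="f j" and r=1])
    show "f j (of_real x) \<in> \<real>" if "\<bar>x\<bar> < 1" for x :: real
    proof -
      have "complex_of_real x \<in> V" using assms(13) that by (auto simp: subset_iff)
      \<comment> \<open>on the real axis \<open>f j z + f j (cnj z)\<close> is \<open>2 * f j z\<close>\<close>
      from assms(14)[OF this, of j] have "(2 * f j (of_real x)) / 2 \<in> \<real>" by (simp add: complex_is_Real_iff)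
      thus ?thesis by simp
    qed
  qed (use As \<open>\<delta> > 0\<close> in auto)
  have fs: "(\<lambda>m. of_real (a j m) * z ^ m) sums f j z" if "norm z \<le> r" for j z
    using As[of z j] that rR by (simp add: Aa)
  have as: "summable (\<lambda>m. \<bar>a j m\<bar> * real m * R ^ m)" for j
  proof (rule summable_powser_times_index[OF _ _ rR(3)])
    fix x :: real assume "\<bar>x\<bar> < 1 + \<delta>"
    then have "summable (\<lambda>m. complex_of_real (a j m * x ^ m))"
      using sums_summable[OF As[of "of_real x" j]] by (simp add: Aa)
    thus "summable (\<lambda>m. a j m * x ^ m)" by (simp only: summable_of_real_iff)
  qed (use rR in auto)
  have "\<forall>j. \<exists>C. \<forall>z. norm (f j z) \<le> C"
  proof
    fix j
    have "continuous_on (cball 0 (1 + \<delta>)) (f j)"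
      using analytic_imp_holomorphic[OF assms(10)] by (rule holomorphic_on_imp_continuous_on)
    then have "bounded (f j ` cball 0 (1 + \<delta>))"
      by (intro compact_imp_bounded compact_continuous_image compact_cball)
    with assms(11)[of j] have "bounded (f j ` cball 0 (1 + \<delta>) \<union> f j ` {z. cmod z > 1 + \<delta>})" by simp
    then obtain C where "\<And>y. y \<in> f j ` cball 0 (1 + \<delta>) \<union> f j ` {z. cmod z > 1 + \<delta>} \<Longrightarrow> norm y \<le> C"
      by (auto simp: bounded_iff)
    moreover have "f j z \<in> f j ` cball 0 (1 + \<delta>) \<union> f j ` {z. cmod z > 1 + \<delta>}" for z
      by (cases "norm z \<le> 1 + \<delta>") auto
    ultimately show "\<exists>C. \<forall>z. norm (f j z) \<le> C" by blast
  qed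
  from choice[OF this] obtain C where C: "\<forall>j z. norm (f j z) \<le> C j" ..
  note model = rR(1,2) assms(8) fs as C[rule_format]
  \<comment> \<open>the factor \<open>sqrt m\<close> is the standard deviation of the limit of the \<open>m\<close>-th trace\<close>
  define c where "c m = (\<chi> j. sqrt (real m) * a j m)" for m
  have "summable (\<lambda>m. norm (c m))"
  proof (rule summable_comparison_test'[OF summable_sum[OF as]])
    fix m
    have "norm (c m) \<le> (\<Sum>j\<in>UNIV. \<bar>sqrt (real m) * a j m\<bar>)"
      using L2_set_le_sum[of UNIV "\<lambda>j. norm (c m $ j)"] by (simp add: norm_vec_def c_def)
    also have "\<dots> \<le> (\<Sum>j\<in>UNIV. \<bar>a j m\<bar> * real m * R ^ m)"
    proof (rule sum_mono)
      fix j
      have "sqrt (real m) \<le> real m" by (cases "m = 0") (auto intro!: real_le_lsqrt simp: power2_eq_square)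
      also have "\<dots> * 1 \<le> real m * R ^ m" using rR by (intro mult_left_mono one_le_power) auto
      finally have "sqrt (real m) \<le> real m * R ^ m" by simp
      from mult_left_mono[OF this, of "\<bar>a j m\<bar>"] show "\<bar>sqrt (real m) * a j m\<bar> \<le> \<bar>a j m\<bar> * real m * R ^ m"
        by (simp add: abs_mult mult_ac)
    qed
    finally show "norm (norm (c m)) \<le> (\<Sum>j\<in>UNIV. \<bar>a j m\<bar> * real m * R ^ m)" by simp
  qed
  from gaussian_law_with_covariance[OF this] obtain \<nu> where
    gauss: "gaussian_law \<nu>" and int: "integrable \<nu> norm" and mean: "\<And>t. (\<integral>x. t \<bullet> x \<partial>\<nu>) = 0"
    and cov: "\<And>t u. (\<lambda>m. (t \<bullet> c m) * (u \<bullet> c m)) sums (\<integral>x. (t \<bullet> x) * (u \<bullet> x) \<partial>\<nu>)"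
    and char: "\<And>t. (\<integral>x. cis (t \<bullet> x) \<partial>\<nu>) = of_real (exp (- ((\<Sum>m. (t \<bullet> c m)\<^sup>2) / 2)))"
    by blast
  have ps: "prob_space \<nu>" and sets: "sets \<nu> = sets borel" using gauss by (auto simp: gaussian_law_def)
  have ax: "axis i 1 \<bullet> x = x $ i" for x :: "real ^ 'k" and i by (simp add: inner_axis')
  have "(\<integral>x. x $ i \<partial>\<nu>) = 0" for i using mean[of "axis i 1"] by (simp only: ax)
  moreover have "complex_of_real (\<integral>x. x $ i * x $ j \<partial>\<nu>) =
         - (1 / (4 * complex_of_real pi ^ 2)) *
           contour_integral \<gamma> (\<lambda>w. contour_integral \<gamma> (\<lambda>z.
             f i z * f j w * (1 - z * w) powi (-2)))" for i j
  proof (rule sums_unique2)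
    have "(\<lambda>m. c m $ i * c m $ j) sums (\<integral>x. x $ i * x $ j \<partial>\<nu>)"
      using cov[of "axis i 1" "axis j 1"] by (simp only: ax)
    moreover have "c m $ i * c m $ j = real m * (a i m * a j m)" for m
    proof -
      have "c m $ i * c m $ j = (sqrt (real m) * sqrt (real m)) * (a i m * a j m)"
        by (simp only: c_def vec_lambda_beta mult_ac)
      thus ?thesis by simp
    qed
    ultimately have "(\<lambda>m. real m * (a i m * a j m)) sums (\<integral>x. x $ i * x $ j \<partial>\<nu>)" by (simp only:)
    thus "(\<lambda>m. complex_of_real (real m * (a i m * a j m))) sums complex_of_real (\<integral>x. x $ i * x $ j \<partial>\<nu>)"
      by (rule sums_of_real)
    have "(\<lambda>m. of_nat m * (A i m * A j m)) sums (- (1 / (4 * complex_of_real pi ^ 2)) *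
           contour_integral \<gamma> (\<lambda>w. contour_integral \<gamma> (\<lambda>z. f i z * f j w * (1 - z * w) powi (-2))))"
      unfolding A_def using \<open>\<delta> > 0\<close>
      by (intro double_contour_integral_sums[OF _ hol assms(18) assms(18) assms(15-17) assms(19)]) auto
    thus "(\<lambda>m. complex_of_real (real m * (a i m * a j m))) sums (- (1 / (4 * complex_of_real pi ^ 2)) *
           contour_integral \<gamma> (\<lambda>w. contour_integral \<gamma> (\<lambda>z. f i z * f j w * (1 - z * w) powi (-2))))"
      by (simp add: Aa)
  qed
  moreover have "converges_weakly
        (\<lambda>N. distr (M N) borel (centered_statistics f N (M N) (Y N)))
        (distr \<nu> borel (\<lambda>x. \<chi> j. complex_of_real (x $ j)))"
  proof -
    let ?Z = "\<lambda>N. centered_statistics f N (M N) (Y N)"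
    let ?e = "\<lambda>x :: real ^ 'k. \<chi> j. complex_of_real (x $ j)"
    have Zm: "?Z N \<in> borel_measurable (M N)" if "N \<ge> 1" for N
      by (rule centered_statistics_measurable(2)[where f=f and a=a and r=r and R=R and C=C]) (fact model that)+
    have em: "?e \<in> borel_measurable \<nu>"
    proof -
      have "continuous_on UNIV ?e" by (intro continuous_intros)
      thus ?thesis unfolding measurable_cong_sets[OF sets refl] by (rule borel_measurable_continuous_onI)
    qed
    have ne: "norm (?e x) = norm x" for x by (simp add: norm_vec_def)
    have "\<exists>B. \<forall>\<^sub>F N in sequentially. integrable (M N) (\<lambda>\<omega>. norm (?Z N \<omega>)) \<and> (\<integral>\<omega>. norm (?Z N \<omega>) \<partial>M N) \<le> B"
      by (rule norm_statistics_bounded[where f=f and a=a and r=r and R=R and C=C]) (fact model)+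
    then obtain B where B: "\<forall>\<^sub>F N in sequentially. integrable (M N) (\<lambda>\<omega>. norm (?Z N \<omega>)) \<and> (\<integral>\<omega>. norm (?Z N \<omega>) \<partial>M N) \<le> B" ..
    show ?thesis
    proof (rule converges_weakly_if_char_tendsto[where B="max B (\<integral>x. norm x \<partial>\<nu>)"])
      show "\<forall>\<^sub>F N in sequentially. prob_space (distr (M N) borel (?Z N))"
        using eventually_ge_at_top[of 1]
        by eventually_elim (intro prob_space.prob_space_distr prob_space_M Zm)
      show "prob_space (distr \<nu> borel ?e)" by (rule prob_space.prob_space_distr[OF ps em])
      show "\<forall>\<^sub>F N in sequentially. integrable (distr (M N) borel (?Z N)) norm \<and> (\<integral>x. norm x \<partial>distr (M N) borel (?Z N)) \<le> max B (\<integral>x. norm x \<partial>\<nu>)"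
        using B eventually_ge_at_top[of 1]
      proof eventually_elim
        case (elim N)
        have "integrable (distr (M N) borel (?Z N)) norm \<longleftrightarrow> integrable (M N) (\<lambda>\<omega>. norm (?Z N \<omega>))"
          by (rule integrable_distr_eq[OF Zm[OF elim(2)]]) simp
        moreover have "(\<integral>x. norm x \<partial>distr (M N) borel (?Z N)) = (\<integral>\<omega>. norm (?Z N \<omega>) \<partial>M N)"
          by (rule integral_distr[OF Zm[OF elim(2)]]) simp
        ultimately show ?case using elim(1) by linarith
      qed
      show "integrable (distr \<nu> borel ?e) norm"
        using int integrable_distr_eq[OF em, of norm] by (simp add: ne)
      show "(\<integral>x. norm x \<partial>distr \<nu> borel ?e) \<le> max B (\<integral>x. norm x \<partial>\<nu>)"
        using integral_distr[OF em, of norm] by (simp add: ne)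
      fix \<theta> :: "complex ^ 'k"
      define s where "s = (\<chi> j. Re (\<theta> $ j))"
      have e: "\<theta> \<bullet> ?e x = s \<bullet> x" for x by (simp add: inner_vec_def s_def inner_complex_def)
      have sc: "(s \<bullet> c m)\<^sup>2 = real m * (\<Sum>j\<in>UNIV. Re (\<theta> $ j) * a j m)\<^sup>2" for m
      proof -
        have "s \<bullet> c m = sqrt (real m) * (\<Sum>j\<in>UNIV. Re (\<theta> $ j) * a j m)"
          by (simp add: inner_vec_def s_def c_def sum_distrib_left mult_ac)
        thus ?thesis by (simp add: power_mult_distrib)
      qed
      have "summable (\<lambda>m. (s \<bullet> c m)\<^sup>2)" using sums_summable[OF cov[of s s]] by (simp add: power2_eq_square)
      then have v: "(\<lambda>m. real m * (\<Sum>j\<in>UNIV. Re (\<theta> $ j) * a j m)\<^sup>2) sums (\<Sum>m. (s \<bullet> c m)\<^sup>2)"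
        unfolding sc by (rule summable_sums)
      have lim: "(\<lambda>N. \<integral>\<omega>. cis (\<theta> \<bullet> ?Z N \<omega>) \<partial>M N) \<longlonglongrightarrow> of_real (exp (- ((\<Sum>m. (s \<bullet> c m)\<^sup>2) / 2)))"
        by (rule char_statistics_tendsto[where f=f and a=a and r=r and R=R and C=C]) (fact model v)+
      have cb: "(\<lambda>x. cis (\<theta> \<bullet> x)) \<in> borel_measurable borel" by measurable
      have "(\<integral>x. cis (\<theta> \<bullet> x) \<partial>distr \<nu> borel ?e) = of_real (exp (- ((\<Sum>m. (s \<bullet> c m)\<^sup>2) / 2)))"
        unfolding integral_distr[OF em cb] e by (rule char)
      moreover have "(\<lambda>N. \<integral>x. cis (\<theta> \<bullet> x) \<partial>distr (M N) borel (?Z N)) \<longlonglongrightarrow> of_real (exp (- ((\<Sum>m. (s \<bullet> c m)\<^sup>2) / 2)))"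
      proof (rule Lim_transform_eventually[OF lim])
        show "\<forall>\<^sub>F N in sequentially. (\<integral>\<omega>. cis (\<theta> \<bullet> ?Z N \<omega>) \<partial>M N) = (\<integral>x. cis (\<theta> \<bullet> x) \<partial>distr (M N) borel (?Z N))"
          using eventually_ge_at_top[of 1] by eventually_elim (rule integral_distr[OF Zm cb, symmetric])
      qed
      ultimately show "(\<lambda>N. \<integral>x. cis (\<theta> \<bullet> x) \<partial>distr (M N) borel (?Z N)) \<longlonglongrightarrow> (\<integral>x. cis (\<theta> \<bullet> x) \<partial>distr \<nu> borel ?e)"
        by simp
    qed auto
  qed
  ultimately show ?thesis using gauss by blast
qed

end
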